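(* In the two-wall setting of the context, for each $a=(a_1,a_2)\in(\mathbb Z_{>0})^2_{\mathrm{prim}}$, $$\varPsi^{(a)}\in\Big(\bigoplus_{k\ge1}\mathcal W^1_{P_a}(U)\,z^{km_a}\check\partial_{n_a}\Big)[[t]],\qquad \digamma^{(a)}\in\Big(\bigoplus_{k\ge1}\sum_{n\in N}\mathcal W^0_{P_a}(U)\,z^{km_a}\check\partial_n\Big)[[t]],$$ where $n_a\in N$ is the unique primitive element vanishing on $TP_a$ with $(\nu_{P_a},n_a)<0$.
   Context: General conventions. $M\cong\mathbb Z^n$, $N=\mathrm{Hom}(M,\mathbb Z)$, pairing $(m,n)$, $M_{\mathbb R}$ with affine structure, flat connection $\nabla$, a fixed Riemannian metric $g=(g_{jk})$ of Hessian type, parameter $\hbar>0$; $\partial_n:=\frac{\hbar}{4\pi}\sum n^jg_{jk}\partial/\partial x_k$; $R=\mathbb C[[t]]$, $\mathbf m=tR$. For open $W$: $\mathcal W^{-\infty}_k(W)$ = $k$-forms depending smoothly on $\hbar>0$ with, near each point, $\|\nabla^j\alpha\|_{L^\infty(V)}\le D_{j,V}e^{-c_V/\hbar}$ for all $j$; $\mathcal W^\infty_k(W)$ the same with $D_{j,V}\hbar^{-N_{j,V}}$. $\mathbf g^*_N(W)$ = finite sums $\sum_{j\le N}\sum_{m,n}\alpha^n_{jm}z^m\check\partial_nt^j$, $\alpha\in\mathcal W^\infty_*(W)$, with $\bar\partial(\alpha z^m\check\partial_n)=(d\alpha)z^m\check\partial_n$ and bracket $[\alpha z^m\check\partial_n,\beta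 z^{m'}\check\partial_{n'}]=\alpha\wedge\beta\,z^{m+m'}\check\partial_{(m',n)n'-(m,n')n}+\alpha\wedge(\nabla_{\partial_n}\beta)z^{m+m'}\check\partial_{n'}-(-1)^{|\alpha||\beta|}\beta\wedge(\nabla_{\partial_{n'}}\alpha)z^{m+m'}\check\partial_n$; $\hat{\mathbf g}^*(W)=\varprojlim\mathbf g^*_N(W)$. Asymptotic support $\mathcal W^s_P(W)$ for a closed rational tropical polyhedral subset $P$ of codimension $k$ (connected, locally convex, locally cut out by rational affine equations/inequalities; $\nu_P=dx_1\wedge\dots\wedge dx_k$ where the affine span of $P$ is $\{x_1=\dots=x_k=0\}$, $\nu_P^\vee=\partial_{x_1}\wedge\dots\wedge\partial_{x_k}$): $\alpha\in\mathcal W^\infty_k(W)$ with (1) $\alpha\in\mathcal W^{-\infty}_k$ near each point off $P$; (2) $\alpha=h\nu_P+\eta$ near $P$, $\eta\in\mathcal W^{-\infty}_k$; (3) each $p\in P$ has a small convex neighbourhood $V$ with leaves $P_{V,x'}=\{x'=\mathrm{const}\}$, $x'=(x_1,\dots,x_k)\in N_V$, such that $\int_{N_V}(x')^\beta\sup_{P_{V,x'}}|\nabla^j\iota_{\nu_P^\vee}\alpha|\,dx'\le D_{j,V,\beta}\hbar^{-(j+s-|\beta|-k)/2}$ for all $j\ge0$, $\beta\in\mathbb Z^k_{\ge0}$. Two-wall setting. $V\subset M_{\mathbb R}$ convex open; $Q\subset V$ a codimension-2 rational affine subspace; $m_1,m_2\in M$ linearly independent with $\mathrm{span}(m_1,m_2)\cap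 TQ=0$; $P_i=(Q+\mathbb Rm_i)\cap V$. Fix an orientation of $M_{\mathbb R}$; $\nu_{P_1}=-m_2$, $\nu_{P_2}=m_1$; $n_i\in N$ primitive, vanishing on $TP_i$, $(\nu_{P_i},n_i)<0$; constants $a^{(i)}_{jk}\in\mathbb C$ ($j,k\ge1$, finitely many $k$ per $j$). Fix $q_0\in Q$, a constant inner product $g_V$ with $m_1,m_2,TQ$ pairwise orthogonal, $x^0\in(q_0+\mathbb R_{>0}m_1+\mathbb R_{>0}m_2)\cap V$, and an open $g_V$-ball $U\subset V$ centred at $x^0$ containing $q_0$. For $a\in(\mathbb Z_{\ge0})^2_{\mathrm{prim}}$ (primitive nonzero vectors with nonnegative entries), $m_a=a_1m_1+a_2m_2$, $P_a=(Q-\mathbb R_{\ge0}m_a)\cap U$, and $\nu_{P_a}$ a normal to $P_a$ such that $\{-m_a,\nu_{P_a}\}$ induces on $M_{\mathbb R}/TQ$ the same orientation as $\{-m_1,-m_2\}$. Homotopy operator $H$: for $0\neq m\in M$ let $U^\perp_m$ be the hyperplane through $x^0$ $g_V$-orthogonal to $m$, with affine coordinates $u_\perp$ centred at $x^0$, and coordinates $(u_1,u_\perp)\mapsto u_\perp-u_1m$ on $U$; writing $\alpha=\alpha_0+du_1\wedge\alpha_1$ with $\iota_{\partial_{u_1}}\alpha_0=\iota_{\partial_{u_1}}\alpha_1=0$, $H_m(\alpha)=\int_0^1\rho^*(\alpha_0|_{U^\perp_m})+\int_0^{u_1}\alpha_1(s,u_\perp)ds$ with $\rho(r,u_\perp)=ru_\perp$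 (first term extended constantly in $u_1$); $H_0$ is the same for a fixed choice of affine coordinates centred at $x^0$; $H(\alpha z^m\check\partial_nt^j)=H_m(\alpha)z^m\check\partial_nt^j$. Inputs: for $i=1,2$, $\Pi^{(i)}\in\hat{\mathbf g}^1(U)$, whose class is a Maurer–Cartan solution of $\varprojlim\mathbf g^*_N(U)/\mathcal E^*_N(U)$ ($\mathcal E_N$ defined like $\mathbf g_N$ with $\mathcal W^{-\infty}$), of the form $\Pi^{(i)}=-\sum_{j,k\ge1}a^{(i)}_{jk}(\delta^{(i)}_{jk}+\epsilon^{(i)}_{jk})z^{km_i}\check\partial_{n_i}t^j$ with $\epsilon^{(i)}_{jk}\in\mathcal W^0_{P_i}(U)$, $\delta^{(i)}_{jk}\in\mathcal W^1_{P_i}(U)$, and $\delta^{(i)}_{jk}=(\pi\hbar)^{-1/2}e^{-\eta^2/\hbar}d\eta$ near $P_i$ for an affine $\eta$ with $P_i=\{\eta=0\}$ locally, $d\eta(\nu_{P_i})>0$. Let $\breve\Pi:=-\sum_{i,j,k}a^{(i)}_{jk}\delta^{(i)}_{jk}z^{km_i}\check\partial_{n_i}t^j$ and $\Pi=\Pi^{(1)}+\Pi^{(2)}$. Definitions of $\Phi,\varPsi,\digamma$. $\Phi\in\hat{\mathbf g}^1(U)$ is the unique solution (order by order in $t$) of $\Phi=\Pi-\tfrac12H[\Phi,\Phi]$. $\varPsi$ is the unique solution of $\varPsi=\breve\Pi-\tfrac12H\,\natural(\varPsi,\varPsi)$, where $\natural$ is the bilinear operation with $\natural(fz^m\check\partial_nt^j,f'z^{m'}\check\partial_{n'}t^{j'})=f\wedge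 f'\,z^{m+m'}\check\partial_{(m',n)n'-(m,n')n}t^{j+j'}$ for $1$-forms $f,f'$. $\digamma:=\Phi-\varPsi$. Every Fourier mode $z^m$ occurring in $\Phi$ or $\varPsi$ is of the form $m=km_a$ with $k\ge1$ and $a\in(\mathbb Z_{\ge0})^2_{\mathrm{prim}}$; $\varPsi^{(a)}$, $\digamma^{(a)}$ denote the sums of the terms of $\varPsi$, resp. $\digamma$, whose mode is a positive multiple of $m_a$. *)

theory Defs
  imports "HOL-Analysis.Analysis"
begin

text \<open>M = Z^n is modelled as int^('n::{finite,linorder}), N = Hom(M,Z) as int^('n::{finite,linorder}) via the standard dual basis,
  M_R = real^('n::{finite,linorder}) with its standard affine coordinates (flat connection = coordinate derivatives).
  Differential forms on open sets of M_R depending on hbar are modelled by their coefficients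
  in the basis dx_I (I a subset of the index type, increasing order):
  a form is a function  hbar => x => I => complex.  The symbol check-partial_n is linear in n,
  so a coefficient  sum_n alpha_n z^m check-partial_n  is stored as its components in the
  basis check-partial_{e_l}: a function l => form.\<close>

type_synonym 'n cf = "'n set \<Rightarrow> complex"
type_synonym 'n form = "real \<Rightarrow> real^('n::{finite,linorder}) \<Rightarrow> 'n set \<Rightarrow> complex"
type_synonym 'n vform = "'n \<Rightarrow> 'n form"
type_synonym 'n series = "nat \<Rightarrow> int^('n::{finite,linorder}) \<Rightarrow> 'n vform"

definition rvec :: "int^('n::{finite,linorder}) \<Rightarrow> real^('n::{finite,linorder})" where
  "rvec m = (\<chi> i. real_of_int (m $ i))"

definition pairing :: "int^('n::{finite,linorder}) \<Rightarrow> int^('n::{finite,linorder}) \<Rightarrow> int" where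
  "pairing m n = (\<Sum>i\<in>UNIV. m $ i * n $ i)"

definition ev :: "'n::{finite,linorder} \<Rightarrow> int^('n::{finite,linorder})" where
  "ev i = axis i 1"

definition primitive :: "int^('n::{finite,linorder}) \<Rightarrow> bool" where
  "primitive n \<longleftrightarrow> n \<noteq> 0 \<and> (\<forall>(k::int) w. n = k *s w \<longrightarrow> k = 1 \<or> k = -1)"

fun Ck :: "nat \<Rightarrow> 'a::euclidean_space set \<Rightarrow> ('a \<Rightarrow> 'b::real_normed_vector) \<Rightarrow> bool" where
  "Ck 0 S f = continuous_on S f"
| "Ck (Suc k) S f = (continuous_on S f \<and> (\<forall>x\<in>S. f differentiable (at x)) \<and>
      (\<forall>b\<in>Basis. Ck k S (\<lambda>x. frechet_derivative f (at x) b)))"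

definition Cinf :: "'a::euclidean_space set \<Rightarrow> ('a \<Rightarrow> 'b::real_normed_vector) \<Rightarrow> bool" where
  "Cinf S f \<longleftrightarrow> (\<forall>k. Ck k S f)"

definition pd :: "'n::{finite,linorder} \<Rightarrow> (real^('n::{finite,linorder}) \<Rightarrow> 'b::real_normed_vector) \<Rightarrow> real^('n::{finite,linorder}) \<Rightarrow> 'b" where
  "pd k f x = frechet_derivative f (at x) (axis k 1)"

primrec iterpd :: "'n::{finite,linorder} list \<Rightarrow> (real^('n::{finite,linorder}) \<Rightarrow> 'b::real_normed_vector) \<Rightarrow> real^('n::{finite,linorder}) \<Rightarrow> 'b" where
  "iterpd [] f = f"
| "iterpd (k # ks) f = pd k (iterpd ks f)"

text \<open>pointwise norm of the j-th covariant derivative (flat connection, coordinate norm;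
  equivalent up to constants on small neighbourhoods to the g-norm)\<close>
definition jnorm :: "nat \<Rightarrow> (real^('n::{finite,linorder}) \<Rightarrow> complex) \<Rightarrow> real^('n::{finite,linorder}) \<Rightarrow> real" where
  "jnorm j f y = (\<Sum>ks\<in>{ks. set ks \<subseteq> UNIV \<and> length ks = j}. norm (iterpd ks f y))"

definition hessian_metric :: "(real^('n::{finite,linorder}) \<Rightarrow> real^('n::{finite,linorder})^('n::{finite,linorder})) \<Rightarrow> bool" where
  "hessian_metric g \<longleftrightarrow>
     (\<forall>x j k. g x $ j $ k = g x $ k $ j) \<and>
     (\<forall>x v. v \<noteq> 0 \<longrightarrow> v \<bullet> (g x *v v) > 0) \<and>
     (\<forall>j k. Cinf UNIV (\<lambda>x. g x $ j $ k)) \<and>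
     (\<forall>x. \<exists>Ob (\<phi>::real^('n::{finite,linorder}) \<Rightarrow> real). open Ob \<and> x \<in> Ob \<and> Cinf Ob \<phi> \<and>
          (\<forall>y\<in>Ob. \<forall>j k. g y $ j $ k = pd j (pd k \<phi>) y))"

definition xsgn :: "'n::linorder set \<Rightarrow> 'n set \<Rightarrow> complex" where
  "xsgn I J = (-1) ^ card {(i,j). i \<in> I \<and> j \<in> J \<and> j < i}"

definition wedge0 :: "'n::{finite,linorder} cf \<Rightarrow> 'n cf \<Rightarrow> 'n cf" where
  "wedge0 a b K = (\<Sum>I\<in>Pow K. xsgn I (K - I) * a I * b (K - I))"

definition wedge :: "'n::{finite,linorder} form \<Rightarrow> 'n form \<Rightarrow> 'n form" where
  "wedge \<alpha> \<beta> = (\<lambda>h x. wedge0 (\<alpha> h x) (\<beta> h x))"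

definition twedge :: "'n::{finite,linorder} form \<Rightarrow> 'n form \<Rightarrow> 'n form" where
  "twedge \<beta> \<gamma> = (\<lambda>h x K. (\<Sum>I\<in>Pow K. (-1) ^ (card I * card (K - I)) * xsgn I (K - I)
                             * \<beta> h x I * \<gamma> h x (K - I)))"

definition dform :: "'n::{finite,linorder} form \<Rightarrow> 'n form" where
  "dform \<alpha> h x K = (\<Sum>i\<in>K. xsgn {i} (K - {i}) * pd i (\<lambda>y. \<alpha> h y (K - {i})) x)"

definition iota0 :: "real^('n::{finite,linorder}) \<Rightarrow> 'n cf \<Rightarrow> 'n cf" where
  "iota0 v a J = (\<Sum>i\<in>- J. xsgn {i} J * complex_of_real (v $ i) * a (insert i J))"

definition cov1 :: "real^('n::{finite,linorder}) \<Rightarrow> 'n cf" where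
  "cov1 l K = (if card K = 1 then complex_of_real (l $ the_elem K) else 0)"

definition one0 :: "'n cf" where
  "one0 K = (if K = {} then 1 else 0)"

definition pull1 :: "real^('n::{finite,linorder})^('n::{finite,linorder}) \<Rightarrow> 'n \<Rightarrow> 'n cf" where
  "pull1 A i K = (if card K = 1 then complex_of_real (A $ i $ the_elem K) else 0)"

definition pull0 :: "real^('n::{finite,linorder})^('n::{finite,linorder}) \<Rightarrow> 'n cf \<Rightarrow> 'n cf" where
  "pull0 A c K = (\<Sum>J\<in>UNIV. c J * foldr wedge0 (map (pull1 A) (sorted_list_of_set J)) one0 K)"

definition formk :: "(real^('n::{finite,linorder})) set \<Rightarrow> nat \<Rightarrow> 'n form \<Rightarrow> bool" where
  "formk W k \<alpha> \<longleftrightarrow> (\<forall>I. Cinf ({0<..} \<times> W) (\<lambda>p. \<alpha> (fst p) (snd p) I)) \<and>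
     (\<forall>h>0. \<forall>x\<in>W. \<forall>I. card I \<noteq> k \<longrightarrow> \<alpha> h x I = 0)"

definition Wneg :: "(real^('n::{finite,linorder})) set \<Rightarrow> nat \<Rightarrow> 'n form \<Rightarrow> bool" where
  "Wneg W k \<alpha> \<longleftrightarrow> formk W k \<alpha> \<and>
     (\<forall>x\<in>W. \<exists>V. open V \<and> x \<in> V \<and> V \<subseteq> W \<and> (\<exists>c>0. \<forall>j. \<exists>D h0. h0 > 0 \<and>
        (\<forall>h. 0 < h \<and> h < h0 \<longrightarrow> (\<forall>y\<in>V. \<forall>I. jnorm j (\<lambda>z. \<alpha> h z I) y \<le> D * exp (- c / h)))))"

definition Winf :: "(real^('n::{finite,linorder})) set \<Rightarrow> nat \<Rightarrow> 'n form \<Rightarrow> bool" where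
  "Winf W k \<alpha> \<longleftrightarrow> formk W k \<alpha> \<and>
     (\<forall>x\<in>W. \<exists>V. open V \<and> x \<in> V \<and> V \<subseteq> W \<and> (\<forall>j. \<exists>D N h0. h0 > 0 \<and>
        (\<forall>h. 0 < h \<and> h < h0 \<longrightarrow> (\<forall>y\<in>V. \<forall>I. jnorm j (\<lambda>z. \<alpha> h z I) y \<le> D * h powr (- N)))))"

text \<open>asymptotic support W^s_P(W) for a codimension-one tropical polyhedral subset P
  (the only case needed below): coordinates x1 = l.(x - p0) with affine span of P = {x1 = 0},
  nu_P = dx1, nu_P^dual = a vector v with dx1(v) = 1.\<close>
definition asupp1 :: "(real^('n::{finite,linorder})) set \<Rightarrow> (real^('n::{finite,linorder})) set \<Rightarrow> real \<Rightarrow> 'n form \<Rightarrow> bool" where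
  "asupp1 W P s \<alpha> \<longleftrightarrow> Winf W 1 \<alpha> \<and>
    (\<forall>x\<in>W - P. \<exists>Ob. open Ob \<and> x \<in> Ob \<and> Ob \<subseteq> W \<and> Wneg Ob 1 \<alpha>) \<and>
    (\<exists>l p0 v. l \<noteq> 0 \<and> affine hull P = {x. l \<bullet> (x - p0) = 0} \<and> l \<bullet> v = 1 \<and>
      (\<exists>Ob h \<eta>. open Ob \<and> P \<subseteq> Ob \<and> Ob \<subseteq> W \<and> Wneg Ob 1 \<eta> \<and>
         (\<forall>hb>0. \<forall>x\<in>Ob. \<forall>I. \<alpha> hb x I = h hb x * cov1 l I + \<eta> hb x I)) \<and>
      (\<forall>p\<in>P. \<exists>V. open V \<and> convex V \<and> p \<in> V \<and> V \<subseteq> W \<and>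
         (\<forall>j (\<beta>::nat). \<exists>D h0. h0 > 0 \<and> (\<forall>hb. 0 < hb \<and> hb < h0 \<longrightarrow>
            (let G = (\<lambda>y. (\<lambda>x. jnorm j (\<lambda>z. iota0 v (\<alpha> hb z) {}) x) ` {x\<in>V. l \<bullet> (x - p0) = y});
                 NV = (\<lambda>x. l \<bullet> (x - p0)) ` V
             in (\<forall>y\<in>NV. bdd_above (G y)) \<and>
                (\<lambda>y. \<bar>y\<bar> ^ \<beta> * Sup (G y)) integrable_on NV \<and>
                integral NV (\<lambda>y. \<bar>y\<bar> ^ \<beta> * Sup (G y))
                   \<le> D * hb powr (- (real j + s - real \<beta> - 1) / 2))))))"

definition dvec :: "(real^('n::{finite,linorder}) \<Rightarrow> real^('n::{finite,linorder})^('n::{finite,linorder})) \<Rightarrow> int^('n::{finite,linorder}) \<Rightarrow> real \<Rightarrow> real^('n::{finite,linorder}) \<Rightarrow> real^('n::{finite,linorder})" where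
  "dvec g n h x = (\<chi> k. h / (4 * pi) * (\<Sum>j\<in>UNIV. real_of_int (n $ j) * g x $ j $ k))"

definition nabla :: "(real \<Rightarrow> real^('n::{finite,linorder}) \<Rightarrow> real^('n::{finite,linorder})) \<Rightarrow> 'n form \<Rightarrow> 'n form" where
  "nabla w \<beta> h x I = (\<Sum>k\<in>UNIV. complex_of_real (w h x $ k) * pd k (\<lambda>y. \<beta> h y I) x)"

text \<open>bracket of  alpha z^m check-d_n  and  beta z^m' check-d_n'  (components of the check-d part)\<close>
definition tbr :: "(real^('n::{finite,linorder}) \<Rightarrow> real^('n::{finite,linorder})^('n::{finite,linorder})) \<Rightarrow> int^('n::{finite,linorder}) \<Rightarrow> int^('n::{finite,linorder}) \<Rightarrow> int^('n::{finite,linorder}) \<Rightarrow> int^('n::{finite,linorder})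
    \<Rightarrow> 'n form \<Rightarrow> 'n form \<Rightarrow> 'n vform" where
  "tbr g m n m' n' \<alpha> \<beta> = (\<lambda>l h x K.
       of_int (pairing m' n * n' $ l - pairing m n' * n $ l) * wedge \<alpha> \<beta> h x K
     + of_int (n' $ l) * wedge \<alpha> (nabla (dvec g n) \<beta>) h x K
     - of_int (n $ l) * twedge \<beta> (nabla (dvec g n') \<alpha>) h x K)"

definition brk :: "(real^('n::{finite,linorder}) \<Rightarrow> real^('n::{finite,linorder})^('n::{finite,linorder})) \<Rightarrow> int^('n::{finite,linorder}) \<Rightarrow> int^('n::{finite,linorder}) \<Rightarrow> 'n vform \<Rightarrow> 'n vform \<Rightarrow> 'n vform" where
  "brk g m m' A B = (\<lambda>l h x K. \<Sum>i\<in>UNIV. \<Sum>j\<in>UNIV. tbr g m (ev i) m' (ev j) (A i) (B j) l h x K)"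

definition nbr :: "int^('n::{finite,linorder}) \<Rightarrow> int^('n::{finite,linorder}) \<Rightarrow> 'n vform \<Rightarrow> 'n vform \<Rightarrow> 'n vform" where
  "nbr m m' A B = (\<lambda>l h x K. \<Sum>i\<in>UNIV. \<Sum>j\<in>UNIV.
       of_int (pairing m' (ev i) * ev j $ l - pairing m (ev j) * ev i $ l) * wedge (A i) (B j) h x K)"

definition gV :: "real^('n::{finite,linorder})^('n::{finite,linorder}) \<Rightarrow> real^('n::{finite,linorder}) \<Rightarrow> real^('n::{finite,linorder}) \<Rightarrow> real" where
  "gV G u v = u \<bullet> (G *v v)"

definition Hdir :: "int^('n::{finite,linorder}) \<Rightarrow> real^('n::{finite,linorder})" where
  "Hdir m = (if m = 0 then axis (LEAST i. True) 1 else rvec m)"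

definition Hu1 :: "real^('n::{finite,linorder})^('n::{finite,linorder}) \<Rightarrow> real^('n::{finite,linorder}) \<Rightarrow> int^('n::{finite,linorder}) \<Rightarrow> real^('n::{finite,linorder}) \<Rightarrow> real" where
  "Hu1 G x0 m x = - gV G (x - x0) (Hdir m) / gV G (Hdir m) (Hdir m)"

definition Huperp :: "real^('n::{finite,linorder})^('n::{finite,linorder}) \<Rightarrow> real^('n::{finite,linorder}) \<Rightarrow> int^('n::{finite,linorder}) \<Rightarrow> real^('n::{finite,linorder}) \<Rightarrow> real^('n::{finite,linorder})" where
  "Huperp G x0 m x = (x - x0) + Hu1 G x0 m x *\<^sub>R Hdir m"

definition Hproj :: "real^('n::{finite,linorder})^('n::{finite,linorder}) \<Rightarrow> int^('n::{finite,linorder}) \<Rightarrow> real^('n::{finite,linorder})^('n::{finite,linorder})" where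
  "Hproj G m = (\<chi> i j. (if i = j then 1 else 0)
                   - Hdir m $ i * (G *v Hdir m) $ j / gV G (Hdir m) (Hdir m))"

definition oint :: "real \<Rightarrow> real \<Rightarrow> (real \<Rightarrow> complex) \<Rightarrow> complex" where
  "oint a b f = (if a \<le> b then integral {a..b} f else - integral {b..a} f)"

text \<open>H_m: coordinates x = x0 + u_perp - u1 m with u_perp g_V-orthogonal to m;
  first term: fibre integral over r of rho^*(alpha_0 restricted to U_m^perp), extended constantly in u1
  (= pullback along the projection of  int_0^1 r^(k-1) iota_{u_perp} alpha(x0 + r u_perp) dr);
  second term:  int_0^{u1} (iota_{d/du1} alpha)(s, u_perp) ds.\<close>
definition Hm :: "real^('n::{finite,linorder})^('n::{finite,linorder}) \<Rightarrow> real^('n::{finite,linorder}) \<Rightarrow> int^('n::{finite,linorder}) \<Rightarrow> 'n form \<Rightarrow> 'n form" where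
  "Hm G x0 m \<alpha> h x J =
     pull0 (Hproj G m) (\<lambda>J'. integral {0..1} (\<lambda>r. complex_of_real (r ^ card J') *
          iota0 (Huperp G x0 m x) (\<alpha> h (x0 + r *\<^sub>R Huperp G x0 m x)) J')) J
   + oint 0 (Hu1 G x0 m x) (\<lambda>s. iota0 (- Hdir m) (\<alpha> h (x0 + Huperp G x0 m x - s *\<^sub>R Hdir m)) J)"

definition Hv :: "real^('n::{finite,linorder})^('n::{finite,linorder}) \<Rightarrow> real^('n::{finite,linorder}) \<Rightarrow> int^('n::{finite,linorder}) \<Rightarrow> 'n vform \<Rightarrow> 'n vform" where
  "Hv G x0 m A = (\<lambda>l. Hm G x0 m (A l))"

definition ssupp :: "'n series \<Rightarrow> nat \<Rightarrow> (int^('n::{finite,linorder})) set" where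
  "ssupp \<Phi> j = {m. \<Phi> j m \<noteq> (\<lambda>l h x K. 0)}"

definition sbr :: "(real^('n::{finite,linorder}) \<Rightarrow> real^('n::{finite,linorder})^('n::{finite,linorder})) \<Rightarrow> 'n series \<Rightarrow> 'n series \<Rightarrow> 'n series" where
  "sbr g \<Phi> \<Psi> j m = (\<lambda>l h x K. \<Sum>j1\<in>{..j}. \<Sum>m1\<in>ssupp \<Phi> j1.
       brk g m1 (m - m1) (\<Phi> j1 m1) (\<Psi> (j - j1) (m - m1)) l h x K)"

definition snat :: "'n::{finite,linorder} series \<Rightarrow> 'n series \<Rightarrow> 'n series" where
  "snat \<Phi> \<Psi> j m = (\<lambda>l h x K. \<Sum>j1\<in>{..j}. \<Sum>m1\<in>ssupp \<Phi> j1.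
       nbr m1 (m - m1) (\<Phi> j1 m1) (\<Psi> (j - j1) (m - m1)) l h x K)"

definition sdf :: "'n::{finite,linorder} series \<Rightarrow> 'n series" where
  "sdf \<Phi> j m = (\<lambda>l. dform (\<Phi> j m l))"

text \<open>the input  - sum_{j,k>=1} c_{jk} (delta_{jk} + eps_{jk}) z^{k m_i} check-d_{n_i} t^j\<close>
definition wall_series :: "(nat \<Rightarrow> nat \<Rightarrow> complex) \<Rightarrow> (nat \<Rightarrow> nat \<Rightarrow> 'n form) \<Rightarrow> (nat \<Rightarrow> nat \<Rightarrow> 'n form)
     \<Rightarrow> int^('n::{finite,linorder}) \<Rightarrow> int^('n::{finite,linorder}) \<Rightarrow> 'n series" where
  "wall_series c \<delta> \<epsilon> mi ni j m =
     (if 1 \<le> j \<and> (\<exists>k::nat. 1 \<le> k \<and> m = int k *s mi)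
      then (let k = (THE k::nat. 1 \<le> k \<and> m = int k *s mi) in
            (\<lambda>l h x K. - of_int (ni $ l) * c j k * (\<delta> j k h x K + \<epsilon> j k h x K)))
      else (\<lambda>l h x K. 0))"

text \<open>the class of Pi in lim g_N / E_N is a Maurer-Cartan solution:
  every t^j z^m coefficient of  d Pi + 1/2 [Pi,Pi]  lies in  sum_n W^{-infinity}_2(U) check-d_n\<close>
definition mc_mod :: "(real^('n::{finite,linorder}) \<Rightarrow> real^('n::{finite,linorder})^('n::{finite,linorder})) \<Rightarrow> (real^('n::{finite,linorder})) set \<Rightarrow> 'n series \<Rightarrow> bool" where
  "mc_mod g U Pm \<longleftrightarrow> (\<forall>j m. \<exists>S f. finite S \<and> (\<forall>n\<in>S. Wneg U 2 (f n)) \<and>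
      (\<forall>h>0. \<forall>x\<in>U. \<forall>l K. sdf Pm j m l h x K + 1/2 * sbr g Pm Pm j m l h x K
                         = (\<Sum>n\<in>S. of_int (n $ l) * f n h x K)))"

definition gaussian_near :: "(real^('n::{finite,linorder})) set \<Rightarrow> (real^('n::{finite,linorder})) set \<Rightarrow> real^('n::{finite,linorder}) \<Rightarrow> 'n form \<Rightarrow> bool" where
  "gaussian_near U P \<nu> \<delta> \<longleftrightarrow> (\<exists>Ob l b. open Ob \<and> P \<subseteq> Ob \<and> Ob \<subseteq> U \<and>
      {x\<in>Ob. l \<bullet> x + b = 0} = P \<inter> Ob \<and> l \<bullet> \<nu> > 0 \<and>
      (\<forall>h>0. \<forall>x\<in>Ob. \<forall>I. \<delta> h x I =
          complex_of_real ((pi * h) powr (-1/2) * exp (- (l \<bullet> x + b)\<^sup>2 / h)) * cov1 l I))"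

text \<open>Phi = Pi - 1/2 H[Phi,Phi], solved order by order (no t^0 term)\<close>
definition Phi_of :: "(real^('n::{finite,linorder}) \<Rightarrow> real^('n::{finite,linorder})^('n::{finite,linorder})) \<Rightarrow> real^('n::{finite,linorder})^('n::{finite,linorder}) \<Rightarrow> real^('n::{finite,linorder}) \<Rightarrow> 'n series \<Rightarrow> 'n series" where
  "Phi_of g G x0 Pm = (THE \<Phi>. (\<forall>m. \<Phi> 0 m = (\<lambda>l h x K. 0)) \<and>
      (\<forall>j m. \<Phi> j m = (\<lambda>l h x K. Pm j m l h x K - 1/2 * Hv G x0 m (sbr g \<Phi> \<Phi> j m) l h x K)))"

definition Psi_of :: "real^('n::{finite,linorder})^('n::{finite,linorder}) \<Rightarrow> real^('n::{finite,linorder}) \<Rightarrow> 'n series \<Rightarrow> 'n series" where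
  "Psi_of G x0 Pm = (THE \<Psi>. (\<forall>m. \<Psi> 0 m = (\<lambda>l h x K. 0)) \<and>
      (\<forall>j m. \<Psi> j m = (\<lambda>l h x K. Pm j m l h x K - 1/2 * Hv G x0 m (snat \<Psi> \<Psi> j m) l h x K)))"

end

(*
A 1-form lies in W^s_P for a half-hyperplane P exactly when (i) it is exponentially small off P,
(ii) its contraction with every direction tangent to P is exponentially small, and (iii) locally
|d^j alpha| <= C h^(-(j+s)/2) (1 + dist/sqrt h)^(-b) for all j and b, where dist is the distance to
the hyperplane: the slice integrals give the pointwise bounds by a one-dimensional Sobolev
inequality.  In this form the class is stable under the operations that occur.  Two such forms on
transversal supports through Q have a wedge product concentrated on Q, of order s + r, and on
parallel supports the product is exponentially small.  The operator h times a derivative lowers s by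
one.  Since Q lies behind the hyperplane through x0, the homotopy operator H_m integrates a form
concentrated on Q over lines in direction m; the result is supported on Q - R_{>=0} m and the
integration across the scale sqrt h lowers the order by one.  Hence natural-brackets of two forms of
order 1 give order 1, while every other contribution to Phi - Psi has order 0.  The directions n match
because the integral covector N(p,q), which annihilates L and p m1 + q m2, is additive in (p,q) and
(m',N) N' - (m,N') N is a multiple of N + N'.
*)

theory Submission
  imports Defs
begin

text \<open>The slice integrals take suprema along the leaves parallel to one support. They do not
  multiply well, because the leaves of two transversal supports cross. Pointwise decay does
  multiply: (1 + a)(1 + b) dominates 1 + a + b, and for transversal supports the two distances
  together control the distance to Q. The decay exponent is arbitrary, so a step may spend a fixed
  number of its powers; the homotopy operator spends two, which turn the integral along m into a
  Lorentzian integral of size sqrt h. That bound is uniform in x because for a given m every point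
  of Q has the same positive coordinate \<open>kap\<close> along m.

  The series are never estimated as a whole. One induction on the power of t carries both of them
  coefficient by coefficient, and each replacement of a factor by its leading part leaves an error
  one order lower. Directions have to be kept apart from orders: a single covector is claimed only
  for \<Psi>, so \<open>good\<close> records a factorisation for \<Psi> and a bare order for the
  difference.\<close>

type_synonym 'n rn = "(real, 'n) vec"

subsection \<open>Calculus of smooth functions\<close>

lemma Ck_cong:
  assumes "open S" "\<And>x. x \<in> S \<Longrightarrow> f x = g x"
  shows "Ck k S f \<longleftrightarrow> Ck k S g"
  using assms(2)
proof (induction k arbitrary: f g)
  case 0
  then show ?case by (simp cong: continuous_on_cong)
next
  case (Suc k)
  have *: "(f has_derivative D) (at x) \<longleftrightarrow> (g has_derivative D) (at x)" if "x \<in> S" for x D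
    using that Suc.prems assms(1) has_derivative_transform_within_open[of f D x UNIV S g]
      has_derivative_transform_within_open[of g D x UNIV S f] by fastforce
  have fr: "frechet_derivative f (at x) = frechet_derivative g (at x)" if "x \<in> S" for x
    using *[OF that] by (simp add: frechet_derivative_def)
  have d: "f differentiable (at x) \<longleftrightarrow> g differentiable (at x)" if "x \<in> S" for x
    using *[OF that] by (simp add: differentiable_def)
  have "Ck k S (\<lambda>x. frechet_derivative f (at x) b) \<longleftrightarrow> Ck k S (\<lambda>x. frechet_derivative g (at x) b)" for b
    by (rule Suc.IH) (simp add: fr)
  then show ?case
    using d Suc.prems by (simp cong: continuous_on_cong)
qed

lemma Ck_Suc_imp: "Ck (Suc k) S f \<Longrightarrow> Ck k S f"
proof (induction k arbitrary: f)
  case (Suc k)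
  then show ?case by (metis Ck.simps(2))
qed auto

text \<open>\<open>frechet_derivative\<close> is a choice, so \<open>Ck\<close> is awkward to verify
  directly. On an open set any explicit derivative \<open>D\<close> equals the chosen one, which
  reduces the closure properties below to the formula for a derivative.\<close>

lemma Ck_SucI:
  assumes "open S" "\<And>x. x \<in> S \<Longrightarrow> (f has_derivative D x) (at x)"
    and "\<And>b. b \<in> Basis \<Longrightarrow> Ck k S (\<lambda>x. D x b)"
  shows "Ck (Suc k) S f"
proof -
  have "Ck k S (\<lambda>x. frechet_derivative f (at x) b)" if "b \<in> Basis" for b
    using assms(3)[OF that] Ck_cong[OF assms(1), of "\<lambda>x. frechet_derivative f (at x) b" "\<lambda>x. D x b"]
      assms(2) frechet_derivative_at by metis
  moreover have "continuous_on S f"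
    using assms(1,2) by (metis continuous_at_imp_continuous_on has_derivative_continuous)
  ultimately show ?thesis
    using assms(2) by (auto simp: differentiable_def)
qed

lemma Ck_Suc_has_derivative:
  "Ck (Suc k) S f \<Longrightarrow> x \<in> S \<Longrightarrow> (f has_derivative frechet_derivative f (at x)) (at x)"
  by (simp add: frechet_derivative_works)

lemma Ck_const: "open S \<Longrightarrow> Ck k S (\<lambda>x. c)"
proof (induction k arbitrary: c)
  case (Suc k)
  show ?case
    by (rule Ck_SucI[where D="\<lambda>x v. 0"]) (use Suc in \<open>auto\<close>)
qed auto

lemma Ck_add:
  assumes "open S" shows "Ck k S f \<Longrightarrow> Ck k S g \<Longrightarrow> Ck k S (\<lambda>x. f x + g x)"
proof (induction k arbitrary: f g)
  case 0
  then show ?case by (simp add: continuous_on_add)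
next
  case (Suc k)
  show ?case
  proof (rule Ck_SucI[OF assms])
    show "((\<lambda>x. f x + g x) has_derivative
        (\<lambda>v. frechet_derivative f (at x) v + frechet_derivative g (at x) v)) (at x)" if "x \<in> S" for x
      using that Suc.prems by (intro has_derivative_add Ck_Suc_has_derivative)
    show "Ck k S (\<lambda>x. frechet_derivative f (at x) b + frechet_derivative g (at x) b)" if "b \<in> Basis" for b
      using that Suc by simp
  qed
qed

lemma Ck_sum:
  assumes "open S" "\<And>i. i \<in> I \<Longrightarrow> Ck k S (f i)"
  shows "Ck k S (\<lambda>x. \<Sum>i\<in>I. f i x)"
  using assms(2)
  by (induction I rule: infinite_finite_induct) (auto simp: assms(1) Ck_const Ck_add)

lemma Ck_mult:
  fixes f g :: "'a::euclidean_space \<Rightarrow> 'b::real_normed_algebra"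
  assumes "open S" shows "Ck k S f \<Longrightarrow> Ck k S g \<Longrightarrow> Ck k S (\<lambda>x. f x * g x)"
proof (induction k arbitrary: f g)
  case 0
  then show ?case by (simp add: continuous_on_mult)
next
  case (Suc k)
  show ?case
  proof (rule Ck_SucI[OF assms])
    show "((\<lambda>x. f x * g x) has_derivative
        (\<lambda>v. f x * frechet_derivative g (at x) v + frechet_derivative f (at x) v * g x)) (at x)" if "x \<in> S" for x
      using that Suc.prems by (intro has_derivative_mult Ck_Suc_has_derivative)
    show "Ck k S (\<lambda>x. f x * frechet_derivative g (at x) b + frechet_derivative f (at x) b * g x)"
      if "b \<in> Basis" for b
      using that Suc.prems by (intro Ck_add assms Suc.IH) (auto intro: Ck_Suc_imp)
  qed
qed

lemma Ck_bounded_linear: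
  assumes "open S" "bounded_linear f"
  shows "Ck k S f"
proof (cases k)
  case 0
  then show ?thesis using assms by (simp add: linear_continuous_on)
next
  case (Suc k')
  show ?thesis unfolding Suc
    by (rule Ck_SucI[where D="\<lambda>x. f"])
      (use assms in \<open>auto intro: bounded_linear_imp_has_derivative Ck_const\<close>)
qed

section \<open>Smoothness jointly in h > 0 and x\<close>

definition smooth :: "('n::{finite,linorder}) rn set \<Rightarrow> (real \<Rightarrow> 'n rn \<Rightarrow> complex) \<Rightarrow> bool" where
  "smooth U f \<longleftrightarrow> Cinf ({0<..} \<times> U) (\<lambda>p. f (fst p) (snd p))"

lemma formk_iff:
  "formk U k \<alpha> \<longleftrightarrow> (\<forall>I. smooth U (\<lambda>h x. \<alpha> h x I)) \<and> (\<forall>h>0. \<forall>x\<in>U. \<forall>I. card I \<noteq> k \<longrightarrow> \<alpha> h x I = 0)"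
  by (simp add: formk_def smooth_def)

context
  fixes U :: "('n::{finite,linorder}) rn set"
  assumes U: "open U"
begin

lemma open_hU: "open ({0::real<..} \<times> U)"
  using U by (simp add: open_Times)

lemma smooth_cong:
  assumes "\<And>h x. h > 0 \<Longrightarrow> x \<in> U \<Longrightarrow> f h x = g h x"
  shows "smooth U f \<longleftrightarrow> smooth U g"
  unfolding smooth_def Cinf_def
  using Ck_cong[OF open_hU, of "\<lambda>p. f (fst p) (snd p)" "\<lambda>p. g (fst p) (snd p)"] assms by auto

lemma smooth_const: "smooth U (\<lambda>h x. c)"
  by (simp add: smooth_def Cinf_def Ck_const open_hU)

lemma smooth_add: "smooth U f \<Longrightarrow> smooth U g \<Longrightarrow> smooth U (\<lambda>h x. f h x + g h x)"
  by (simp add: smooth_def Cinf_def Ck_add open_hU)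

lemma smooth_sum: "(\<And>i. i \<in> I \<Longrightarrow> smooth U (f i)) \<Longrightarrow> smooth U (\<lambda>h x. \<Sum>i\<in>I. f i h x)"
  by (simp add: smooth_def Cinf_def Ck_sum open_hU)

lemma smooth_mult: "smooth U f \<Longrightarrow> smooth U g \<Longrightarrow> smooth U (\<lambda>h x. f h x * g h x)"
  by (simp add: smooth_def Cinf_def Ck_mult open_hU)

lemma smooth_h: "smooth U (\<lambda>h x. complex_of_real h)"
  unfolding smooth_def Cinf_def
  by (intro allI Ck_bounded_linear open_hU bounded_linear_compose[OF bounded_linear_of_real bounded_linear_fst])

lemma smooth_linear:
  assumes "bounded_linear (f :: 'n rn \<Rightarrow> real)"
  shows "smooth U (\<lambda>h x. complex_of_real (f x))"
  unfolding smooth_def Cinf_def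
  using bounded_linear_compose[OF bounded_linear_of_real bounded_linear_compose[OF assms bounded_linear_snd]]
  by (auto intro: Ck_bounded_linear open_hU)

lemma smooth_of_real:
  assumes "Cinf UNIV (f :: 'n rn \<Rightarrow> real)"
  shows "smooth U (\<lambda>h x. complex_of_real (f x))"
proof -
  have "Ck k UNIV f \<Longrightarrow> Ck k ({0::real<..} \<times> U) (\<lambda>p. complex_of_real (f (snd p)))" for k
  proof (induction k arbitrary: f)
    case 0
    then show ?case
      by (auto intro!: continuous_intros continuous_on_compose2[of UNIV f])
  next
    case (Suc k)
    show ?case
    proof (rule Ck_SucI[OF open_hU, where D="\<lambda>p v. complex_of_real (frechet_derivative f (at (snd p)) (snd v))"])
      fix p :: "real \<times> ('n rn)"
      have 1: "(f has_derivative frechet_derivative f (at (snd p))) (at (snd p))"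
        using Suc.prems by (intro Ck_Suc_has_derivative) auto
      show "((\<lambda>p. complex_of_real (f (snd p))) has_derivative
          (\<lambda>v. of_real (frechet_derivative f (at (snd p)) (snd v)))) (at p)"
        by (rule has_derivative_of_real[OF has_derivative_compose[OF has_derivative_snd[OF has_derivative_ident] 1]])
    next
      fix b :: "real \<times> ('n rn)" assume "b \<in> Basis"
      \<comment> \<open>A basis vector of the product either points along h, where the derivative
        vanishes, or is a basis vector of the second factor.\<close>
      then consider "snd b = 0" | "snd b \<in> Basis" by (auto simp: Basis_prod_def)
      then show "Ck k ({0::real<..} \<times> U) (\<lambda>p. complex_of_real (frechet_derivative f (at (snd p)) (snd b)))"
      proof cases
        case 1
        have "frechet_derivative f (at y) 0 = 0" for y
          using Suc.prems by (intro linear_0 linear_frechet_derivative) auto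
        then show ?thesis using 1 by (simp add: Ck_const[OF open_hU])
      next
        case 2
        then show ?thesis using Suc by auto
      qed
    qed
  qed
  then show ?thesis using assms by (auto simp: smooth_def Cinf_def)
qed

lemma smooth_has_derivative:
  assumes "smooth U f" "h > 0" "x \<in> U"
  shows "((\<lambda>p. f (fst p) (snd p)) has_derivative
     frechet_derivative (\<lambda>p. f (fst p) (snd p)) (at (h, x))) (at (h, x))"
  using assms Ck_Suc_has_derivative[of 0 "{0<..} \<times> U" "\<lambda>p. f (fst p) (snd p)" "(h,x)"]
  unfolding smooth_def Cinf_def by auto

lemma smooth_has_derivative_x:
  assumes "smooth U f" "h > 0" "x \<in> U"
  shows "(f h has_derivative (\<lambda>v. frechet_derivative (\<lambda>p. f (fst p) (snd p)) (at (h, x)) (0, v))) (at x)"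
  using has_derivative_compose[OF has_derivative_Pair[OF has_derivative_const has_derivative_ident]
     smooth_has_derivative[OF assms], of UNIV]
  by simp

lemma smooth_differentiable:
  assumes "smooth U f" "h > 0" "x \<in> U"
  shows "f h differentiable (at x)"
  using smooth_has_derivative_x[OF assms] by (auto simp: differentiable_def)

lemma pd_eq_frechet:
  assumes "smooth U f" "h > 0" "x \<in> U"
  shows "pd k (f h) x = frechet_derivative (\<lambda>p. f (fst p) (snd p)) (at (h, x)) (0, axis k 1)"
  unfolding pd_def frechet_derivative_at[OF smooth_has_derivative_x[OF assms], symmetric] ..

lemma smooth_pd:
  assumes "smooth U f"
  shows "smooth U (\<lambda>h. pd k (f h))"
proof -
  have b: "(0, axis k 1) \<in> (Basis :: (real \<times> 'n rn) set)"
    by (simp add: Basis_prod_def axis_in_Basis_iff image_iff)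
  have "Ck m ({0<..} \<times> U) (\<lambda>p. frechet_derivative (\<lambda>p. f (fst p) (snd p)) (at p) (0, axis k 1))" for m
  proof -
    have "Ck (Suc m) ({0<..} \<times> U) (\<lambda>p. f (fst p) (snd p))"
      using assms by (simp only: smooth_def Cinf_def)
    then show ?thesis unfolding Ck.simps using b by blast
  qed
  then have "smooth U (\<lambda>h x. frechet_derivative (\<lambda>p. f (fst p) (snd p)) (at (h,x)) (0, axis k 1))"
    unfolding smooth_def Cinf_def by simp
  then show ?thesis
    by (subst smooth_cong[where g="\<lambda>h x. frechet_derivative (\<lambda>p. f (fst p) (snd p)) (at (h,x)) (0, axis k 1)"])
      (simp_all add: pd_eq_frechet[OF assms])
qed

lemma smooth_iterpd: "smooth U f \<Longrightarrow> smooth U (\<lambda>h. iterpd ks (f h))"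
  by (induction ks) (auto intro: smooth_pd)

lemma smooth_continuous_on:
  "smooth U f \<Longrightarrow> continuous_on ({0<..} \<times> U) (\<lambda>p. f (fst p) (snd p))"
  unfolding smooth_def Cinf_def by (meson Ck.simps(1))

lemma smooth_continuous_on_x:
  assumes "smooth U f" "h > 0" shows "continuous_on U (f h)"
proof -
  have "continuous_on U (\<lambda>x. (\<lambda>p. f (fst p) (snd p)) (h, x))"
    using assms by (intro continuous_on_compose2[OF smooth_continuous_on]) (auto intro!: continuous_intros)
  then show ?thesis by simp
qed

lemma frechet_axis_sum:
  fixes f :: "'n rn \<Rightarrow> 'b::real_normed_vector"
  assumes "f differentiable (at x)"
  shows "frechet_derivative f (at x) v = (\<Sum>k\<in>UNIV. v $ k *\<^sub>R pd k f x)"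
proof -
  interpret linear "frechet_derivative f (at x)"
    using assms by (rule linear_frechet_derivative)
  have "v = (\<Sum>k\<in>UNIV. v $ k *\<^sub>R axis k 1)"
    by (metis basis_expansion scalar_mult_eq_scaleR)
  then have "frechet_derivative f (at x) v = frechet_derivative f (at x) (\<Sum>k\<in>UNIV. v $ k *\<^sub>R axis k 1)" by simp
  also have "\<dots> = (\<Sum>k\<in>UNIV. v $ k *\<^sub>R pd k f x)"
    by (simp add: sum scale pd_def)
  finally show ?thesis .
qed

lemma pd_cong:
  assumes "\<And>x. x \<in> U \<Longrightarrow> f x = g x" "x \<in> U"
  shows "pd k f x = pd k g x"
proof -
  have "(f has_derivative D) (at x) \<longleftrightarrow> (g has_derivative D) (at x)" for D
    using assms U has_derivative_transform_within_open[of f D x UNIV U g]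
      has_derivative_transform_within_open[of g D x UNIV U f] by fastforce
  then show ?thesis by (simp add: pd_def frechet_derivative_def)
qed

lemma iterpd_cong:
  assumes "\<And>x. x \<in> U \<Longrightarrow> f x = g x" "x \<in> U"
  shows "iterpd ks f x = iterpd ks g x"
  using assms(2)
proof (induction ks arbitrary: x)
  case Nil
  then show ?case using assms(1) by simp
next
  case (Cons k ks)
  then show ?case by (auto intro!: pd_cong)
qed

end

lemma iterpd_snoc: "iterpd (ks @ [k]) f = iterpd ks (pd k f)"
  by (induction ks) auto

lemma pd_add:
  assumes "f differentiable (at x)" "g differentiable (at x)"
  shows "pd k (\<lambda>x. f x + g x) x = pd k f x + pd k g x"
  unfolding pd_def
  by (simp add: frechet_derivative_at[OF has_derivative_add[OF
    assms[unfolded frechet_derivative_works]], symmetric])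

lemma pd_const: "pd k (\<lambda>x. c) x = 0"
  by (simp add: pd_def frechet_derivative_const)

lemma iterpd_0: "iterpd ks (\<lambda>x. 0) = (\<lambda>x. 0)"
  by (induction ks) (auto simp: pd_const)

lemma pd_mult:
  fixes f g :: "('n::{finite,linorder}) rn \<Rightarrow> 'b::real_normed_algebra"
  assumes "f differentiable (at x)" "g differentiable (at x)"
  shows "pd k (\<lambda>x. f x * g x) x = f x * pd k g x + pd k f x * g x"
  unfolding pd_def
  by (simp add: frechet_derivative_at[OF has_derivative_mult[OF
    assms[unfolded frechet_derivative_works]], symmetric])

subsection \<open>Bounds on all derivatives as \<open>h \<rightarrow> 0\<close>\<close>

text \<open>The weight is indexed by the order of differentiation, so that differentiating the
  function amounts to shifting the weight (\<open>derivs_bounded_ord_Suc\<close>). Inductions on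
  \<open>n\<close> then run for all weights at once. The threshold for h may depend on the
  derivative taken.\<close>

definition derivs_bounded_ord :: "nat \<Rightarrow> ('n::{finite,linorder}) rn set \<Rightarrow> (nat \<Rightarrow> real \<Rightarrow> 'n rn \<Rightarrow> real) \<Rightarrow> (real \<Rightarrow> 'n rn \<Rightarrow> complex) \<Rightarrow> bool" where
  "derivs_bounded_ord n K \<phi> f \<longleftrightarrow> (\<forall>ks. length ks = n \<longrightarrow>
     (\<exists>D. \<forall>\<^sub>F h in at_right 0. \<forall>x\<in>K. norm (iterpd ks (f h) x) \<le> D * \<phi> n h x))"

definition derivs_bounded :: "('n::{finite,linorder}) rn set \<Rightarrow> (nat \<Rightarrow> real \<Rightarrow> 'n rn \<Rightarrow> real) \<Rightarrow> (real \<Rightarrow> 'n rn \<Rightarrow> complex) \<Rightarrow> bool" where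
  "derivs_bounded K \<phi> f \<longleftrightarrow> (\<forall>n. derivs_bounded_ord n K \<phi> f)"

definition nonneg_on :: "('n::{finite,linorder}) rn set \<Rightarrow> (nat \<Rightarrow> real \<Rightarrow> 'n rn \<Rightarrow> real) \<Rightarrow> bool" where
  "nonneg_on K \<phi> \<longleftrightarrow> (\<forall>j h x. 0 < h \<longrightarrow> x \<in> K \<longrightarrow> 0 \<le> \<phi> j h x)"

lemma eventually_h01: "\<forall>\<^sub>F h in at_right (0::real). 0 < h \<and> h < 1"
  by (simp add: eventually_at_right_field) (metis zero_less_one)

lemma derivs_bounded_ord_0: "derivs_bounded_ord 0 K \<phi> f \<longleftrightarrow> (\<exists>D. \<forall>\<^sub>F h in at_right 0. \<forall>x\<in>K. norm (f h x) \<le> D * \<phi> 0 h x)"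
  by (simp add: derivs_bounded_ord_def)

text \<open>It is the innermost derivative, the last entry of the list, that is split off: the
  function changes to \<open>pd k (f h)\<close>, and the inductions that follow are general in the
  function.\<close>

lemma derivs_bounded_ord_Suc: "derivs_bounded_ord (Suc n) K \<phi> f \<longleftrightarrow> (\<forall>k. derivs_bounded_ord n K (\<lambda>j. \<phi> (Suc j)) (\<lambda>h. pd k (f h)))"
proof
  assume *: "derivs_bounded_ord (Suc n) K \<phi> f"
  show "\<forall>k. derivs_bounded_ord n K (\<lambda>j. \<phi> (Suc j)) (\<lambda>h. pd k (f h))"
    unfolding derivs_bounded_ord_def
  proof (intro allI impI)
    fix k and ks :: "'a list" assume "length ks = n"
    then have "length (ks @ [k]) = Suc n" by simp
    then show "\<exists>D. \<forall>\<^sub>F h in at_right 0. \<forall>x\<in>K. norm (iterpd ks (pd k (f h)) x) \<le> D * \<phi> (Suc n) h x"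
      using * unfolding derivs_bounded_ord_def iterpd_snoc[symmetric] by blast
  qed
next
  assume *: "\<forall>k. derivs_bounded_ord n K (\<lambda>j. \<phi> (Suc j)) (\<lambda>h. pd k (f h))"
  show "derivs_bounded_ord (Suc n) K \<phi> f"
    unfolding derivs_bounded_ord_def
  proof (intro allI impI)
    fix ks :: "'a list" assume "length ks = Suc n"
    then obtain k ks' where "ks = ks' @ [k]" "length ks' = n"
      by (metis length_Suc_conv_rev)
    then show "\<exists>D. \<forall>\<^sub>F h in at_right 0. \<forall>x\<in>K. norm (iterpd ks (f h) x) \<le> D * \<phi> (Suc n) h x"
      using * unfolding derivs_bounded_ord_def by (auto simp: iterpd_snoc)
  qed
qed

lemma derivs_bounded_pd: "derivs_bounded K \<phi> f \<Longrightarrow> derivs_bounded K (\<lambda>j. \<phi> (Suc j)) (\<lambda>h. pd k (f h))"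
  by (metis derivs_bounded_def derivs_bounded_ord_Suc)

lemma nonneg_on_Suc: "nonneg_on K \<phi> \<Longrightarrow> nonneg_on K (\<lambda>j. \<phi> (Suc j))"
  by (simp add: nonneg_on_def)

lemma derivs_bounded_subset:
  assumes "derivs_bounded K \<phi> f" "K' \<subseteq> K" shows "derivs_bounded K' \<phi> f"
  unfolding derivs_bounded_def derivs_bounded_ord_def
proof (intro allI impI)
  fix n and ks :: "'a list" assume "length ks = n"
  then obtain D where "\<forall>\<^sub>F h in at_right 0. \<forall>x\<in>K. norm (iterpd ks (f h) x) \<le> D * \<phi> n h x"
    using assms(1) unfolding derivs_bounded_def derivs_bounded_ord_def by blast
  then have "\<forall>\<^sub>F h in at_right 0. \<forall>x\<in>K'. norm (iterpd ks (f h) x) \<le> D * \<phi> n h x"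
    by eventually_elim (use assms(2) in auto)
  then show "\<exists>D. \<forall>\<^sub>F h in at_right 0. \<forall>x\<in>K'. norm (iterpd ks (f h) x) \<le> D * \<phi> n h x" ..
qed

lemma derivs_bounded_mono:
  assumes "derivs_bounded K \<phi> f" "nonneg_on K \<phi>"
    and "\<And>n. \<exists>C. \<forall>\<^sub>F h in at_right 0. \<forall>x\<in>K. \<phi> n h x \<le> C * \<psi> n h x"
  shows "derivs_bounded K \<psi> f"
  unfolding derivs_bounded_def derivs_bounded_ord_def
proof (intro allI impI)
  fix n and ks :: "'a list" assume "length ks = n"
  then obtain D where D: "\<forall>\<^sub>F h in at_right 0. \<forall>x\<in>K. norm (iterpd ks (f h) x) \<le> D * \<phi> n h x"
    using assms(1) unfolding derivs_bounded_def derivs_bounded_ord_def by blast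
  obtain C where C: "\<forall>\<^sub>F h in at_right 0. \<forall>x\<in>K. \<phi> n h x \<le> C * \<psi> n h x"
    using assms(3) by blast
  have "\<forall>\<^sub>F h in at_right 0. \<forall>x\<in>K. norm (iterpd ks (f h) x) \<le> (\<bar>D\<bar> * C) * \<psi> n h x"
    using C D eventually_h01
  proof eventually_elim
    case (elim h)
    show ?case
    proof
      fix x assume x: "x \<in> K"
      have "norm (iterpd ks (f h) x) \<le> D * \<phi> n h x" using elim x by blast
      also have "\<dots> \<le> \<bar>D\<bar> * \<phi> n h x"
        using assms(2) elim x by (intro mult_right_mono) (auto simp: nonneg_on_def)
      also have "\<dots> \<le> \<bar>D\<bar> * (C * \<psi> n h x)"
        using elim x by (intro mult_left_mono) auto
      finally show "norm (iterpd ks (f h) x) \<le> (\<bar>D\<bar> * C) * \<psi> n h x" by (simp add: mult.assoc)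
    qed
  qed
  then show "\<exists>D. \<forall>\<^sub>F h in at_right 0. \<forall>x\<in>K. norm (iterpd ks (f h) x) \<le> D * \<psi> n h x" ..
qed

lemma derivs_bounded_Un:
  assumes "derivs_bounded K \<phi> f" "derivs_bounded K' \<phi> f" "nonneg_on (K \<union> K') \<phi>"
  shows "derivs_bounded (K \<union> K') \<phi> f"
  unfolding derivs_bounded_def derivs_bounded_ord_def
proof (intro allI impI)
  fix n and ks :: "'a list" assume "length ks = n"
  then obtain D D' where D: "\<forall>\<^sub>F h in at_right 0. \<forall>x\<in>K. norm (iterpd ks (f h) x) \<le> D * \<phi> n h x"
     and D': "\<forall>\<^sub>F h in at_right 0. \<forall>x\<in>K'. norm (iterpd ks (f h) x) \<le> D' * \<phi> n h x"
    using assms(1,2) unfolding derivs_bounded_def derivs_bounded_ord_def by blast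
  have "\<forall>\<^sub>F h in at_right 0. \<forall>x\<in>K \<union> K'. norm (iterpd ks (f h) x) \<le> max D D' * \<phi> n h x"
    using D D' eventually_h01
  proof eventually_elim
    case (elim h)
    show ?case
    proof
      fix x assume x: "x \<in> K \<union> K'"
      have "D * \<phi> n h x \<le> max D D' * \<phi> n h x" "D' * \<phi> n h x \<le> max D D' * \<phi> n h x"
        using assms(3) elim x by (auto simp: nonneg_on_def intro!: mult_right_mono)
      then show "norm (iterpd ks (f h) x) \<le> max D D' * \<phi> n h x" using elim x by fastforce
    qed
  qed
  then show "\<exists>D. \<forall>\<^sub>F h in at_right 0. \<forall>x\<in>K \<union> K'. norm (iterpd ks (f h) x) \<le> D * \<phi> n h x" ..
qed

lemma derivs_bounded_empty: "derivs_bounded {} \<phi> f"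
  by (simp add: derivs_bounded_def derivs_bounded_ord_def)

lemma derivs_bounded_zero: "derivs_bounded K \<phi> (\<lambda>h x. 0)"
  unfolding derivs_bounded_def derivs_bounded_ord_def iterpd_0 by (auto intro!: exI[of _ 0])

text \<open>A finite subcover reduces a property that is hereditary and stable under binary unions
  to neighbourhoods of points. Bounds valid for all sufficiently small h are of this kind.\<close>

lemma compact_local:
  assumes "compact K" "\<And>x. x \<in> K \<Longrightarrow> \<exists>V. open V \<and> x \<in> V \<and> Pr V"
    and "Pr {}" "\<And>A B. Pr A \<Longrightarrow> Pr B \<Longrightarrow> Pr (A \<union> B)" "\<And>A B. Pr B \<Longrightarrow> A \<subseteq> B \<Longrightarrow> Pr A"
  shows "Pr K"
proof -
  obtain V where V: "\<And>x. x \<in> K \<Longrightarrow> open (V x) \<and> x \<in> V x \<and> Pr (V x)"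
    using assms(2) by metis
  obtain F where F: "F \<subseteq> K" "finite F" "K \<subseteq> (\<Union>x\<in>F. V x)"
    using compactE_image[OF assms(1), of K V] V by (metis UN_I subsetI)
  from F(2,1) have "Pr (\<Union>x\<in>F. V x)"
    by (induction rule: finite_induct) (auto simp: assms(3) V intro: assms(4))
  then show ?thesis using assms(5) F(3) by blast
qed

context
  fixes U :: "('n::{finite,linorder}) rn set"
  assumes U: "open U"
begin

lemma derivs_bounded_ord_cong:
  assumes "\<And>h x. h > 0 \<Longrightarrow> x \<in> U \<Longrightarrow> f h x = g h x" "K \<subseteq> U"
  shows "derivs_bounded_ord n K \<phi> f \<longleftrightarrow> derivs_bounded_ord n K \<phi> g"
proof -
  have "(\<forall>\<^sub>F h in at_right 0. \<forall>x\<in>K. norm (iterpd ks (f h) x) \<le> D * \<phi> n h x) \<longleftrightarrow>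
     (\<forall>\<^sub>F h in at_right 0. \<forall>x\<in>K. norm (iterpd ks (g h) x) \<le> D * \<phi> n h x)" for ks D
  proof (rule eventually_subst, use eventually_h01 in eventually_elim)
    fix h :: real assume "0 < h \<and> h < 1"
    then have "iterpd ks (f h) x = iterpd ks (g h) x" if "x \<in> K" for x
      using that assms by (intro iterpd_cong[OF U]) auto
    then show "(\<forall>x\<in>K. norm (iterpd ks (f h) x) \<le> D * \<phi> n h x) =
         (\<forall>x\<in>K. norm (iterpd ks (g h) x) \<le> D * \<phi> n h x)" by simp
  qed
  then show ?thesis by (simp add: derivs_bounded_ord_def)
qed

lemma derivs_bounded_cong:
  assumes "\<And>h x. h > 0 \<Longrightarrow> x \<in> U \<Longrightarrow> f h x = g h x" "K \<subseteq> U"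
  shows "derivs_bounded K \<phi> f \<longleftrightarrow> derivs_bounded K \<phi> g"
  using derivs_bounded_ord_cong[OF assms] by (simp add: derivs_bounded_def)

lemma derivs_bounded_ord_add:
  assumes "K \<subseteq> U"
  shows "smooth U f \<Longrightarrow> smooth U g \<Longrightarrow> derivs_bounded_ord n K \<phi> f \<Longrightarrow> derivs_bounded_ord n K \<phi> g \<Longrightarrow> derivs_bounded_ord n K \<phi> (\<lambda>h x. f h x + g h x)"
proof (induction n arbitrary: \<phi> f g)
  case 0
  then obtain D D' where D: "\<forall>\<^sub>F h in at_right 0. \<forall>x\<in>K. norm (f h x) \<le> D * \<phi> 0 h x"
     and D': "\<forall>\<^sub>F h in at_right 0. \<forall>x\<in>K. norm (g h x) \<le> D' * \<phi> 0 h x"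
    unfolding derivs_bounded_ord_0 by blast
  have "\<forall>\<^sub>F h in at_right 0. \<forall>x\<in>K. norm (f h x + g h x) \<le> (D + D') * \<phi> 0 h x"
    using D D' by eventually_elim (auto simp: distrib_right intro: norm_triangle_mono)
  then show ?case unfolding derivs_bounded_ord_0 by blast
next
  case (Suc n)
  show ?case
    unfolding derivs_bounded_ord_Suc
  proof
    fix k
    have "derivs_bounded_ord n K (\<lambda>j. \<phi> (Suc j)) (\<lambda>h x. pd k (f h) x + pd k (g h) x)"
      using Suc by (intro Suc.IH smooth_pd U) (auto simp: derivs_bounded_ord_Suc)
    then show "derivs_bounded_ord n K (\<lambda>j. \<phi> (Suc j)) (\<lambda>h. pd k (\<lambda>x. f h x + g h x))"
      by (subst derivs_bounded_ord_cong[OF _ assms])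
        (auto intro!: pd_add smooth_differentiable[OF U] simp: Suc.prems)
  qed
qed

lemma derivs_bounded_add:
  "K \<subseteq> U \<Longrightarrow> smooth U f \<Longrightarrow> smooth U g \<Longrightarrow> derivs_bounded K \<phi> f \<Longrightarrow> derivs_bounded K \<phi> g \<Longrightarrow> derivs_bounded K \<phi> (\<lambda>h x. f h x + g h x)"
  by (simp add: derivs_bounded_def derivs_bounded_ord_add)

lemma derivs_bounded_sum:
  assumes "K \<subseteq> U" "\<And>i. i \<in> I \<Longrightarrow> smooth U (f i)" "\<And>i. i \<in> I \<Longrightarrow> derivs_bounded K \<phi> (f i)"
  shows "derivs_bounded K \<phi> (\<lambda>h x. \<Sum>i\<in>I. f i h x)"
  using assms(2,3)
proof (induction I rule: infinite_finite_induct)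
  case (insert i I)
  then show ?case
    using derivs_bounded_add[OF assms(1), of "f i" "\<lambda>h x. \<Sum>i\<in>I. f i h x"] smooth_sum[OF U, of I f] by simp
qed (auto intro: derivs_bounded_zero)

text \<open>Leibniz rule. A derivative hits one factor and shifts that factor's weight, and either
  shift moves \<open>\<theta>\<close> by one, because the product condition involves only i + j.
  Hence the induction generalises over all three weights.\<close>

lemma derivs_bounded_ord_mult:
  assumes "K \<subseteq> U"
  shows "smooth U f \<Longrightarrow> smooth U g \<Longrightarrow> derivs_bounded K \<phi> f \<Longrightarrow> derivs_bounded K \<psi> g \<Longrightarrow> nonneg_on K \<phi> \<Longrightarrow> nonneg_on K \<psi> \<Longrightarrow>
     (\<And>i j. \<exists>C. \<forall>\<^sub>F h in at_right 0. \<forall>x\<in>K. \<phi> i h x * \<psi> j h x \<le> C * \<theta> (i + j) h x) \<Longrightarrow>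
     derivs_bounded_ord n K \<theta> (\<lambda>h x. f h x * g h x)"
proof (induction n arbitrary: \<phi> \<psi> \<theta> f g)
  case 0
  then obtain D D' C where D: "\<forall>\<^sub>F h in at_right 0. \<forall>x\<in>K. norm (f h x) \<le> D * \<phi> 0 h x"
     and D': "\<forall>\<^sub>F h in at_right 0. \<forall>x\<in>K. norm (g h x) \<le> D' * \<psi> 0 h x"
     and C: "\<forall>\<^sub>F h in at_right 0. \<forall>x\<in>K. \<phi> 0 h x * \<psi> 0 h x \<le> C * \<theta> 0 h x"
    using spec[OF 0(3)[unfolded derivs_bounded_def], of 0] spec[OF 0(4)[unfolded derivs_bounded_def], of 0] 0(7)[of 0 0]
    unfolding derivs_bounded_ord_0 by (auto simp only: add_0)
  have "\<forall>\<^sub>F h in at_right 0. \<forall>x\<in>K. norm (f h x * g h x) \<le> (\<bar>D\<bar> * \<bar>D'\<bar> * C) * \<theta> 0 h x"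
    using D D' C eventually_h01
  proof eventually_elim
    case (elim h)
    show ?case
    proof
      fix x assume x: "x \<in> K"
      have nonneg_on: "0 \<le> \<phi> 0 h x" "0 \<le> \<psi> 0 h x" using 0 elim x by (auto simp: nonneg_on_def)
      have "norm (f h x) \<le> D * \<phi> 0 h x" "norm (g h x) \<le> D' * \<psi> 0 h x"
        using elim x by blast+
      then have "norm (f h x) \<le> \<bar>D\<bar> * \<phi> 0 h x" "norm (g h x) \<le> \<bar>D'\<bar> * \<psi> 0 h x"
        using nonneg_on by (metis abs_ge_self mult_right_mono order_trans)+
      then have "norm (f h x * g h x) \<le> (\<bar>D\<bar> * \<phi> 0 h x) * (\<bar>D'\<bar> * \<psi> 0 h x)"
        unfolding norm_mult by (intro mult_mono) (auto simp: nonneg_on)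
      also have "\<dots> = \<bar>D\<bar> * \<bar>D'\<bar> * (\<phi> 0 h x * \<psi> 0 h x)" by simp
      also have "\<dots> \<le> \<bar>D\<bar> * \<bar>D'\<bar> * (C * \<theta> 0 h x)"
        using elim x by (intro mult_left_mono) auto
      finally show "norm (f h x * g h x) \<le> (\<bar>D\<bar> * \<bar>D'\<bar> * C) * \<theta> 0 h x" by (simp add: mult.assoc)
    qed
  qed
  then show ?case unfolding derivs_bounded_ord_0 by blast
next
  case (Suc n)
  show ?case
    unfolding derivs_bounded_ord_Suc
  proof
    fix k
    have 1: "derivs_bounded_ord n K (\<lambda>j. \<theta> (Suc j)) (\<lambda>h x. f h x * pd k (g h) x)"
    proof (rule Suc.IH)
      show "\<exists>C. \<forall>\<^sub>F h in at_right 0. \<forall>x\<in>K. \<phi> i h x * \<psi> (Suc j) h x \<le> C * \<theta> (Suc (i + j)) h x" for i j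
        using Suc.prems(7)[of i "Suc j"] by simp
    qed (use Suc.prems in \<open>auto intro: smooth_pd[OF U] derivs_bounded_pd nonneg_on_Suc\<close>)
    have 2: "derivs_bounded_ord n K (\<lambda>j. \<theta> (Suc j)) (\<lambda>h x. pd k (f h) x * g h x)"
    proof (rule Suc.IH)
      show "\<exists>C. \<forall>\<^sub>F h in at_right 0. \<forall>x\<in>K. \<phi> (Suc i) h x * \<psi> j h x \<le> C * \<theta> (Suc (i + j)) h x" for i j
        using Suc.prems(7)[of "Suc i" j] by simp
    qed (use Suc.prems in \<open>auto intro: smooth_pd[OF U] derivs_bounded_pd nonneg_on_Suc\<close>)
    have "derivs_bounded_ord n K (\<lambda>j. \<theta> (Suc j)) (\<lambda>h x. f h x * pd k (g h) x + pd k (f h) x * g h x)"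
      using Suc.prems by (intro derivs_bounded_ord_add assms 1 2 smooth_mult smooth_pd U)
    then show "derivs_bounded_ord n K (\<lambda>j. \<theta> (Suc j)) (\<lambda>h. pd k (\<lambda>x. f h x * g h x))"
      by (subst derivs_bounded_ord_cong[OF _ assms])
        (auto intro!: pd_mult smooth_differentiable[OF U] simp: Suc.prems)
  qed
qed

lemma derivs_bounded_mult:
  "K \<subseteq> U \<Longrightarrow> smooth U f \<Longrightarrow> smooth U g \<Longrightarrow> derivs_bounded K \<phi> f \<Longrightarrow> derivs_bounded K \<psi> g \<Longrightarrow> nonneg_on K \<phi> \<Longrightarrow> nonneg_on K \<psi> \<Longrightarrow>
     (\<And>i j. \<exists>C. \<forall>\<^sub>F h in at_right 0. \<forall>x\<in>K. \<phi> i h x * \<psi> j h x \<le> C * \<theta> (i + j) h x) \<Longrightarrow>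
     derivs_bounded K \<theta> (\<lambda>h x. f h x * g h x)"
  unfolding derivs_bounded_def using derivs_bounded_ord_mult[unfolded derivs_bounded_def] by blast

end

section \<open>Exponential smallness, and polynomial decay away from the support\<close>

definition exp_small_on :: "('n::{finite,linorder}) rn set \<Rightarrow> (real \<Rightarrow> 'n rn \<Rightarrow> complex) \<Rightarrow> bool" where
  "exp_small_on K f \<longleftrightarrow> (\<exists>c>0. derivs_bounded K (\<lambda>j h x. exp (- c / h)) f)"

definition exp_small_at :: "('n::{finite,linorder}) rn set \<Rightarrow> (real \<Rightarrow> 'n rn \<Rightarrow> complex) \<Rightarrow> 'n rn \<Rightarrow> bool" where
  "exp_small_at U f x \<longleftrightarrow> (\<exists>V. open V \<and> x \<in> V \<and> V \<subseteq> U \<and> exp_small_on V f)"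

text \<open>The weight \<open>w\<close> is the distance to the support: decay at scale \<open>sqrt h\<close>, faster than any power.\<close>

definition decay_weight :: "(('n::{finite,linorder}) rn \<Rightarrow> real) \<Rightarrow> real \<Rightarrow> nat \<Rightarrow> nat \<Rightarrow> real \<Rightarrow> 'n rn \<Rightarrow> real" where
  "decay_weight w s \<beta> j h x = h powr (- (real j + s) / 2) / (1 + w x / sqrt h) ^ \<beta>"

definition decay :: "('n::{finite,linorder}) rn set \<Rightarrow> ('n rn \<Rightarrow> real) \<Rightarrow> real \<Rightarrow> (real \<Rightarrow> 'n rn \<Rightarrow> complex) \<Rightarrow> bool" where
  "decay U w s f \<longleftrightarrow> (\<forall>K \<beta>. compact K \<longrightarrow> K \<subseteq> U \<longrightarrow> derivs_bounded K (decay_weight w s \<beta>) f)"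

lemma nonneg_on_exp: "nonneg_on K (\<lambda>j h x. exp (- c / h))"
  by (simp add: nonneg_on_def)

lemma nonneg_on_decay_weight: "(\<And>x. 0 \<le> w x) \<Longrightarrow> nonneg_on K (decay_weight w s \<beta>)"
  by (auto simp: nonneg_on_def decay_weight_def)

lemma derivs_bounded_exp_mono:
  assumes "derivs_bounded K (\<lambda>j h x. exp (- c / h)) f" "c' \<le> c"
  shows "derivs_bounded K (\<lambda>j h x. exp (- c' / h)) f"
proof (rule derivs_bounded_mono[OF assms(1) nonneg_on_exp])
  show "\<exists>C. \<forall>\<^sub>F h in at_right 0. \<forall>x\<in>K. exp (- c / h) \<le> C * exp (- c' / h)"
    using eventually_h01 assms(2)
    by (intro exI[of _ 1], elim eventually_mono) (auto simp: divide_right_mono)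
qed

lemma exp_small_on_subset: "exp_small_on K f \<Longrightarrow> K' \<subseteq> K \<Longrightarrow> exp_small_on K' f"
  unfolding exp_small_on_def using derivs_bounded_subset by blast

lemma exp_small_on_Un:
  assumes "exp_small_on K f" "exp_small_on K' f" shows "exp_small_on (K \<union> K') f"
proof -
  obtain c c' where c: "c > 0" "c' > 0" "derivs_bounded K (\<lambda>j h x. exp (- c / h)) f" "derivs_bounded K' (\<lambda>j h x. exp (- c' / h)) f"
    using assms unfolding exp_small_on_def by blast
  then have "derivs_bounded (K \<union> K') (\<lambda>j h x. exp (- min c c' / h)) f"
    by (intro derivs_bounded_Un nonneg_on_exp derivs_bounded_exp_mono[OF c(3)] derivs_bounded_exp_mono[OF c(4)]) auto
  then show ?thesis unfolding exp_small_on_def using c by (metis min_less_iff_conj)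
qed

text \<open>The rate c must serve all orders of derivatives at once, as in \<open>Wneg\<close>. On a
  compact set the minimum of finitely many local rates still does.\<close>

lemma exp_small_on_compact:
  assumes "compact K" "\<And>x. x \<in> K \<Longrightarrow> exp_small_at U f x" shows "exp_small_on K f"
  using assms(1)
proof (rule compact_local)
  show "exp_small_on {} f" unfolding exp_small_on_def using derivs_bounded_empty by (metis zero_less_one)
  show "\<exists>V. open V \<and> x \<in> V \<and> exp_small_on V f" if "x \<in> K" for x
    using assms(2)[OF that] by (auto simp: exp_small_at_def)
qed (auto intro: exp_small_on_Un exp_small_on_subset)

lemma exp_small_at_open:
  assumes "exp_small_at U f x" shows "\<exists>V. open V \<and> x \<in> V \<and> V \<subseteq> U \<and> (\<forall>y\<in>V. exp_small_at U f y)"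
  using assms by (auto simp: exp_small_at_def)

lemma exp_small_at_subset: "exp_small_at U' f x \<Longrightarrow> U' \<subseteq> U \<Longrightarrow> exp_small_at U f x"
  by (auto simp: exp_small_at_def)

lemma exp_small_at_restrict:
  assumes "exp_small_at U f x" "open U'" "x \<in> U'" shows "exp_small_at U' f x"
proof -
  obtain V where "open V" "x \<in> V" "exp_small_on V f" using assms(1) by (auto simp: exp_small_at_def)
  then show ?thesis
    using assms by (auto simp: exp_small_at_def intro!: exI[of _ "V \<inter> U'"] elim: exp_small_on_subset)
qed

lemma powr_le_powr_01:
  fixes h :: real
  assumes "0 < h" "h < 1" "a \<le> b" shows "h powr b \<le> h powr a"
  using assms powr_mono' by auto

text \<open>Follows from (1 + y/k)^k \<le> e^y at y = c/h for one integer k \<ge> A, which gives the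
  explicit constant (k/c)^k.\<close>

lemma exp_le_powr:
  fixes c A :: real
  assumes "c > 0"
  shows "\<exists>C. \<forall>h. 0 < h \<and> h < 1 \<longrightarrow> exp (- c / h) \<le> C * h powr A"
proof -
  \<comment> \<open>\<open>Suc\<close> keeps k positive even for A \<le> 0, as the division by k
    requires.\<close>
  define k where "k = Suc (nat \<lceil>A\<rceil>)"
  have k: "k > 0" "A \<le> real k" by (auto simp: k_def) linarith
  have "exp (- c / h) \<le> (real k / c) ^ k * h powr A" if h: "0 < h" "h < 1" for h
  proof -
    have "(c / h / real k) ^ k \<le> (1 + (c / h) / real k) ^ k"
      using assms h by (intro power_mono) auto
    also have "\<dots> \<le> exp (c / h)"
      using assms h k by (intro exp_ge_one_plus_x_over_n_power_n) (auto intro: order_trans[of _ 0])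
    finally have "inverse (exp (c / h)) \<le> inverse ((c / h / real k) ^ k)"
      using assms h k by (intro le_imp_inverse_le) auto
    then have "exp (- c / h) \<le> (real k / c) ^ k * h ^ k"
      using assms h k by (simp add: exp_minus power_divide power_mult_distrib field_simps)
    also have "\<dots> = (real k / c) ^ k * h powr real k"
      using h by (simp add: powr_realpow)
    also have "\<dots> \<le> (real k / c) ^ k * h powr A"
      using assms h k by (intro mult_left_mono powr_le_powr_01) auto
    finally show ?thesis .
  qed
  then show ?thesis by blast
qed

text \<open>Where w is bounded, the weight is bounded below by a power of h, since 1 + w / sqrt h
  \<le> M' / sqrt h for h < 1. So exponentially small functions decay with respect to every bounded
  w.\<close>

lemma exp_le_decay_weight:
  assumes "c > 0" "\<And>x. 0 \<le> w x" "\<And>x. x \<in> K \<Longrightarrow> w x \<le> M"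
  shows "\<exists>C. \<forall>\<^sub>F h in at_right 0. \<forall>x\<in>K. exp (- c / h) \<le> C * decay_weight w s \<beta> n h x"
proof -
  obtain C where C: "\<And>h. 0 < h \<Longrightarrow> h < 1 \<Longrightarrow> exp (- c / h) \<le> C * h powr (real \<beta> / 2 - (real n + s) / 2)"
    using exp_le_powr[OF assms(1)] by metis
  define M' where "M' = 1 + \<bar>M\<bar>"
  have "\<forall>\<^sub>F h in at_right 0. \<forall>x\<in>K. exp (- c / h) \<le> (\<bar>C\<bar> * M' ^ \<beta>) * decay_weight w s \<beta> n h x"
    using eventually_h01
  proof (eventually_elim, intro ballI)
    fix h x assume h: "(0::real) < h \<and> h < 1" and x: "x \<in> K"
    have s: "0 < sqrt h" "sqrt h \<le> 1" using h by auto
    have "1 + w x / sqrt h \<le> M' / sqrt h"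
      using s add_mono[OF s(2) order_trans[OF assms(3)[OF x] abs_ge_self]]
      by (simp add: M'_def le_divide_eq distrib_right)
    then have "(1 + w x / sqrt h) ^ \<beta> \<le> (M' / sqrt h) ^ \<beta>"
      using assms(2) s by (intro power_mono) auto
    moreover have "0 < (1 + w x / sqrt h) ^ \<beta>" using assms(2) s by (intro zero_less_power add_pos_nonneg) auto
    moreover have M': "M' > 0" by (simp add: M'_def)
    ultimately have "1 \<le> (M' / sqrt h) ^ \<beta> / (1 + w x / sqrt h) ^ \<beta>"
      by (subst le_divide_eq_1_pos)
    then have "sqrt h ^ \<beta> * 1 \<le> sqrt h ^ \<beta> * ((M' / sqrt h) ^ \<beta> / (1 + w x / sqrt h) ^ \<beta>)"
      using s by (intro mult_left_mono) auto
    then have 1: "sqrt h ^ \<beta> \<le> M' ^ \<beta> / (1 + w x / sqrt h) ^ \<beta>"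
      using s by (simp add: power_divide)
    have 2: "sqrt h ^ \<beta> = h powr (real \<beta> / 2)"
      using h powr_power[of h "1/2" \<beta>] by (simp add: powr_half_sqrt)
    have "exp (- c / h) \<le> \<bar>C\<bar> * h powr (real \<beta> / 2 - (real n + s) / 2)"
      using C h by (meson abs_ge_self mult_right_mono order_trans powr_ge_zero)
    also have "\<dots> = \<bar>C\<bar> * (sqrt h ^ \<beta> * h powr (- (real n + s) / 2))"
      unfolding 2 powr_add[symmetric] by (rule arg_cong[where f="\<lambda>a. \<bar>C\<bar> * h powr a"]) (simp add: field_simps)
    also have "\<dots> \<le> \<bar>C\<bar> * ((M' ^ \<beta> / (1 + w x / sqrt h) ^ \<beta>) * h powr (- (real n + s) / 2))"
      using 1 by (intro mult_left_mono mult_right_mono) auto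
    also have "\<dots> = (\<bar>C\<bar> * M' ^ \<beta>) * decay_weight w s \<beta> n h x"
      by (simp add: decay_weight_def)
    finally show "exp (- c / h) \<le> (\<bar>C\<bar> * M' ^ \<beta>) * decay_weight w s \<beta> n h x" .
  qed
  then show ?thesis by blast
qed

text \<open>The inequality 1 + a + b \<le> (1 + a)(1 + b) is what makes pointwise decay
  multiplicative: factors decaying in w and w' give a product decaying in any w'' controlled by
  their sum, with the same exponent \<beta>.\<close>

lemma decay_weight_mult:
  assumes "\<And>x. 0 \<le> w x" "\<And>x. 0 \<le> w' x" "\<And>x. 0 \<le> w'' x"
    and "c \<ge> 1" "\<And>x. x \<in> K \<Longrightarrow> w'' x \<le> c * (w x + w' x)"
  shows "\<exists>C. \<forall>\<^sub>F h in at_right 0. \<forall>x\<in>K. decay_weight w s \<beta> i h x * decay_weight w' s' \<beta> j h x \<le> C * decay_weight w'' (s + s') \<beta> (i + j) h x"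
proof -
  have "\<forall>\<^sub>F h in at_right 0. \<forall>x\<in>K. decay_weight w s \<beta> i h x * decay_weight w' s' \<beta> j h x \<le> c ^ \<beta> * decay_weight w'' (s + s') \<beta> (i + j) h x"
    using eventually_h01
  proof (eventually_elim, intro ballI)
    fix h x assume h: "(0::real) < h \<and> h < 1" and x: "x \<in> K"
    define a b d where "a = w x / sqrt h" and "b = w' x / sqrt h" and "d = w'' x / sqrt h"
    have nonneg_on: "0 \<le> a" "0 \<le> b" "0 \<le> d" using assms(1-3) h by (auto simp: a_def b_def d_def)
    have "d \<le> c * (a + b)"
      using assms(5)[OF x] h by (simp add: a_def b_def d_def field_simps)
    then have "1 + d \<le> c * (1 + (a + b))" using assms(4) by (simp add: distrib_left)
    also have "\<dots> \<le> c * ((1 + a) * (1 + b))"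
      using nonneg_on assms(4) by (intro mult_left_mono) (auto simp: algebra_simps)
    finally have "(1 + d) ^ \<beta> \<le> (c * ((1 + a) * (1 + b))) ^ \<beta>"
      using nonneg_on by (intro power_mono) auto
    then have "(1 + d) ^ \<beta> \<le> c ^ \<beta> * ((1 + a) ^ \<beta> * (1 + b) ^ \<beta>)"
      by (simp add: power_mult_distrib)
    moreover have "0 < (1 + d) ^ \<beta>" "0 < (1 + a) ^ \<beta>" "0 < (1 + b) ^ \<beta>"
      using nonneg_on by (auto intro!: zero_less_power)
    ultimately have 1: "1 / ((1 + a) ^ \<beta> * (1 + b) ^ \<beta>) \<le> c ^ \<beta> / (1 + d) ^ \<beta>"
      by (simp add: field_simps)
    have "decay_weight w s \<beta> i h x * decay_weight w' s' \<beta> j h x =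
      h powr (- (real (i + j) + (s + s')) / 2) * (1 / ((1 + a) ^ \<beta> * (1 + b) ^ \<beta>))"
      unfolding decay_weight_def a_def b_def by (simp add: powr_add[symmetric] add_divide_distrib diff_divide_distrib algebra_simps)
    also have "\<dots> \<le> h powr (- (real (i + j) + (s + s')) / 2) * (c ^ \<beta> / (1 + d) ^ \<beta>)"
      using 1 by (intro mult_left_mono) auto
    also have "\<dots> = c ^ \<beta> * decay_weight w'' (s + s') \<beta> (i + j) h x"
      unfolding decay_weight_def d_def by simp
    finally show "decay_weight w s \<beta> i h x * decay_weight w' s' \<beta> j h x \<le> c ^ \<beta> * decay_weight w'' (s + s') \<beta> (i + j) h x" .
  qed
  then show ?thesis by blast
qed

context
  fixes U :: "('n::{finite,linorder}) rn set"
  assumes U: "open U"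
begin

lemma exp_small_at_cong:
  assumes "\<And>h x. h > 0 \<Longrightarrow> x \<in> U \<Longrightarrow> f h x = g h x"
  shows "exp_small_at U f x \<longleftrightarrow> exp_small_at U g x"
proof -
  have "derivs_bounded V \<phi> f \<longleftrightarrow> derivs_bounded V \<phi> g" if "V \<subseteq> U" for V \<phi>
    by (rule derivs_bounded_cong[OF U assms that])
  then show ?thesis unfolding exp_small_at_def exp_small_on_def by (metis (no_types, lifting))
qed

lemma decay_cong:
  assumes "\<And>h x. h > 0 \<Longrightarrow> x \<in> U \<Longrightarrow> f h x = g h x"
  shows "decay U w s f \<longleftrightarrow> decay U w s g"
proof -
  have "derivs_bounded V \<phi> f \<longleftrightarrow> derivs_bounded V \<phi> g" if "V \<subseteq> U" for V \<phi>
    by (rule derivs_bounded_cong[OF U assms that])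
  then show ?thesis unfolding decay_def by auto
qed

lemma exp_small_at_zero: "x \<in> U \<Longrightarrow> exp_small_at U (\<lambda>h x. 0) x"
  unfolding exp_small_at_def exp_small_on_def using U derivs_bounded_zero by (metis order_refl zero_less_one)

lemma exp_small_at_add:
  assumes "smooth U f" "smooth U g" "exp_small_at U f x" "exp_small_at U g x"
  shows "exp_small_at U (\<lambda>h x. f h x + g h x) x"
proof -
  obtain V V' c c' where V: "open V" "x \<in> V" "V \<subseteq> U" "open V'" "x \<in> V'" "c > 0" "c' > 0"
    "derivs_bounded V (\<lambda>j h x. exp (- c / h)) f" "derivs_bounded V' (\<lambda>j h x. exp (- c' / h)) g"
    using assms(3,4) unfolding exp_small_at_def exp_small_on_def by blast
  have "derivs_bounded (V \<inter> V') (\<lambda>j h x. exp (- min c c' / h)) (\<lambda>h x. f h x + g h x)"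
  proof (intro derivs_bounded_add[OF U] assms(1,2))
    show "derivs_bounded (V \<inter> V') (\<lambda>j h x. exp (- min c c' / h)) f"
      by (rule derivs_bounded_subset[OF derivs_bounded_exp_mono[OF V(8)]]) auto
    show "derivs_bounded (V \<inter> V') (\<lambda>j h x. exp (- min c c' / h)) g"
      by (rule derivs_bounded_subset[OF derivs_bounded_exp_mono[OF V(9)]]) auto
  qed (use V in auto)
  moreover have "min c c' > 0" using V by simp
  ultimately show ?thesis
    unfolding exp_small_at_def exp_small_on_def using V by (intro exI[of _ "V \<inter> V'"]) blast
qed

lemma exp_small_at_sum:
  assumes "x \<in> U" "\<And>i. i \<in> I \<Longrightarrow> smooth U (f i)" "\<And>i. i \<in> I \<Longrightarrow> exp_small_at U (f i) x"
  shows "exp_small_at U (\<lambda>h x. \<Sum>i\<in>I. f i h x) x"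
  using assms(2,3)
proof (induction I rule: infinite_finite_induct)
  case (insert i I)
  then show ?case
    using exp_small_at_add[of "f i" "\<lambda>h x. \<Sum>i\<in>I. f i h x"] smooth_sum[OF U, of I f] by simp
qed (auto intro: exp_small_at_zero assms)

lemma exp_small_at_pd:
  assumes "exp_small_at U f x" shows "exp_small_at U (\<lambda>h. pd k (f h)) x"
  using assms unfolding exp_small_at_def exp_small_on_def using derivs_bounded_pd by fastforce

lemma decay_pd:
  assumes "decay U w s f" shows "decay U w (s + 1) (\<lambda>h. pd k (f h))"
proof -
  have "(\<lambda>j. decay_weight w s \<beta> (Suc j)) = decay_weight w (s + 1) \<beta>" for \<beta>
    by (simp add: fun_eq_iff decay_weight_def algebra_simps)
  then show ?thesis
    using assms unfolding decay_def by (metis derivs_bounded_pd)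
qed

lemma decay_add:
  "smooth U f \<Longrightarrow> smooth U g \<Longrightarrow> decay U w s f \<Longrightarrow> decay U w s g \<Longrightarrow> decay U w s (\<lambda>h x. f h x + g h x)"
  by (simp add: decay_def derivs_bounded_add[OF U])

lemma decay_sum:
  "(\<And>i. i \<in> I \<Longrightarrow> smooth U (f i)) \<Longrightarrow> (\<And>i. i \<in> I \<Longrightarrow> decay U w s (f i)) \<Longrightarrow> decay U w s (\<lambda>h x. \<Sum>i\<in>I. f i h x)"
  by (simp add: decay_def derivs_bounded_sum[OF U])

lemma decay_mult:
  assumes "smooth U f" "smooth U g" "decay U w s f" "decay U w' s' g"
    and "\<And>x. 0 \<le> w x" "\<And>x. 0 \<le> w' x" "\<And>x. 0 \<le> w'' x"
    and "c \<ge> 1" "\<And>x. x \<in> U \<Longrightarrow> w'' x \<le> c * (w x + w' x)"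
  shows "decay U w'' (s + s') (\<lambda>h x. f h x * g h x)"
  unfolding decay_def
proof (intro allI impI)
  fix K \<beta> assume K: "compact K" "K \<subseteq> U"
  show "derivs_bounded K (decay_weight w'' (s + s') \<beta>) (\<lambda>h x. f h x * g h x)"
  proof (rule derivs_bounded_mult[OF U K(2) assms(1,2)])
    show "derivs_bounded K (decay_weight w s \<beta>) f" "derivs_bounded K (decay_weight w' s' \<beta>) g"
      using assms(3,4) K by (auto simp: decay_def)
    show "\<exists>C. \<forall>\<^sub>F h in at_right 0. \<forall>x\<in>K. decay_weight w s \<beta> i h x * decay_weight w' s' \<beta> j h x \<le> C * decay_weight w'' (s + s') \<beta> (i + j) h x" for i j
      using assms K by (intro decay_weight_mult[where c=c]) auto
  qed (use assms in \<open>auto intro: nonneg_on_decay_weight\<close>)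
qed

lemma decay_mono:
  assumes "decay U w s f" "s \<le> s'" "\<And>x. 0 \<le> w x"
  shows "decay U w s' f"
  unfolding decay_def
proof (intro allI impI)
  fix K \<beta> assume K: "compact K" "K \<subseteq> U"
  show "derivs_bounded K (decay_weight w s' \<beta>) f"
  proof (rule derivs_bounded_mono)
    show "derivs_bounded K (decay_weight w s \<beta>) f" using assms K by (auto simp: decay_def)
    show "\<exists>C. \<forall>\<^sub>F h in at_right 0. \<forall>x\<in>K. decay_weight w s \<beta> n h x \<le> C * decay_weight w s' \<beta> n h x" for n
      using eventually_h01
    proof (intro exI[of _ 1], eventually_elim, intro ballI)
      fix h x assume h: "(0::real) < h \<and> h < 1" and x: "x \<in> K"
      then show "decay_weight w s \<beta> n h x \<le> 1 * decay_weight w s' \<beta> n h x"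
        unfolding decay_weight_def using assms(2,3)
        by (auto intro!: divide_right_mono powr_le_powr_01)
    qed
  qed (use assms in \<open>auto intro: nonneg_on_decay_weight\<close>)
qed

text \<open>Derivatives are bounded on compact sets by continuity, and h powr (- j / 2) is at least
  1 for h < 1. The weight function 0 asserts no decay.\<close>

lemma decay_const_h:
  assumes "smooth U (\<lambda>h. f)" shows "decay U (\<lambda>x. 0) 0 (\<lambda>h. f)"
  unfolding decay_def derivs_bounded_def derivs_bounded_ord_def
proof (intro allI impI)
  fix K \<beta> n and ks :: "'n list" assume K: "compact K" "K \<subseteq> U" "length ks = n"
  have "continuous_on K (iterpd ks f)"
    using smooth_continuous_on_x[OF U smooth_iterpd[OF U assms], of 1 ks] K(2)
    by (auto elim: continuous_on_subset)
  then have "bounded (iterpd ks f ` K)"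
    using K by (metis compact_continuous_image compact_imp_bounded)
  then obtain M where M: "\<And>x. x \<in> K \<Longrightarrow> norm (iterpd ks f x) \<le> M"
    unfolding bounded_iff by blast
  have "\<forall>\<^sub>F h in at_right 0. \<forall>x\<in>K. norm (iterpd ks f x) \<le> \<bar>M\<bar> * decay_weight (\<lambda>x. 0) 0 \<beta> n h x"
    using eventually_h01
  proof (eventually_elim, intro ballI)
    fix h x assume h: "(0::real) < h \<and> h < 1" and x: "x \<in> K"
    have "h powr 0 \<le> h powr (- (real n + 0) / 2)" using h by (intro powr_le_powr_01) auto
    then have "1 \<le> decay_weight (\<lambda>x. 0) 0 \<beta> n h x" using h by (simp add: decay_weight_def)
    then have "\<bar>M\<bar> * 1 \<le> \<bar>M\<bar> * decay_weight (\<lambda>x. 0) 0 \<beta> n h x" by (intro mult_left_mono) auto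
    then show "norm (iterpd ks f x) \<le> \<bar>M\<bar> * decay_weight (\<lambda>x. 0) 0 \<beta> n h x"
      using M[OF x] by linarith
  qed
  then show "\<exists>D. \<forall>\<^sub>F h in at_right 0. \<forall>x\<in>K. norm (iterpd ks f x) \<le> D * decay_weight (\<lambda>x. 0) 0 \<beta> n h x" ..
qed

text \<open>Since h = h powr (-(0 - 2) / 2), the factor h in \<open>dvec\<close> has order -2. With
  +1 for the derivative it accompanies, this is the drop by one in
  \<open>asym_form_nabla\<close>.\<close>

lemma decay_h: "decay U (\<lambda>x. 0) (-2) (\<lambda>h x. complex_of_real h)"
  unfolding decay_def derivs_bounded_def
proof (intro allI impI)
  fix K :: "'n rn set" and \<beta> n
  show "derivs_bounded_ord n K (decay_weight (\<lambda>x. 0) (-2) \<beta>) (\<lambda>h x. complex_of_real h)"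
  proof (cases n)
    case 0
    show ?thesis unfolding 0 derivs_bounded_ord_0
      using eventually_h01
      by (intro exI[of _ 1], elim eventually_mono) (auto simp: decay_weight_def)
  next
    case (Suc m)
    have *: "pd k (\<lambda>x. complex_of_real h) = (\<lambda>x. 0)" for k :: 'n and h
      by (simp add: fun_eq_iff pd_const)
    show ?thesis unfolding Suc derivs_bounded_ord_Suc * by (intro allI derivs_bounded_zero[unfolded derivs_bounded_def, rule_format])
  qed
qed

text \<open>Multiplication by the constant 1, a function with weight 0, lets
  \<open>decay_mult\<close> exchange w for any weight dominated by it.\<close>

lemma decay_weight:
  assumes "smooth U f" "decay U w s f" "\<And>x. 0 \<le> w x" "\<And>x. 0 \<le> w' x" "c \<ge> 1" "\<And>x. x \<in> U \<Longrightarrow> w' x \<le> c * w x"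
  shows "decay U w' s f"
  using decay_mult[OF assms(1) smooth_const[OF U, of 1] assms(2) decay_const_h[OF smooth_const[OF U, of 1]], of w' c]
    assms(3-) by simp

lemma decay_tempered:
  assumes "smooth U f" "decay U w s f" "\<And>x. 0 \<le> w x"
  shows "decay U (\<lambda>x. 0) s f"
  by (rule decay_weight[OF assms(1,2), where c=1]) (use assms in auto)

text \<open>Half of the rate absorbs the power of h carried by g. That power grows with the order of
  differentiation, but the remaining rate c/2 does not depend on it.\<close>

lemma exp_small_at_mult:
  assumes "smooth U f" "smooth U g" "exp_small_at U f x" "decay U (\<lambda>x. 0) s g"
  shows "exp_small_at U (\<lambda>h x. f h x * g h x) x"
proof -
  obtain V c where V: "open V" "x \<in> V" "V \<subseteq> U" "c > 0" "derivs_bounded V (\<lambda>j h x. exp (- c / h)) f"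
    using assms(3) unfolding exp_small_at_def exp_small_on_def by blast
  obtain e where e: "e > 0" "cball x e \<subseteq> V"
    using V open_contains_cball by blast
  have f: "derivs_bounded (ball x e) (\<lambda>j h x. exp (- c / h)) f"
    using V e by (meson derivs_bounded_subset ball_subset_cball order_trans)
  have g: "derivs_bounded (ball x e) (decay_weight (\<lambda>x. 0) s 0) g"
    using assms(4) V e unfolding decay_def by (meson derivs_bounded_subset ball_subset_cball order_trans compact_cball)
  have "derivs_bounded (ball x e) (\<lambda>j h x. exp (- (c/2) / h)) (\<lambda>h x. f h x * g h x)"
  proof (rule derivs_bounded_mult[OF U _ assms(1,2) f g nonneg_on_exp nonneg_on_decay_weight])
    fix i j
    obtain C where C: "\<And>h. 0 < h \<Longrightarrow> h < 1 \<Longrightarrow> exp (- (c/2) / h) \<le> C * h powr ((real j + s) / 2)"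
      using exp_le_powr[of "c/2"] V(4) by (metis half_gt_zero)
    have "\<forall>\<^sub>F h in at_right 0. \<forall>x\<in>ball x e. exp (- c / h) * decay_weight (\<lambda>x. 0) s 0 j h x \<le> C * exp (- (c/2) / h)"
      using eventually_h01
    proof (eventually_elim, intro ballI)
      fix h and y :: "'n rn" assume h: "(0::real) < h \<and> h < 1"
      have "exp (- c / h) * decay_weight (\<lambda>x. 0) s 0 j h y = exp (- (c/2) / h) * (exp (- (c/2) / h) * h powr (- (real j + s) / 2))"
        by (simp add: decay_weight_def exp_add[symmetric] flip: mult.assoc)
      also have "\<dots> \<le> exp (- (c/2) / h) * (C * h powr ((real j + s) / 2) * h powr (- (real j + s) / 2))"
        using C h by (intro mult_left_mono mult_right_mono) auto
      also have "\<dots> = C * exp (- (c/2) / h)"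
        using h by (simp add: powr_add[symmetric] mult.assoc flip: add_divide_distrib)
      finally show "exp (- c / h) * decay_weight (\<lambda>x. 0) s 0 j h y \<le> C * exp (- (c/2) / h)" .
    qed
    then show "\<exists>C. \<forall>\<^sub>F h in at_right 0. \<forall>x\<in>ball x e. exp (- c / h) * decay_weight (\<lambda>x. 0) s 0 j h x \<le> C * exp (- (c/2) / h)" ..
  qed (use e(2) V(3) ball_subset_cball in \<open>blast, simp\<close>)
  then show ?thesis
    unfolding exp_small_at_def exp_small_on_def using e(1) V(4) subset_trans[OF subset_trans[OF ball_subset_cball e(2)] V(3)]
    by (intro exI[of _ "ball x e"]) (auto intro!: exI[of _ "c/2"])
qed

lemma exp_small_at_mult':
  assumes "smooth U f" "smooth U g" "exp_small_at U g x" "decay U (\<lambda>x. 0) s f"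
  shows "exp_small_at U (\<lambda>h x. f h x * g h x) x"
  using exp_small_at_mult[OF assms(2,1,3,4)] by (simp add: mult.commute)

lemma exp_small_at_derivs_bounded:
  assumes "exp_small_at U f x" "continuous_on U w" "\<And>x. 0 \<le> w x"
  shows "\<exists>V. open V \<and> x \<in> V \<and> (\<forall>\<beta>. derivs_bounded V (decay_weight w s \<beta>) f)"
proof -
  obtain V c where V: "open V" "x \<in> V" "V \<subseteq> U" "c > 0" "derivs_bounded V (\<lambda>j h x. exp (- c / h)) f"
    using assms(1) unfolding exp_small_at_def exp_small_on_def by blast
  obtain e where e: "e > 0" "cball x e \<subseteq> V"
    using V open_contains_cball by blast
  have "bounded (w ` cball x e)"
    by (meson assms(2) compact_cball compact_continuous_image compact_imp_bounded continuous_on_subset e(2) order_trans V(3))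
  then obtain M where M: "\<And>y. y \<in> cball x e \<Longrightarrow> w y \<le> M"
    unfolding bounded_iff by (metis abs_le_D1 image_eqI real_norm_def)
  have "derivs_bounded (ball x e) (decay_weight w s \<beta>) f" for \<beta>
  proof (rule derivs_bounded_mono[OF _ nonneg_on_exp])
    show "derivs_bounded (ball x e) (\<lambda>j h x. exp (- c / h)) f"
      using V e by (meson derivs_bounded_subset ball_subset_cball order_trans)
    show "\<exists>C. \<forall>\<^sub>F h in at_right 0. \<forall>x\<in>ball x e. exp (- c / h) \<le> C * decay_weight w s \<beta> n h x" for n
      using M V(4) assms(3) by (intro exp_le_decay_weight[where M=M]) auto
  qed
  then show ?thesis using e by (intro exI[of _ "ball x e"]) auto
qed

lemma decay_local:
  assumes "\<And>x \<beta>. x \<in> U \<Longrightarrow> \<exists>V. open V \<and> x \<in> V \<and> derivs_bounded V (decay_weight w s \<beta>) f" "\<And>x. 0 \<le> w x"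
  shows "decay U w s f"
  unfolding decay_def
proof (intro allI impI)
  fix K \<beta> assume K: "compact K" "K \<subseteq> U"
  show "derivs_bounded K (decay_weight w s \<beta>) f"
    using K(1)
  proof (rule compact_local)
    show "\<exists>V. open V \<and> x \<in> V \<and> derivs_bounded V (decay_weight w s \<beta>) f" if "x \<in> K" for x
      using assms(1) that K by blast
  qed (auto intro: derivs_bounded_empty derivs_bounded_subset derivs_bounded_Un nonneg_on_decay_weight assms(2))
qed

lemma decay_exp_small_at:
  assumes "\<And>x. x \<in> U \<Longrightarrow> exp_small_at U f x" "continuous_on U w" "\<And>x. 0 \<le> w x"
  shows "decay U w s f"
  using exp_small_at_derivs_bounded[OF assms(1) assms(2,3)] by (intro decay_local assms(3)) blast

end

subsection \<open>Integration along an affine family of maps\<close>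

text \<open>After rescaling the variable of integration, both terms of the homotopy operator are of the
  form \<open>\<integral>\<^sub>0\<^sup>1 q(r) f(x0 + B(r) (x - x0)) dr\<close>, with limits independent of \<open>x\<close>.\<close>

definition aff :: "(real \<Rightarrow> ((real,'n::{finite,linorder}) vec,'n) vec) \<Rightarrow> 'n rn \<Rightarrow> real \<Rightarrow> 'n rn \<Rightarrow> 'n rn" where
  "aff B x0 r x = x0 + B r *v (x - x0)"

definition aff_integral :: "(real \<Rightarrow> complex) \<Rightarrow> (real \<Rightarrow> ((real,'n::{finite,linorder}) vec,'n) vec) \<Rightarrow> 'n rn \<Rightarrow>
    (real \<Rightarrow> 'n rn \<Rightarrow> complex) \<Rightarrow> real \<Rightarrow> 'n rn \<Rightarrow> complex" where
  "aff_integral q B x0 f h x = integral {0..1} (\<lambda>r. q r * f h (aff B x0 r x))"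

text \<open>Smoothness is joint in (h, x), so differentiation under the integral sign must also
  produce the derivative in h. The estimates themselves only concern derivatives in x.\<close>

definition dh :: "(real \<Rightarrow> 'n::{finite,linorder} rn \<Rightarrow> complex) \<Rightarrow> real \<Rightarrow> 'n rn \<Rightarrow> complex" where
  "dh f h x = frechet_derivative (\<lambda>p. f (fst p) (snd p)) (at (h, x)) (1, 0)"

lemma smooth_dh:
  assumes "smooth U f" shows "smooth U (dh f)"
proof -
  have b: "(1, 0) \<in> (Basis :: (real \<times> 'a rn) set)"
    by (simp add: Basis_prod_def image_iff)
  have "Ck m ({0::real<..} \<times> U) (\<lambda>p. frechet_derivative (\<lambda>p. f (fst p) (snd p)) (at p) (1, 0))" for m
  proof -
    have "Ck (Suc m) ({0::real<..} \<times> U) (\<lambda>p. f (fst p) (snd p))"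
      using assms by (simp only: smooth_def Cinf_def)
    then show ?thesis unfolding Ck.simps using b by blast
  qed
  then show ?thesis
    unfolding smooth_def Cinf_def dh_def by simp
qed

lemma frechet_split:
  assumes "open U" "smooth U f" "h > 0" "x \<in> U"
  shows "frechet_derivative (\<lambda>p. f (fst p) (snd p)) (at (h, x)) v =
     complex_of_real (fst v) * dh f h x + (\<Sum>k\<in>UNIV. complex_of_real (snd v $ k) * pd k (f h) x)"
proof -
  let ?D = "frechet_derivative (\<lambda>p. f (fst p) (snd p)) (at (h, x))"
  interpret linear ?D
    using smooth_has_derivative[OF assms] by (rule has_derivative_linear)
  have "v = fst v *\<^sub>R (1, 0) + (0, snd v)" by (cases v) simp
  then have "?D v = ?D (fst v *\<^sub>R (1, 0) + (0, snd v))" by (rule arg_cong)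
  also have "\<dots> = fst v *\<^sub>R ?D (1, 0) + ?D (0, snd v)" by (simp only: add scale)
  finally have "?D v = fst v *\<^sub>R ?D (1, 0) + ?D (0, snd v)" .
  moreover have "?D (0, snd v) = (\<Sum>k\<in>UNIV. snd v $ k *\<^sub>R pd k (f h) x)"
  proof -
    have "?D (0, snd v) = frechet_derivative (f h) (at x) (snd v)"
      using fun_cong[OF frechet_derivative_at[OF smooth_has_derivative_x[OF assms]], of "snd v"] .
    then show ?thesis
      using frechet_axis_sum[OF assms(1) smooth_differentiable[OF assms]] by simp
  qed
  ultimately show ?thesis by (simp add: dh_def scaleR_conv_of_real)
qed

context
  fixes U :: "('n::{finite,linorder}) rn set" and x0 :: "'n rn" and B :: "real \<Rightarrow> ((real,'n) vec,'n) vec"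
  assumes U: "open U" "convex U"
    and B: "continuous_on {0..1} B"
    and maps: "\<And>r x. r \<in> {0..1} \<Longrightarrow> x \<in> U \<Longrightarrow> aff B x0 r x \<in> U"
begin

lemma continuous_on_aff:
  assumes "continuous_on S f" "continuous_on S g" "f ` S \<subseteq> {0..1}"
  shows "continuous_on S (\<lambda>p. aff B x0 (f p) (g p))"
proof -
  have "continuous_on S (\<lambda>p. B (f p))"
    by (rule continuous_on_compose2[OF B assms(1,3)])
  then show ?thesis
    unfolding aff_def matrix_vector_mult_def
    by (intro continuous_intros assms(2)) 
qed

lemma continuous_on_smooth_aff:
  assumes "smooth U f"
  shows "continuous_on (({0::real<..} \<times> U) \<times> {0..1}) (\<lambda>(p, r). f (fst p) (aff B x0 r (snd p)))"
proof -
  have "continuous_on (({0::real<..} \<times> U) \<times> {0..1}) (\<lambda>z. (\<lambda>p. f (fst p) (snd p)) (fst (fst z), aff B x0 (snd z) (snd (fst z))))"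
    by (intro continuous_on_compose2[OF smooth_continuous_on[OF U(1) assms]] continuous_on_Pair continuous_intros continuous_on_aff)
      (use maps in auto)
  then show ?thesis by (simp add: case_prod_unfold)
qed

lemma aff_integral_continuous:
  assumes "smooth U f" "h > 0" "x \<in> U" "continuous_on {0..1} q"
  shows "continuous_on {0..1} (\<lambda>r. q r * f h (aff B x0 r x))"
proof -
  have "continuous_on {0..1} (\<lambda>r. (\<lambda>(p, r). f (fst p) (aff B x0 r (snd p))) ((h, x), r))"
    by (intro continuous_on_compose2[OF continuous_on_smooth_aff[OF assms(1)]] continuous_intros)
      (use assms in auto)
  then show ?thesis using assms by (intro continuous_intros) auto
qed

lemma aff_integral_integrable:
  assumes "smooth U f" "h > 0" "x \<in> U" "continuous_on {0..1} q"
  shows "(\<lambda>r. q r * f h (aff B x0 r x)) integrable_on {0..1}"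
  using aff_integral_continuous[OF assms] by (rule integrable_continuous_interval)

lemma aff_integral_has_derivative:
  assumes "smooth U f" "h > 0" "x \<in> U" "continuous_on {0..1} q"
  shows "((\<lambda>p. aff_integral q B x0 f (fst p) (snd p)) has_derivative
     (\<lambda>v. integral {0..1} (\<lambda>r. q r * (complex_of_real (fst v) * dh f h (aff B x0 r x)
        + (\<Sum>k\<in>UNIV. complex_of_real ((B r *v snd v) $ k) * pd k (f h) (aff B x0 r x)))))) (at (h, x))"
proof -
  define E where "E p r v = q r * (complex_of_real (fst v) * dh f (fst p) (aff B x0 r (snd p))
        + (\<Sum>k\<in>UNIV. complex_of_real ((B r *v snd v) $ k) * pd k (f (fst p)) (aff B x0 r (snd p))))"
    for p :: "real \<times> 'n rn" and r and v :: "real \<times> 'n rn"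
  define W where "W = {0::real<..} \<times> U"
  have W: "open W" "convex W" "(h, x) \<in> W"
    using U assms by (auto simp: W_def open_Times convex_Times)
  have der: "((\<lambda>p. q r * f (fst p) (aff B x0 r (snd p))) has_derivative E p r) (at p)"
    if "p \<in> W" "r \<in> {0..1}" for p r
  proof -
    have p: "fst p > 0" "snd p \<in> U" "aff B x0 r (snd p) \<in> U"
      using that maps by (auto simp: W_def)
    have "((\<lambda>p. (fst p, aff B x0 r (snd p))) has_derivative (\<lambda>v. (fst v, B r *v snd v))) (at p)"
      unfolding aff_def
      by (intro has_derivative_Pair has_derivative_fst has_derivative_ident)
        (auto intro!: derivative_eq_intros bounded_linear.has_derivative[OF matrix_vector_mul_bounded_linear])
    from has_derivative_compose[OF this smooth_has_derivative[OF U(1) assms(1) p(1,3)]]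
    have "((\<lambda>p. f (fst p) (aff B x0 r (snd p))) has_derivative
       (\<lambda>v. frechet_derivative (\<lambda>p. f (fst p) (snd p)) (at (fst p, aff B x0 r (snd p))) (fst v, B r *v snd v))) (at p)"
      by simp
    from has_derivative_mult_right[OF this, of "q r"]
    show ?thesis
      unfolding E_def frechet_split[OF U(1) assms(1) p(1,3)] by simp
  qed
  \<comment> \<open>\<open>leibniz_rule\<close> wants the derivative as a continuous family of
    bounded operators. In finite dimension continuity may be tested on vectors, where the formula
    \<open>E\<close> is explicit.\<close>
  define fx where "fx p r = Blinfun (E p r)" for p r
  have fx: "blinfun_apply (fx p r) = E p r" if "p \<in> W" "r \<in> {0..1}" for p r
    unfolding fx_def by (rule bounded_linear_Blinfun_apply[OF has_derivative_bounded_linear[OF der[OF that]]])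
  have cont: "continuous_on (W \<times> cbox 0 1) (\<lambda>(p, r). fx p r)"
  proof (rule continuous_on_blinfun_componentwise)
    fix b :: "real \<times> 'n rn"
    have "continuous_on (W \<times> {0..1}) (\<lambda>z. B (snd z))"
      by (intro continuous_on_compose2[OF B] continuous_intros) auto
    moreover have "continuous_on (W \<times> {0..1}) (\<lambda>z. q (snd z))"
      by (intro continuous_on_compose2[OF assms(4)] continuous_intros) auto
    ultimately have "continuous_on (W \<times> {0..1}) (\<lambda>z. E (fst z) (snd z) b)"
      unfolding E_def matrix_vector_mult_def W_def
      using continuous_on_smooth_aff[OF smooth_dh[OF assms(1)]]
        continuous_on_smooth_aff[OF smooth_pd[OF U(1) assms(1)]]
      by (intro continuous_intros) (auto simp: case_prod_unfold)
    then show "continuous_on (W \<times> cbox 0 1) (\<lambda>z. blinfun_apply (case z of (p, r) \<Rightarrow> fx p r) b)"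
      unfolding cbox_interval by (rule continuous_on_eq) (auto simp: fx)
  qed
  have "((\<lambda>p. integral (cbox 0 1) (\<lambda>r. q r * f (fst p) (aff B x0 r (snd p)))) has_derivative
      blinfun_apply (integral (cbox 0 1) (fx (h, x)))) (at (h, x) within W)"
  proof (rule leibniz_rule[OF _ _ cont W(3,2)])
    show "((\<lambda>p. q r * f (fst p) (aff B x0 r (snd p))) has_derivative blinfun_apply (fx p r)) (at p within W)"
      if "p \<in> W" "r \<in> cbox 0 1" for p r
      using der[of p r] that fx[of p r] by (auto intro: has_derivative_at_withinI)
    show "(\<lambda>r. q r * f (fst p) (aff B x0 r (snd p))) integrable_on cbox 0 1" if "p \<in> W" for p
      using aff_integral_integrable[OF assms(1) _ _ assms(4), of "fst p" "snd p"] that by (auto simp: W_def)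
  qed
  moreover have "blinfun_apply (integral (cbox 0 1) (fx (h, x))) = (\<lambda>v. integral {0..1} (\<lambda>r. E (h, x) r v))"
  proof
    fix v
    have "continuous_on (cbox 0 1) (\<lambda>r. (\<lambda>(p, r). fx p r) ((h, x), r))"
      by (intro continuous_on_compose2[OF cont] continuous_intros) (use W in auto)
    then have "(fx (h, x)) integrable_on cbox 0 1"
      by (auto intro: integrable_continuous_interval)
    then have "blinfun_apply (integral (cbox 0 1) (fx (h, x))) v = integral (cbox 0 1) (\<lambda>r. blinfun_apply (fx (h, x) r) v)"
      by (rule blinfun_apply_integral)
    also have "\<dots> = integral {0..1} (\<lambda>r. E (h, x) r v)"
      using fx[OF W(3)] by (auto intro: integral_cong)
    finally show "blinfun_apply (integral (cbox 0 1) (fx (h, x))) v = integral {0..1} (\<lambda>r. E (h, x) r v)" .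
  qed
  ultimately show ?thesis
    using W at_within_open[OF W(3,1)] unfolding aff_integral_def E_def by simp
qed

lemma aff_integral_linear_sum:
  assumes "\<And>i. i \<in> I \<Longrightarrow> smooth U (f i)" "h > 0" "x \<in> U" "\<And>i. i \<in> I \<Longrightarrow> continuous_on {0..1} (q i)" "finite I"
  shows "(\<Sum>i\<in>I. aff_integral (q i) B x0 (f i) h x) = integral {0..1} (\<lambda>r. \<Sum>i\<in>I. q i r * f i h (aff B x0 r x))"
  unfolding aff_integral_def by (rule integral_sum[symmetric]) (use assms aff_integral_integrable in auto)

lemma continuous_on_B_component:
  "continuous_on {0..1} q \<Longrightarrow> continuous_on {0..1} (\<lambda>r. q r * complex_of_real (B r $ k $ i))"
  by (intro continuous_intros B)

lemma aff_integral_deriv_x: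
  assumes "smooth U f" "h > 0" "x \<in> U" "continuous_on {0..1} q"
  shows "integral {0..1} (\<lambda>r. q r * (complex_of_real 0 * dh f h (aff B x0 r x)
        + (\<Sum>k\<in>UNIV. complex_of_real ((B r *v axis i 1) $ k) * pd k (f h) (aff B x0 r x))))
      = (\<Sum>k\<in>UNIV. aff_integral (\<lambda>r. q r * complex_of_real (B r $ k $ i)) B x0 (\<lambda>h. pd k (f h)) h x)"
  by (subst aff_integral_linear_sum)
    (use assms smooth_pd[OF U(1) assms(1)] continuous_on_B_component in
      \<open>auto simp: matrix_vector_mult_basis column_def sum_distrib_left mult.assoc\<close>)

text \<open>The functions \<open>aff_integral q B x0 f\<close> are closed under differentiation up
  to finite sums: in h, f becomes \<open>dh f\<close>; in x, q is multiplied by an entry of B and f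
  becomes \<open>pd k\<close> of f. Hence the induction is over all f and q.\<close>

lemma smooth_aff_integral:
  assumes "smooth U f" "continuous_on {0..1} q"
  shows "smooth U (aff_integral q B x0 f)"
proof -
  have "smooth U f \<Longrightarrow> continuous_on {0..1} q \<Longrightarrow>
      Ck m ({0::real<..} \<times> U) (\<lambda>p. aff_integral q B x0 f (fst p) (snd p))" for m f q
  proof (induction m arbitrary: f q)
    case 0
    have "continuous (at p) (\<lambda>p. aff_integral q B x0 f (fst p) (snd p))" if "p \<in> {0::real<..} \<times> U" for p
      using aff_integral_has_derivative[OF 0(1) _ _ 0(2), of "fst p" "snd p"] that
      by (auto intro: has_derivative_continuous)
    then show ?case by (auto intro: continuous_at_imp_continuous_on)
  next
    case (Suc m)
    show ?case
    proof (rule Ck_SucI[OF open_hU[OF U(1)]])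
      fix p assume "p \<in> {0::real<..} \<times> U"
      then show "((\<lambda>p. aff_integral q B x0 f (fst p) (snd p)) has_derivative
        (\<lambda>v. integral {0..1} (\<lambda>r. q r * (complex_of_real (fst v) * dh f (fst p) (aff B x0 r (snd p))
        + (\<Sum>k\<in>UNIV. complex_of_real ((B r *v snd v) $ k) * pd k (f (fst p)) (aff B x0 r (snd p))))))) (at p)"
        using aff_integral_has_derivative[OF Suc.prems(1) _ _ Suc.prems(2), of "fst p" "snd p"] by auto
    next
      fix b :: "real \<times> 'n rn" assume "b \<in> Basis"
      then consider "b = (1, 0)" | i where "b = (0, axis i 1)"
        by (auto simp: Basis_prod_def Basis_vec_def)
      then show "Ck m ({0::real<..} \<times> U) (\<lambda>p. integral {0..1} (\<lambda>r. q r * (complex_of_real (fst b) * dh f (fst p) (aff B x0 r (snd p))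
        + (\<Sum>k\<in>UNIV. complex_of_real ((B r *v snd b) $ k) * pd k (f (fst p)) (aff B x0 r (snd p))))))"
      proof cases
        case 1
        then show ?thesis using Suc.IH[OF smooth_dh[OF Suc.prems(1)] Suc.prems(2)]
          by (simp add: aff_integral_def)
      next
        case 2
        have "Ck m ({0::real<..} \<times> U) (\<lambda>p. \<Sum>k\<in>UNIV. aff_integral (\<lambda>r. q r * complex_of_real (B r $ k $ i)) B x0 (\<lambda>h. pd k (f h)) (fst p) (snd p))"
          by (intro Ck_sum open_hU U Suc.IH smooth_pd Suc.prems continuous_on_B_component)
        then show ?thesis unfolding 2 fst_conv snd_conv
          by (subst Ck_cong[OF open_hU[OF U(1)] aff_integral_deriv_x]) (use Suc.prems in auto)
      qed
    qed
  qed
  then show ?thesis using assms by (simp add: smooth_def Cinf_def)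
qed

lemma pd_aff_integral:
  assumes "smooth U f" "h > 0" "x \<in> U" "continuous_on {0..1} q"
  shows "pd i (aff_integral q B x0 f h) x = (\<Sum>k\<in>UNIV. aff_integral (\<lambda>r. q r * complex_of_real (B r $ k $ i)) B x0 (\<lambda>h. pd k (f h)) h x)"
  unfolding pd_eq_frechet[OF U(1) smooth_aff_integral[OF assms(1,4)] assms(2,3)]
    frechet_derivative_at[OF aff_integral_has_derivative[OF assms], symmetric] fst_conv snd_conv
  by (rule aff_integral_deriv_x[OF assms])

text \<open>Differentiating in x only multiplies q by bounded entries of B, so each order reduces to
  the size of f on the paths. The last premise speaks of the integral of the weight and not of its
  supremum: that is where integration across Q can improve the power of h.\<close>

lemma derivs_bounded_ord_aff_integral:
  assumes "K \<subseteq> U"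
  shows "smooth U f \<Longrightarrow> continuous_on {0..1} q \<Longrightarrow> derivs_bounded ((\<lambda>(r, x). aff B x0 r x) ` ({0..1} \<times> K)) \<phi> f \<Longrightarrow>
     nonneg_on ((\<lambda>(r, x). aff B x0 r x) ` ({0..1} \<times> K)) \<phi> \<Longrightarrow>
     (\<And>j. \<exists>C. \<forall>\<^sub>F h in at_right 0. \<forall>x\<in>K. \<exists>I. ((\<lambda>r. \<phi> j h (aff B x0 r x)) has_integral I) {0..1} \<and> I \<le> C * \<psi> j h x) \<Longrightarrow>
     derivs_bounded_ord n K \<psi> (aff_integral q B x0 f)"
proof (induction n arbitrary: f q \<phi> \<psi>)
  case 0
  obtain D where D: "\<forall>\<^sub>F h in at_right 0. \<forall>y\<in>(\<lambda>(r, x). aff B x0 r x) ` ({0..1} \<times> K). norm (f h y) \<le> D * \<phi> 0 h y"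
    using spec[OF 0(3)[unfolded derivs_bounded_def], of 0] unfolding derivs_bounded_ord_0 by blast
  obtain C where C: "\<forall>\<^sub>F h in at_right 0. \<forall>x\<in>K. \<exists>I. ((\<lambda>r. \<phi> 0 h (aff B x0 r x)) has_integral I) {0..1} \<and> I \<le> C * \<psi> 0 h x"
    using 0(5) by blast
  have "bounded (q ` {0..1})"
    using 0(2) by (intro compact_imp_bounded compact_continuous_image) auto
  then obtain M where M: "M > 0" "\<And>r. r \<in> {0..1} \<Longrightarrow> norm (q r) \<le> M"
    unfolding bounded_pos by blast
  have "\<forall>\<^sub>F h in at_right 0. \<forall>x\<in>K. norm (aff_integral q B x0 f h x) \<le> (M * \<bar>D\<bar> * C) * \<psi> 0 h x"
    using C D eventually_h01
  proof (eventually_elim, intro ballI)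
    fix h x
    assume C: "\<forall>x\<in>K. \<exists>I. ((\<lambda>r. \<phi> 0 h (aff B x0 r x)) has_integral I) {0..1} \<and> I \<le> C * \<psi> 0 h x"
      and D: "\<forall>y\<in>(\<lambda>(r, x). aff B x0 r x) ` ({0..1} \<times> K). norm (f h y) \<le> D * \<phi> 0 h y"
      and h: "0 < h \<and> h < 1" and x: "x \<in> K"
    obtain I where I: "((\<lambda>r. \<phi> 0 h (aff B x0 r x)) has_integral I) {0..1}" "I \<le> C * \<psi> 0 h x"
      using C x by blast
    have "norm (q r * f h (aff B x0 r x)) \<le> M * \<bar>D\<bar> * \<phi> 0 h (aff B x0 r x)" if r: "r \<in> {0..1}" for r
    proof -
      have mem: "aff B x0 r x \<in> (\<lambda>(r, x). aff B x0 r x) ` ({0..1} \<times> K)" using r x by force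
      have "norm (f h (aff B x0 r x)) \<le> D * \<phi> 0 h (aff B x0 r x)" using D mem by blast
      also have "\<dots> \<le> \<bar>D\<bar> * \<phi> 0 h (aff B x0 r x)"
        using 0(4) h mem by (intro mult_right_mono) (auto simp: nonneg_on_def)
      finally show ?thesis
        unfolding norm_mult mult.assoc using M(2)[OF r] M(1) by (intro mult_mono) auto
    qed
    then have "norm (aff_integral q B x0 f h x) \<le> integral {0..1} (\<lambda>r. M * \<bar>D\<bar> * \<phi> 0 h (aff B x0 r x))"
      unfolding aff_integral_def
      using 0 h x assms integrable_on_mult_right[OF has_integral_integrable[OF I(1)], of "M * \<bar>D\<bar>"]
      by (intro integral_norm_bound_integral aff_integral_integrable) auto
    also have "\<dots> = M * \<bar>D\<bar> * I"
      by (rule integral_unique[OF has_integral_mult_right[OF I(1)]])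
    also have "\<dots> \<le> M * \<bar>D\<bar> * (C * \<psi> 0 h x)"
      using I(2) M(1) by (intro mult_left_mono) auto
    finally show "norm (aff_integral q B x0 f h x) \<le> (M * \<bar>D\<bar> * C) * \<psi> 0 h x" by (simp add: mult.assoc)
  qed
  then show ?case unfolding derivs_bounded_ord_0 by blast
next
  case (Suc n)
  show ?case
    unfolding derivs_bounded_ord_Suc
  proof
    fix i
    have i1: "derivs_bounded_ord n K (\<lambda>j. \<psi> (Suc j)) (aff_integral (\<lambda>r. q r * complex_of_real (B r $ k $ i)) B x0 (\<lambda>h. pd k (f h)))" for k
      by (rule Suc.IH[where \<phi> = "\<lambda>j. \<phi> (Suc j)"])
        (use Suc.prems in \<open>auto intro: smooth_pd[OF U(1)] continuous_on_B_component derivs_bounded_pd nonneg_on_Suc\<close>)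
    have i2: "smooth U (aff_integral (\<lambda>r. q r * complex_of_real (B r $ k $ i)) B x0 (\<lambda>h. pd k (f h)))" for k
      using Suc.prems by (intro smooth_aff_integral smooth_pd U continuous_on_B_component)
    have "derivs_bounded_ord n K (\<lambda>j. \<psi> (Suc j)) (\<lambda>h x. \<Sum>k\<in>S. aff_integral (\<lambda>r. q r * complex_of_real (B r $ k $ i)) B x0 (\<lambda>h. pd k (f h)) h x)" if "finite S" for S
      using that
    proof (induction S rule: finite_induct)
      case empty
      then show ?case by (simp add: derivs_bounded_zero[unfolded derivs_bounded_def])
    next
      case (insert k S)
      then show ?case
        using i1[of k] i2 derivs_bounded_ord_add[OF U(1) assms, of "aff_integral (\<lambda>r. q r * complex_of_real (B r $ k $ i)) B x0 (\<lambda>h. pd k (f h))"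
            "\<lambda>h x. \<Sum>k\<in>S. aff_integral (\<lambda>r. q r * complex_of_real (B r $ k $ i)) B x0 (\<lambda>h. pd k (f h)) h x"]
        smooth_sum[OF U(1), of S "\<lambda>k. aff_integral (\<lambda>r. q r * complex_of_real (B r $ k $ i)) B x0 (\<lambda>h. pd k (f h))"]
        by simp
    qed
    then show "derivs_bounded_ord n K (\<lambda>j. \<psi> (Suc j)) (\<lambda>h. pd i (aff_integral q B x0 f h))"
      by (subst derivs_bounded_ord_cong[OF U(1) pd_aff_integral assms]) (use Suc.prems in auto)
  qed
qed

lemma derivs_bounded_aff_integral:
  assumes "K \<subseteq> U" "smooth U f" "continuous_on {0..1} q"
    "derivs_bounded ((\<lambda>(r, x). aff B x0 r x) ` ({0..1} \<times> K)) \<phi> f"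
    "nonneg_on ((\<lambda>(r, x). aff B x0 r x) ` ({0..1} \<times> K)) \<phi>"
    "\<And>j. \<exists>C. \<forall>\<^sub>F h in at_right 0. \<forall>x\<in>K. \<exists>I. ((\<lambda>r. \<phi> j h (aff B x0 r x)) has_integral I) {0..1} \<and> I \<le> C * \<psi> j h x"
  shows "derivs_bounded K \<psi> (aff_integral q B x0 f)"
  unfolding derivs_bounded_def by (intro allI derivs_bounded_ord_aff_integral[OF assms])

lemma compact_aff_image:
  assumes "compact K" "K \<subseteq> U"
  shows "compact ((\<lambda>(r, x). aff B x0 r x) ` ({0..1} \<times> K))" "(\<lambda>(r, x). aff B x0 r x) ` ({0..1} \<times> K) \<subseteq> U"
proof -
  have "continuous_on ({0..1} \<times> K) (\<lambda>z. aff B x0 (fst z) (snd z))"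
    by (intro continuous_on_aff continuous_intros) auto
  then show "compact ((\<lambda>(r, x). aff B x0 r x) ` ({0..1} \<times> K))"
    using assms by (intro compact_continuous_image compact_Times) (auto simp: case_prod_unfold)
  show "(\<lambda>(r, x). aff B x0 r x) ` ({0..1} \<times> K) \<subseteq> U" using maps assms by auto
qed

text \<open>The points where f is exponentially small form an open set containing the path of x. The
  tube lemma gives a ball of points whose paths stay in that set, and compactness of the swept
  region gives a common rate.\<close>

lemma exp_small_at_aff_integral:
  assumes "smooth U f" "x \<in> U" "continuous_on {0..1} q" "\<And>r. r \<in> {0..1} \<Longrightarrow> exp_small_at U f (aff B x0 r x)"
  shows "exp_small_at U (aff_integral q B x0 f) x"
proof -
  define S where "S = {y. exp_small_at U f y}"
  have "open S"
  proof (rule Topological_Spaces.openI)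
    fix y assume "y \<in> S"
    then obtain V where "open V" "y \<in> V" "\<forall>z\<in>V. exp_small_at U f z"
      using exp_small_at_open[of U f y] unfolding S_def by auto
    then show "\<exists>T. open T \<and> y \<in> T \<and> T \<subseteq> S" by (auto simp: S_def)
  qed
  have c: "continuous_on (U \<times> {0..1}) (\<lambda>z. aff B x0 (snd z) (fst z))"
    by (intro continuous_on_aff continuous_intros) auto
  obtain T where T: "open T" "T \<inter> (U \<times> {0..1}) = (\<lambda>z. aff B x0 (snd z) (fst z)) -` S \<inter> (U \<times> {0..1})"
    using mp[OF spec[OF c[unfolded continuous_on_open_invariant], of S] \<open>open S\<close>] by (elim exE conjE)
  have "{x} \<times> {0..1} \<subseteq> T"
    using T(2) assms(2,4) by (auto simp: S_def)
  then obtain X where X: "x \<in> X" "open X" "X \<times> {0..1} \<subseteq> T"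
    using Elementary_Topology.tube_lemma[of "{0..1::real}" T x] T(1) by auto
  obtain e where e: "e > 0" "cball x e \<subseteq> X \<inter> U"
    using X U assms(2) open_contains_cball[of "X \<inter> U"] by blast
  define K where "K = cball x e"
  have K: "compact K" "K \<subseteq> U" "K \<subseteq> X" using e by (auto simp: K_def)
  have "aff B x0 r y \<in> S" if "r \<in> {0..1}" "y \<in> K" for r y
    using T(2) X(3) K that by fastforce
  then have "exp_small_on ((\<lambda>(r, x). aff B x0 r x) ` ({0..1} \<times> K)) f"
    using compact_aff_image[OF K(1,2)] by (intro exp_small_on_compact[where U=U]) (auto simp: S_def)
  then obtain c where cc: "c > 0" "derivs_bounded ((\<lambda>(r, x). aff B x0 r x) ` ({0..1} \<times> K)) (\<lambda>j h x. exp (- c / h)) f"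
    unfolding exp_small_on_def by blast
  have "derivs_bounded K (\<lambda>j h x. exp (- c / h)) (aff_integral q B x0 f)"
  proof (rule derivs_bounded_aff_integral[OF K(2) assms(1,3) cc(2) nonneg_on_exp])
    show "\<exists>C. \<forall>\<^sub>F h in at_right 0. \<forall>x\<in>K. \<exists>I. ((\<lambda>r. exp (- c / h)) has_integral I) {0..1::real} \<and> I \<le> C * exp (- c / h)"
    proof (rule exI[of _ 1], intro always_eventually allI ballI)
      show "\<exists>I. ((\<lambda>r. exp (- c / h)) has_integral I) {0..1::real} \<and> I \<le> 1 * exp (- c / h)" for h
        using has_integral_const_real[of "exp (- c / h)" 0 1] by (intro exI[of _ "exp (- c / h)"]) simp
    qed
  qed
  then have "exp_small_on (ball x e) (aff_integral q B x0 f)"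
    unfolding exp_small_on_def using cc(1) by (metis K_def ball_subset_cball derivs_bounded_subset)
  then show ?thesis
    unfolding exp_small_at_def using e by (intro exI[of _ "ball x e"]) auto
qed

lemma aff_integral_add:
  assumes "smooth U f" "smooth U g" "h > 0" "x \<in> U" "continuous_on {0..1} q"
  shows "aff_integral q B x0 (\<lambda>h x. f h x + g h x) h x = aff_integral q B x0 f h x + aff_integral q B x0 g h x"
  unfolding aff_integral_def distrib_left by (rule integral_add) (use assms aff_integral_integrable in auto)

lemma aff_integral_cong:
  assumes "\<And>y. y \<in> U \<Longrightarrow> f h y = g h y" "x \<in> U"
  shows "aff_integral q B x0 f h x = aff_integral q B x0 g h x"
  unfolding aff_integral_def using assms maps by (intro integral_cong) auto

end

subsection \<open>Forms with asymptotic support\<close>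

lemma xsgn_empty [simp]: "xsgn {} J = 1" "xsgn I {} = 1"
  by (simp_all add: xsgn_def)

lemma xsgn_singleton: "xsgn {k} {i} = (if i < k then -1 else 1)"
proof -
  have "{(a, b). a \<in> {k} \<and> b \<in> {i} \<and> b < a} = (if i < k then {(k, i)} else {})" by auto
  then show ?thesis unfolding xsgn_def by simp
qed

lemma iota0_empty: "iota0 v a {} = (\<Sum>k\<in>UNIV. complex_of_real (v $ k) * a {k})"
  by (simp add: iota0_def)

text \<open>Expands e_i = l_i v + (e_i - l_i v). If l(v) = 1, the second vector is tangent to the
  hyperplane l = 0, so for a form with asymptotic support there everything but the normal part is
  exponentially small.\<close>

lemma covector_split:
  fixes a :: "'n::{finite,linorder} cf"
  shows "a {i} = complex_of_real (l $ i) * iota0 v a {} + iota0 (axis i 1 - (l $ i) *\<^sub>R v) a {}"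
proof -
  have "iota0 (axis i 1 - (l $ i) *\<^sub>R v) a {} = (\<Sum>k\<in>UNIV. (if k = i then a {k} else 0) - complex_of_real (l $ i) * (complex_of_real (v $ k) * a {k}))"
    unfolding iota0_empty by (intro sum.cong) (auto simp: axis_def algebra_simps)
  then show ?thesis by (simp add: sum_subtractf iota0_empty sum_distrib_left)
qed

lemma iota0_eq_0:
  fixes a :: "'n::{finite,linorder} cf"
  assumes "\<And>I. card I \<noteq> Suc k \<Longrightarrow> a I = 0" "card J \<noteq> k"
  shows "iota0 v a J = 0"
  unfolding iota0_def
proof (intro sum.neutral ballI)
  fix i assume "i \<in> - J"
  then have "card (insert i J) \<noteq> Suc k" using assms(2) by simp
  then show "xsgn {i} J * complex_of_real (v $ i) * a (insert i J) = 0" using assms(1) by simp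
qed

lemma wedge0_doubleton:
  fixes a b :: "'n::{finite,linorder} cf"
  assumes "\<And>I. card I \<noteq> 1 \<Longrightarrow> a I = 0" "\<And>I. card I \<noteq> 1 \<Longrightarrow> b I = 0" "k \<noteq> i"
  shows "wedge0 a b {k, i} = xsgn {k} {i} * (a {k} * b {i} - a {i} * b {k})"
proof -
  have P: "Pow {k, i} = {{}, {k}, {i}, {k, i}}" by auto
  have "a {} = 0" "a {k, i} = 0" using assms by auto
  moreover have "{k, i} - {k} = {i}" "{k, i} - {i} = {k}" using assms(3) by auto
  ultimately show ?thesis
    unfolding wedge0_def P using assms(3)
    by (cases "i < k") (simp_all add: xsgn_singleton doubleton_eq_iff not_less_iff_gr_or_eq)
qed

lemma wedge0_eq_0:
  fixes a b :: "'n::{finite,linorder} cf"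
  assumes "\<And>I. card I \<noteq> 1 \<Longrightarrow> a I = 0" "\<And>I. card I \<noteq> 1 \<Longrightarrow> b I = 0" "card K \<noteq> 2"
  shows "wedge0 a b K = 0"
  unfolding wedge0_def
proof (intro sum.neutral ballI)
  fix I assume "I \<in> Pow K"
  then have "card K = card I + card (K - I)" by (metis PowD card_Diff_subset card_mono finite le_add_diff_inverse)
  then show "xsgn I (K - I) * a I * b (K - I) = 0" using assms by (cases "card I = 1") auto
qed

text \<open>Contraction is an antiderivation. For two 1-forms each term has a contraction as a
  scalar factor, so the contraction of the product is small once those of both factors are.\<close>

lemma iota0_wedge0:
  fixes a b :: "'n::{finite,linorder} cf"
  assumes "\<And>I. card I \<noteq> 1 \<Longrightarrow> a I = 0" "\<And>I. card I \<noteq> 1 \<Longrightarrow> b I = 0"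
  shows "iota0 v (wedge0 a b) {i} = iota0 v a {} * b {i} - a {i} * iota0 v b {}"
proof -
  have "iota0 v (wedge0 a b) {i} = (\<Sum>k\<in>- {i}. complex_of_real (v $ k) * (a {k} * b {i} - a {i} * b {k}))"
    unfolding iota0_def
  proof (rule sum.cong[OF refl])
    fix k assume "k \<in> - {i}"
    then show "xsgn {k} {i} * complex_of_real (v $ k) * wedge0 a b (insert k {i}) =
        complex_of_real (v $ k) * (a {k} * b {i} - a {i} * b {k})"
      using wedge0_doubleton[of a b k i, OF assms] by (simp add: xsgn_singleton)
  qed
  also have "\<dots> = (\<Sum>k\<in>UNIV. complex_of_real (v $ k) * (a {k} * b {i} - a {i} * b {k}))"
    by (rule sum.mono_neutral_left) auto
  also have "\<dots> = iota0 v a {} * b {i} - a {i} * iota0 v b {}"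
    by (simp add: iota0_empty sum_distrib_left sum_distrib_right sum_subtractf algebra_simps)
  finally show ?thesis .
qed

text \<open>Both forms have degree 1, so the graded sign is -1; terms of any other degree
  vanish.\<close>

lemma twedge_eq:
  assumes "\<And>I. card I \<noteq> 1 \<Longrightarrow> \<beta> h x I = 0" "\<And>I. card I \<noteq> 1 \<Longrightarrow> \<gamma> h x I = 0"
  shows "twedge \<beta> \<gamma> h x K = - wedge \<beta> \<gamma> h x K"
  unfolding twedge_def wedge_def wedge0_def sum_negf[symmetric]
proof (rule sum.cong[OF refl])
  fix I
  show "(- 1) ^ (card I * card (K - I)) * xsgn I (K - I) * \<beta> h x I * \<gamma> h x (K - I)
     = - (xsgn I (K - I) * \<beta> h x I * \<gamma> h x (K - I))"
    using assms(1)[of I] assms(2)[of "K - I"] by (cases "card I = 1"; cases "card (K - I) = 1") auto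
qed

text \<open>\<open>W\<close> consists of the directions tangent to the support \<open>P\<close>, and \<open>w\<close> measures the
  distance to the linear span of \<open>P\<close>.\<close>

definition asym_form :: "('n::{finite,linorder}) rn set \<Rightarrow> nat \<Rightarrow> 'n rn set \<Rightarrow> ('n rn \<Rightarrow> real) \<Rightarrow> 'n rn set \<Rightarrow> real \<Rightarrow> 'n form \<Rightarrow> bool" where
  "asym_form U k W w P s \<alpha> \<longleftrightarrow> formk U k \<alpha> \<and>
     (\<forall>x\<in>U - P. \<forall>I. exp_small_at U (\<lambda>h x. \<alpha> h x I) x) \<and>
     (\<forall>v\<in>W. \<forall>J. \<forall>x\<in>U. exp_small_at U (\<lambda>h x. iota0 v (\<alpha> h x) J) x) \<and>
     (\<forall>I. decay U w s (\<lambda>h x. \<alpha> h x I))"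

lemma asym_form_smooth: "asym_form U k W w P s \<alpha> \<Longrightarrow> smooth U (\<lambda>h x. \<alpha> h x I)"
  by (auto simp: asym_form_def formk_iff)

lemma asym_form_card: "asym_form U k W w P s \<alpha> \<Longrightarrow> 0 < h \<Longrightarrow> x \<in> U \<Longrightarrow> card I \<noteq> k \<Longrightarrow> \<alpha> h x I = 0"
  by (auto simp: asym_form_def formk_iff)

lemma asym_form_decay: "asym_form U k W w P s \<alpha> \<Longrightarrow> decay U w s (\<lambda>h x. \<alpha> h x I)"
  by (auto simp: asym_form_def)

lemma asym_form_exp_small_at_off: "asym_form U k W w P s \<alpha> \<Longrightarrow> x \<in> U \<Longrightarrow> x \<notin> P \<Longrightarrow> exp_small_at U (\<lambda>h x. \<alpha> h x I) x"
  by (auto simp: asym_form_def)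

lemma asym_form_exp_small_at_iota: "asym_form U k W w P s \<alpha> \<Longrightarrow> x \<in> U \<Longrightarrow> v \<in> W \<Longrightarrow> exp_small_at U (\<lambda>h x. iota0 v (\<alpha> h x) J) x"
  by (auto simp: asym_form_def)

context
  fixes U :: "('n::{finite,linorder}) rn set"
  assumes U: "open U"
begin

lemma formk_cong:
  assumes "\<And>h x I. h > 0 \<Longrightarrow> x \<in> U \<Longrightarrow> \<alpha> h x I = \<beta> h x I"
  shows "formk U k \<alpha> \<longleftrightarrow> formk U k \<beta>"
proof -
  have "smooth U (\<lambda>h x. \<alpha> h x I) = smooth U (\<lambda>h x. \<beta> h x I)" for I
    by (rule smooth_cong[OF U]) (rule assms)
  then show ?thesis by (simp add: formk_iff assms)
qed

lemma asym_form_cong: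
  assumes "\<And>h x I. h > 0 \<Longrightarrow> x \<in> U \<Longrightarrow> \<alpha> h x I = \<beta> h x I"
  shows "asym_form U k W w P s \<alpha> \<longleftrightarrow> asym_form U k W w P s \<beta>"
proof -
  have 1: "exp_small_at U (\<lambda>h x. \<alpha> h x I) x = exp_small_at U (\<lambda>h x. \<beta> h x I) x" for I x
    by (rule exp_small_at_cong[OF U]) (rule assms)
  have 2: "decay U w s (\<lambda>h x. \<alpha> h x I) = decay U w s (\<lambda>h x. \<beta> h x I)" for I
    by (rule decay_cong[OF U]) (rule assms)
  have 3: "exp_small_at U (\<lambda>h x. iota0 v (\<alpha> h x) J) x = exp_small_at U (\<lambda>h x. iota0 v (\<beta> h x) J) x" for v J x
    by (rule exp_small_at_cong[OF U]) (simp add: assms iota0_def)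
  show ?thesis unfolding asym_form_def 1 2 3 using formk_cong[OF assms] by simp
qed

lemma smooth_cmult: "smooth U f \<Longrightarrow> smooth U (\<lambda>h x. c * f h x)"
  by (intro smooth_mult[OF U] smooth_const[OF U])

lemma exp_small_at_cmult: "smooth U f \<Longrightarrow> exp_small_at U f x \<Longrightarrow> exp_small_at U (\<lambda>h x. c * f h x) x"
  by (rule exp_small_at_mult'[OF U smooth_const[OF U] _ _ decay_const_h[OF U smooth_const[OF U]]])

lemma decay_cmult:
  assumes "smooth U f" "decay U w s f" "\<And>x. 0 \<le> w x"
  shows "decay U w s (\<lambda>h x. c * f h x)"
proof -
  have "decay U w (0 + s) (\<lambda>h x. c * f h x)"
    by (rule decay_mult[OF U smooth_const[OF U] assms(1) decay_const_h[OF U smooth_const[OF U]] assms(2), where c=1])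
      (use assms in auto)
  then show ?thesis by simp
qed

lemma smooth_iota0: "(\<And>I. smooth U (\<lambda>h x. \<alpha> h x I)) \<Longrightarrow> smooth U (\<lambda>h x. iota0 v (\<alpha> h x) J)"
  unfolding iota0_def by (intro smooth_sum[OF U] smooth_cmult)

lemma exp_small_at_iota0:
  assumes "\<And>I. smooth U (\<lambda>h x. \<alpha> h x I)" "\<And>I. exp_small_at U (\<lambda>h x. \<alpha> h x I) x" "x \<in> U"
  shows "exp_small_at U (\<lambda>h x. iota0 v (\<alpha> h x) J) x"
  unfolding iota0_def by (intro exp_small_at_sum[OF U] smooth_cmult exp_small_at_cmult assms)

lemma decay_iota0:
  assumes "\<And>I. smooth U (\<lambda>h x. \<alpha> h x I)" "\<And>I. decay U w s (\<lambda>h x. \<alpha> h x I)" "\<And>x. 0 \<le> w x"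
  shows "decay U w s (\<lambda>h x. iota0 v (\<alpha> h x) J)"
  unfolding iota0_def by (intro decay_sum[OF U] smooth_cmult decay_cmult assms)

lemma asym_form_exp_small_at:
  assumes "formk U k \<alpha>" "\<And>x I. x \<in> U \<Longrightarrow> exp_small_at U (\<lambda>h x. \<alpha> h x I) x" "continuous_on U w" "\<And>x. 0 \<le> w x"
  shows "asym_form U k W w P s \<alpha>"
  unfolding asym_form_def using assms
  by (auto intro!: decay_exp_small_at[OF U] exp_small_at_iota0 simp: formk_iff)

lemma asym_form_zero:
  assumes "continuous_on U w" "\<And>x. 0 \<le> w x"
  shows "asym_form U k W w P s (\<lambda>h x I. 0)"
  by (rule asym_form_exp_small_at[OF _ _ assms]) (auto simp: formk_iff smooth_const[OF U] exp_small_at_zero[OF U])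

lemma asym_form_add:
  assumes "asym_form U k W w P s \<alpha>" "asym_form U k W w P s \<beta>"
  shows "asym_form U k W w P s (\<lambda>h x I. \<alpha> h x I + \<beta> h x I)"
proof -
  note s = asym_form_smooth[OF assms(1)] asym_form_smooth[OF assms(2)]
  have *: "iota0 v (\<lambda>I. \<alpha> h x I + \<beta> h x I) J = iota0 v (\<alpha> h x) J + iota0 v (\<beta> h x) J" for v J h x
    by (simp add: iota0_def distrib_left sum.distrib)
  show ?thesis
    unfolding asym_form_def formk_iff *
    by (intro conjI ballI allI impI smooth_add[OF U] exp_small_at_add[OF U] decay_add[OF U] s smooth_iota0
        asym_form_decay[OF assms(1)] asym_form_decay[OF assms(2)] asym_form_exp_small_at_off[OF assms(1)] asym_form_exp_small_at_off[OF assms(2)]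
        asym_form_exp_small_at_iota[OF assms(1)] asym_form_exp_small_at_iota[OF assms(2)])
      (auto simp: asym_form_card[OF assms(1)] asym_form_card[OF assms(2)])
qed

lemma asym_form_cmult:
  assumes "asym_form U k W w P s \<alpha>" "\<And>x. 0 \<le> w x"
  shows "asym_form U k W w P s (\<lambda>h x I. c * \<alpha> h x I)"
proof -
  note s = asym_form_smooth[OF assms(1)]
  have *: "iota0 v (\<lambda>I. c * \<alpha> h x I) J = c * iota0 v (\<alpha> h x) J" for v J h x
    by (simp add: iota0_def sum_distrib_left algebra_simps)
  show ?thesis
    unfolding asym_form_def formk_iff *
    by (intro conjI ballI allI impI smooth_cmult exp_small_at_cmult decay_cmult s smooth_iota0
        asym_form_decay[OF assms(1)] asym_form_exp_small_at_off[OF assms(1)] asym_form_exp_small_at_iota[OF assms(1)] assms)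
      (auto simp: asym_form_card[OF assms(1)])
qed

lemma asym_form_sum:
  assumes "\<And>i. i \<in> S \<Longrightarrow> asym_form U k W w P s (\<alpha> i)" "continuous_on U w" "\<And>x. 0 \<le> w x"
  shows "asym_form U k W w P s (\<lambda>h x I. \<Sum>i\<in>S. \<alpha> i h x I)"
  using assms(1)
proof (induction S rule: infinite_finite_induct)
  case (insert i S)
  then show ?case
    using asym_form_add[of k W w P s "\<alpha> i" "\<lambda>h x I. \<Sum>i\<in>S. \<alpha> i h x I"] by simp
qed (simp_all add: asym_form_zero assms)

lemma asym_form_mono:
  assumes "asym_form U k W w P s \<alpha>" "s \<le> s'" "\<And>x. 0 \<le> w x"
  shows "asym_form U k W w P s' \<alpha>"
  using assms decay_mono[OF U _ assms(2,3)] by (auto simp: asym_form_def)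

lemma formk_wedge:
  assumes "formk U 1 \<alpha>" "formk U 1 \<beta>"
  shows "formk U 2 (wedge \<alpha> \<beta>)"
proof -
  have "smooth U (\<lambda>h x. wedge \<alpha> \<beta> h x I)" for I
    unfolding wedge_def wedge0_def using assms
    by (intro smooth_sum[OF U] smooth_mult[OF U] smooth_const[OF U]) (auto simp: formk_iff)
  moreover have "wedge \<alpha> \<beta> h x I = 0" if "h > 0" "x \<in> U" "card I \<noteq> 2" for h x I
    unfolding wedge_def using assms that by (intro wedge0_eq_0) (auto simp: formk_iff)
  ultimately show ?thesis by (simp add: formk_iff)
qed

text \<open>A point of U off P misses P1 or P2, so one factor is exponentially small and the other
  is at most a power of 1/h. The condition on the weights expresses transversality: being far from
  the common support means being far from one of the two.\<close>

lemma asym_form_wedge: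
  assumes \<alpha>: "asym_form U 1 W1 w1 P1 s \<alpha>" and \<beta>: "asym_form U 1 W2 w2 P2 r \<beta>"
    and "U \<inter> P1 \<inter> P2 \<subseteq> P" "W \<subseteq> W1 \<inter> W2"
    and w: "\<And>x. 0 \<le> w1 x" "\<And>x. 0 \<le> w2 x" "\<And>x. 0 \<le> w x"
    and c: "c \<ge> 1" "\<And>x. x \<in> U \<Longrightarrow> w x \<le> c * (w1 x + w2 x)"
  shows "asym_form U 2 W w P (s + r) (wedge \<alpha> \<beta>)"
proof -
  note s\<alpha> = asym_form_smooth[OF \<alpha>] and s\<beta> = asym_form_smooth[OF \<beta>]
  note t\<alpha> = decay_tempered[OF U s\<alpha> asym_form_decay[OF \<alpha>] w(1)] and t\<beta> = decay_tempered[OF U s\<beta> asym_form_decay[OF \<beta>] w(2)]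
  have f: "formk U 2 (wedge \<alpha> \<beta>)" using \<alpha> \<beta> by (intro formk_wedge) (auto simp: asym_form_def)
  have n: "exp_small_at U (\<lambda>h x. \<alpha> h x I * \<beta> h x J) x" if "x \<in> U" "x \<notin> P" for x I J
  proof (cases "x \<in> P1")
    case True
    then show ?thesis
      using that assms(3) by (intro exp_small_at_mult'[OF U s\<alpha> s\<beta> asym_form_exp_small_at_off[OF \<beta>] t\<alpha>]) auto
  next
    case False
    then show ?thesis using that by (intro exp_small_at_mult[OF U s\<alpha> s\<beta> asym_form_exp_small_at_off[OF \<alpha>] t\<beta>])
  qed
  have 1: "exp_small_at U (\<lambda>h x. wedge \<alpha> \<beta> h x I) x" if "x \<in> U - P" for x I
    unfolding wedge_def wedge0_def mult.assoc
    using that by (intro exp_small_at_sum[OF U] smooth_cmult exp_small_at_cmult smooth_mult[OF U] s\<alpha> s\<beta> n) auto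
  have 2: "decay U w (s + r) (\<lambda>h x. wedge \<alpha> \<beta> h x I)" for I
    unfolding wedge_def wedge0_def mult.assoc
    by (intro decay_sum[OF U] smooth_cmult decay_cmult smooth_mult[OF U] s\<alpha> s\<beta> w
        decay_mult[OF U s\<alpha> s\<beta> asym_form_decay[OF \<alpha>] asym_form_decay[OF \<beta>] w c])
  have 3: "exp_small_at U (\<lambda>h x. iota0 v (wedge \<alpha> \<beta> h x) J) x" if v: "v \<in> W" and x: "x \<in> U" for v J x
  proof (cases "card J = 1")
    case True
    then obtain i where J: "J = {i}" by (metis card_1_singletonE)
    have "exp_small_at U (\<lambda>h x. iota0 v (\<alpha> h x) {} * \<beta> h x {i} + (-1) * (\<alpha> h x {i} * iota0 v (\<beta> h x) {})) x"
      using v x assms(4)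
      by (intro exp_small_at_add[OF U] exp_small_at_cmult smooth_cmult smooth_mult[OF U] s\<alpha> s\<beta> smooth_iota0
          exp_small_at_mult[OF U _ _ asym_form_exp_small_at_iota[OF \<alpha>] t\<beta>] exp_small_at_mult'[OF U _ _ asym_form_exp_small_at_iota[OF \<beta>] t\<alpha>]) auto
    then show ?thesis
    proof (subst exp_small_at_cong[OF U])
      fix h x assume hx: "0 < (h::real)" "x \<in> U"
      show "iota0 v (wedge \<alpha> \<beta> h x) J = iota0 v (\<alpha> h x) {} * \<beta> h x {i} + (-1) * (\<alpha> h x {i} * iota0 v (\<beta> h x) {})"
        unfolding J wedge_def by (subst iota0_wedge0) (use asym_form_card[OF \<alpha> hx] asym_form_card[OF \<beta> hx] in auto)
    qed
  next
    case False
    then have "iota0 v (wedge \<alpha> \<beta> h x) J = 0" if "0 < h" "x \<in> U" for h x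
      using f that by (intro iota0_eq_0[where k=1]) (auto simp: formk_iff)
    then show ?thesis
      by (subst exp_small_at_cong[OF U]) (auto intro: exp_small_at_zero[OF U x])
  qed
  show ?thesis unfolding asym_form_def using f 1 2 3 by blast
qed

text \<open>Modulo exponentially small terms both forms are multiples of the same covector N, and
  the wedge square of a covector vanishes.\<close>

lemma asym_form_wedge_parallel:
  assumes \<alpha>: "asym_form U 1 {v. N \<bullet> v = 0} w1 P1 s \<alpha>" and \<beta>: "asym_form U 1 {v. N \<bullet> v = 0} w2 P2 r \<beta>" and N: "N \<noteq> 0"
    and w: "\<And>x. 0 \<le> w1 x" "\<And>x. 0 \<le> w2 x" and x: "x \<in> U"
  shows "exp_small_at U (\<lambda>h x. wedge \<alpha> \<beta> h x I) x"
proof -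
  note s\<alpha> = asym_form_smooth[OF \<alpha>] and s\<beta> = asym_form_smooth[OF \<beta>]
  note t\<alpha> = decay_tempered[OF U s\<alpha> asym_form_decay[OF \<alpha>] w(1)] and t\<beta> = decay_tempered[OF U s\<beta> asym_form_decay[OF \<beta>] w(2)]
  have f: "formk U 2 (wedge \<alpha> \<beta>)" using \<alpha> \<beta> by (intro formk_wedge) (auto simp: asym_form_def)
  define v where "v = (1 / (N \<bullet> N)) *\<^sub>R N"
  have v: "N \<bullet> v = 1" using N by (simp add: v_def)
  define e where "e i = axis i 1 - (N $ i) *\<^sub>R v" for i
  have e: "e i \<in> {v. N \<bullet> v = 0}" for i
    by (simp add: e_def inner_diff_right v inner_axis)
  have dec: "a {i} = complex_of_real (N $ i) * iota0 v a {} + iota0 (e i) a {}" for a :: "'n cf" and i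
    unfolding e_def by (rule covector_split)
  show ?thesis
  proof (cases "card I = 2")
    case True
    then obtain k i where I: "I = {k, i}" "k \<noteq> i" by (auto simp: card_2_iff)
    let ?a = "\<lambda>h x. iota0 v (\<alpha> h x) {}" and ?b = "\<lambda>h x. iota0 v (\<beta> h x) {}"
    let ?ae = "\<lambda>k h x. iota0 (e k) (\<alpha> h x) {}" and ?be = "\<lambda>k h x. iota0 (e k) (\<beta> h x) {}"
    \<comment> \<open>In a_k b_i - a_i b_k the terms with N_k N_i cancel; every remaining term
      contains a contraction with a vector \<open>e k\<close> or \<open>e i\<close> of the
      hyperplane.\<close>
    have eq: "wedge \<alpha> \<beta> h x I = xsgn {k} {i} * (complex_of_real (N $ k) * (?be i h x * ?a h x) + (- complex_of_real (N $ i)) * (?be k h x * ?a h x)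
       + (?ae k h x * \<beta> h x {i} + (-1) * (?ae i h x * \<beta> h x {k})))" if hx: "0 < h" "x \<in> U" for h x
      unfolding I wedge_def
      by (subst wedge0_doubleton[OF _ _ I(2)])
        (use asym_form_card[OF \<alpha> hx] asym_form_card[OF \<beta> hx] dec[of "\<alpha> h x"] dec[of "\<beta> h x"] in \<open>auto simp: algebra_simps\<close>)
    have "exp_small_at U (\<lambda>h x. xsgn {k} {i} * (complex_of_real (N $ k) * (?be i h x * ?a h x) + (- complex_of_real (N $ i)) * (?be k h x * ?a h x)
       + (?ae k h x * \<beta> h x {i} + (-1) * (?ae i h x * \<beta> h x {k})))) x"
      by (intro exp_small_at_add[OF U] exp_small_at_cmult smooth_cmult smooth_mult[OF U] smooth_add[OF U] s\<alpha> s\<beta> smooth_iota0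
          exp_small_at_mult[OF U _ _ asym_form_exp_small_at_iota[OF \<alpha> x e] t\<beta>]
          exp_small_at_mult[OF U _ _ asym_form_exp_small_at_iota[OF \<beta> x e] decay_iota0[OF s\<alpha> t\<alpha>]]) auto
    then show ?thesis by (subst exp_small_at_cong[OF U eq])
  next
    case False
    then have "wedge \<alpha> \<beta> h x I = 0" if "0 < h" "x \<in> U" for h x
      using f that by (auto simp: formk_iff)
    then show ?thesis
      by (subst exp_small_at_cong[OF U]) (auto intro: exp_small_at_zero[OF U x])
  qed
qed

lemma pd_iota0:
  assumes "\<And>I. smooth U (\<lambda>h x. \<alpha> h x I)" "0 < h" "x \<in> U"
  shows "pd k (\<lambda>y. iota0 v (\<alpha> h y) J) x = iota0 v (\<lambda>I. pd k (\<lambda>y. \<alpha> h y I) x) J"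
proof -
  have "((\<lambda>y. \<alpha> h y I) has_derivative frechet_derivative (\<lambda>y. \<alpha> h y I) (at x)) (at x)" for I
    using smooth_differentiable[OF U assms(1) assms(2,3)] by (simp add: frechet_derivative_works)
  then have "((\<lambda>y. iota0 v (\<alpha> h y) J) has_derivative (\<lambda>u. iota0 v (\<lambda>I. frechet_derivative (\<lambda>y. \<alpha> h y I) (at x) u) J)) (at x)"
    unfolding iota0_def by (intro has_derivative_sum has_derivative_mult_right)
  from fun_cong[OF frechet_derivative_at[OF this], of "axis k 1"]
  show ?thesis by (simp add: pd_def)
qed

text \<open>The tangent directions are constant vectors, so contraction commutes with the
  derivatives (\<open>pd_iota0\<close>) and the support data survive unchanged.\<close>

lemma asym_form_nabla:
  assumes g: "hessian_metric g" and \<beta>: "asym_form U 1 W w P s \<beta>" and w: "\<And>x. 0 \<le> w x"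
  shows "asym_form U 1 W w P (s - 1) (nabla (dvec g n) \<beta>)"
proof -
  define c where "c k x = complex_of_real (1 / (4 * pi)) * (\<Sum>j\<in>UNIV. complex_of_real (real_of_int (n $ j)) * complex_of_real (g x $ j $ k))" for k x
  have c: "smooth U (\<lambda>h. c k)" for k
    unfolding c_def using g
    by (intro smooth_cmult smooth_sum[OF U] smooth_of_real[OF U]) (auto simp: hessian_metric_def)
  have eq: "nabla (dvec g n) \<beta> h x I = (\<Sum>k\<in>UNIV. complex_of_real h * (c k x * pd k (\<lambda>y. \<beta> h y I) x))" for h x I
    by (simp add: nabla_def dvec_def c_def mult.assoc)
  note s = asym_form_smooth[OF \<beta>]
  have p: "smooth U (\<lambda>h x. pd k (\<lambda>y. \<beta> h y I) x)" for k I
    using smooth_pd[OF U s[of I]] .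
  note sm = smooth_sum[OF U] smooth_mult[OF U smooth_h[OF U]] smooth_mult[OF U c] p
  have negI: "exp_small_at U (\<lambda>h x. \<Sum>k\<in>UNIV. complex_of_real h * (c k x * F k h x)) x"
    if "x \<in> U" "\<And>k. smooth U (F k)" "\<And>k. exp_small_at U (F k) x" for F x
    by (rule exp_small_at_sum[OF U])
      (auto intro!: that sm exp_small_at_mult'[OF U smooth_h[OF U] _ _ decay_h[OF U]] exp_small_at_mult'[OF U c _ _ decay_const_h[OF U c]])
  \<comment> \<open>Order bookkeeping: -2 from h, 0 from the metric coefficient, s + 1 from the
    derivative.\<close>
  have e: "decay U w (-2 + (0 + (s + 1))) (\<lambda>h x. complex_of_real h * (c k x * pd k (\<lambda>y. \<beta> h y I) x))" for k I
    by (rule decay_mult[OF U smooth_h[OF U] smooth_mult[OF U c p] decay_h[OF U]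
          decay_mult[OF U c p decay_const_h[OF U c] decay_pd[OF U asym_form_decay[OF \<beta>]], where c=1 and w''=w], where c=1])
      (use w in auto)
  have i: "iota0 v (nabla (dvec g n) \<beta> h x) J = (\<Sum>k\<in>UNIV. complex_of_real h * (c k x * pd k (\<lambda>y. iota0 v (\<beta> h y) J) x))"
    if "0 < h" "x \<in> U" for v J h x
    unfolding pd_iota0[OF s that] unfolding eq iota0_def sum_distrib_left
    by (subst sum.swap) (simp add: algebra_simps)
  show ?thesis
    unfolding asym_form_def formk_iff
  proof (intro conjI allI ballI impI)
    show "smooth U (\<lambda>h x. nabla (dvec g n) \<beta> h x I)" for I
      unfolding eq by (intro sm)
    show "nabla (dvec g n) \<beta> h x I = 0" if "h > 0" "x \<in> U" "card I \<noteq> 1" for h x I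
    proof -
      have "pd k (\<lambda>y. \<beta> h y I) x = pd k (\<lambda>y. 0) x" for k
        by (rule pd_cong[OF U _ that(2)]) (use asym_form_card[OF \<beta>] that in auto)
      then show ?thesis by (simp add: eq pd_const)
    qed
    show "exp_small_at U (\<lambda>h x. nabla (dvec g n) \<beta> h x I) x" if "x \<in> U - P" for x I
      unfolding eq using that by (intro negI exp_small_at_pd[OF U] p asym_form_exp_small_at_off[OF \<beta>]) auto
    show "exp_small_at U (\<lambda>h x. iota0 v (nabla (dvec g n) \<beta> h x) J) x" if "v \<in> W" "x \<in> U" for v J x
      by (subst exp_small_at_cong[OF U i], assumption+)
        (intro negI exp_small_at_pd[OF U] smooth_pd[OF U] smooth_iota0 s that asym_form_exp_small_at_iota[OF \<beta>])
    show "decay U w (s - 1) (\<lambda>h x. nabla (dvec g n) \<beta> h x I)" for I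
      unfolding eq using e by (intro decay_sum[OF U] sm) simp
  qed
qed

end

subsection \<open>The geometry of two walls\<close>

lemma rvec_add: "rvec (a + b) = rvec a + rvec b"
  and rvec_smult: "rvec (k *s a) = real_of_int k *\<^sub>R rvec a"
  by (simp_all add: rvec_def vec_eq_iff)

lemma rvec_0 [simp]: "rvec 0 = 0"
  by (simp add: rvec_def vec_eq_iff)

lemma rvec_eq_0_iff: "rvec a = 0 \<longleftrightarrow> a = 0"
  by (simp add: rvec_def vec_eq_iff)

lemma pairing_inner: "real_of_int (pairing a b) = rvec a \<bullet> rvec b"
  by (simp add: pairing_def rvec_def inner_vec_def)

lemma gV_add_left: "gV G (a + b) c = gV G a c + gV G b c"
  and gV_add_right: "gV G c (a + b) = gV G c a + gV G c b"
  and gV_scale_left: "gV G (r *\<^sub>R a) c = r * gV G a c"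
  and gV_scale_right: "gV G c (r *\<^sub>R a) = r * gV G c a"
  and gV_diff_left: "gV G (a - b) c = gV G a c - gV G b c"
  and gV_diff_right: "gV G c (a - b) = gV G c a - gV G c b"
  by (simp_all add: gV_def inner_add_left inner_add_right matrix_vector_right_distrib
      inner_diff_left inner_diff_right matrix_vector_mult_diff_distrib matrix_vector_mult_scaleR)

lemmas gV_bilinear = gV_add_left gV_add_right gV_scale_left gV_scale_right gV_diff_left gV_diff_right

lemma gV_sym:
  assumes "\<forall>i j. G $ i $ j = G $ j $ i" shows "gV G a b = gV G b a"
proof -
  have "transpose G = G" using assms by (simp add: transpose_def vec_eq_iff)
  then show ?thesis
    unfolding gV_def by (metis dot_lmul_matrix inner_commute transpose_matrix_vector)
qed

section \<open>Line integrals: substitution and the Lorentzian bound\<close>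

lemma oint_eq:
  assumes "continuous_on (closed_segment 0 u) f"
  shows "oint 0 u f = complex_of_real u * integral {0..1} (\<lambda>r. f (r * u))"
proof -
  consider "u = 0" | "u > 0" | "u < 0" by linarith
  then show ?thesis
  proof cases
    case 2
    have "continuous_on {0..u} f" using assms 2 by (simp add: closed_segment_eq_real_ivl)
    then have "f integrable_on cbox 0 u" by (simp add: integrable_continuous_interval)
    from has_integral_affinity[OF integrable_integral[OF this], of u 0]
    have "((\<lambda>x. f (u * x)) has_integral (1 / u) *\<^sub>R integral {0..u} f) ((\<lambda>x. x / u) ` {0..u})"
      using 2 by simp
    moreover have "(\<lambda>x. x / u) ` {0..u} = {0..1}"
      using 2 by (auto simp: image_iff field_simps intro!: bexI[of _ "u * x" for x])
    ultimately have "integral {0..1} (\<lambda>r. f (r * u)) = (1 / u) *\<^sub>R integral {0..u} f"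
      by (simp add: integral_unique mult.commute)
    then show ?thesis using 2 by (simp add: oint_def scaleR_conv_of_real)
  next
    case 3
    have "continuous_on {u..0} f" using assms 3 by (simp add: closed_segment_eq_real_ivl)
    then have "f integrable_on cbox u 0" by (simp add: integrable_continuous_interval)
    from has_integral_affinity[OF integrable_integral[OF this], of u 0]
    have "((\<lambda>x. f (u * x)) has_integral (- 1 / u) *\<^sub>R integral {u..0} f) ((\<lambda>x. x / u) ` {u..0})"
      using 3 by simp
    moreover have "(\<lambda>x. x / u) ` {u..0} = {0..1}"
      using 3 by (auto simp: image_iff field_simps mult_nonneg_nonpos intro!: bexI[of _ "u * x" for x])
    ultimately have "integral {0..1} (\<lambda>r. f (r * u)) = (- 1 / u) *\<^sub>R integral {u..0} f"
      by (simp add: integral_unique mult.commute)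
    then show ?thesis using 3 by (simp add: oint_def scaleR_conv_of_real)
  qed (simp add: oint_def)
qed

text \<open>The point is uniformity in u, the signed length of the line. If u is at most half of
  \<kappa>, the line ends before it comes near the peak and the integrand is O(h). Otherwise the
  primitive is an arctan, whose variation is at most \<pi>, with prefactor sqrt h / u < 2 sqrt h /
  \<kappa>.\<close>

lemma lorentzian_integral:
  fixes h \<kappa> u :: real
  assumes "0 < h" "h < 1" "0 < \<kappa>"
  shows "integral {0..1} (\<lambda>r. h / (h + (\<kappa> - r * u)\<^sup>2)) \<le> (4 / \<kappa>\<^sup>2 + 2 * pi / \<kappa>) * sqrt h"
proof -
  have pos: "0 < h + (\<kappa> - r * u)\<^sup>2" for r using assms(1) by (simp add: add_pos_nonneg)
  then have "continuous_on {0..1} (\<lambda>r. h / (h + (\<kappa> - r * u)\<^sup>2))"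
    by (intro continuous_intros) (metis less_irrefl)
  then have int: "(\<lambda>r. h / (h + (\<kappa> - r * u)\<^sup>2)) integrable_on {0..1}"
    by (rule integrable_continuous_interval)
  have sq: "h \<le> sqrt h"
    using assms by (metis less_eq_real_def mult_left_le real_sqrt_le_1_iff real_sqrt_ge_zero real_sqrt_mult_self abs_of_pos)
  show ?thesis
  proof (cases "u \<le> \<kappa> / 2")
    case True
    have "integral {0..1} (\<lambda>r. h / (h + (\<kappa> - r * u)\<^sup>2)) \<le> integral {0..1::real} (\<lambda>r. (4 / \<kappa>\<^sup>2) * h)"
    proof (rule integral_le[OF int])
      fix r :: real assume r: "r \<in> {0..1}"
      have "r * u \<le> \<kappa> / 2"
      proof (cases "u \<le> 0")
        case True
        then show ?thesis using r assms(3) by (smt (verit) atLeastAtMost_iff half_gt_zero mult_nonneg_nonpos)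
      next
        case False
        then show ?thesis using r \<open>u \<le> \<kappa> / 2\<close> by (smt (verit) atLeastAtMost_iff mult_left_le_one_le)
      qed
      then have "(\<kappa> / 2)\<^sup>2 \<le> (\<kappa> - r * u)\<^sup>2"
        using assms(3) by (intro power_mono) auto
      then have "\<kappa>\<^sup>2 / 4 \<le> h + (\<kappa> - r * u)\<^sup>2" using assms(1) by (simp add: power_divide)
      then have "h / (h + (\<kappa> - r * u)\<^sup>2) \<le> h / (\<kappa>\<^sup>2 / 4)"
        using assms by (intro divide_left_mono mult_pos_pos pos) auto
      then show "h / (h + (\<kappa> - r * u)\<^sup>2) \<le> (4 / \<kappa>\<^sup>2) * h" by (simp add: mult.commute)
    qed auto
    also have "\<dots> = (4 / \<kappa>\<^sup>2) * h" by simp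
    also have "\<dots> \<le> (4 / \<kappa>\<^sup>2) * sqrt h" using sq by (intro mult_left_mono) auto
    also have "\<dots> \<le> (4 / \<kappa>\<^sup>2 + 2 * pi / \<kappa>) * sqrt h"
      using assms by (intro mult_right_mono) auto
    finally show ?thesis .
  next
    case False
    then have u: "u > 0" "\<kappa> / 2 < u" using assms(3) by auto
    define F where "F r = (sqrt h / u) * arctan ((r * u - \<kappa>) / sqrt h)" for r
    have "((\<lambda>r. h / (h + (\<kappa> - r * u)\<^sup>2)) has_integral (F 1 - F 0)) {0..1}"
    proof (rule fundamental_theorem_of_calculus)
      fix r :: real assume "r \<in> {0..1}"
      have "(F has_field_derivative (sqrt h / u) * ((u / sqrt h) * inverse (1 + ((r * u - \<kappa>) / sqrt h)\<^sup>2))) (at r)"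
      proof -
        have "((\<lambda>r. (r * u - \<kappa>) / sqrt h) has_field_derivative u / sqrt h) (at r)"
          by (rule DERIV_cdivide) (auto intro!: derivative_eq_intros)
        from DERIV_cmult[OF DERIV_chain2[OF DERIV_arctan this], of "sqrt h / u"]
        show ?thesis unfolding F_def[abs_def] by (simp only: mult.commute[of "u / sqrt h"])
      qed
      moreover have "(sqrt h / u) * ((u / sqrt h) * inverse (1 + ((r * u - \<kappa>) / sqrt h)\<^sup>2)) = h / (h + (\<kappa> - r * u)\<^sup>2)"
      proof -
        have "inverse (1 + ((r * u - \<kappa>) / sqrt h)\<^sup>2) = h / (h + (\<kappa> - r * u)\<^sup>2)"
          using assms(1) pos[of r] by (simp add: power_divide power2_commute[of \<kappa>] field_simps)
        then show ?thesis using u assms(1) by simp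
      qed
      ultimately show "(F has_vector_derivative h / (h + (\<kappa> - r * u)\<^sup>2)) (at r within {0..1})"
        by (auto simp: has_real_derivative_iff_has_vector_derivative intro: has_vector_derivative_at_within)
    qed simp
    then have "integral {0..1} (\<lambda>r. h / (h + (\<kappa> - r * u)\<^sup>2)) = F 1 - F 0" by (rule integral_unique)
    also have "\<dots> = (sqrt h / u) * (arctan ((u - \<kappa>) / sqrt h) - arctan (- \<kappa> / sqrt h))"
      by (simp add: F_def algebra_simps)
    also have "\<dots> \<le> (sqrt h / u) * pi"
      using arctan_ubound[of "(u - \<kappa>) / sqrt h"] arctan_lbound[of "- \<kappa> / sqrt h"] u assms(1)
      by (intro mult_left_mono) auto
    also have "\<dots> \<le> (sqrt h / (\<kappa> / 2)) * pi"
      using u assms by (intro mult_right_mono divide_left_mono) auto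
    also have "\<dots> \<le> (4 / \<kappa>\<^sup>2 + 2 * pi / \<kappa>) * sqrt h"
      using assms by (simp add: algebra_simps)
    finally show ?thesis .
  qed
qed

section \<open>The plane M_R / L, its modes and their covectors\<close>

locale two_walls =
  fixes G :: "((real,'n::{finite,linorder}) vec,'n) vec" and x0 q0 :: "'n rn" and L U :: "'n rn set"
    and m1 m2 n1 n2 :: "(int,'n) vec" and R :: real
  assumes L: "subspace L" "dim L + 2 = CARD('n)"
    and m12: "\<forall>\<alpha> \<beta>. \<alpha> *\<^sub>R rvec m1 + \<beta> *\<^sub>R rvec m2 \<in> L \<longrightarrow> \<alpha> = 0 \<and> \<beta> = 0"
    and n1: "\<forall>l\<in>L. l \<bullet> rvec n1 = 0" "pairing m1 n1 = 0" "pairing (- m2) n1 < 0"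
    and n2: "\<forall>l\<in>L. l \<bullet> rvec n2 = 0" "pairing m2 n2 = 0" "pairing m1 n2 < 0"
    and G: "\<forall>i j. G $ i $ j = G $ j $ i" "\<forall>v. v \<noteq> 0 \<longrightarrow> gV G v v > 0"
           "gV G (rvec m1) (rvec m2) = 0"
           "\<forall>l\<in>L. gV G l (rvec m1) = 0 \<and> gV G l (rvec m2) = 0"
    and x0: "\<exists>s1 s2. s1 > 0 \<and> s2 > 0 \<and> x0 = q0 + s1 *\<^sub>R rvec m1 + s2 *\<^sub>R rvec m2"
    and U_eq: "U = {y. gV G (y - x0) (y - x0) < R\<^sup>2}"
    and q0U: "q0 \<in> U"
begin

lemma gV_nonneg: "0 \<le> gV G v v"
  using G(2) by (cases "v = 0") (auto simp: gV_def less_imp_le)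

lemma open_U: "open U"
  unfolding U_eq gV_def matrix_vector_mult_def
  by (intro open_Collect_less continuous_intros)

lemma convex_U: "convex U"
  unfolding convex_def
proof (intro ballI allI impI)
  fix x y and u v :: real
  assume xy: "x \<in> U" "y \<in> U" and uv: "0 \<le> u" "0 \<le> v" "u + v = 1"
  define a b where "a = x - x0" and "b = y - x0"
  have v: "v = 1 - u" using uv by simp
  have e: "u *\<^sub>R x + v *\<^sub>R y - x0 = u *\<^sub>R a + v *\<^sub>R b"
    by (simp add: a_def b_def v algebra_simps)
  \<comment> \<open>The convexity defect of a quadratic form is u v times its value at a -
    b.\<close>
  have "u * gV G a a + v * gV G b b - gV G (u *\<^sub>R a + v *\<^sub>R b) (u *\<^sub>R a + v *\<^sub>R b) = u * v * gV G (a - b) (a - b)"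
    using gV_sym[OF G(1), of a b] by (simp add: gV_bilinear v algebra_simps)
  then have "gV G (u *\<^sub>R a + v *\<^sub>R b) (u *\<^sub>R a + v *\<^sub>R b) \<le> u * gV G a a + v * gV G b b"
    using uv gV_nonneg[of "a - b"] by (metis diff_ge_0_iff_ge mult_nonneg_nonneg)
  also have "\<dots> < R\<^sup>2"
    using xy uv unfolding U_eq a_def b_def by (intro convex_bound_lt) auto
  finally show "u *\<^sub>R x + v *\<^sub>R y \<in> U" unfolding U_eq using e by simp
qed

text \<open>\<open>t1\<close>, \<open>t2\<close> are the coordinates on \<open>M\<^sub>R / L\<close> dual to \<open>m1\<close>, \<open>m2\<close>.\<close>

definition d1 :: int where "d1 = pairing m2 n1"
definition d2 :: int where "d2 = - pairing m1 n2"

lemma d_pos: "d1 > 0" "d2 > 0"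
  using n1(3) n2(3) by (auto simp: d1_def d2_def pairing_def sum_negf)

definition t1 :: "'n rn \<Rightarrow> real" where "t1 z = - (z \<bullet> rvec n2) / d2"
definition t2 :: "'n rn \<Rightarrow> real" where "t2 z = (z \<bullet> rvec n1) / d1"

lemma linear_t: "linear t1" "linear t2"
  unfolding t1_def t2_def by (auto intro!: linearI simp: inner_add_left add_divide_distrib)

lemma t_L: "l \<in> L \<Longrightarrow> t1 l = 0" "l \<in> L \<Longrightarrow> t2 l = 0"
  using n1 n2 by (auto simp: t1_def t2_def)

lemma t_m: "t1 (rvec m1) = 1" "t1 (rvec m2) = 0" "t2 (rvec m1) = 0" "t2 (rvec m2) = 1"
proof -
  have "real_of_int d2 = - (rvec m1 \<bullet> rvec n2)" "real_of_int d1 = rvec m2 \<bullet> rvec n1"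
    by (simp_all add: d1_def d2_def pairing_inner)
  then show "t1 (rvec m1) = 1" "t2 (rvec m2) = 1"
    using d_pos unfolding t1_def t2_def by auto
  show "t1 (rvec m2) = 0" "t2 (rvec m1) = 0"
    using n1(2) n2(2) pairing_inner[of m1 n1] pairing_inner[of m2 n2] by (simp_all add: t1_def t2_def)
qed

text \<open>By the dimension hypothesis L, m1 and m2 span the whole space; applying the dual
  coordinates t1 and t2, which vanish on L, identifies the two coefficients.\<close>

lemma decomp: "z - t1 z *\<^sub>R rvec m1 - t2 z *\<^sub>R rvec m2 \<in> L"
proof -
  have sL: "span L = L" using L(1) by (simp add: span_eq_iff)
  have 2: "rvec m2 \<notin> span L" unfolding sL using m12[rule_format, of 0 1] by auto
  have 1: "rvec m1 \<notin> span (insert (rvec m2) L)"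
  proof
    assume "rvec m1 \<in> span (insert (rvec m2) L)"
    then obtain k where "rvec m1 - k *\<^sub>R rvec m2 \<in> L" unfolding span_insert sL by auto
    then show False using m12[rule_format, of 1 "- k"] by simp
  qed
  have "dim (insert (rvec m1) (insert (rvec m2) L)) = dim L + 2"
    using 1 2 by (simp add: dim_insert)
  then have "span (insert (rvec m1) (insert (rvec m2) L)) = UNIV"
    using L(2) dim_eq_full by (metis DIM_cart DIM_real mult.right_neutral)
  then have "z \<in> span (insert (rvec m1) (insert (rvec m2) L))" by simp
  then obtain k1 k2 where k: "z - k1 *\<^sub>R rvec m1 - k2 *\<^sub>R rvec m2 \<in> L"
    unfolding span_insert[of "rvec m1"] span_insert[of "rvec m2"] sL by auto
  have "t1 (z - k1 *\<^sub>R rvec m1 - k2 *\<^sub>R rvec m2) = 0" "t2 (z - k1 *\<^sub>R rvec m1 - k2 *\<^sub>R rvec m2) = 0"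
    using k t_L by auto
  then have "t1 z = k1" "t2 z = k2"
    by (simp_all add: linear_diff[OF linear_t(1)] linear_diff[OF linear_t(2)]
       linear_scale[OF linear_t(1)] linear_scale[OF linear_t(2)] t_m)
  then show ?thesis using k by simp
qed

definition mode :: "nat \<Rightarrow> nat \<Rightarrow> (int,'n) vec" where
  "mode p q = int p *s m1 + int q *s m2"

text \<open>An integral covector annihilating \<open>L\<close> and \<open>mode p q\<close>.  It need not be primitive, but it is
  additive in \<open>(p, q)\<close>, which makes the directions in the bracket match.\<close>

definition N :: "nat \<Rightarrow> nat \<Rightarrow> (int,'n) vec" where
  "N p q = (int p * d2) *s n1 + (int q * d1) *s n2"

definition W1 :: "nat \<Rightarrow> nat \<Rightarrow> 'n rn set" where "W1 p q = {v. rvec (N p q) \<bullet> v = 0}"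
definition w1 :: "nat \<Rightarrow> nat \<Rightarrow> 'n rn \<Rightarrow> real" where "w1 p q x = \<bar>rvec (N p q) \<bullet> (x - q0)\<bar>"
text \<open>The two walls (\<open>p = 0\<close> or \<open>q = 0\<close>) extend to both sides of \<open>Q\<close>, all other supports only behind it.\<close>

definition P1 :: "nat \<Rightarrow> nat \<Rightarrow> 'n rn set" where
  "P1 p q = {x\<in>U. rvec (N p q) \<bullet> (x - q0) = 0 \<and> (0 < p \<and> 0 < q \<longrightarrow> t1 (x - q0) \<le> 0)}"
definition wQ :: "'n rn \<Rightarrow> real" where "wQ x = \<bar>t1 (x - q0)\<bar> + \<bar>t2 (x - q0)\<bar>"
definition PQ :: "'n rn set" where "PQ = {x. t1 (x - q0) = 0 \<and> t2 (x - q0) = 0}"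

abbreviation A :: "real \<Rightarrow> nat \<Rightarrow> nat \<Rightarrow> 'n form \<Rightarrow> bool" where
  "A s p q \<equiv> asym_form U 1 (W1 p q) (w1 p q) (P1 p q) s"
abbreviation BQ :: "real \<Rightarrow> 'n form \<Rightarrow> bool" where
  "BQ s \<equiv> asym_form U 2 L wQ PQ s"

lemma rvec_mode: "rvec (mode p q) = real p *\<^sub>R rvec m1 + real q *\<^sub>R rvec m2"
  by (simp add: mode_def rvec_add rvec_smult)

lemma t_mode: "t1 (rvec (mode p q)) = real p" "t2 (rvec (mode p q)) = real q"
  unfolding rvec_mode
  by (simp_all add: linear_add[OF linear_t(1)] linear_add[OF linear_t(2)]
       linear_scale[OF linear_t(1)] linear_scale[OF linear_t(2)] t_m)

lemma mode_eq_iff: "mode p q = mode p' q' \<longleftrightarrow> p = p' \<and> q = q'"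
  using t_mode[of p q] t_mode[of p' q'] by auto

lemma mode_add: "mode p q + mode p' q' = mode (p + p') (q + q')"
  by (simp add: mode_def vector_sadd_rdistrib algebra_simps)

lemma mode_eq_0_iff: "mode p q = 0 \<longleftrightarrow> p = 0 \<and> q = 0"
  using mode_eq_iff[of p q 0 0] by (simp add: mode_def)

text \<open>Up to the factor d1 * d2 this is the determinant of (p, q) and (t1 z, t2 z). Questions
  about supports and transversality thereby become questions about 2 x 2 determinants.\<close>

lemma N_inner: "rvec (N p q) \<bullet> z = d1 * d2 * (p * t2 z - q * t1 z)"
proof -
  have "rvec n1 \<bullet> z = d1 * t2 z" "rvec n2 \<bullet> z = - (d2 * t1 z)"
    using d_pos by (simp_all add: t1_def t2_def inner_commute)
  then show ?thesis
    by (simp add: N_def rvec_add rvec_smult inner_add_left algebra_simps)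
qed

lemma N_add: "N p q + N p' q' = N (p + p') (q + q')"
  by (simp add: N_def vector_sadd_rdistrib algebra_simps)

lemma N_neq_0: "(p, q) \<noteq> (0, 0) \<Longrightarrow> N p q \<noteq> 0"
proof
  assume pq: "(p, q) \<noteq> (0, 0)" and "N p q = 0"
  then have "rvec (N p q) \<bullet> z = 0" for z by (simp add: rvec_eq_0_iff)
  then have "p * t2 z - q * t1 z = 0" for z using d_pos unfolding N_inner by auto
  from this[of "rvec m1"] this[of "rvec m2"] show False using pq by (simp add: t_m)
qed

text \<open>A vanishing determinant makes (t1 v, t2 v) proportional to (p, q), and
  \<open>decomp\<close> supplies the rest. The kernel of N is thus L plus the line of the mode,
  which is how tangent contractions are split in \<open>A_H\<close>.\<close>

lemma W1_decomp:
  assumes nz: "(p, q) \<noteq> (0, 0)" and v: "v \<in> W1 p q"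
  shows "\<exists>t. v - t *\<^sub>R rvec (mode p q) \<in> L"
proof -
  have e: "p * t2 v = q * t1 v" using v d_pos by (simp add: W1_def N_inner)
  obtain t :: real where t: "t1 v = t * p" "t2 v = t * q"
  proof (cases "p = 0")
    case True
    then show ?thesis using nz e that[of "t2 v / q"] by auto
  next
    case False
    then show ?thesis using e that[of "t1 v / p"] by (auto simp: field_simps)
  qed
  have "v - t *\<^sub>R rvec (mode p q) \<in> L"
    using decomp[of v] unfolding t rvec_mode by (simp add: algebra_simps)
  then show ?thesis ..
qed

text \<open>The value changes sign when the two pairs are exchanged. In (m', N) N' - (m, N') N both
  covectors therefore receive the same coefficient, and the bracket of directions becomes a multiple
  of N + N'.\<close>

lemma pairing_mode_N: "pairing (mode p' q') (N p q) = d1 * d2 * (int p * int q' - int q * int p')"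
proof -
  have "real_of_int (pairing (mode p' q') (N p q)) = real_of_int (d1 * d2 * (int p * int q' - int q * int p'))"
    by (simp add: pairing_inner inner_commute[of "rvec (mode p' q')"] N_inner t_mode)
  then show ?thesis by (simp only: of_int_eq_iff)
qed

lemma w_nonneg: "0 \<le> w1 p q x" "0 \<le> wQ x"
  by (simp_all add: w1_def wQ_def)

lemma continuous_w: "continuous_on S (w1 p q)" "continuous_on S wQ"
  unfolding w1_def wQ_def t1_def t2_def by (intro continuous_intros; use d_pos in simp)+

lemma A_wedge:
  assumes \<alpha>: "A s p q \<alpha>" and \<beta>: "A r p' q' \<beta>" and nz: "(p, q) \<noteq> (0, 0)" "(p', q') \<noteq> (0, 0)"
  shows "BQ (s + r) (wedge \<alpha> \<beta>)"
proof (cases "int p * int q' - int p' * int q = 0")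
  case False
  \<comment> \<open>\<open>D\<close> is the determinant of the two modes. Cramer's rule
    (\<open>e1\<close>, \<open>e2\<close>) recovers t1 and t2, hence the distance to Q, from the two
    covectors; being a nonzero integer, D has absolute value at least 1, which gives the
    constant.\<close>
  define D where "D = int p * int q' - int p' * int q"
  have D: "D \<noteq> 0" "1 \<le> \<bar>D\<bar>" using False by (auto simp: D_def)
  have e1: "real p' * (rvec (N p q) \<bullet> z) - real p * (rvec (N p' q') \<bullet> z) = d1 * d2 * D * t1 z" for z
    by (simp add: N_inner D_def algebra_simps)
  have e2: "real q' * (rvec (N p q) \<bullet> z) - real q * (rvec (N p' q') \<bullet> z) = d1 * d2 * D * t2 z" for z
    by (simp add: N_inner D_def algebra_simps)
  have pos: "1 \<le> \<bar>d1 * d2 * D\<bar>" using d_pos D by (simp add: abs_mult) (smt (verit) mult_less_cancel_left1 zero_less_mult_iff)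
  show ?thesis
  proof (rule asym_form_wedge[OF open_U \<alpha> \<beta>])
    show "U \<inter> P1 p q \<inter> P1 p' q' \<subseteq> PQ"
    proof
      fix x assume "x \<in> U \<inter> P1 p q \<inter> P1 p' q'"
      then have "d1 * d2 * D * t1 (x - q0) = 0" "d1 * d2 * D * t2 (x - q0) = 0"
        using e1[of "x - q0"] e2[of "x - q0"] by (auto simp: P1_def)
      then show "x \<in> PQ" using d_pos D by (auto simp: PQ_def)
    qed
    show "L \<subseteq> W1 p q \<inter> W1 p' q'" by (auto simp: W1_def N_inner t_L)
    show "1 \<le> real (p + q + p' + q')" using nz by (auto simp: Suc_le_eq)
    fix x
    have "1 * wQ x \<le> \<bar>d1 * d2 * D\<bar> * wQ x"
      using pos by (intro mult_right_mono w_nonneg) linarith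
    also have "\<dots> = \<bar>d1 * d2 * D * t1 (x - q0)\<bar> + \<bar>d1 * d2 * D * t2 (x - q0)\<bar>"
      by (simp add: wQ_def abs_mult algebra_simps)
    also have "\<dots> \<le> (real p' * w1 p q x + real p * w1 p' q' x) + (real q' * w1 p q x + real q * w1 p' q' x)"
      unfolding e1[symmetric] e2[symmetric] w1_def
      by (intro add_mono order_trans[OF abs_triangle_ineq4]) (auto simp: abs_mult)
    also have "\<dots> \<le> real (p + q + p' + q') * (w1 p q x + w1 p' q' x)"
      using w_nonneg(1)[of p q x] w_nonneg(1)[of p' q' x] by (simp add: algebra_simps)
    finally show "wQ x \<le> real (p + q + p' + q') * (w1 p q x + w1 p' q' x)" by simp
  qed (auto simp: w_nonneg)
next
  case True
  \<comment> \<open>Proportional modes, such as (1, 1) and (2, 2), share the kernel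
    \<open>W1\<close>, and this is what the parallel case asks for.\<close>
  then have eq: "p * q' = p' * q" by (metis eq_iff_diff_eq_0 of_nat_eq_iff of_nat_mult)
  have *: "a' * t = b' * s" if "a * b' = a' * b" "(a, b) \<noteq> (0, 0)" "a * t = b * s" for a b a' b' s t :: real
  proof (cases "a = 0")
    case True
    then show ?thesis using that by auto
  next
    case False
    have "a * (a' * t) = a * (b' * s)" using that by (metis mult.assoc mult.commute)
    then show ?thesis using False by simp
  qed
  have eqr: "real p * real q' = real p' * real q" using eq by (metis of_nat_mult)
  have "W1 p' q' = W1 p q"
  proof -
    have "real p * t2 v = real q * t1 v \<longleftrightarrow> real p' * t2 v = real q' * t1 v" for v
      using *[of "real p" "real q'" "real p'" "real q" "t2 v" "t1 v"]
        *[of "real p'" "real q" "real p" "real q'" "t2 v" "t1 v"] eqr nz by auto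
    then show ?thesis using d_pos by (auto simp: W1_def N_inner)
  qed
  then have \<beta>': "asym_form U 1 (W1 p q) (w1 p' q') (P1 p' q') r \<beta>" using \<beta> by simp
  have "rvec (N p q) \<noteq> 0" using N_neq_0[OF nz(1)] by (simp add: rvec_eq_0_iff)
  then have "exp_small_at U (\<lambda>h x. wedge \<alpha> \<beta> h x I) x" if "x \<in> U" for x I
    by (rule asym_form_wedge_parallel[OF open_U \<alpha>[unfolded W1_def] \<beta>'[unfolded W1_def] _ w_nonneg(1) w_nonneg(1) that])
  then show ?thesis
    using \<alpha> \<beta> by (intro asym_form_exp_small_at open_U formk_wedge continuous_w w_nonneg) (auto simp: asym_form_def)
qed

end

subsection \<open>The homotopy operator\<close>

lemma one_div_le:
  fixes X Y c :: real
  assumes "X \<le> c * Y" "0 < X" "0 < Y" shows "1 / Y \<le> c / X"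
  using assms by (simp add: field_simps)

lemma wedge0_one0: "wedge0 a one0 K = a K"
proof -
  have "wedge0 a one0 K = (\<Sum>I\<in>{K}. xsgn I (K - I) * a I * one0 (K - I))"
    unfolding wedge0_def by (rule sum.mono_neutral_right) (auto simp: one0_def)
  then show ?thesis by (simp add: one0_def)
qed

lemma pull0_1form:
  fixes c :: "'n::{finite,linorder} cf"
  assumes "\<And>J. card J \<noteq> 1 \<Longrightarrow> c J = 0"
  shows "pull0 M c K = (\<Sum>j\<in>UNIV. c {j} * pull1 M j K)"
proof -
  let ?F = "\<lambda>J. c J * foldr wedge0 (map (pull1 M) (sorted_list_of_set J)) one0 K"
  have "pull0 M c K = sum ?F (range (\<lambda>j. {j}))"
    unfolding pull0_def
  proof (rule sum.mono_neutral_right)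
    show "\<forall>J\<in>UNIV - range (\<lambda>j. {j}). ?F J = 0"
    proof
      fix J assume "J \<in> UNIV - range (\<lambda>j::'n. {j})"
      then have "card J \<noteq> 1" by (auto simp: card_1_singleton_iff)
      then show "?F J = 0" using assms by simp
    qed
  qed auto
  also have "\<dots> = (\<Sum>j\<in>UNIV. ?F {j})"
    by (subst sum.reindex) (auto simp: inj_on_def)
  finally show ?thesis by (simp add: wedge0_one0)
qed

lemma aff_integral_cmult: "aff_integral (\<lambda>r. c * q r) B x0 f h x = c * aff_integral q B x0 f h x"
  by (simp add: aff_integral_def mult.assoc)

lemma smooth_affine:
  assumes "open U" "\<And>x. F x = f x + c" "bounded_linear (f :: 'n::{finite,linorder} rn \<Rightarrow> real)"
  shows "smooth U (\<lambda>h x. complex_of_real (F x))"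
  unfolding assms(2) of_real_add
  by (intro smooth_add smooth_linear smooth_const assms)

text \<open>Successive contractions of a 2-form anticommute. With u = v this kills the double
  contraction along m in \<open>A_H\<close>.\<close>

lemma iota0_antisym:
  fixes a :: "'n::{finite,linorder} cf"
  shows "(\<Sum>i\<in>UNIV. complex_of_real (v $ i) * iota0 u a {i}) = - (\<Sum>i\<in>UNIV. complex_of_real (u $ i) * iota0 v a {i})"
proof -
  define F where "F i k = (if k = i then 0 else xsgn {k} {i} * a {k, i})" for i k
  have F: "F i k = - F k i" for i k
    by (auto simp: F_def xsgn_singleton insert_commute)
  have *: "iota0 u a {i} = (\<Sum>k\<in>UNIV. complex_of_real (u $ k) * F i k)" for u i
    unfolding iota0_def by (rule sum.mono_neutral_cong_left) (auto simp: F_def)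
  have "(\<Sum>i\<in>UNIV. complex_of_real (v $ i) * iota0 u a {i}) = (\<Sum>k\<in>UNIV. \<Sum>i\<in>UNIV. complex_of_real (v $ i) * (complex_of_real (u $ k) * F i k))"
    unfolding * sum_distrib_left by (rule sum.swap)
  also have "\<dots> = - (\<Sum>k\<in>UNIV. complex_of_real (u $ k) * iota0 v a {k})"
    unfolding * sum_distrib_left sum_negf[symmetric]
    by (intro sum.cong refl) (subst F, simp)
  finally show ?thesis .
qed

lemma iota0_add: "iota0 (u + v) a J = iota0 u a J + iota0 v a J"
  and iota0_scale: "iota0 (c *\<^sub>R u) a J = complex_of_real c * iota0 u a J"
  by (simp_all add: iota0_def algebra_simps sum.distrib sum_distrib_left sum_negf)

context two_walls
begin

context
  fixes p q :: nat and m :: "(int,'n) vec"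
  assumes pq: "(p, q) \<noteq> (0, 0)" and m: "m = mode p q"
begin

lemma m_nz: "m \<noteq> 0"
  using pq unfolding m mode_eq_0_iff by auto

lemma Hdir_m: "Hdir m = rvec m"
  using m_nz by (simp add: Hdir_def)

lemma gmm: "gV G (rvec m) (rvec m) > 0"
  using G(2) m_nz by (simp add: rvec_eq_0_iff)

lemma Hproj_apply: "Hproj G m *v z = z - (gV G z (rvec m) / gV G (rvec m) (rvec m)) *\<^sub>R rvec m"
proof -
  have "(Hproj G m *v z) $ i = z $ i - (gV G z (rvec m) / gV G (rvec m) (rvec m)) * rvec m $ i" for i
  proof -
    have "(Hproj G m *v z) $ i = (\<Sum>j\<in>UNIV. (if i = j then z $ j else 0)
         - rvec m $ i / gV G (rvec m) (rvec m) * (z $ j * (G *v rvec m) $ j))"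
      unfolding matrix_vector_mult_def Hproj_def Hdir_m
      by (auto intro!: sum.cong simp: algebra_simps)
    also have "\<dots> = z $ i - rvec m $ i / gV G (rvec m) (rvec m) * gV G z (rvec m)"
      by (simp add: sum_subtractf sum_distrib_left sum_divide_distrib gV_def[of G z] inner_vec_def)
    finally show ?thesis by simp
  qed
  then show ?thesis by (simp add: vec_eq_iff)
qed

abbreviation up :: "'n rn \<Rightarrow> 'n rn" where "up \<equiv> Huperp G x0 m"
abbreviation u1 :: "'n rn \<Rightarrow> real" where "u1 \<equiv> Hu1 G x0 m"

lemma up_eq: "up x = Hproj G m *v (x - x0)"
  by (simp add: Huperp_def Hproj_apply Hu1_def Hdir_m)

lemma x_eq: "x = x0 + up x - u1 x *\<^sub>R rvec m"
  by (simp add: Huperp_def Hdir_m)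

lemma gV_up: "gV G (up x) (rvec m) = 0" "gV G (rvec m) (up x) = 0"
proof -
  show "gV G (up x) (rvec m) = 0"
    using gmm by (simp add: up_eq Hproj_apply gV_bilinear)
  then show "gV G (rvec m) (up x) = 0" by (simp add: gV_sym[OF G(1)])
qed

text \<open>The two paths of the homotopy operator: \<open>aff B1 x0 r x\<close> runs from x0 to the
  foot \<open>x0 + up x\<close> of x on the hyperplane through x0, and \<open>aff B2 x0 r x\<close>
  from that foot to x along the direction of m.\<close>

definition B1 :: "real \<Rightarrow> ((real,'n) vec,'n) vec" where "B1 r = r *\<^sub>R Hproj G m"
definition B2 :: "real \<Rightarrow> ((real,'n) vec,'n) vec" where "B2 r = Hproj G m + r *\<^sub>R (mat 1 - Hproj G m)"

lemma aff_B1: "aff B1 x0 r x = x0 + r *\<^sub>R up x"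
  by (simp add: aff_def B1_def up_eq scaleR_matrix_vector_assoc)

lemma aff_B2: "aff B2 x0 r x = x0 + up x - (r * u1 x) *\<^sub>R rvec m"
proof -
  have "(mat 1 - Hproj G m) *v (x - x0) = - (u1 x *\<^sub>R rvec m)"
    unfolding matrix_vector_mult_diff_rdistrib matrix_vector_mul_lid up_eq[symmetric]
    by (simp add: Huperp_def Hdir_m)
  then show ?thesis
    by (simp add: aff_def B2_def matrix_vector_mult_add_rdistrib up_eq[symmetric] scaleR_matrix_vector_assoc[symmetric])
qed

lemma aff_B2': "aff B2 x0 r x = x + ((1 - r) * u1 x) *\<^sub>R rvec m"
  by (subst (2) x_eq[of x]) (simp add: aff_B2 algebra_simps)

lemma cont_B: "continuous_on S B1" "continuous_on S B2"
  unfolding B1_def B2_def by (intro continuous_intros)+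

text \<open>Pythagoras for g_V: \<open>up x\<close> and m are orthogonal, so shrinking either
  component of x - x0 keeps the point in the ball. Both paths therefore stay in U.\<close>

lemma up_in_U:
  assumes "x \<in> U" "\<bar>a\<bar> \<le> 1" "\<bar>b\<bar> \<le> \<bar>u1 x\<bar>"
  shows "x0 + a *\<^sub>R up x - b *\<^sub>R rvec m \<in> U"
proof -
  have "gV G (a *\<^sub>R up x - b *\<^sub>R rvec m) (a *\<^sub>R up x - b *\<^sub>R rvec m) = a\<^sup>2 * gV G (up x) (up x) + b\<^sup>2 * gV G (rvec m) (rvec m)"
    by (simp add: gV_bilinear gV_up power2_eq_square)
  also have "\<dots> \<le> 1 * gV G (up x) (up x) + (u1 x)\<^sup>2 * gV G (rvec m) (rvec m)"
    using assms by (intro add_mono mult_right_mono gV_nonneg) (auto simp: abs_le_square_iff[symmetric] abs_square_le_1)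
  also have "\<dots> = gV G (up x - u1 x *\<^sub>R rvec m) (up x - u1 x *\<^sub>R rvec m)"
    by (simp add: gV_bilinear gV_up power2_eq_square)
  also have "\<dots> = gV G (x - x0) (x - x0)" by (subst (5 6) x_eq) simp
  also have "\<dots> < R\<^sup>2" using assms(1) by (simp add: U_eq)
  finally show ?thesis by (simp add: U_eq add_diff_eq[symmetric])
qed

lemma maps_B1: "r \<in> {0..1} \<Longrightarrow> x \<in> U \<Longrightarrow> aff B1 x0 r x \<in> U"
  unfolding aff_B1 using up_in_U[of x r 0] by simp

lemma maps_B2: "r \<in> {0..1} \<Longrightarrow> x \<in> U \<Longrightarrow> aff B2 x0 r x \<in> U"
  unfolding aff_B2 using up_in_U[of x 1 "r * u1 x"] by (simp add: abs_mult mult_left_le_one_le)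

lemmas IB1 = open_U convex_U cont_B(1) maps_B1
lemmas IB2 = open_U convex_U cont_B(2) maps_B2

text \<open>The hyperplane term carries the factor r because contracting a 2-form leaves a 1-form,
  pulled back along the dilation by r. The line term becomes an integral over [0, 1] by the
  substitution s = r u1, which moves the dependence of the limit on x into a factor.\<close>

lemma Hm_singleton:
  assumes \<gamma>: "formk U 2 \<gamma>" and h: "h > 0" and x: "x \<in> U"
  shows "Hm G x0 m \<gamma> h x {i} =
     (\<Sum>j\<in>UNIV. (\<Sum>k\<in>- {j}. xsgn {k} {j} * (complex_of_real (up x $ k) * aff_integral complex_of_real B1 x0 (\<lambda>h x. \<gamma> h x {k, j}) h x))
          * complex_of_real (Hproj G m $ j $ i))
     + complex_of_real (u1 x) * aff_integral (\<lambda>_. 1) B2 x0 (\<lambda>h x. iota0 (- rvec m) (\<gamma> h x) {i}) h x"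
    (is "_ = ?T + ?S")
  and Hm_eq_0: "card J \<noteq> 1 \<Longrightarrow> Hm G x0 m \<gamma> h x J = 0"
proof -
  have sm: "smooth U (\<lambda>h x. \<gamma> h x I)" for I using \<gamma> by (simp add: formk_iff)
  have c0: "\<gamma> h y I = 0" if "y \<in> U" "card I \<noteq> Suc 1" for y I using \<gamma> h that by (simp add: formk_iff)
  define c where "c J' = integral {0..1} (\<lambda>r. complex_of_real (r ^ card J') * iota0 (up x) (\<gamma> h (x0 + r *\<^sub>R up x)) J')" for J'
  have cJ: "c J' = 0" if "card J' \<noteq> 1" for J'
  proof -
    have "iota0 (up x) (\<gamma> h (x0 + r *\<^sub>R up x)) J' = 0" if r: "r \<in> {0..1}" for r
      using c0[OF maps_B1[OF r x]] \<open>card J' \<noteq> 1\<close> unfolding aff_B1 by (rule iota0_eq_0)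
    then show ?thesis unfolding c_def by (intro integral_unique has_integral_is_0) auto
  qed
  have cj: "c {j} = (\<Sum>k\<in>- {j}. xsgn {k} {j} * (complex_of_real (up x $ k) * aff_integral complex_of_real B1 x0 (\<lambda>h x. \<gamma> h x {k, j}) h x))" for j
  proof -
    have "c {j} = integral {0..1} (\<lambda>r. \<Sum>k\<in>- {j}. (xsgn {k} {j} * complex_of_real (up x $ k) * complex_of_real r) * \<gamma> h (aff B1 x0 r x) {k, j})"
      unfolding c_def iota0_def aff_B1 by (simp add: sum_distrib_left algebra_simps)
    also have "\<dots> = (\<Sum>k\<in>- {j}. aff_integral (\<lambda>r. xsgn {k} {j} * complex_of_real (up x $ k) * complex_of_real r) B1 x0 (\<lambda>h x. \<gamma> h x {k, j}) h x)"
      by (rule aff_integral_linear_sum[OF IB1, symmetric]) (auto intro!: sm h x continuous_intros)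
    finally show ?thesis by (simp add: aff_integral_cmult mult.assoc)
  qed
  have cont: "continuous_on (closed_segment 0 (u1 x)) (\<lambda>s. iota0 (- rvec m) (\<gamma> h (x0 + up x - s *\<^sub>R rvec m)) J)" for J
  proof -
    have "x0 + up x - s *\<^sub>R rvec m \<in> U" if s: "s \<in> closed_segment 0 (u1 x)" for s
    proof -
      obtain r where "s = r * u1 x" "0 \<le> r" "r \<le> 1" using s by (auto simp: in_segment)
      then show ?thesis using maps_B2[of r x] x by (simp add: aff_B2)
    qed
    then have "continuous_on (closed_segment 0 (u1 x)) (\<lambda>s. (\<lambda>y. iota0 (- rvec m) (\<gamma> h y) J) (x0 + up x - s *\<^sub>R rvec m))"
      by (intro continuous_on_compose2[OF smooth_continuous_on_x[OF open_U smooth_iota0[OF open_U sm] h]] continuous_intros) auto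
    then show ?thesis .
  qed
  have o: "oint 0 (u1 x) (\<lambda>s. iota0 (- rvec m) (\<gamma> h (x0 + up x - s *\<^sub>R rvec m)) J)
     = complex_of_real (u1 x) * aff_integral (\<lambda>_. 1) B2 x0 (\<lambda>h x. iota0 (- rvec m) (\<gamma> h x) J) h x" for J
    unfolding oint_eq[OF cont] aff_integral_def aff_B2 by simp
  have H: "Hm G x0 m \<gamma> h x J = (\<Sum>j\<in>UNIV. c {j} * pull1 (Hproj G m) j J)
     + complex_of_real (u1 x) * aff_integral (\<lambda>_. 1) B2 x0 (\<lambda>h x. iota0 (- rvec m) (\<gamma> h x) J) h x" for J
    unfolding Hm_def Hdir_m o c_def[symmetric] using pull0_1form[of c "Hproj G m" J, OF cJ] by simp
  show "Hm G x0 m \<gamma> h x {i} = ?T + ?S"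
    unfolding H cj pull1_def by simp
  show "Hm G x0 m \<gamma> h x J = 0" if J: "card J \<noteq> 1"
  proof -
    have "iota0 (- rvec m) (\<gamma> h (aff B2 x0 r x)) J = 0" if r: "r \<in> {0..1}" for r
      using c0[OF maps_B2[OF r x]] J by (rule iota0_eq_0)
    then have "aff_integral (\<lambda>_. 1) B2 x0 (\<lambda>h x. iota0 (- rvec m) (\<gamma> h x) J) h x = 0"
      unfolding aff_integral_def by (intro integral_unique has_integral_is_0) auto
    then show ?thesis unfolding H using J by (simp add: pull1_def)
  qed
qed

text \<open>The coordinate \<open>u1\<close> of q0; since L is g_V-orthogonal to m, it is the
  coordinate of every point of Q.\<close>

definition kap :: real where "kap = gV G (x0 - q0) (rvec m) / gV G (rvec m) (rvec m)"

lemma gV_decomp: "gV G z (rvec m) = p * t1 z * gV G (rvec m1) (rvec m1) + q * t2 z * gV G (rvec m2) (rvec m2)"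
proof -
  define l where "l = z - t1 z *\<^sub>R rvec m1 - t2 z *\<^sub>R rvec m2"
  have z: "z = l + t1 z *\<^sub>R rvec m1 + t2 z *\<^sub>R rvec m2" by (simp add: l_def)
  have "l \<in> L" using decomp by (simp add: l_def)
  then have "gV G l (rvec m1) = 0" "gV G l (rvec m2) = 0" using G(4) by auto
  moreover have "gV G (rvec m2) (rvec m1) = 0" using G(3) gV_sym[OF G(1)] by simp
  ultimately show ?thesis
    by (subst z) (simp add: m rvec_mode gV_bilinear G(3) algebra_simps)
qed

lemma gmi: "gV G (rvec m1) (rvec m1) > 0" "gV G (rvec m2) (rvec m2) > 0"
proof -
  have "rvec m1 \<noteq> 0" "rvec m2 \<noteq> 0"
    using t_m linear_0[OF linear_t(1)] linear_0[OF linear_t(2)] by auto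
  then show "gV G (rvec m1) (rvec m1) > 0" "gV G (rvec m2) (rvec m2) > 0" using G(2) by auto
qed

text \<open>By orthogonality of m1 and m2 the numerator is p s1 |m1|^2 + q s2 |m2|^2. This is where
  the position of x0 in the open cone over q0 enters: Q lies strictly on the side u1 > 0 of the
  hyperplane through x0.\<close>

lemma kap_pos: "kap > 0"
proof -
  obtain s1 s2 where s: "s1 > 0" "s2 > 0" "x0 - q0 = s1 *\<^sub>R rvec m1 + s2 *\<^sub>R rvec m2"
    using x0 by auto
  have "t1 (x0 - q0) = s1" "t2 (x0 - q0) = s2"
    unfolding s(3) by (simp_all add: linear_add[OF linear_t(1)] linear_add[OF linear_t(2)]
       linear_scale[OF linear_t(1)] linear_scale[OF linear_t(2)] t_m)
  then have "gV G (x0 - q0) (rvec m) = p * s1 * gV G (rvec m1) (rvec m1) + q * s2 * gV G (rvec m2) (rvec m2)"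
    by (simp add: gV_decomp)
  also have "\<dots> > 0"
  proof -
    have nonneg_on: "0 \<le> p * s1 * gV G (rvec m1) (rvec m1)" "0 \<le> q * s2 * gV G (rvec m2) (rvec m2)"
      using s gmi by (simp_all add: less_imp_le)
    consider "p > 0" | "q > 0" using pq by auto
    then show ?thesis
    proof cases
      case 1
      then have "0 < p * s1 * gV G (rvec m1) (rvec m1)" using s gmi by simp
      then show ?thesis using nonneg_on by linarith
    next
      case 2
      then have "0 < q * s2 * gV G (rvec m2) (rvec m2)" using s gmi by simp
      then show ?thesis using nonneg_on by linarith
    qed
  qed
  finally show ?thesis unfolding kap_def using gmm by simp
qed

lemma gV_aff:
  "gV G (aff B1 x0 r x - q0) (rvec m) = kap * gV G (rvec m) (rvec m)"
  "gV G (aff B2 x0 r x - q0) (rvec m) = (kap - r * u1 x) * gV G (rvec m) (rvec m)"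
  using gmm gV_up[of x] by (simp_all add: aff_B1 aff_B2 gV_bilinear kap_def field_simps)

lemma PQ_gV: "y \<in> PQ \<Longrightarrow> gV G (y - q0) (rvec m) = 0"
  by (simp add: PQ_def gV_decomp)

text \<open>The path has u1 = 0 throughout, whereas u1 = kap > 0 on Q. Consequently, for a form
  concentrated on Q, the hyperplane term of the homotopy operator is exponentially small
  everywhere.\<close>

lemma B1_not_PQ: "aff B1 x0 r x \<notin> PQ"
  using PQ_gV[of "aff B1 x0 r x"] gV_aff(1) kap_pos gmm by auto

lemma t_aff_B2:
  "t1 (aff B2 x0 r x - q0) = t1 (x - q0) + (1 - r) * u1 x * p"
  "t2 (aff B2 x0 r x - q0) = t2 (x - q0) + (1 - r) * u1 x * q"
proof -
  have e: "aff B2 x0 r x - q0 = (x - q0) + ((1 - r) * u1 x) *\<^sub>R rvec m" by (simp add: aff_B2')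
  have tm: "t1 (rvec m) = p" "t2 (rvec m) = q" by (simp_all add: m t_mode)
  show "t1 (aff B2 x0 r x - q0) = t1 (x - q0) + (1 - r) * u1 x * p"
    "t2 (aff B2 x0 r x - q0) = t2 (x - q0) + (1 - r) * u1 x * q"
    unfolding e linear_add[OF linear_t(1)] linear_add[OF linear_t(2)]
      linear_scale[OF linear_t(1)] linear_scale[OF linear_t(2)] tm by simp_all
qed

lemma w1_aff_B2: "rvec (N p q) \<bullet> (aff B2 x0 r x - q0) = rvec (N p q) \<bullet> (x - q0)"
  unfolding N_inner t_aff_B2 by (simp add: algebra_simps)

text \<open>A path that reaches Q at the parameter r satisfies kap = r u1, which forces u1 > 0. Then
  x = y - (1 - r) u1 m with y in Q and a nonnegative coefficient, so x lies behind Q and belongs to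
  the support.\<close>

lemma B2_not_PQ:
  assumes "x \<in> U" "x \<notin> P1 p q" "r \<in> {0..1}"
  shows "aff B2 x0 r x \<notin> PQ"
proof
  assume Q: "aff B2 x0 r x \<in> PQ"
  then have "kap = r * u1 x"
    using PQ_gV[OF Q] gV_aff(2)[of r x] gmm by auto
  then have "u1 x > 0" using kap_pos assms(3) by (metis atLeastAtMost_iff mult_nonneg_nonpos not_le)
  then have "0 \<le> (1 - r) * u1 x * p" using assms(3) by auto
  moreover have "t1 (x - q0) + (1 - r) * u1 x * p = 0" using Q by (simp add: PQ_def t_aff_B2[symmetric])
  ultimately have "t1 (x - q0) \<le> 0" by linarith
  moreover have "rvec (N p q) \<bullet> (aff B2 x0 r x - q0) = 0"
    using Q by (simp add: N_inner PQ_def)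
  then have "rvec (N p q) \<bullet> (x - q0) = 0" by (simp only: w1_aff_B2)
  ultimately show False using assms by (simp add: P1_def)
qed

text \<open>Two transversal coordinates are extracted from \<open>wQ\<close>: one varies along the
  line in direction m and will be integrated, the other is constant along the line and survives as
  the weight of the result.\<close>

lemma weight_le:
  "\<exists>C\<ge>1. (\<forall>y. \<bar>gV G (y - q0) (rvec m)\<bar> / gV G (rvec m) (rvec m) \<le> C * wQ y) \<and> (\<forall>y. w1 p q y \<le> C * wQ y)"
proof -
  define C1 where "C1 = (p * gV G (rvec m1) (rvec m1) + q * gV G (rvec m2) (rvec m2)) / gV G (rvec m) (rvec m)"
  define C2 where "C2 = real_of_int (d1 * d2) * (p + q)"
  have dd: "real_of_int (d1 * d2) > 0" using d_pos by simp
  have le1: "\<bar>gV G (y - q0) (rvec m)\<bar> / gV G (rvec m) (rvec m) \<le> C1 * wQ y" for y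
  proof -
    have "\<bar>gV G (y - q0) (rvec m)\<bar> \<le> p * gV G (rvec m1) (rvec m1) * \<bar>t1 (y - q0)\<bar> + q * gV G (rvec m2) (rvec m2) * \<bar>t2 (y - q0)\<bar>"
      unfolding gV_decomp using gmi by (intro order_trans[OF abs_triangle_ineq]) (simp add: abs_mult mult_ac)
    also have "\<dots> \<le> (p * gV G (rvec m1) (rvec m1) + q * gV G (rvec m2) (rvec m2)) * wQ y"
      using gmi by (simp add: wQ_def algebra_simps)
    finally show ?thesis using gmm unfolding C1_def by (simp add: divide_right_mono)
  qed
  have le2: "w1 p q y \<le> C2 * wQ y" for y
  proof -
    have "w1 p q y = real_of_int (d1 * d2) * \<bar>p * t2 (y - q0) - q * t1 (y - q0)\<bar>"
      using dd unfolding w1_def N_inner abs_mult by simp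
    also have "\<dots> \<le> real_of_int (d1 * d2) * ((p + q) * wQ y)"
    proof (intro mult_left_mono)
      have "\<bar>p * t2 (y - q0) - q * t1 (y - q0)\<bar> \<le> p * \<bar>t2 (y - q0)\<bar> + q * \<bar>t1 (y - q0)\<bar>"
        by (intro order_trans[OF abs_triangle_ineq4]) (simp add: abs_mult)
      also have "\<dots> \<le> (p + q) * wQ y" by (simp add: wQ_def algebra_simps)
      finally show "\<bar>p * t2 (y - q0) - q * t1 (y - q0)\<bar> \<le> (p + q) * wQ y" .
    qed (use dd in auto)
    finally show ?thesis by (simp add: C2_def)
  qed
  show ?thesis
  proof (intro exI[of _ "max 1 (max C1 C2)"] conjI allI)
    show "\<bar>gV G (y - q0) (rvec m)\<bar> / gV G (rvec m) (rvec m) \<le> max 1 (max C1 C2) * wQ y" for y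
      by (rule order_trans[OF le1]) (intro mult_right_mono w_nonneg, auto)
    show "w1 p q y \<le> max 1 (max C1 C2) * wQ y" for y
      by (rule order_trans[OF le2]) (intro mult_right_mono w_nonneg, auto)
  qed auto
qed

text \<open>Integrating across \<open>Q\<close> in the direction of \<open>m\<close> gains a factor \<open>sqrt h\<close>.\<close>

lemma decay_weight_integral:
  assumes "K \<subseteq> U"
  shows "\<exists>C. \<forall>\<^sub>F h in at_right 0. \<forall>x\<in>K. \<exists>I. ((\<lambda>r. decay_weight wQ s (\<beta> + 2) j h (aff B2 x0 r x)) has_integral I) {0..1}
     \<and> I \<le> C * decay_weight (w1 p q) (s - 1) \<beta> j h x"
proof -
  obtain C where C: "C \<ge> 1" "\<And>y. \<bar>gV G (y - q0) (rvec m)\<bar> / gV G (rvec m) (rvec m) \<le> C * wQ y"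
    "\<And>y. w1 p q y \<le> C * wQ y" using weight_le by metis
  define C3 where "C3 = 4 / kap\<^sup>2 + 2 * pi / kap"
  have "\<forall>\<^sub>F h in at_right 0. \<forall>x\<in>K. \<exists>I. ((\<lambda>r. decay_weight wQ s (\<beta> + 2) j h (aff B2 x0 r x)) has_integral I) {0..1}
     \<and> I \<le> C ^ (\<beta> + 2) * C3 * decay_weight (w1 p q) (s - 1) \<beta> j h x"
    using eventually_h01
  proof (eventually_elim, intro ballI)
    fix h x assume h: "(0::real) < h \<and> h < 1" and x: "x \<in> K"
    define E where "E = h powr (- (real j + s) / 2)"
    define W where "W = (1 + w1 p q x / sqrt h) ^ \<beta>"
    have W: "W > 0" unfolding W_def using h w_nonneg(1)[of p q x] by (intro zero_less_power add_pos_nonneg) auto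
    have E: "E \<ge> 0" by (simp add: E_def)
    let ?f = "\<lambda>r. decay_weight wQ s (\<beta> + 2) j h (aff B2 x0 r x)"
    have pw: "1 + wQ y / sqrt h > 0" for y
      using h w_nonneg(2)[of y] by (intro add_pos_nonneg) auto
    have "continuous_on {0..1} (\<lambda>r. wQ (aff B2 x0 r x))"
      by (rule continuous_on_compose2[OF continuous_w(2)[of UNIV]])
        (auto simp: aff_B2 intro!: continuous_intros)
    moreover have "1 + wQ y / sqrt h \<noteq> 0" for y using pw[of y] by linarith
    ultimately have "continuous_on {0..1} ?f"
      unfolding decay_weight_def using h by (intro continuous_intros) auto
    then have int: "?f integrable_on {0..1}" by (rule integrable_continuous_interval)
    \<comment> \<open>Of the \<beta> + 2 powers, \<beta> are converted into the weight of
      \<open>w1\<close>, which does not change along the line; the last two bound the distance to Q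
      along the line and give the Lorentzian.\<close>
    have pt: "?f r \<le> C ^ (\<beta> + 2) * E / W * (h / (h + (kap - r * u1 x)\<^sup>2))" if r: "r \<in> {0..1}" for r
    proof -
      define y where "y = aff B2 x0 r x"
      define b where "b = \<bar>kap - r * u1 x\<bar>"
      have b: "b \<le> C * wQ y"
        using C(2)[of y] gmm unfolding y_def gV_aff(2) b_def by (simp add: abs_mult)
      have a: "w1 p q x \<le> C * wQ y"
        using C(3)[of y] unfolding y_def w1_def w1_aff_B2 .
      have le: "1 + c / sqrt h \<le> C * (1 + wQ y / sqrt h)" if "c \<le> C * wQ y" for c
      proof -
        have "c / sqrt h \<le> C * wQ y / sqrt h" using that h by (intro divide_right_mono) auto
        then show ?thesis using C(1) by (simp add: distrib_left)
      qed
      have "W * (1 + b / sqrt h)\<^sup>2 \<le> (C * (1 + wQ y / sqrt h)) ^ \<beta> * (C * (1 + wQ y / sqrt h))\<^sup>2"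
        unfolding W_def using le[OF a] le[OF b] h w_nonneg(1)[of p q x] C(1) pw[of y]
        by (intro mult_mono power_mono) (auto simp: b_def intro!: add_nonneg_nonneg divide_nonneg_nonneg zero_le_power)
      also have "\<dots> = C ^ (\<beta> + 2) * (1 + wQ y / sqrt h) ^ (\<beta> + 2)"
        by (simp only: power_mult_distrib power_add mult_ac)
      finally have 1: "W * (1 + b / sqrt h)\<^sup>2 \<le> C ^ (\<beta> + 2) * (1 + wQ y / sqrt h) ^ (\<beta> + 2)" .
      have "(h + b\<^sup>2) / h \<le> (1 + b / sqrt h)\<^sup>2"
        using h by (simp add: power2_sum power_divide add_divide_distrib b_def)
      then have "W * ((h + b\<^sup>2) / h) \<le> C ^ (\<beta> + 2) * (1 + wQ y / sqrt h) ^ (\<beta> + 2)"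
        using 1 W by (meson mult_left_mono order_trans less_imp_le)
      moreover have "0 < W * ((h + b\<^sup>2) / h)" using W h by (intro mult_pos_pos divide_pos_pos add_pos_nonneg) auto
      moreover have "0 < (1 + wQ y / sqrt h) ^ (\<beta> + 2)" using pw by (rule zero_less_power)
      ultimately have "1 / (1 + wQ y / sqrt h) ^ (\<beta> + 2) \<le> C ^ (\<beta> + 2) / (W * ((h + b\<^sup>2) / h))"
        by (rule one_div_le)
      then have "E * (1 / (1 + wQ y / sqrt h) ^ (\<beta> + 2)) \<le> E * (C ^ (\<beta> + 2) / (W * ((h + b\<^sup>2) / h)))"
        by (rule mult_left_mono[OF _ E])
      then show ?thesis
        unfolding decay_weight_def E_def[symmetric] y_def[symmetric] b_def power2_abs using h by (simp add: mult_ac)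
    qed
    have "continuous_on {0..1} (\<lambda>r. h / (h + (kap - r * u1 x)\<^sup>2))"
    proof (intro continuous_intros ballI)
      fix r :: real
      have "h + (kap - r * u1 x)\<^sup>2 > 0" using h by (intro add_pos_nonneg) auto
      then show "h + (kap - r * u1 x)\<^sup>2 \<noteq> 0" by linarith
    qed
    then have "integral {0..1} ?f \<le> integral {0..1} (\<lambda>r. C ^ (\<beta> + 2) * E / W * (h / (h + (kap - r * u1 x)\<^sup>2)))"
      using pt by (intro integral_le int integrable_on_mult_right integrable_continuous_interval) auto
    also have "\<dots> = C ^ (\<beta> + 2) * E / W * integral {0..1} (\<lambda>r. (h / (h + (kap - r * u1 x)\<^sup>2)))"
      by (rule integral_mult_right)
    also have "\<dots> \<le> C ^ (\<beta> + 2) * E / W * (C3 * sqrt h)"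
      unfolding C3_def using h kap_pos C(1) E W
      by (intro mult_left_mono lorentzian_integral) auto
    also have "\<dots> = C ^ (\<beta> + 2) * C3 * (E * sqrt h / W)" by simp
    also have "E * sqrt h / W = decay_weight (w1 p q) (s - 1) \<beta> j h x"
    proof -
      \<comment> \<open>The factor sqrt h raises the exponent by 1/2, that is, it lowers s by
        one.\<close>
      have "E * sqrt h = h powr (- (real j + s) / 2 + 1 / 2)"
        unfolding E_def powr_add using h by (simp add: powr_half_sqrt)
      also have "- (real j + s) / 2 + 1 / 2 = - (real j + (s - 1)) / 2" by (simp add: field_simps)
      finally show ?thesis by (simp add: decay_weight_def W_def)
    qed
    finally show "\<exists>I. (?f has_integral I) {0..1} \<and> I \<le> C ^ (\<beta> + 2) * C3 * decay_weight (w1 p q) (s - 1) \<beta> j h x"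
      using int by (intro exI[of _ "integral {0..1} ?f"]) (simp add: integrable_integral)
  qed
  then show ?thesis by blast
qed

text \<open>The integrand decays with every exponent, so \<beta> + 2 may be requested of it in order
  to return \<beta>.\<close>

lemma decay_aff_integral_B2:
  assumes "smooth U f" "decay U wQ s f"
  shows "decay U (w1 p q) (s - 1) (aff_integral (\<lambda>_. 1) B2 x0 f)"
  unfolding decay_def
proof (intro allI impI)
  fix K \<beta> assume K: "compact K" "K \<subseteq> U"
  show "derivs_bounded K (decay_weight (w1 p q) (s - 1) \<beta>) (aff_integral (\<lambda>_. 1) B2 x0 f)"
  proof (rule derivs_bounded_aff_integral[OF IB2 K(2) assms(1)])
    show "derivs_bounded ((\<lambda>(r, x). aff B2 x0 r x) ` ({0..1} \<times> K)) (decay_weight wQ s (\<beta> + 2)) f"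
      using assms(2) compact_aff_image[OF IB2 K] by (auto simp: decay_def)
    show "\<exists>C. \<forall>\<^sub>F h in at_right 0. \<forall>x\<in>K. \<exists>I. ((\<lambda>r. decay_weight wQ s (\<beta> + 2) j h (aff B2 x0 r x)) has_integral I) {0..1}
       \<and> I \<le> C * decay_weight (w1 p q) (s - 1) \<beta> j h x" for j
      by (rule decay_weight_integral[OF K(2)])
  qed (auto intro: nonneg_on_decay_weight w_nonneg)
qed

text \<open>The hyperplane term \<open>T\<close> is exponentially small, so only the line term
  \<open>S\<close> has to be located and measured; its factor \<open>u1\<close> is affine in x and
  of order 0. For a tangent vector v = t m + l the part along m disappears by antisymmetry, and l in
  L leaves a contraction that is exponentially small by assumption.\<close>

lemma A_H:
  assumes \<gamma>: "BQ s \<gamma>"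
  shows "A (s - 1) p q (Hm G x0 m \<gamma>)"
proof -
  note sm = asym_form_smooth[OF \<gamma>]
  have f2: "formk U 2 \<gamma>" using \<gamma> by (simp add: asym_form_def)
  have up_s: "smooth U (\<lambda>h x. complex_of_real (up x $ k))" for k
    by (rule smooth_affine[OF open_U, of _ "\<lambda>x. (Hproj G m *v x) $ k" "- (Hproj G m *v x0) $ k"])
      (auto simp: up_eq matrix_vector_mult_diff_distrib
         intro!: bounded_linear_compose[OF bounded_linear_vec_nth matrix_vector_mul_bounded_linear])
  have u_s: "smooth U (\<lambda>h x. complex_of_real (u1 x))"
  proof (rule smooth_affine[OF open_U])
    show "u1 x = (- 1 / gV G (rvec m) (rvec m)) * (x \<bullet> (G *v rvec m)) + gV G x0 (rvec m) / gV G (rvec m) (rvec m)" for x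
      by (simp add: Hu1_def Hdir_m gV_diff_left gV_def[of G x] diff_divide_distrib)
    show "bounded_linear (\<lambda>x. (- 1 / gV G (rvec m) (rvec m)) * (x \<bullet> (G *v rvec m)))"
      by (intro bounded_linear_const_mult bounded_linear_inner_left)
  qed
  define T where "T i h x = (\<Sum>j\<in>UNIV. (\<Sum>k\<in>- {j}. xsgn {k} {j} * (complex_of_real (up x $ k) * aff_integral complex_of_real B1 x0 (\<lambda>h x. \<gamma> h x {k, j}) h x))
          * complex_of_real (Hproj G m $ j $ i))" for i h x
  define S where "S i = aff_integral (\<lambda>_. 1) B2 x0 (\<lambda>h x. iota0 (- rvec m) (\<gamma> h x) {i})" for i
  have cq: "continuous_on {0..1} complex_of_real" "continuous_on {0..1::real} (\<lambda>_. 1::complex)"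
    by (auto intro: continuous_intros)
  note I1s = smooth_aff_integral[OF IB1 sm cq(1)]
  have Ss: "smooth U (S i)" for i
    unfolding S_def by (intro smooth_aff_integral[OF IB2] smooth_iota0[OF open_U] sm cq)
  have uS: "smooth U (\<lambda>h x. complex_of_real (u1 x) * S i h x)" for i
    by (intro smooth_mult[OF open_U] u_s Ss)
  have Ts: "smooth U (T i)" for i
    unfolding T_def[abs_def]
    by (intro smooth_sum[OF open_U] smooth_mult[OF open_U] smooth_const[OF open_U] I1s up_s)
  have Tn: "exp_small_at U (T i) x" if x: "x \<in> U" for i x
  proof -
    have I: "exp_small_at U (aff_integral complex_of_real B1 x0 (\<lambda>h x. \<gamma> h x I)) x" for I
      by (intro exp_small_at_aff_integral[OF IB1] sm cq x asym_form_exp_small_at_off[OF \<gamma>] maps_B1 B1_not_PQ) auto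
    have "exp_small_at U (\<lambda>h x. \<Sum>j\<in>UNIV. complex_of_real (Hproj G m $ j $ i) * (\<Sum>k\<in>- {j}. xsgn {k} {j} * (complex_of_real (up x $ k) * aff_integral complex_of_real B1 x0 (\<lambda>h x. \<gamma> h x {k, j}) h x))) x"
      by (intro exp_small_at_sum[OF open_U x] exp_small_at_cmult[OF open_U] smooth_cmult[OF open_U] smooth_sum[OF open_U] smooth_mult[OF open_U] up_s I1s
          exp_small_at_mult'[OF open_U up_s I1s I decay_const_h[OF open_U up_s]])
    then show ?thesis unfolding T_def[abs_def] by (simp add: mult.commute)
  qed
  have Sn: "exp_small_at U (\<lambda>h x. complex_of_real (u1 x) * F h x) x" if "smooth U F" "exp_small_at U F x" for F x
    by (intro exp_small_at_mult'[OF open_U u_s _ _ decay_const_h[OF open_U u_s]] that)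
  have H: "Hm G x0 m \<gamma> h x {i} = T i h x + complex_of_real (u1 x) * S i h x" if "h > 0" "x \<in> U" for h x i
    unfolding T_def S_def by (rule Hm_singleton[OF f2 that])
  have H0: "Hm G x0 m \<gamma> h x J = 0" if "h > 0" "x \<in> U" "card J \<noteq> 1" for h x J
    using Hm_eq_0[OF f2 that] .
  show ?thesis
    unfolding asym_form_def formk_iff
  proof (intro conjI allI ballI impI)
    show "smooth U (\<lambda>h x. Hm G x0 m \<gamma> h x I)" for I
    proof (cases "card I = 1")
      case True
      then obtain i where I: "I = {i}" by (metis card_1_singletonE)
      show ?thesis unfolding I
        by (subst smooth_cong[OF open_U H], assumption+) (intro smooth_add[OF open_U] Ts uS)
    next
      case False
      then show ?thesis
        by (subst smooth_cong[OF open_U H0]) (auto intro: smooth_const[OF open_U])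
    qed
    show "Hm G x0 m \<gamma> h x I = 0" if "h > 0" "x \<in> U" "card I \<noteq> 1" for h x I
      using H0 that .
    show "exp_small_at U (\<lambda>h x. Hm G x0 m \<gamma> h x I) x" if x: "x \<in> U - P1 p q" for x I
    proof (cases "card I = 1")
      case True
      then obtain i where I: "I = {i}" by (metis card_1_singletonE)
      have Sx: "exp_small_at U (S i) x"
        unfolding S_def using x
        by (intro exp_small_at_aff_integral[OF IB2] smooth_iota0[OF open_U] sm cq exp_small_at_iota0[OF open_U] asym_form_exp_small_at_off[OF \<gamma>] maps_B2 B2_not_PQ) auto
      have "x \<in> U" using x by simp
      then show ?thesis unfolding I
        by (subst exp_small_at_cong[OF open_U H]) (assumption+, intro exp_small_at_add[OF open_U] Ts uS Tn Sn Ss Sx)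
    next
      case False
      then show ?thesis using x
        by (subst exp_small_at_cong[OF open_U H0]) (auto intro: exp_small_at_zero[OF open_U])
    qed
    show "decay U (w1 p q) (s - 1) (\<lambda>h x. Hm G x0 m \<gamma> h x I)" for I
    proof (cases "card I = 1")
      case True
      then obtain i where I: "I = {i}" by (metis card_1_singletonE)
      have "decay U (w1 p q) (s - 1) (S i)"
        unfolding S_def
        by (intro decay_aff_integral_B2 smooth_iota0[OF open_U] decay_iota0[OF open_U] sm asym_form_decay[OF \<gamma>] w_nonneg)
      then have "decay U (w1 p q) (0 + (s - 1)) (\<lambda>h x. complex_of_real (u1 x) * S i h x)"
        by (intro decay_mult[OF open_U u_s Ss decay_const_h[OF open_U u_s], where c=1]) (auto simp: w_nonneg)
      then have "decay U (w1 p q) (s - 1) (\<lambda>h x. complex_of_real (u1 x) * S i h x)" by simp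
      moreover have "decay U (w1 p q) (s - 1) (T i)"
        by (intro decay_exp_small_at[OF open_U] Tn continuous_w w_nonneg)
      ultimately have "decay U (w1 p q) (s - 1) (\<lambda>h x. T i h x + complex_of_real (u1 x) * S i h x)"
        by (intro decay_add[OF open_U] Ts uS)
      then show ?thesis unfolding I
        by (subst decay_cong[OF open_U H])
    next
      case False
      then show ?thesis
        by (subst decay_cong[OF open_U H0]) (auto intro!: decay_exp_small_at[OF open_U] exp_small_at_zero[OF open_U] continuous_w w_nonneg)
    qed
    show "exp_small_at U (\<lambda>h x. iota0 v (Hm G x0 m \<gamma> h x) J) x" if v: "v \<in> W1 p q" and x: "x \<in> U" for v J x
    proof (cases "J = {}")
      case True
      obtain t where l: "v - t *\<^sub>R rvec m \<in> L" using W1_decomp[OF pq v] unfolding m by blast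
      define l where "l = v - t *\<^sub>R rvec m"
      have l: "l \<in> L" using l by (simp add: l_def)
      \<comment> \<open>\<open>F\<close> contracts \<gamma> with l and with m. It is exponentially
        small on all of U, hence so is its integral along the line, even at points of the
        support.\<close>
      define F where "F h x = (\<Sum>i\<in>UNIV. complex_of_real (rvec m $ i) * iota0 l (\<gamma> h x) {i})" for h x
      have Fs: "smooth U F"
        unfolding F_def[abs_def] by (intro smooth_sum[OF open_U] smooth_cmult[OF open_U] smooth_iota0[OF open_U] sm)
      have Fn: "exp_small_at U F y" if "y \<in> U" for y
        unfolding F_def[abs_def]
        by (intro exp_small_at_sum[OF open_U] exp_small_at_cmult[OF open_U] smooth_cmult[OF open_U] smooth_iota0[OF open_U] sm that asym_form_exp_small_at_iota[OF \<gamma>] l)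
      have self: "(\<Sum>i\<in>UNIV. complex_of_real (u $ i) * iota0 u a {i}) = 0" for u and a :: "'n cf"
        using iota0_antisym[of u u a] by simp
      have F: "(\<Sum>i\<in>UNIV. complex_of_real (v $ i) * iota0 (- rvec m) (\<gamma> h y) {i}) = F h y" for h y
      proof -
        have "(\<Sum>i\<in>UNIV. complex_of_real (v $ i) * iota0 (- rvec m) (\<gamma> h y) {i})
          = (\<Sum>i\<in>UNIV. complex_of_real (rvec m $ i) * iota0 (t *\<^sub>R rvec m + l) (\<gamma> h y) {i})"
          unfolding iota0_antisym[of v] by (simp add: sum_negf l_def)
        also have "\<dots> = complex_of_real t * (\<Sum>i\<in>UNIV. complex_of_real (rvec m $ i) * iota0 (rvec m) (\<gamma> h y) {i}) + F h y"
          unfolding iota0_add iota0_scale F_def by (simp add: distrib_left sum.distrib sum_distrib_left algebra_simps)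
        finally show ?thesis by (simp add: self)
      qed
      have SF: "(\<Sum>i\<in>UNIV. complex_of_real (v $ i) * S i h y) = aff_integral (\<lambda>_. 1) B2 x0 F h y" if "h > 0" "y \<in> U" for h y
      proof -
        have "(\<Sum>i\<in>UNIV. complex_of_real (v $ i) * S i h y) = (\<Sum>i\<in>UNIV. aff_integral (\<lambda>r. complex_of_real (v $ i) * 1) B2 x0 (\<lambda>h x. iota0 (- rvec m) (\<gamma> h x) {i}) h y)"
          unfolding S_def aff_integral_cmult ..
        also have "\<dots> = integral {0..1} (\<lambda>r. \<Sum>i\<in>UNIV. (complex_of_real (v $ i) * 1) * iota0 (- rvec m) (\<gamma> h (aff B2 x0 r y)) {i})"
          by (rule aff_integral_linear_sum[OF IB2]) (auto intro!: smooth_iota0[OF open_U] sm that continuous_intros)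
        also have "\<dots> = aff_integral (\<lambda>_. 1) B2 x0 F h y"
          unfolding aff_integral_def by (simp add: F)
        finally show ?thesis .
      qed
      have eq: "iota0 v (Hm G x0 m \<gamma> h y) J = (\<Sum>i\<in>UNIV. complex_of_real (v $ i) * T i h y)
         + complex_of_real (u1 y) * aff_integral (\<lambda>_. 1) B2 x0 F h y" if "h > 0" "y \<in> U" for h y
        unfolding True iota0_empty H[OF that] SF[OF that, symmetric]
        by (simp add: distrib_left sum.distrib sum_distrib_left algebra_simps)
      have In: "exp_small_at U (aff_integral (\<lambda>_. 1) B2 x0 F) x"
        by (intro exp_small_at_aff_integral[OF IB2] Fs Fn x cq maps_B2)
      show ?thesis
        by (subst exp_small_at_cong[OF open_U eq]) (assumption+, intro exp_small_at_add[OF open_U] exp_small_at_sum[OF open_U x] exp_small_at_cmult[OF open_U] smooth_sum[OF open_U] smooth_cmult[OF open_U]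
            smooth_mult[OF open_U u_s] Ts Tn[OF x] Sn smooth_aff_integral[OF IB2] Fs cq In)
    next
      case False
      then have "iota0 v (Hm G x0 m \<gamma> h y) J = 0" if "h > 0" "y \<in> U" for h y
        using H0[OF that] by (intro iota0_eq_0[where k=0]) auto
      then show ?thesis
        by (subst exp_small_at_cong[OF open_U]) (auto intro: exp_small_at_zero[OF open_U x])
    qed
  qed
qed

text \<open>\<open>Hm\<close> is applied to total functions, but both paths remain in U, so values
  outside U never enter.\<close>

lemma Hm_cong:
  assumes "formk U 2 \<gamma>" "formk U 2 \<gamma>'" "\<And>y I. y \<in> U \<Longrightarrow> \<gamma> h y I = \<gamma>' h y I" "h > 0" "x \<in> U"
  shows "Hm G x0 m \<gamma> h x J = Hm G x0 m \<gamma>' h x J"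
proof (cases "card J = 1")
  case True
  then obtain i where J: "J = {i}" by (metis card_1_singletonE)
  have 1: "aff_integral complex_of_real B1 x0 (\<lambda>h x. \<gamma> h x I) h x = aff_integral complex_of_real B1 x0 (\<lambda>h x. \<gamma>' h x I) h x" for I
    by (rule aff_integral_cong[OF IB1]) (use assms in auto)
  have 2: "aff_integral (\<lambda>_. 1) B2 x0 (\<lambda>h x. iota0 v (\<gamma> h x) I) h x = aff_integral (\<lambda>_. 1) B2 x0 (\<lambda>h x. iota0 v (\<gamma>' h x) I) h x" for v I
    by (rule aff_integral_cong[OF IB2]) (use assms in \<open>auto simp: iota0_def\<close>)
  show ?thesis unfolding J Hm_singleton[OF assms(1,4,5)] Hm_singleton[OF assms(2,4,5)] 1 2 ..
next
  case False
  then show ?thesis using Hm_eq_0[OF assms(1,4,5)] Hm_eq_0[OF assms(2,4,5)] by simp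
qed

lemma Hm_add:
  assumes "formk U 2 \<gamma>" "formk U 2 \<gamma>'" "h > 0" "x \<in> U"
  shows "Hm G x0 m (\<lambda>h x I. \<gamma> h x I + \<gamma>' h x I) h x J = Hm G x0 m \<gamma> h x J + Hm G x0 m \<gamma>' h x J"
proof -
  have sm: "smooth U (\<lambda>h x. \<gamma> h x I)" "smooth U (\<lambda>h x. \<gamma>' h x I)" for I
    using assms(1,2) by (simp_all add: formk_iff)
  have f: "formk U 2 (\<lambda>h x I. \<gamma> h x I + \<gamma>' h x I)"
    using assms(1,2) by (simp add: formk_iff smooth_add[OF open_U])
  show ?thesis
  proof (cases "card J = 1")
    case True
    then obtain i where J: "J = {i}" by (metis card_1_singletonE)
    have 1: "aff_integral complex_of_real B1 x0 (\<lambda>h x. \<gamma> h x I + \<gamma>' h x I) h x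
       = aff_integral complex_of_real B1 x0 (\<lambda>h x. \<gamma> h x I) h x + aff_integral complex_of_real B1 x0 (\<lambda>h x. \<gamma>' h x I) h x" for I
      by (rule aff_integral_add[OF IB1 sm assms(3,4)]) (auto intro: continuous_intros)
    have "iota0 v (\<lambda>I. \<gamma> h x I + \<gamma>' h x I) I = iota0 v (\<gamma> h x) I + iota0 v (\<gamma>' h x) I" for v I h x
      by (simp add: iota0_def distrib_left sum.distrib)
    then have 2: "aff_integral (\<lambda>_. 1) B2 x0 (\<lambda>h x. iota0 v (\<lambda>I. \<gamma> h x I + \<gamma>' h x I) I) h x
      = aff_integral (\<lambda>_. 1) B2 x0 (\<lambda>h x. iota0 v (\<gamma> h x) I) h x + aff_integral (\<lambda>_. 1) B2 x0 (\<lambda>h x. iota0 v (\<gamma>' h x) I) h x" for v I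
      using aff_integral_add[OF IB2 smooth_iota0[OF open_U sm(1)] smooth_iota0[OF open_U sm(2)] assms(3,4), of "\<lambda>_. 1"] by simp
    show ?thesis unfolding J Hm_singleton[OF assms(1,3,4)] Hm_singleton[OF assms(2,3,4)] Hm_singleton[OF f assms(3,4)] 1 2
      by (simp add: distrib_left distrib_right sum.distrib)
  next
    case False
    then show ?thesis using Hm_eq_0[OF assms(1,3,4)] Hm_eq_0[OF assms(2,3,4)] Hm_eq_0[OF f assms(3,4)] by simp
  qed
qed

lemma Hm_cmult:
  assumes "formk U 2 \<gamma>" "h > 0" "x \<in> U"
  shows "Hm G x0 m (\<lambda>h x I. c * \<gamma> h x I) h x J = c * Hm G x0 m \<gamma> h x J"
proof -
  have sm: "smooth U (\<lambda>h x. \<gamma> h x I)" for I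
    using assms(1) by (simp add: formk_iff)
  have f: "formk U 2 (\<lambda>h x I. c * \<gamma> h x I)"
    using assms(1) by (simp add: formk_iff smooth_cmult[OF open_U])
  show ?thesis
  proof (cases "card J = 1")
    case True
    then obtain i where J: "J = {i}" by (metis card_1_singletonE)
    have 1: "aff_integral q' B' x0 (\<lambda>h x. c * F h x) h x = c * aff_integral q' B' x0 F h x" for q' B' F
      by (simp add: aff_integral_def mult.left_commute)
    have 2: "iota0 v (\<lambda>I. c * \<gamma> h x I) I = c * iota0 v (\<gamma> h x) I" for v I h x
      by (simp add: iota0_def sum_distrib_left algebra_simps)
    show ?thesis unfolding J Hm_singleton[OF assms] Hm_singleton[OF f assms(2,3)] 1 2
      by (simp add: distrib_left sum_distrib_left sum_distrib_right algebra_simps)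
  next
    case False
    then show ?thesis using Hm_eq_0[OF assms] Hm_eq_0[OF f assms(2,3)] by simp
  qed
qed

end

end

subsection \<open>Pointwise form of asymptotic support\<close>

lemma eventually_at_right_0_iff:
  "(\<exists>h0>0. \<forall>h. 0 < h \<and> h < h0 \<longrightarrow> P h) \<longleftrightarrow> (\<forall>\<^sub>F h in at_right (0::real). P h)"
  unfolding eventually_at_right_field by blast

lemma finite_lists_length: "finite {ks :: 'n::finite list. set ks \<subseteq> UNIV \<and> length ks = j}"
  by (rule finite_lists_length_eq) simp

lemma iterpd_le_jnorm: "norm (iterpd ks f y) \<le> jnorm (length ks) f y"
  unfolding jnorm_def by (rule member_le_sum[OF _ _ finite_lists_length]) auto

lemma jnorm_nonneg: "0 \<le> jnorm j f y"
  unfolding jnorm_def by (rule sum_nonneg) simp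

lemma derivs_bounded_iff_jnorm:
  "derivs_bounded V \<phi> f \<longleftrightarrow> (\<forall>j. \<exists>D. \<forall>\<^sub>F h in at_right 0. \<forall>y\<in>V. jnorm j (f h) y \<le> D * \<phi> j h y)"
proof
  assume b: "derivs_bounded V \<phi> f"
  show "\<forall>j. \<exists>D. \<forall>\<^sub>F h in at_right 0. \<forall>y\<in>V. jnorm j (f h) y \<le> D * \<phi> j h y"
  proof
    fix j
    let ?S = "{ks :: 'a list. set ks \<subseteq> UNIV \<and> length ks = j}"
    have "\<forall>ks\<in>?S. \<exists>D. \<forall>\<^sub>F h in at_right 0. \<forall>y\<in>V. norm (iterpd ks (f h) y) \<le> D * \<phi> j h y"
      using b by (auto simp: derivs_bounded_def derivs_bounded_ord_def)
    from bchoice[OF this] obtain D where D: "\<forall>ks\<in>?S. \<forall>\<^sub>F h in at_right 0. \<forall>y\<in>V. norm (iterpd ks (f h) y) \<le> D ks * \<phi> j h y"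
      by (elim exE)
    then have "\<forall>\<^sub>F h in at_right 0. \<forall>ks\<in>?S. \<forall>y\<in>V. norm (iterpd ks (f h) y) \<le> D ks * \<phi> j h y"
      by (rule eventually_ball_finite[OF finite_lists_length])
    then have "\<forall>\<^sub>F h in at_right 0. \<forall>y\<in>V. jnorm j (f h) y \<le> (\<Sum>ks\<in>?S. D ks) * \<phi> j h y"
    proof eventually_elim
      case (elim h)
      show ?case
        unfolding jnorm_def sum_distrib_right
        using elim by (intro ballI sum_mono) simp
    qed
    then show "\<exists>D. \<forall>\<^sub>F h in at_right 0. \<forall>y\<in>V. jnorm j (f h) y \<le> D * \<phi> j h y" ..
  qed
next
  assume j: "\<forall>j. \<exists>D. \<forall>\<^sub>F h in at_right 0. \<forall>y\<in>V. jnorm j (f h) y \<le> D * \<phi> j h y"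
  show "derivs_bounded V \<phi> f"
    unfolding derivs_bounded_def derivs_bounded_ord_def
  proof (intro allI impI)
    fix n and ks :: "'a list" assume ks: "length ks = n"
    obtain D where "\<forall>\<^sub>F h in at_right 0. \<forall>y\<in>V. jnorm n (f h) y \<le> D * \<phi> n h y" using j by blast
    then have "\<forall>\<^sub>F h in at_right 0. \<forall>y\<in>V. norm (iterpd ks (f h) y) \<le> D * \<phi> n h y"
    proof eventually_elim
      case (elim h)
      show ?case
      proof
        fix y assume "y \<in> V"
        then show "norm (iterpd ks (f h) y) \<le> D * \<phi> n h y"
          using elim iterpd_le_jnorm[of ks "f h" y] unfolding ks by (blast intro: order_trans)
      qed
    qed
    then show "\<exists>D. \<forall>\<^sub>F h in at_right 0. \<forall>y\<in>V. norm (iterpd ks (f h) y) \<le> D * \<phi> n h y" ..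
  qed
qed

lemma derivs_bounded_all_jnorm:
  fixes \<alpha> :: "'n::{finite,linorder} form"
  assumes "\<And>I. derivs_bounded V \<phi> (\<lambda>h x. \<alpha> h x I)" "nonneg_on V \<phi>"
  shows "\<exists>D h0. h0 > 0 \<and> (\<forall>h. 0 < h \<and> h < h0 \<longrightarrow> (\<forall>y\<in>V. \<forall>I. jnorm j (\<lambda>z. \<alpha> h z I) y \<le> D * \<phi> j h y))"
proof -
  have "\<forall>I. \<exists>D. \<forall>\<^sub>F h in at_right 0. \<forall>y\<in>V. jnorm j (\<lambda>z. \<alpha> h z I) y \<le> D * \<phi> j h y"
    using assms(1) unfolding derivs_bounded_iff_jnorm by blast
  from choice[OF this] obtain D where D: "\<forall>I. \<forall>\<^sub>F h in at_right 0. \<forall>y\<in>V. jnorm j (\<lambda>z. \<alpha> h z I) y \<le> D I * \<phi> j h y"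
    by (elim exE)
  then have "\<forall>\<^sub>F h in at_right 0. \<forall>I\<in>UNIV. \<forall>y\<in>V. jnorm j (\<lambda>z. \<alpha> h z I) y \<le> D I * \<phi> j h y"
    by (intro eventually_ball_finite) auto
  then have "\<forall>\<^sub>F h in at_right 0. \<forall>y\<in>V. \<forall>I. jnorm j (\<lambda>z. \<alpha> h z I) y \<le> Max (range D) * \<phi> j h y"
    using eventually_h01
  proof eventually_elim
    case (elim h)
    show ?case
    proof (intro ballI allI)
      fix y I assume y: "y \<in> V"
      have "jnorm j (\<lambda>z. \<alpha> h z I) y \<le> D I * \<phi> j h y" using elim y by simp
      also have "\<dots> \<le> Max (range D) * \<phi> j h y"
        using assms(2) elim y by (intro mult_right_mono) (auto simp: nonneg_on_def)
      finally show "jnorm j (\<lambda>z. \<alpha> h z I) y \<le> Max (range D) * \<phi> j h y" .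
    qed
  qed
  then show ?thesis unfolding eventually_at_right_0_iff[symmetric] by blast
qed

lemma Wneg_exp_small_at:
  assumes "Wneg W k \<alpha>" "x \<in> W"
  shows "exp_small_at W (\<lambda>h x. \<alpha> h x I) x"
proof -
  obtain V c where V: "open V" "x \<in> V" "V \<subseteq> W" "c > 0"
    and b: "\<And>j. \<exists>D h0. h0 > 0 \<and> (\<forall>h. 0 < h \<and> h < h0 \<longrightarrow> (\<forall>y\<in>V. \<forall>I. jnorm j (\<lambda>z. \<alpha> h z I) y \<le> D * exp (- c / h)))"
    using assms unfolding Wneg_def by metis
  have "derivs_bounded V (\<lambda>j h x. exp (- c / h)) (\<lambda>h x. \<alpha> h x I)"
    unfolding derivs_bounded_iff_jnorm
  proof
    fix j
    obtain D h0 where "h0 > 0" "\<forall>h. 0 < h \<and> h < h0 \<longrightarrow> (\<forall>y\<in>V. \<forall>I. jnorm j (\<lambda>z. \<alpha> h z I) y \<le> D * exp (- c / h))"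
      using b by metis
    then have "\<forall>\<^sub>F h in at_right 0. \<forall>y\<in>V. jnorm j (\<lambda>z. \<alpha> h z I) y \<le> D * exp (- c / h)"
      unfolding eventually_at_right_0_iff[symmetric] by blast
    then show "\<exists>D. \<forall>\<^sub>F h in at_right 0. \<forall>y\<in>V. jnorm j (\<lambda>z. \<alpha> h z I) y \<le> D * exp (- c / h)" ..
  qed
  then show ?thesis using V by (auto simp: exp_small_at_def exp_small_on_def)
qed

lemma Wneg_I:
  fixes \<alpha> :: "'n::{finite,linorder} form"
  assumes "formk W k \<alpha>" "\<And>x I. x \<in> W \<Longrightarrow> exp_small_at W (\<lambda>h x. \<alpha> h x I) x"
  shows "Wneg W k \<alpha>"
  unfolding Wneg_def
proof (intro conjI assms(1) ballI)
  fix x assume "x \<in> W"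
  then have "\<forall>I. \<exists>V c. open V \<and> x \<in> V \<and> V \<subseteq> W \<and> c > 0 \<and> derivs_bounded V (\<lambda>j h x. exp (- c / h)) (\<lambda>h x. \<alpha> h x I)"
    using assms(2) unfolding exp_small_at_def exp_small_on_def by meson
  then obtain V c where V: "\<And>I. open (V I)" "\<And>I. x \<in> V I" "\<And>I. V I \<subseteq> W" "\<And>I. c I > (0::real)"
    "\<And>I. derivs_bounded (V I) (\<lambda>j h x. exp (- c I / h)) (\<lambda>h x. \<alpha> h x I)" by metis
  \<comment> \<open>There are only finitely many index sets I, so the neighbourhoods may be
    intersected and the rates replaced by their minimum.\<close>
  define V' c' where "V' = (\<Inter>I. V I)" and "c' = Min (range c)"
  have V': "open V'" "x \<in> V'" using V(1,2) unfolding V'_def by (auto intro: open_INT)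
  have V'W: "V' \<subseteq> W" using V(3)[of "{}"] unfolding V'_def by blast
  have c': "c' > 0" "\<And>I. c' \<le> c I" using V(4) unfolding c'_def by auto
  have "derivs_bounded V' (\<lambda>j h x. exp (- c' / h)) (\<lambda>h x. \<alpha> h x I)" for I
    by (rule derivs_bounded_subset[OF derivs_bounded_exp_mono[OF V(5) c'(2)]]) (auto simp: V'_def)
  from derivs_bounded_all_jnorm[of V' "\<lambda>j h x. exp (- c' / h)" \<alpha>, OF this nonneg_on_exp]
  have *: "\<forall>j. \<exists>D h0. h0 > 0 \<and> (\<forall>h. 0 < h \<and> h < h0 \<longrightarrow> (\<forall>y\<in>V'. \<forall>I. jnorm j (\<lambda>z. \<alpha> h z I) y \<le> D * exp (- c' / h)))"
    by (rule allI)
  then show "\<exists>V. open V \<and> x \<in> V \<and> V \<subseteq> W \<and> (\<exists>c>0. \<forall>j. \<exists>D h0. h0 > 0 \<and>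
        (\<forall>h. 0 < h \<and> h < h0 \<longrightarrow> (\<forall>y\<in>V. \<forall>I. jnorm j (\<lambda>z. \<alpha> h z I) y \<le> D * exp (- c / h))))"
    by (intro exI[of _ V'] conjI V' V'W exI[of _ c'] c'(1) *)
qed

section \<open>Passing between pointwise decay and slice integrals\<close>

definition slice_bound :: "('n::{finite,linorder}) rn set \<Rightarrow> 'n rn \<Rightarrow> 'n rn \<Rightarrow> real \<Rightarrow> (real \<Rightarrow> 'n rn \<Rightarrow> complex) \<Rightarrow> bool" where
  "slice_bound V l p0 s f \<longleftrightarrow> (\<forall>j (\<beta>::nat). \<exists>D. \<forall>\<^sub>F h in at_right 0.
     (\<forall>y\<in>(\<lambda>x. l \<bullet> (x - p0)) ` V. bdd_above (jnorm j (f h) ` {x\<in>V. l \<bullet> (x - p0) = y})) \<and>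
     (\<lambda>y. \<bar>y\<bar> ^ \<beta> * Sup (jnorm j (f h) ` {x\<in>V. l \<bullet> (x - p0) = y})) integrable_on (\<lambda>x. l \<bullet> (x - p0)) ` V \<and>
     integral ((\<lambda>x. l \<bullet> (x - p0)) ` V) (\<lambda>y. \<bar>y\<bar> ^ \<beta> * Sup (jnorm j (f h) ` {x\<in>V. l \<bullet> (x - p0) = y}))
       \<le> D * h powr (- (real j + s - real \<beta> - 1) / 2))"

lemma asupp1_iff:
  "asupp1 U P s \<alpha> \<longleftrightarrow> Winf U 1 \<alpha> \<and>
    (\<forall>x\<in>U - P. \<exists>Ob. open Ob \<and> x \<in> Ob \<and> Ob \<subseteq> U \<and> Wneg Ob 1 \<alpha>) \<and>
    (\<exists>l p0 v. l \<noteq> 0 \<and> affine hull P = {x. l \<bullet> (x - p0) = 0} \<and> l \<bullet> v = 1 \<and>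
      (\<exists>Ob h \<eta>. open Ob \<and> P \<subseteq> Ob \<and> Ob \<subseteq> U \<and> Wneg Ob 1 \<eta> \<and>
         (\<forall>hb>0. \<forall>x\<in>Ob. \<forall>I. \<alpha> hb x I = h hb x * cov1 l I + \<eta> hb x I)) \<and>
      (\<forall>p\<in>P. \<exists>V. open V \<and> convex V \<and> p \<in> V \<and> V \<subseteq> U \<and>
         slice_bound V l p0 s (\<lambda>h x. iota0 v (\<alpha> h x) {})))"
  unfolding asupp1_def slice_bound_def eventually_at_right_0_iff Let_def ..

lemma formk_subset:
  assumes "formk W k \<alpha>" "W' \<subseteq> W"
  shows "formk W' k \<alpha>"
proof -
  have "Ck m S f \<Longrightarrow> S' \<subseteq> S \<Longrightarrow> Ck m S' f" for m and S S' :: "'b::euclidean_space set" and f :: "'b \<Rightarrow> complex"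
    by (induction m arbitrary: f) (auto elim: continuous_on_subset)
  then have "Cinf S f \<Longrightarrow> S' \<subseteq> S \<Longrightarrow> Cinf S' f" for S S' :: "(real \<times> 'a rn) set" and f :: "real \<times> 'a rn \<Rightarrow> complex"
    unfolding Cinf_def by blast
  moreover have "{0::real<..} \<times> W' \<subseteq> {0<..} \<times> W" using assms(2) by auto
  ultimately show ?thesis using assms unfolding formk_def by blast
qed

lemma Winf_I:
  fixes \<alpha> :: "'n::{finite,linorder} form"
  assumes U: "open U" and \<alpha>: "asym_form U k W w P s \<alpha>" and w: "\<And>x. 0 \<le> w x"
  shows "Winf U k \<alpha>"
  unfolding Winf_def
proof (intro conjI ballI)
  show "formk U k \<alpha>" using \<alpha> by (simp add: asym_form_def)
  fix x assume "x \<in> U"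
  then obtain e where e: "e > 0" "cball x e \<subseteq> U" using U open_contains_cball by blast
  have "derivs_bounded (ball x e) (decay_weight w s 0) (\<lambda>h x. \<alpha> h x I)" for I
    using asym_form_decay[OF \<alpha>, of I] e(2) unfolding decay_def
    by (intro derivs_bounded_subset[OF _ ball_subset_cball]) simp
  from derivs_bounded_all_jnorm[of "ball x e" "decay_weight w s 0" \<alpha>, OF this nonneg_on_decay_weight[OF w]]
  have *: "\<exists>D h0. h0 > 0 \<and> (\<forall>h. 0 < h \<and> h < h0 \<longrightarrow> (\<forall>y\<in>ball x e. \<forall>I. jnorm j (\<lambda>z. \<alpha> h z I) y \<le> D * h powr (- ((real j + s) / 2))))" for j
    by (simp add: decay_weight_def minus_divide_left)
  show "\<exists>V. open V \<and> x \<in> V \<and> V \<subseteq> U \<and> (\<forall>j. \<exists>D N h0. h0 > 0 \<and>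
        (\<forall>h. 0 < h \<and> h < h0 \<longrightarrow> (\<forall>y\<in>V. \<forall>I. jnorm j (\<lambda>z. \<alpha> h z I) y \<le> D * h powr (- N))))"
  proof (intro exI[of _ "ball x e"] conjI allI)
    show "\<exists>D N h0. h0 > 0 \<and> (\<forall>h. 0 < h \<and> h < h0 \<longrightarrow> (\<forall>y\<in>ball x e. \<forall>I. jnorm j (\<lambda>z. \<alpha> h z I) y \<le> D * h powr (- N)))" for j
      using *[of j] by blast
  qed (use e ball_subset_cball in auto)
qed

text \<open>\<open>asupp1\<close> comes with its own equation of the affine hull, while the geometry
  supplies the covector N. Two equations of one hyperplane are proportional, with factor
  l'(v).\<close>

lemma hyperplane_eq_imp:
  fixes l l' :: "'a::real_inner"
  assumes "{x. l \<bullet> (x - p) = 0} = {x. l' \<bullet> (x - p') = 0}" "l \<bullet> v = 1"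
  shows "l' \<bullet> z = (l' \<bullet> v) * (l \<bullet> z)" "l' \<bullet> (z - p') = (l' \<bullet> v) * (l \<bullet> (z - p))"
proof -
  have "p \<in> {x. l \<bullet> (x - p) = 0}" by simp
  then have p: "l' \<bullet> (p - p') = 0" unfolding assms(1) by simp
  have k: "l' \<bullet> u = 0" if "l \<bullet> u = 0" for u
  proof -
    have "p + u \<in> {x. l \<bullet> (x - p) = 0}" using that by simp
    then have "l' \<bullet> (p + u - p') = 0" unfolding assms(1) by simp
    then show ?thesis using p by (simp add: inner_diff_right inner_add_right)
  qed
  have *: "l' \<bullet> z = (l' \<bullet> v) * (l \<bullet> z)" for z
    using k[of "z - (l \<bullet> z) *\<^sub>R v"] assms(2) by (simp add: inner_diff_right)
  show "l' \<bullet> z = (l' \<bullet> v) * (l \<bullet> z)" by (rule *)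
  show "l' \<bullet> (z - p') = (l' \<bullet> v) * (l \<bullet> (z - p))"
    using *[of "z - p"] p by (simp add: inner_diff_right)
qed

text \<open>One-dimensional Sobolev inequality along a transversal line: the value at \<open>x\<close> is
  \<open>- \<integral> ((1 - t/\<rho>) F(x + t v))' dt\<close>, moving in the direction in which \<open>\<bar>y\<bar>\<close> grows.\<close>

lemma sobolev_slice:
  fixes F :: "'n::{finite,linorder} rn \<Rightarrow> complex" and l p0 v :: "'n rn"
  assumes \<rho>: "\<rho> > 0" and l: "l \<bullet> v = 1"
    and diff: "\<And>z. z \<in> V \<Longrightarrow> F differentiable (at z)"
    and inV: "\<And>t. \<bar>t\<bar> \<le> \<rho> \<Longrightarrow> x + t *\<^sub>R v \<in> V"
    and S0: "\<And>z. z \<in> V \<Longrightarrow> \<bar>l \<bullet> (z - p0)\<bar> ^ \<beta> * norm (F z) \<le> S0 (l \<bullet> (z - p0))"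
    and S1: "\<And>z k. z \<in> V \<Longrightarrow> \<bar>l \<bullet> (z - p0)\<bar> ^ \<beta> * norm (pd k F z) \<le> S1 (l \<bullet> (z - p0))"
    and NV: "NV = (\<lambda>z. l \<bullet> (z - p0)) ` V"
    and int: "S0 integrable_on NV" "S1 integrable_on NV"
    and nonneg_on: "\<And>y. y \<in> NV \<Longrightarrow> 0 \<le> S0 y" "\<And>y. y \<in> NV \<Longrightarrow> 0 \<le> S1 y"
  shows "\<bar>l \<bullet> (x - p0)\<bar> ^ \<beta> * norm (F x) \<le> (1 / \<rho>) * integral NV S0 + (\<Sum>k\<in>UNIV. \<bar>v $ k\<bar>) * integral NV S1"
proof -
  define y where "y = l \<bullet> (x - p0)"
  \<comment> \<open>Moving away from y = 0 keeps |y|^\<beta> below its value at the new point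
    (\<open>grow\<close>), so the moment can be taken under the integral.\<close>
  define \<epsilon> :: real where "\<epsilon> = (if y \<ge> 0 then 1 else -1)"
  have \<epsilon>: "\<bar>\<epsilon>\<bar> = 1" "\<epsilon> * \<epsilon> = 1" "\<epsilon> \<noteq> 0" by (auto simp: \<epsilon>_def)
  define C where "C = (\<Sum>k\<in>UNIV. \<bar>v $ k\<bar>)"
  have C: "C \<ge> 0" by (simp add: C_def sum_nonneg)
  define \<gamma> where "\<gamma> t = x + (t * \<epsilon>) *\<^sub>R v" for t
  have \<gamma>: "\<gamma> t \<in> V" if "t \<in> {0..\<rho>}" for t
    using that inV[of "t * \<epsilon>"] \<epsilon> by (auto simp: \<gamma>_def abs_mult)
  have ly: "l \<bullet> (\<gamma> t - p0) = y + \<epsilon> * t" for t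
    using l by (simp add: \<gamma>_def y_def inner_diff_right inner_add_right)
  have inNV: "y + \<epsilon> * t \<in> NV" if "t \<in> {0..\<rho>}" for t
    unfolding NV using \<gamma>[OF that] ly by (metis image_eqI)
  have grow: "\<bar>y\<bar> ^ \<beta> \<le> \<bar>y + \<epsilon> * t\<bar> ^ \<beta>" if "t \<ge> 0" for t
    using that by (intro power_mono) (auto simp: \<epsilon>_def)
  \<comment> \<open>\<open>E\<close> is the derivative of F along the line multiplied by the cutoff
    1 - t/\<rho>, the product being differentiated as a whole. The cutoff is 1 at x and 0 at the far
    end, so the integral of \<open>E\<close> is -F(x).\<close>
  define E where "E t = (1 - t / \<rho>) *\<^sub>R frechet_derivative F (at (\<gamma> t)) (\<epsilon> *\<^sub>R v) - (1 / \<rho>) *\<^sub>R F (\<gamma> t)" for t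
  have der: "((\<lambda>t. (1 - t / \<rho>) *\<^sub>R F (\<gamma> t)) has_vector_derivative E t) (at t within {0..\<rho>})" if t: "t \<in> {0..\<rho>}" for t
  proof -
    have "(\<gamma> has_derivative (\<lambda>s. (s * \<epsilon>) *\<^sub>R v)) (at t within {0..\<rho>})"
      unfolding \<gamma>_def[abs_def] by (auto intro!: derivative_eq_intros)
    from has_derivative_compose[OF this diff[OF \<gamma>[OF t], unfolded frechet_derivative_works]]
    have "((\<lambda>t. F (\<gamma> t)) has_derivative (\<lambda>s. frechet_derivative F (at (\<gamma> t)) ((s * \<epsilon>) *\<^sub>R v))) (at t within {0..\<rho>})" .
    moreover have "frechet_derivative F (at (\<gamma> t)) ((s * \<epsilon>) *\<^sub>R v) = s *\<^sub>R frechet_derivative F (at (\<gamma> t)) (\<epsilon> *\<^sub>R v)" for s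
      using linear_scale[OF linear_frechet_derivative[OF diff[OF \<gamma>[OF t]]], of s "\<epsilon> *\<^sub>R v"] by simp
    ultimately have 1: "((\<lambda>t. F (\<gamma> t)) has_vector_derivative frechet_derivative F (at (\<gamma> t)) (\<epsilon> *\<^sub>R v)) (at t within {0..\<rho>})"
      unfolding has_vector_derivative_def by simp
    have 2: "((\<lambda>t. 1 - t / \<rho>) has_field_derivative (- 1 / \<rho>)) (at t within {0..\<rho>})"
      using \<rho> by (auto intro!: derivative_eq_intros)
    from has_vector_derivative_scaleR[OF 2 1]
    show ?thesis unfolding E_def by (simp add: algebra_simps)
  qed
  have "(E has_integral (1 - \<rho> / \<rho>) *\<^sub>R F (\<gamma> \<rho>) - (1 - 0 / \<rho>) *\<^sub>R F (\<gamma> 0)) {0..\<rho>}"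
    using \<rho> der by (intro fundamental_theorem_of_calculus) auto
  then have E: "(E has_integral - F x) {0..\<rho>}" using \<rho> by (simp add: \<gamma>_def)
  \<comment> \<open>Since l(v) = 1, the segment moves with unit speed in y and sweeps an interval
    inside NV; a nonnegative integrand can only gain on all of NV.\<close>
  have shift: "(\<lambda>t. S (y + \<epsilon> * t)) integrable_on {0..\<rho>} \<and> integral {0..\<rho>} (\<lambda>t. S (y + \<epsilon> * t)) \<le> integral NV S"
    if S: "S integrable_on NV" "\<And>z. z \<in> NV \<Longrightarrow> 0 \<le> S z" for S :: "real \<Rightarrow> real"
  proof -
    define a b where "a = (if y \<ge> 0 then y else y - \<rho>)" and "b = (if y \<ge> 0 then y + \<rho> else y)"
    have sub: "{a..b} \<subseteq> NV"
    proof
      fix z assume "z \<in> {a..b}"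
      then have "\<epsilon> * (z - y) \<in> {0..\<rho>}" by (auto simp: a_def b_def \<epsilon>_def split: if_splits)
      from inNV[OF this] show "z \<in> NV" using \<epsilon>(2) by (simp add: mult.assoc[symmetric])
    qed
    have i: "S integrable_on {a..b}" using S(1) sub by (rule integrable_on_subinterval)
    have im: "(\<lambda>t. (1 / \<epsilon>) *\<^sub>R t + - ((1 / \<epsilon>) *\<^sub>R y)) ` cbox a b = {0..\<rho>}"
    proof (cases "y \<ge> 0")
      case True
      have "(\<lambda>t. t - y) ` {y..y + \<rho>} = {0..\<rho>}" by simp
      then show ?thesis using True by (simp add: a_def b_def \<epsilon>_def)
    next
      case False
      have "(\<lambda>t. y - t) ` {y - \<rho>..y} = {0..\<rho>}" by simp
      then show ?thesis using False by (simp add: a_def b_def \<epsilon>_def)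
    qed
    have "((\<lambda>t. S (\<epsilon> *\<^sub>R t + y)) has_integral (1 / \<bar>\<epsilon>\<bar> ^ DIM(real)) *\<^sub>R integral {a..b} S)
        ((\<lambda>t. (1 / \<epsilon>) *\<^sub>R t + - ((1 / \<epsilon>) *\<^sub>R y)) ` cbox a b)"
      using i \<epsilon> by (intro has_integral_affinity) (auto simp: integrable_integral)
    then have h: "((\<lambda>t. S (y + \<epsilon> * t)) has_integral integral {a..b} S) {0..\<rho>}"
      unfolding im using \<epsilon> by (simp add: add.commute)
    have "integral {a..b} S \<le> integral NV S"
      using sub i S by (intro integral_subset_le) auto
    then show ?thesis using h by (auto simp: integral_unique has_integral_integrable)
  qed
  define Bd where "Bd t = (1 / \<rho>) * S0 (y + \<epsilon> * t) + C * S1 (y + \<epsilon> * t)" for t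
  have i0: "(\<lambda>t. S0 (y + \<epsilon> * t)) integrable_on {0..\<rho>}" "integral {0..\<rho>} (\<lambda>t. S0 (y + \<epsilon> * t)) \<le> integral NV S0"
    using shift[OF int(1) nonneg_on(1)] by auto
  have i1: "(\<lambda>t. S1 (y + \<epsilon> * t)) integrable_on {0..\<rho>}" "integral {0..\<rho>} (\<lambda>t. S1 (y + \<epsilon> * t)) \<le> integral NV S1"
    using shift[OF int(2) nonneg_on(2)] by auto
  have Bi: "Bd integrable_on {0..\<rho>}"
    unfolding Bd_def[abs_def] by (intro integrable_add integrable_on_mult_right i0 i1)
  have pt: "norm ((\<bar>y\<bar> ^ \<beta>) *\<^sub>R E t) \<le> Bd t" if t: "t \<in> {0..\<rho>}" for t
  proof -
    define Y where "Y = \<bar>y + \<epsilon> * t\<bar> ^ \<beta>"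
    have Y: "Y \<ge> 0" by (simp add: Y_def)
    have D: "frechet_derivative F (at (\<gamma> t)) (\<epsilon> *\<^sub>R v) = (\<Sum>k\<in>UNIV. (\<epsilon> * v $ k) *\<^sub>R pd k F (\<gamma> t))"
      using frechet_axis_sum[OF open_UNIV diff[OF \<gamma>[OF t]]] by simp
    have p: "Y * norm (pd k F (\<gamma> t)) \<le> S1 (y + \<epsilon> * t)" for k
      using S1[OF \<gamma>[OF t]] unfolding ly Y_def .
    have "Y * norm (frechet_derivative F (at (\<gamma> t)) (\<epsilon> *\<^sub>R v)) \<le> Y * (\<Sum>k\<in>UNIV. \<bar>v $ k\<bar> * norm (pd k F (\<gamma> t)))"
      unfolding D using Y \<epsilon> by (intro mult_left_mono sum_norm_le) (auto simp: abs_mult)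
    also have "\<dots> = (\<Sum>k\<in>UNIV. \<bar>v $ k\<bar> * (Y * norm (pd k F (\<gamma> t))))"
      by (simp add: sum_distrib_left mult_ac)
    also have "\<dots> \<le> (\<Sum>k\<in>UNIV. \<bar>v $ k\<bar> * S1 (y + \<epsilon> * t))"
      by (intro sum_mono mult_left_mono p) auto
    finally have d: "Y * norm (frechet_derivative F (at (\<gamma> t)) (\<epsilon> *\<^sub>R v)) \<le> C * S1 (y + \<epsilon> * t)"
      by (simp add: C_def sum_distrib_right)
    have f: "Y * norm (F (\<gamma> t)) \<le> S0 (y + \<epsilon> * t)"
      using S0[OF \<gamma>[OF t]] unfolding ly Y_def .
    have t1: "\<bar>1 - t / \<rho>\<bar> \<le> 1" using t \<rho> by (auto simp: abs_le_iff)
    have "norm (E t) \<le> 1 * norm (frechet_derivative F (at (\<gamma> t)) (\<epsilon> *\<^sub>R v)) + (1 / \<rho>) * norm (F (\<gamma> t))"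
      unfolding E_def using t1 \<rho>
      by (intro order_trans[OF norm_triangle_ineq4] add_mono) (auto intro: mult_left_le_one_le)
    then have "Y * norm (E t) \<le> Y * (norm (frechet_derivative F (at (\<gamma> t)) (\<epsilon> *\<^sub>R v)) + (1 / \<rho>) * norm (F (\<gamma> t)))"
      using Y by (intro mult_left_mono) auto
    also have "\<dots> = (1 / \<rho>) * (Y * norm (F (\<gamma> t))) + Y * norm (frechet_derivative F (at (\<gamma> t)) (\<epsilon> *\<^sub>R v))"
      by (simp add: algebra_simps)
    also have "\<dots> \<le> Bd t"
      unfolding Bd_def using d f \<rho> by (intro add_mono mult_left_mono) auto
    finally have "Y * norm (E t) \<le> Bd t" .
    moreover have "\<bar>y\<bar> ^ \<beta> * norm (E t) \<le> Y * norm (E t)"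
      unfolding Y_def using grow[of t] t by (intro mult_right_mono) auto
    ultimately show ?thesis by simp
  qed
  have "norm (\<bar>y\<bar> ^ \<beta> *\<^sub>R F x) = norm (integral {0..\<rho>} (\<lambda>t. \<bar>y\<bar> ^ \<beta> *\<^sub>R E t))"
    using integral_unique[OF has_integral_cmul[OF E, of "\<bar>y\<bar> ^ \<beta>"]] by simp
  also have "\<dots> \<le> integral {0..\<rho>} Bd"
    using E pt Bi by (intro integral_norm_bound_integral) (auto intro: integrable_cmul)
  also have "\<dots> = (1 / \<rho>) * integral {0..\<rho>} (\<lambda>t. S0 (y + \<epsilon> * t)) + C * integral {0..\<rho>} (\<lambda>t. S1 (y + \<epsilon> * t))"
    unfolding Bd_def[abs_def]
    by (simp only: integral_add[OF integrable_on_mult_right[OF i0(1)] integrable_on_mult_right[OF i1(1)]] integral_mult_right)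
  also have "\<dots> \<le> (1 / \<rho>) * integral NV S0 + C * integral NV S1"
    using i0 i1 \<rho> C by (intro add_mono mult_left_mono) auto
  finally show ?thesis by (simp add: y_def C_def)
qed

lemma powr_mult_sqrt_power:
  assumes "0 < (h::real)" shows "sqrt h ^ b = h powr (real b / 2)"
  using assms powr_power[of h "1/2" b] by (simp add: powr_half_sqrt)

text \<open>With t = w / sqrt h, b powers of 1 + t cancel the moment t^b and the two others leave at
  most 1 / (1 + t^2), which is integrable on the line. The moment itself contributes sqrt h^b, the
  shift by b in the exponent.\<close>

lemma decay_weight_alt:
  assumes "0 < h" "0 \<le> w x"
  shows "\<bar>w x\<bar> ^ b * decay_weight w s (b + 2) j h x \<le> h powr (- (real j + s - real b) / 2) * (h / (h + (w x)\<^sup>2))"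
proof -
  define t where "t = w x / sqrt h"
  have t: "0 \<le> t" "w x = sqrt h * t" using assms by (auto simp: t_def)
  have "t ^ b / (1 + t) ^ (b + 2) \<le> 1 / (1 + t)\<^sup>2"
  proof -
    have "t ^ b \<le> (1 + t) ^ b" using t by (intro power_mono) auto
    then have "t ^ b / (1 + t) ^ (b + 2) \<le> (1 + t) ^ b / (1 + t) ^ (b + 2)"
      using t by (intro divide_right_mono zero_le_power) auto
    also have "\<dots> = 1 / (1 + t)\<^sup>2" using t by (simp add: power_add power2_eq_square)
    finally show ?thesis .
  qed
  also have "\<dots> \<le> 1 / (1 + t\<^sup>2)"
  proof (rule frac_le)
    show "1 + t\<^sup>2 \<le> (1 + t)\<^sup>2" using t by (simp add: power2_sum)
    show "0 < 1 + t\<^sup>2" by (simp add: add_pos_nonneg)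
  qed auto
  also have "\<dots> = h / (h + (w x)\<^sup>2)"
  proof -
    have "h + (w x)\<^sup>2 = h * (1 + t\<^sup>2)"
      using assms by (simp add: t(2) power_mult_distrib distrib_left)
    then show ?thesis using assms(1) by simp
  qed
  finally have *: "t ^ b / (1 + t) ^ (b + 2) \<le> h / (h + (w x)\<^sup>2)" .
  have "\<bar>w x\<bar> ^ b * decay_weight w s (b + 2) j h x = (sqrt h ^ b * h powr (- (real j + s) / 2)) * (t ^ b / (1 + t) ^ (b + 2))"
    unfolding decay_weight_def t_def[symmetric] using t assms by (simp add: t(2)[symmetric] power_mult_distrib flip: t(2))
      (simp add: t(2) power_mult_distrib)
  also have "sqrt h ^ b * h powr (- (real j + s) / 2) = h powr (- (real j + s - real b) / 2)"
    unfolding powr_mult_sqrt_power[OF assms(1)] powr_add[symmetric]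
    by (rule arg_cong[where f="\<lambda>a. h powr a"]) (simp add: field_simps)
  also have "h powr (- (real j + s - real b) / 2) * (t ^ b / (1 + t) ^ (b + 2))
      \<le> h powr (- (real j + s - real b) / 2) * (h / (h + (w x)\<^sup>2))"
    using * by (intro mult_left_mono) auto
  finally show ?thesis .
qed

lemma lorentzian_integral_symmetric:
  fixes h M :: real
  assumes "0 < h" "0 \<le> M"
  shows "(\<lambda>y. h / (h + y\<^sup>2)) integrable_on {-M<..<M}"
    "integral {-M<..<M} (\<lambda>y. h / (h + y\<^sup>2)) \<le> pi * sqrt h"
proof -
  have pos: "0 < h + y\<^sup>2" for y using assms(1) by (simp add: add_pos_nonneg)
  define F where "F y = sqrt h * arctan (y / sqrt h)" for y
  have "((\<lambda>y. h / (h + y\<^sup>2)) has_integral (F M - F (- M))) {-M..M}"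
  proof (rule fundamental_theorem_of_calculus)
    fix y :: real assume "y \<in> {-M..M}"
    have "((\<lambda>y. y / sqrt h) has_field_derivative 1 / sqrt h) (at y)"
      by (rule DERIV_cdivide) (auto intro!: derivative_eq_intros)
    from DERIV_cmult[OF DERIV_chain2[OF DERIV_arctan this], of "sqrt h"]
    have "(F has_field_derivative sqrt h * (inverse (1 + (y / sqrt h)\<^sup>2) * (1 / sqrt h))) (at y)"
      unfolding F_def[abs_def] .
    moreover have "sqrt h * (inverse (1 + (y / sqrt h)\<^sup>2) * (1 / sqrt h)) = h / (h + y\<^sup>2)"
    proof -
      have "inverse (1 + (y / sqrt h)\<^sup>2) = h / (h + y\<^sup>2)"
        using assms pos[of y] by (simp add: power_divide field_simps)
      then show ?thesis using assms by simp
    qed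
    ultimately show "(F has_vector_derivative h / (h + y\<^sup>2)) (at y within {-M..M})"
      by (auto simp: has_real_derivative_iff_has_vector_derivative intro: has_vector_derivative_at_within)
  qed (use assms in auto)
  then have "(\<lambda>y. h / (h + y\<^sup>2)) integrable_on {-M..M}" "integral {-M..M} (\<lambda>y. h / (h + y\<^sup>2)) = F M - F (-M)"
    by (auto simp: integral_unique has_integral_integrable)
  moreover have "F M - F (-M) \<le> sqrt h * pi"
    unfolding F_def right_diff_distrib[symmetric]
    using arctan_ubound[of "M / sqrt h"] arctan_lbound[of "- M / sqrt h"] assms
    by (intro mult_left_mono) auto
  ultimately show "(\<lambda>y. h / (h + y\<^sup>2)) integrable_on {-M<..<M}"
    "integral {-M<..<M} (\<lambda>y. h / (h + y\<^sup>2)) \<le> pi * sqrt h"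
    by (simp_all add: integrable_on_open_interval_real integral_open_interval_real[symmetric] mult.commute)
qed

text \<open>The supremum over the leaves is lower semicontinuous, hence measurable.\<close>

lemma measurable_Sup_slices:
  fixes l p0 :: "'n::{finite,linorder} rn" and J :: "'n rn \<Rightarrow> real"
  assumes "open V" "l \<noteq> 0" "continuous_on V J" "\<And>y. bdd_above (J ` {x\<in>V. l \<bullet> (x - p0) = y})"
  shows "(\<lambda>y. Sup (J ` {x\<in>V. l \<bullet> (x - p0) = y})) \<in> borel_measurable (lebesgue_on ((\<lambda>x. l \<bullet> (x - p0)) ` V))"
    and "open ((\<lambda>x. l \<bullet> (x - p0)) ` V)"
proof -
  have op: "open ((\<lambda>x. l \<bullet> (x - p0)) ` S)" if "open S" for S
  proof -
    have "surj (\<lambda>z. l \<bullet> z)"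
    proof (rule surjI)
      show "l \<bullet> ((y / (l \<bullet> l)) *\<^sub>R l) = y" for y using assms(2) by simp
    qed
    then have "open ((\<lambda>z. l \<bullet> z) ` ((\<lambda>x. x - p0) ` S))"
      using that by (intro open_surjective_linear_image open_translation_subtract)
        (auto simp: bounded_linear.linear bounded_linear_inner_right)
    then show ?thesis by (simp add: image_image)
  qed
  let ?NV = "(\<lambda>x. l \<bullet> (x - p0)) ` V"
  show oNV: "open ?NV" using op assms(1) by blast
  show "(\<lambda>y. Sup (J ` {x\<in>V. l \<bullet> (x - p0) = y})) \<in> borel_measurable (lebesgue_on ?NV)"
    unfolding borel_measurable_iff_greater
  proof
    fix c
    have "{y \<in> ?NV. c < Sup (J ` {x\<in>V. l \<bullet> (x - p0) = y})} = (\<lambda>x. l \<bullet> (x - p0)) ` {x\<in>V. c < J x}"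
    proof (intro set_eqI iffI)
      fix y assume "y \<in> {y \<in> ?NV. c < Sup (J ` {x\<in>V. l \<bullet> (x - p0) = y})}"
      then have y: "J ` {x\<in>V. l \<bullet> (x - p0) = y} \<noteq> {}" "c < Sup (J ` {x\<in>V. l \<bullet> (x - p0) = y})" by auto
      from less_cSupD[OF this] obtain z where "z \<in> J ` {x\<in>V. l \<bullet> (x - p0) = y}" "c < z"
        by (elim bexE)
      then show "y \<in> (\<lambda>x. l \<bullet> (x - p0)) ` {x\<in>V. c < J x}" by auto
    next
      fix y assume "y \<in> (\<lambda>x. l \<bullet> (x - p0)) ` {x\<in>V. c < J x}"
      then obtain x where x: "x \<in> V" "c < J x" "y = l \<bullet> (x - p0)" by auto
      then have "J x \<le> Sup (J ` {x\<in>V. l \<bullet> (x - p0) = y})" by (intro cSup_upper assms(4)) auto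
      then have "c < Sup (J ` {x\<in>V. l \<bullet> (x - p0) = y})" using x(2) by linarith
      moreover have "y \<in> ?NV" using x by blast
      ultimately show "y \<in> {y \<in> ?NV. c < Sup (J ` {x\<in>V. l \<bullet> (x - p0) = y})}"
        by (intro CollectI conjI)
    qed
    moreover have "open {x\<in>V. c < J x}"
    proof -
      have "{x\<in>V. c < J x} = V \<inter> J -` {c<..}" by auto
      then show ?thesis using continuous_open_preimage[OF assms(3,1) open_greaterThan] by simp
    qed
    ultimately have "open {y \<in> ?NV. c < Sup (J ` {x\<in>V. l \<bullet> (x - p0) = y})}" using op by simp
    then show "{y \<in> space (lebesgue_on ?NV). c < Sup (J ` {x\<in>V. l \<bullet> (x - p0) = y})} \<in> sets (lebesgue_on ?NV)"
      using oNV by (subst sets_restrict_space_iff) (auto simp: borel_open sets_completionI_sets)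
  qed
qed

text \<open>The normal coefficient is the contraction with v = l / |l|^2; by
  \<open>covector_split\<close> the rest of \<alpha> consists of contractions with tangent vectors
  and is exponentially small. The pointwise weight is constant along each leaf, so it bounds the
  supremum, and its moments are dominated by Lorentzian integrals.\<close>

lemma asupp1I:
  fixes \<alpha> :: "'n::{finite,linorder} form"
  assumes U: "open U" and \<alpha>: "asym_form U 1 {v. l \<bullet> v = 0} (\<lambda>x. \<bar>l \<bullet> (x - p0)\<bar>) P s \<alpha>"
    and l: "l \<noteq> 0" and hull: "affine hull P = {x. l \<bullet> (x - p0) = 0}" and PU: "P \<subseteq> U"
  shows "asupp1 U P s \<alpha>"
proof -
  define w where "w x = \<bar>l \<bullet> (x - p0)\<bar>" for x
  have w: "0 \<le> w x" for x by (simp add: w_def)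
  define v where "v = (1 / (l \<bullet> l)) *\<^sub>R l"
  have lv: "l \<bullet> v = 1" using l by (simp add: v_def)
  note \<alpha>' = \<alpha>[folded w_def]
  note sm = asym_form_smooth[OF \<alpha>]
  define f where "f h x = iota0 v (\<alpha> h x) {}" for h x
  have fs: "smooth U f" unfolding f_def[abs_def] by (intro smooth_iota0[OF U] sm)
  have fE: "decay U w s f" unfolding f_def[abs_def] by (intro decay_iota0[OF U] sm asym_form_decay[OF \<alpha>'] w)
  have off: "\<exists>Ob. open Ob \<and> x \<in> Ob \<and> Ob \<subseteq> U \<and> Wneg Ob 1 \<alpha>" if x: "x \<in> U - P" for x
  proof -
    have "\<forall>I. \<exists>V. open V \<and> x \<in> V \<and> V \<subseteq> U \<and> (\<forall>y\<in>V. exp_small_at U (\<lambda>h x. \<alpha> h x I) y)"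
      using asym_form_exp_small_at_off[OF \<alpha>] x by (intro allI exp_small_at_open) auto
    from choice[OF this] obtain V where V: "\<forall>I. open (V I) \<and> x \<in> V I \<and> V I \<subseteq> U \<and> (\<forall>y\<in>V I. exp_small_at U (\<lambda>h x. \<alpha> h x I) y)"
      by (elim exE)
    define Ob where "Ob = (\<Inter>I. V I)"
    have "open Ob" "x \<in> Ob" using V by (auto simp: Ob_def intro: open_INT)
    moreover have sub: "Ob \<subseteq> U" using V unfolding Ob_def by blast
    moreover have "Wneg Ob 1 \<alpha>"
    proof (rule Wneg_I)
      show "formk Ob 1 \<alpha>" using \<alpha> sub by (auto simp: asym_form_def intro: formk_subset)
      show "exp_small_at Ob (\<lambda>h x. \<alpha> h x I) y" if y: "y \<in> Ob" for y I
      proof -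
        have "y \<in> V I" using y by (simp add: Ob_def)
        then have "exp_small_at U (\<lambda>h x. \<alpha> h x I) y" using V by simp
        then show ?thesis using \<open>open Ob\<close> y by (rule exp_small_at_restrict)
      qed
    qed
    ultimately show ?thesis by blast
  qed
  have near: "\<exists>Ob h \<eta>. open Ob \<and> P \<subseteq> Ob \<and> Ob \<subseteq> U \<and> Wneg Ob 1 \<eta> \<and>
         (\<forall>hb>0. \<forall>x\<in>Ob. \<forall>I. \<alpha> hb x I = h hb x * cov1 l I + \<eta> hb x I)"
  proof -
    define \<eta> where "\<eta> h x I = \<alpha> h x I + (- cov1 l I) * f h x" for h x I
    have \<eta>1: "\<eta> h x {i} = iota0 (axis i 1 - (l $ i) *\<^sub>R v) (\<alpha> h x) {}" for h x i
      using covector_split[of "\<alpha> h x" i l v] by (simp add: \<eta>_def f_def cov1_def)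
    have \<eta>0: "\<eta> h x I = 0" if "h > 0" "x \<in> U" "card I \<noteq> 1" for h x I
      using asym_form_card[OF \<alpha> that] that by (simp add: \<eta>_def cov1_def)
    have "smooth U (\<lambda>h x. \<eta> h x I)" for I
      unfolding \<eta>_def by (intro smooth_add[OF U] smooth_cmult[OF U] sm fs)
    then have fk: "formk U 1 \<eta>" using \<eta>0 by (simp add: formk_iff)
    have "Wneg U 1 \<eta>"
    proof (rule Wneg_I[OF fk])
      fix x I assume x: "x \<in> U"
      show "exp_small_at U (\<lambda>h x. \<eta> h x I) x"
      proof (cases "card I = 1")
        case True
        then obtain i where I: "I = {i}" by (metis card_1_singletonE)
        have "axis i 1 - (l $ i) *\<^sub>R v \<in> {v. l \<bullet> v = 0}"
          by (simp add: inner_diff_right lv inner_axis)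
        then show ?thesis unfolding I \<eta>1 by (rule asym_form_exp_small_at_iota[OF \<alpha> x])
      next
        case False
        then show ?thesis by (subst exp_small_at_cong[OF U \<eta>0]) (auto intro: exp_small_at_zero[OF U x])
      qed
    qed
    then show ?thesis
      using U PU by (intro exI[of _ U] exI[of _ f] exI[of _ \<eta>]) (auto simp: \<eta>_def)
  qed
  have est: "\<exists>V. open V \<and> convex V \<and> p \<in> V \<and> V \<subseteq> U \<and>
         slice_bound V l p0 s f" if p: "p \<in> P" for p
  proof -
    have lp: "l \<bullet> (p - p0) = 0" using hull hull_inc[OF p, of affine] by auto
    obtain e where e: "e > 0" "cball p e \<subseteq> U" using U PU p open_contains_cball by blast
    define V where "V = ball p e"
    have VU: "V \<subseteq> U" using e ball_subset_cball by (auto simp: V_def)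
    \<comment> \<open>On a ball around p the leaves are indexed by an interval symmetric about 0,
      since l(p - p0) = 0.\<close>
    define M where "M = e * norm l"
    have M: "M > 0" using e l by (simp add: M_def)
    have NV: "(\<lambda>x. l \<bullet> (x - p0)) ` V = {-M<..<M}"
    proof (intro set_eqI iffI)
      fix y assume "y \<in> (\<lambda>x. l \<bullet> (x - p0)) ` V"
      then obtain x where "x \<in> V" and x: "y = l \<bullet> (x - p0)" by (elim imageE)
      then have "norm (x - p) < e" by (simp add: V_def dist_norm norm_minus_commute)
      note x = this x
      have "y = l \<bullet> (x - p)" using x(2) lp by (simp add: inner_diff_right)
      then have "\<bar>y\<bar> \<le> norm l * norm (x - p)" using Cauchy_Schwarz_ineq2 by blast
      also have "\<dots> < M" unfolding M_def using x l by (simp add: mult.commute)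
      finally show "y \<in> {-M<..<M}" by (auto simp: abs_less_iff)
    next
      fix y assume "y \<in> {-M<..<M}"
      then have y: "\<bar>y\<bar> < M" by auto
      have nv: "norm v = 1 / norm l"
        using l by (simp add: v_def dot_square_norm power2_eq_square)
      have "p + y *\<^sub>R v \<in> V" using y l by (simp add: V_def dist_norm M_def nv field_simps)
      moreover have "l \<bullet> (p + y *\<^sub>R v - p0) = y" using lp lv by (simp add: inner_diff_right inner_add_right)
      ultimately show "y \<in> (\<lambda>x. l \<bullet> (x - p0)) ` V" by (metis image_eqI)
    qed
    have "slice_bound V l p0 s f"
      unfolding slice_bound_def NV
    proof (intro allI)
      fix j \<beta>
      have "derivs_bounded (cball p e) (decay_weight w s (\<beta> + 2)) f"
        using fE e unfolding decay_def by simp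
      then have "derivs_bounded V (decay_weight w s (\<beta> + 2)) f"
        unfolding V_def by (rule derivs_bounded_subset[OF _ ball_subset_cball])
      from spec[OF this[unfolded derivs_bounded_iff_jnorm], of j]
      obtain D where D: "\<forall>\<^sub>F h in at_right 0. \<forall>x\<in>V. jnorm j (f h) x \<le> D * decay_weight w s (\<beta> + 2) j h x"
        by (elim exE)
      have "\<forall>\<^sub>F h in at_right 0. (\<forall>y\<in>{-M<..<M}. bdd_above (jnorm j (f h) ` {x\<in>V. l \<bullet> (x - p0) = y})) \<and>
                (\<lambda>y. \<bar>y\<bar> ^ \<beta> * Sup (jnorm j (f h) ` {x\<in>V. l \<bullet> (x - p0) = y})) integrable_on {-M<..<M} \<and>
                integral {-M<..<M} (\<lambda>y. \<bar>y\<bar> ^ \<beta> * Sup (jnorm j (f h) ` {x\<in>V. l \<bullet> (x - p0) = y}))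
                   \<le> (\<bar>D\<bar> * pi) * h powr (- (real j + s - real \<beta> - 1) / 2)"
        using D eventually_h01
      proof eventually_elim
        case (elim h)
        then have h: "0 < h" by simp
        define S where "S y = Sup (jnorm j (f h) ` {x\<in>V. l \<bullet> (x - p0) = y})" for y
        have ph_eq: "decay_weight w s (\<beta> + 2) j h x = h powr (- (real j + s) / 2) / (1 + \<bar>y\<bar> / sqrt h) ^ (\<beta> + 2)"
          if "l \<bullet> (x - p0) = y" for x y using that by (simp add: decay_weight_def w_def)
        have le: "jnorm j (f h) x \<le> \<bar>D\<bar> * decay_weight w s (\<beta> + 2) j h x" if "x \<in> V" for x
        proof -
          have "jnorm j (f h) x \<le> D * decay_weight w s (\<beta> + 2) j h x" using elim that by blast
          also have "\<dots> \<le> \<bar>D\<bar> * decay_weight w s (\<beta> + 2) j h x"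
            using nonneg_on_decay_weight[of w UNIV s "\<beta> + 2"] w h by (intro mult_right_mono) (auto simp: nonneg_on_def)
          finally show ?thesis .
        qed
        have bdd: "bdd_above (jnorm j (f h) ` {x\<in>V. l \<bullet> (x - p0) = y})" for y
          by (rule bdd_aboveI[where M="\<bar>D\<bar> * (h powr (- (real j + s) / 2) / (1 + \<bar>y\<bar> / sqrt h) ^ (\<beta> + 2))"])
            (use le ph_eq in auto)
        have S: "0 \<le> S y" "\<bar>y\<bar> ^ \<beta> * S y \<le> \<bar>D\<bar> * (h powr (- (real j + s - real \<beta>) / 2) * (h / (h + y\<^sup>2)))"
          if y: "y \<in> {-M<..<M}" for y
        proof -
          obtain x where x: "x \<in> V" "l \<bullet> (x - p0) = y" using y unfolding NV[symmetric] by auto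
          have "jnorm j (f h) x \<le> S y" unfolding S_def by (rule cSup_upper[OF _ bdd]) (use x in auto)
          then show "0 \<le> S y" using jnorm_nonneg order_trans by blast
          have "S y \<le> \<bar>D\<bar> * decay_weight w s (\<beta> + 2) j h x"
            unfolding S_def
          proof (rule cSup_least)
            show "jnorm j (f h) ` {x\<in>V. l \<bullet> (x - p0) = y} \<noteq> {}" using x by auto
            fix z assume "z \<in> jnorm j (f h) ` {x\<in>V. l \<bullet> (x - p0) = y}"
            then show "z \<le> \<bar>D\<bar> * decay_weight w s (\<beta> + 2) j h x"
              using le ph_eq ph_eq[OF x(2)] by auto
          qed
          then have "\<bar>y\<bar> ^ \<beta> * S y \<le> \<bar>y\<bar> ^ \<beta> * (\<bar>D\<bar> * decay_weight w s (\<beta> + 2) j h x)"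
            by (rule mult_left_mono) simp
          also have "\<dots> = \<bar>D\<bar> * (\<bar>w x\<bar> ^ \<beta> * decay_weight w s (\<beta> + 2) j h x)"
            using x by (simp add: w_def mult.left_commute)
          also have "\<dots> \<le> \<bar>D\<bar> * (h powr (- (real j + s - real \<beta>) / 2) * (h / (h + (w x)\<^sup>2)))"
            by (intro mult_left_mono decay_weight_alt h w) auto
          finally show "\<bar>y\<bar> ^ \<beta> * S y \<le> \<bar>D\<bar> * (h powr (- (real j + s - real \<beta>) / 2) * (h / (h + y\<^sup>2)))"
            using x by (simp add: w_def)
        qed
        note lor = lorentzian_integral_symmetric[OF h less_imp_le[OF M]]
        have contJ: "continuous_on V (jnorm j (f h))"
          unfolding jnorm_def[abs_def]
          by (intro continuous_intros continuous_on_subset[OF smooth_continuous_on_x[OF U smooth_iterpd[OF U fs] h] VU])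
        have Sm: "S \<in> borel_measurable (lebesgue_on {-M<..<M})"
          using measurable_Sup_slices(1)[OF _ l contJ bdd] unfolding NV S_def[abs_def] by (simp add: V_def)
        have ym: "(\<lambda>y. \<bar>y\<bar> ^ \<beta>) \<in> borel_measurable (lebesgue_on {-M<..<M})"
          by (intro continuous_imp_measurable_on_sets_lebesgue continuous_intros) auto
        have gi: "(\<lambda>y. \<bar>D\<bar> * (h powr (- (real j + s - real \<beta>) / 2) * (h / (h + y\<^sup>2)))) integrable_on {-M<..<M}"
          by (intro integrable_on_mult_right lor(1))
        have int: "(\<lambda>y. \<bar>y\<bar> ^ \<beta> * S y) integrable_on {-M<..<M}"
        proof (rule measurable_bounded_by_integrable_imp_integrable[OF _ gi])
          show "(\<lambda>y. \<bar>y\<bar> ^ \<beta> * S y) \<in> borel_measurable (lebesgue_on {-M<..<M})"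
            by (intro borel_measurable_times ym Sm)
          show "norm (\<bar>y\<bar> ^ \<beta> * S y) \<le> \<bar>D\<bar> * (h powr (- (real j + s - real \<beta>) / 2) * (h / (h + y\<^sup>2)))"
            if "y \<in> {-M<..<M}" for y using S[OF that] by simp
        qed auto
        have "integral {-M<..<M} (\<lambda>y. \<bar>y\<bar> ^ \<beta> * S y) \<le> integral {-M<..<M} (\<lambda>y. \<bar>D\<bar> * (h powr (- (real j + s - real \<beta>) / 2) * (h / (h + y\<^sup>2))))"
          by (rule integral_le[OF int gi S(2)])
        also have "\<dots> = \<bar>D\<bar> * (h powr (- (real j + s - real \<beta>) / 2) * integral {-M<..<M} (\<lambda>y. h / (h + y\<^sup>2)))"
          unfolding integral_mult_right ..
        also have "\<dots> \<le> \<bar>D\<bar> * (h powr (- (real j + s - real \<beta>) / 2) * (pi * sqrt h))"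
          by (intro mult_left_mono lor(2)) auto
        also have "\<dots> = (\<bar>D\<bar> * pi) * (h powr (- (real j + s - real \<beta>) / 2) * h powr (1 / 2))"
          using h by (simp add: powr_half_sqrt)
        also have "h powr (- (real j + s - real \<beta>) / 2) * h powr (1 / 2) = h powr (- (real j + s - real \<beta> - 1) / 2)"
          unfolding powr_add[symmetric] by (rule arg_cong[where f="\<lambda>a. h powr a"]) (simp add: field_simps)
        finally have "integral {-M<..<M} (\<lambda>y. \<bar>y\<bar> ^ \<beta> * S y) \<le> (\<bar>D\<bar> * pi) * h powr (- (real j + s - real \<beta> - 1) / 2)" .
        then show ?case using int unfolding S_def by (intro conjI ballI bdd)
      qed
      note ev = this
      show "\<exists>D. \<forall>\<^sub>F h in at_right 0. (\<forall>y\<in>{-M<..<M}. bdd_above (jnorm j (f h) ` {x\<in>V. l \<bullet> (x - p0) = y})) \<and>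
                (\<lambda>y. \<bar>y\<bar> ^ \<beta> * Sup (jnorm j (f h) ` {x\<in>V. l \<bullet> (x - p0) = y})) integrable_on {-M<..<M} \<and>
                integral {-M<..<M} (\<lambda>y. \<bar>y\<bar> ^ \<beta> * Sup (jnorm j (f h) ` {x\<in>V. l \<bullet> (x - p0) = y}))
                   \<le> D * h powr (- (real j + s - real \<beta> - 1) / 2)"
        by (rule exI) (rule ev)
    qed
    then show ?thesis
      using e VU by (intro exI[of _ V] conjI) (auto simp: V_def)
  qed
  show ?thesis
    unfolding asupp1_iff
  proof (intro conjI ballI)
    show "Winf U 1 \<alpha>" by (rule Winf_I[OF U \<alpha>]) simp
    show "\<exists>Ob. open Ob \<and> x \<in> Ob \<and> Ob \<subseteq> U \<and> Wneg Ob 1 \<alpha>" if "x \<in> U - P" for x using off that .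
    show "\<exists>l p0 v. l \<noteq> 0 \<and> affine hull P = {x. l \<bullet> (x - p0) = 0} \<and> l \<bullet> v = 1 \<and>
      (\<exists>Ob h \<eta>. open Ob \<and> P \<subseteq> Ob \<and> Ob \<subseteq> U \<and> Wneg Ob 1 \<eta> \<and>
         (\<forall>hb>0. \<forall>x\<in>Ob. \<forall>I. \<alpha> hb x I = h hb x * cov1 l I + \<eta> hb x I)) \<and>
      (\<forall>p\<in>P. \<exists>V. open V \<and> convex V \<and> p \<in> V \<and> V \<subseteq> U \<and>
         slice_bound V l p0 s (\<lambda>h x. iota0 v (\<alpha> h x) {}))"
      by (intro exI[of _ l] exI[of _ p0] exI[of _ v] conjI ballI l hull lv near est[unfolded f_def[abs_def]])
  qed
qed

lemma one_plus_power_le: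
  fixes t :: real assumes "0 \<le> t" shows "(1 + t) ^ b \<le> 2 ^ b * (1 + t ^ b)"
proof (cases "t \<le> 1")
  case True
  then have "(1 + t) ^ b \<le> 2 ^ b" using assms by (intro power_mono) auto
  also have "\<dots> \<le> 2 ^ b * (1 + t ^ b)" using assms by simp
  finally show ?thesis .
next
  case False
  then have "(1 + t) ^ b \<le> (2 * t) ^ b" by (intro power_mono) auto
  also have "\<dots> \<le> 2 ^ b * (1 + t ^ b)" by (simp add: power_mult_distrib)
  finally show ?thesis .
qed

text \<open>\<open>sobolev_slice\<close> bounds |y|^\<beta> times a derivative of order j by slice
  integrals of orders j and j + 1. The extra derivative costs half a power of h, which is exactly
  what the slice integrals are better by. The moments 0 and \<beta> together yield the decay weight
  with exponent \<beta>.\<close>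

lemma asupp1_derivs_bounded_near:
  fixes U :: "'n::{finite,linorder} rn set" and f :: "real \<Rightarrow> 'n rn \<Rightarrow> complex"
  assumes U: "open U" and sm: "smooth U f" and lv: "l \<bullet> v = 1"
    and V: "open V" "p \<in> V" "V \<subseteq> U"
    and w: "\<And>x. w x = c * \<bar>l \<bullet> (x - p0)\<bar>" "c \<ge> 0"
    and est: "slice_bound V l p0 s f"
  shows "\<exists>V'. open V' \<and> p \<in> V' \<and> V' \<subseteq> U \<and> (\<forall>\<beta>. derivs_bounded V' (decay_weight w s \<beta>) f)"
proof -
  obtain r where r: "r > 0" "ball p (2 * r) \<subseteq> V"
  proof -
    obtain e where "e > 0" "ball p e \<subseteq> V" using V open_contains_ball by metis
    then show ?thesis using that[of "e / 2"] by simp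
  qed
  have v0: "v \<noteq> 0" using lv by auto
  \<comment> \<open>A parameter |t| \<le> \<rho> moves a point by at most r, so segments starting in
    the ball of radius r stay in the ball of radius 2 r.\<close>
  define \<rho> where "\<rho> = r / norm v"
  have \<rho>: "\<rho> > 0" using r v0 by (simp add: \<rho>_def)
  define NV where "NV = (\<lambda>x. l \<bullet> (x - p0)) ` V"
  define S where "S j h y = Sup (jnorm j (f h) ` {x\<in>V. l \<bullet> (x - p0) = y})" for j h y
  have inV: "x + t *\<^sub>R v \<in> V" if "x \<in> ball p r" "\<bar>t\<bar> \<le> \<rho>" for x t
  proof -
    have "norm (t *\<^sub>R v) \<le> r"
      using that(2) v0 r by (simp add: \<rho>_def field_simps)
    then have "dist x (x + t *\<^sub>R v) \<le> r" by (simp add: dist_norm)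
    then have "dist p (x + t *\<^sub>R v) < 2 * r"
      using dist_triangle[of p "x + t *\<^sub>R v" x] that(1) by simp
    then show ?thesis using r(2) by auto
  qed
  have E: "\<exists>D. \<forall>\<^sub>F h in at_right 0. (\<forall>y\<in>NV. bdd_above (jnorm j (f h) ` {x\<in>V. l \<bullet> (x - p0) = y})) \<and>
      (\<lambda>y. \<bar>y\<bar> ^ \<beta> * S j h y) integrable_on NV \<and>
      integral NV (\<lambda>y. \<bar>y\<bar> ^ \<beta> * S j h y) \<le> D * h powr (- (real j + s - real \<beta> - 1) / 2)" for j \<beta>
    using spec[OF spec[OF est[unfolded slice_bound_def], of j], of \<beta>] unfolding NV_def S_def .
  have weighted: "\<exists>D. \<forall>\<^sub>F h in at_right 0. \<forall>x\<in>ball p r.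
      \<bar>l \<bullet> (x - p0)\<bar> ^ \<beta> * norm (iterpd ks (f h) x) \<le> D * h powr (- (real (length ks) + s - real \<beta>) / 2)" for ks \<beta>
  proof -
    define j where "j = length ks"
    define C where "C = (\<Sum>k\<in>UNIV. \<bar>v $ k\<bar>)"
    have C: "C \<ge> 0" by (simp add: C_def sum_nonneg)
    from E[of j \<beta>] obtain D0 where D0: "\<forall>\<^sub>F h in at_right 0. (\<forall>y\<in>NV. bdd_above (jnorm j (f h) ` {x\<in>V. l \<bullet> (x - p0) = y})) \<and>
      (\<lambda>y. \<bar>y\<bar> ^ \<beta> * S j h y) integrable_on NV \<and>
      integral NV (\<lambda>y. \<bar>y\<bar> ^ \<beta> * S j h y) \<le> D0 * h powr (- (real j + s - real \<beta> - 1) / 2)" by (elim exE)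
    from E[of "Suc j" \<beta>] obtain D1 where D1: "\<forall>\<^sub>F h in at_right 0. (\<forall>y\<in>NV. bdd_above (jnorm (Suc j) (f h) ` {x\<in>V. l \<bullet> (x - p0) = y})) \<and>
      (\<lambda>y. \<bar>y\<bar> ^ \<beta> * S (Suc j) h y) integrable_on NV \<and>
      integral NV (\<lambda>y. \<bar>y\<bar> ^ \<beta> * S (Suc j) h y) \<le> D1 * h powr (- (real (Suc j) + s - real \<beta> - 1) / 2)" by (elim exE)
    have "\<forall>\<^sub>F h in at_right 0. \<forall>x\<in>ball p r. \<bar>l \<bullet> (x - p0)\<bar> ^ \<beta> * norm (iterpd ks (f h) x)
       \<le> ((1 / \<rho>) * \<bar>D0\<bar> + C * \<bar>D1\<bar>) * h powr (- (real j + s - real \<beta>) / 2)"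
      using D0 D1 eventually_h01
    proof (eventually_elim, intro ballI)
      fix h x
      assume a1: "(\<forall>y\<in>NV. bdd_above (jnorm j (f h) ` {x\<in>V. l \<bullet> (x - p0) = y})) \<and>
          (\<lambda>y. \<bar>y\<bar> ^ \<beta> * S j h y) integrable_on NV \<and>
          integral NV (\<lambda>y. \<bar>y\<bar> ^ \<beta> * S j h y) \<le> D0 * h powr (- (real j + s - real \<beta> - 1) / 2)"
        and a2: "(\<forall>y\<in>NV. bdd_above (jnorm (Suc j) (f h) ` {x\<in>V. l \<bullet> (x - p0) = y})) \<and>
          (\<lambda>y. \<bar>y\<bar> ^ \<beta> * S (Suc j) h y) integrable_on NV \<and>
          integral NV (\<lambda>y. \<bar>y\<bar> ^ \<beta> * S (Suc j) h y) \<le> D1 * h powr (- (real (Suc j) + s - real \<beta> - 1) / 2)"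
        and h01: "0 < h \<and> h < 1" and xb: "x \<in> ball p r"
      note elim = this
      have h: "0 < h" "h < 1" using h01 by auto
      have up: "jnorm i (f h) z \<le> S i h (l \<bullet> (z - p0))" if z: "z \<in> V" and i: "i = j \<or> i = Suc j" for z i
      proof -
        have m: "l \<bullet> (z - p0) \<in> NV" using z by (auto simp: NV_def)
        have "bdd_above (jnorm i (f h) ` {x\<in>V. l \<bullet> (x - p0) = l \<bullet> (z - p0)})"
          using bspec[OF conjunct1[OF a1] m] bspec[OF conjunct1[OF a2] m] i by (elim disjE) simp_all
        then show ?thesis unfolding S_def by (intro cSup_upper) (use z in auto)
      qed
      have Snn: "0 \<le> \<bar>y\<bar> ^ \<beta> * S i h y" if y: "y \<in> NV" and i: "i = j \<or> i = Suc j" for y i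
      proof -
        obtain z where z: "z \<in> V" "y = l \<bullet> (z - p0)" using y by (auto simp: NV_def)
        have "0 \<le> S i h y" using order_trans[OF jnorm_nonneg up[OF z(1) i]] z(2) by simp
        then show ?thesis by simp
      qed
      have "\<bar>l \<bullet> (x - p0)\<bar> ^ \<beta> * norm (iterpd ks (f h) x) \<le> (1 / \<rho>) * integral NV (\<lambda>y. \<bar>y\<bar> ^ \<beta> * S j h y)
          + (\<Sum>k\<in>UNIV. \<bar>v $ k\<bar>) * integral NV (\<lambda>y. \<bar>y\<bar> ^ \<beta> * S (Suc j) h y)"
      proof (rule sobolev_slice[OF \<rho> lv, where V=V])
        show "iterpd ks (f h) differentiable at z" if "z \<in> V" for z
          using that V h by (intro smooth_differentiable[OF U smooth_iterpd[OF U sm]]) auto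
        show "x + t *\<^sub>R v \<in> V" if "\<bar>t\<bar> \<le> \<rho>" for t using inV[OF xb that] .
        show "\<bar>l \<bullet> (z - p0)\<bar> ^ \<beta> * norm (iterpd ks (f h) z) \<le> \<bar>l \<bullet> (z - p0)\<bar> ^ \<beta> * S j h (l \<bullet> (z - p0))"
          if "z \<in> V" for z
          using order_trans[OF iterpd_le_jnorm up[OF that]] by (intro mult_left_mono) (auto simp: j_def)
        show "\<bar>l \<bullet> (z - p0)\<bar> ^ \<beta> * norm (pd k (iterpd ks (f h)) z) \<le> \<bar>l \<bullet> (z - p0)\<bar> ^ \<beta> * S (Suc j) h (l \<bullet> (z - p0))"
          if "z \<in> V" for z k
          using order_trans[OF iterpd_le_jnorm[of "k # ks"] up[OF that]] by (intro mult_left_mono) (auto simp: j_def)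
      qed (use a1 a2 Snn NV_def in \<open>simp_all\<close>)
      also have "\<dots> \<le> (1 / \<rho>) * (\<bar>D0\<bar> * h powr (- (real j + s - real \<beta>) / 2)) + C * (\<bar>D1\<bar> * h powr (- (real j + s - real \<beta>) / 2))"
        unfolding C_def[symmetric]
      proof (intro add_mono mult_left_mono)
        have "integral NV (\<lambda>y. \<bar>y\<bar> ^ \<beta> * S j h y) \<le> D0 * h powr (- (real j + s - real \<beta> - 1) / 2)" using a1 by (elim conjE)
        \<comment> \<open>At order j half a power of h is to spare, and h < 1 allows it to be
          dropped; at order j + 1 the exponents agree exactly.\<close>
        also have "\<dots> \<le> \<bar>D0\<bar> * h powr (- (real j + s - real \<beta>) / 2)"
          using h by (intro mult_mono powr_le_powr_01) auto
        finally show "integral NV (\<lambda>y. \<bar>y\<bar> ^ \<beta> * S j h y) \<le> \<bar>D0\<bar> * h powr (- (real j + s - real \<beta>) / 2)" .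
        have "integral NV (\<lambda>y. \<bar>y\<bar> ^ \<beta> * S (Suc j) h y) \<le> D1 * h powr (- (real (Suc j) + s - real \<beta> - 1) / 2)" using a2 by (elim conjE)
        also have "\<dots> \<le> \<bar>D1\<bar> * h powr (- (real (Suc j) + s - real \<beta> - 1) / 2)"
          by (intro mult_right_mono) auto
        also have "- (real (Suc j) + s - real \<beta> - 1) / 2 = - (real j + s - real \<beta>) / 2" by simp
        finally show "integral NV (\<lambda>y. \<bar>y\<bar> ^ \<beta> * S (Suc j) h y) \<le> \<bar>D1\<bar> * h powr (- (real j + s - real \<beta>) / 2)" .
      qed (use \<rho> C in \<open>auto simp: C_def sum_nonneg\<close>)
      finally show "\<bar>l \<bullet> (x - p0)\<bar> ^ \<beta> * norm (iterpd ks (f h) x)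
          \<le> ((1 / \<rho>) * \<bar>D0\<bar> + C * \<bar>D1\<bar>) * h powr (- (real j + s - real \<beta>) / 2)"
        by (simp add: algebra_simps)
    qed
    then show ?thesis unfolding j_def by (rule exI)
  qed
  have "derivs_bounded (ball p r) (decay_weight w s \<beta>) f" for \<beta>
    unfolding derivs_bounded_def derivs_bounded_ord_def
  proof (intro allI impI)
    fix n and ks :: "'n list" assume n: "length ks = n"
    from weighted[where \<beta>=0 and ks=ks] obtain D0 where D0: "\<forall>\<^sub>F h in at_right 0. \<forall>x\<in>ball p r.
      \<bar>l \<bullet> (x - p0)\<bar> ^ 0 * norm (iterpd ks (f h) x) \<le> D0 * h powr (- (real (length ks) + s - real 0) / 2)" by (elim exE)
    from weighted[where \<beta>=\<beta> and ks=ks] obtain D1 where D1: "\<forall>\<^sub>F h in at_right 0. \<forall>x\<in>ball p r.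
      \<bar>l \<bullet> (x - p0)\<bar> ^ \<beta> * norm (iterpd ks (f h) x) \<le> D1 * h powr (- (real (length ks) + s - real \<beta>) / 2)" by (elim exE)
    have "\<forall>\<^sub>F h in at_right 0. \<forall>x\<in>ball p r. norm (iterpd ks (f h) x) \<le> (2 ^ \<beta> * (D0 + c ^ \<beta> * D1)) * decay_weight w s \<beta> n h x"
      using D0 D1 eventually_h01
    proof (eventually_elim, intro ballI)
      fix h x
      assume a1: "\<forall>x\<in>ball p r. \<bar>l \<bullet> (x - p0)\<bar> ^ 0 * norm (iterpd ks (f h) x) \<le> D0 * h powr (- (real (length ks) + s - real 0) / 2)"
        and a2: "\<forall>x\<in>ball p r. \<bar>l \<bullet> (x - p0)\<bar> ^ \<beta> * norm (iterpd ks (f h) x) \<le> D1 * h powr (- (real (length ks) + s - real \<beta>) / 2)"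
        and h01: "0 < h \<and> h < 1" and xb: "x \<in> ball p r"
      note elim = this
      have h: "0 < h" "h < 1" using h01 by auto
      define F where "F = norm (iterpd ks (f h) x)"
      define E where "E = h powr (- (real n + s) / 2)"
      define y where "y = \<bar>l \<bullet> (x - p0)\<bar>"
      have F: "F \<ge> 0" by (simp add: F_def)
      have a: "F \<le> D0 * E" using elim n by (simp add: F_def E_def)
      have b: "y ^ \<beta> * F \<le> D1 * (E * sqrt h ^ \<beta>)"
      proof -
        have "E * sqrt h ^ \<beta> = h powr (- (real n + s - real \<beta>) / 2)"
          unfolding powr_mult_sqrt_power[OF h(1)] E_def powr_add[symmetric]
          by (rule arg_cong[where f="\<lambda>a. h powr a"]) (simp add: field_simps)
        then show ?thesis using elim n by (simp add: F_def y_def)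
      qed
      have t: "0 \<le> w x / sqrt h" using w h by simp
      have "(1 + w x / sqrt h) ^ \<beta> * F \<le> 2 ^ \<beta> * (1 + (w x / sqrt h) ^ \<beta>) * F"
        using F one_plus_power_le[OF t] by (intro mult_right_mono) auto
      also have "\<dots> = 2 ^ \<beta> * (F + c ^ \<beta> * (y ^ \<beta> * F) / sqrt h ^ \<beta>)"
        by (simp add: w(1) y_def power_divide power_mult_distrib algebra_simps)
      also have "\<dots> \<le> 2 ^ \<beta> * (D0 * E + c ^ \<beta> * (D1 * (E * sqrt h ^ \<beta>)) / sqrt h ^ \<beta>)"
        using a b w(2) h by (intro mult_left_mono add_mono divide_right_mono) auto
      also have "\<dots> = (2 ^ \<beta> * (D0 + c ^ \<beta> * D1)) * E"
        using h by (simp add: algebra_simps)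
      finally have "(1 + w x / sqrt h) ^ \<beta> * F \<le> (2 ^ \<beta> * (D0 + c ^ \<beta> * D1)) * E" .
      moreover have "0 < (1 + w x / sqrt h) ^ \<beta>" using t by (intro zero_less_power) auto
      ultimately have "F \<le> (2 ^ \<beta> * (D0 + c ^ \<beta> * D1)) * E / (1 + w x / sqrt h) ^ \<beta>"
        by (simp only: pos_le_divide_eq mult.commute)
      then show "norm (iterpd ks (f h) x) \<le> (2 ^ \<beta> * (D0 + c ^ \<beta> * D1)) * decay_weight w s \<beta> n h x"
        by (simp add: F_def E_def decay_weight_def)
    qed
    then show "\<exists>D. \<forall>\<^sub>F h in at_right 0. \<forall>x\<in>ball p r. norm (iterpd ks (f h) x) \<le> D * decay_weight w s \<beta> n h x"
      by (rule exI)
  qed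
  moreover have "ball p r \<subseteq> U"
  proof -
    have "ball p r \<subseteq> ball p (2 * r)" using r(1) by (intro subset_ball) simp
    then show ?thesis using r(2) V(3) by (meson subset_trans)
  qed
  ultimately show ?thesis using r by (intro exI[of _ "ball p r"]) auto
qed

text \<open>Near P the given decomposition shows that a tangent vector sees only \<eta>; away from P
  everything is exponentially small. Hence each coefficient is l_i times the normal coefficient up
  to exponentially small terms, and only the normal one needs the slice estimates. P' may exceed P
  because a larger support is a weaker claim.\<close>

lemma asupp1D:
  fixes \<alpha> :: "'n::{finite,linorder} form"
  assumes U: "open U" and \<alpha>: "asupp1 U P s \<alpha>"
    and hull: "affine hull P = {x. l' \<bullet> (x - p0') = 0}" and l': "l' \<noteq> 0"
    and PU: "P \<subseteq> P'"
  shows "asym_form U 1 {v. l' \<bullet> v = 0} (\<lambda>x. \<bar>l' \<bullet> (x - p0')\<bar>) P' s \<alpha>"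
proof -
  define w where "w x = \<bar>l' \<bullet> (x - p0')\<bar>" for x
  have w: "0 \<le> w x" for x by (simp add: w_def)
  have wc: "continuous_on U w" unfolding w_def by (intro continuous_intros)
  have fk: "formk U 1 \<alpha>" using \<alpha> by (simp add: asupp1_iff Winf_def)
  then have sm: "smooth U (\<lambda>h x. \<alpha> h x I)" and c0: "h > 0 \<Longrightarrow> x \<in> U \<Longrightarrow> card I \<noteq> 1 \<Longrightarrow> \<alpha> h x I = 0" for h x I
    by (auto simp: formk_iff)
  have off: "exp_small_at U (\<lambda>h x. \<alpha> h x I) x" if x: "x \<in> U" "x \<notin> P" for x I
  proof -
    obtain Ob where "open Ob" "x \<in> Ob" "Ob \<subseteq> U" "Wneg Ob 1 \<alpha>"
      using \<alpha> x unfolding asupp1_iff by blast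
    then show ?thesis using Wneg_exp_small_at exp_small_at_subset by metis
  qed
  from \<alpha>[unfolded asupp1_iff, THEN conjunct2, THEN conjunct2]
  obtain l p0 v Ob hh \<eta> where l: "l \<noteq> 0" and hull': "affine hull P = {x. l \<bullet> (x - p0) = 0}" and lv: "l \<bullet> v = 1"
    and Ob: "open Ob" "P \<subseteq> Ob" "Ob \<subseteq> U" "Wneg Ob 1 \<eta>"
    and \<alpha>_eq: "\<forall>hb>0. \<forall>x\<in>Ob. \<forall>I. \<alpha> hb x I = hh hb x * cov1 l I + \<eta> hb x I"
    and est: "\<forall>p\<in>P. \<exists>V. open V \<and> convex V \<and> p \<in> V \<and> V \<subseteq> U \<and>
         slice_bound V l p0 s (\<lambda>h x. iota0 v (\<alpha> h x) {})"
    by (elim exE conjE) (rule that; assumption)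
  define c where "c = l' \<bullet> v"
  note hyp = hyperplane_eq_imp[OF trans[OF hull'[symmetric] hull] lv, folded c_def]
  have c: "c \<noteq> 0" using hyp(1)[of l'] l' by auto
  have w_eq: "w x = \<bar>c\<bar> * \<bar>l \<bullet> (x - p0)\<bar>" for x
    unfolding w_def hyp(2) abs_mult ..
  have tang0: "exp_small_at U (\<lambda>h x. iota0 u (\<alpha> h x) {}) x" if u: "l \<bullet> u = 0" and x: "x \<in> U" for u x
  proof (cases "x \<in> P")
    case True
    have "(\<Sum>k\<in>UNIV. complex_of_real (u $ k) * complex_of_real (l $ k)) = complex_of_real (l \<bullet> u)"
      by (simp add: inner_vec_def mult.commute)
    then have z: "(\<Sum>k\<in>UNIV. complex_of_real (u $ k) * complex_of_real (l $ k)) = 0" using u by simp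
    have eq: "iota0 u (\<alpha> h y) {} = iota0 u (\<eta> h y) {}" if "h > 0" "y \<in> Ob" for h y
    proof -
      have "iota0 u (\<alpha> h y) {} = (\<Sum>k\<in>UNIV. hh h y * (complex_of_real (u $ k) * complex_of_real (l $ k)) + complex_of_real (u $ k) * \<eta> h y {k})"
        unfolding iota0_empty using \<alpha>_eq that by (intro sum.cong) (auto simp: cov1_def algebra_simps)
      also have "\<dots> = hh h y * (\<Sum>k\<in>UNIV. complex_of_real (u $ k) * complex_of_real (l $ k)) + iota0 u (\<eta> h y) {}"
        by (simp add: sum.distrib sum_distrib_left iota0_empty)
      finally show ?thesis using z by simp
    qed
    have \<eta>s: "smooth Ob (\<lambda>h x. \<eta> h x I)" for I using Ob(4) by (simp add: Wneg_def formk_iff)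
    have "exp_small_at Ob (\<lambda>h x. iota0 u (\<eta> h x) {}) x"
      by (rule exp_small_at_iota0[OF Ob(1) \<eta>s Wneg_exp_small_at[OF Ob(4)]]) (use True Ob in auto)
    then have "exp_small_at Ob (\<lambda>h x. iota0 u (\<alpha> h x) {}) x"
      by (subst exp_small_at_cong[OF Ob(1) eq])
    then show ?thesis using Ob(3) by (rule exp_small_at_subset)
  next
    case False
    then show ?thesis by (intro exp_small_at_iota0[OF U] sm off x)
  qed
  have tang: "exp_small_at U (\<lambda>h x. iota0 u (\<alpha> h x) J) x" if u: "l \<bullet> u = 0" and x: "x \<in> U" for u x J
  proof (cases "J = {}")
    case True
    then show ?thesis using tang0[OF u x] by simp
  next
    case False
    then have "iota0 u (\<alpha> h y) J = 0" if "h > 0" "y \<in> U" for h y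
      using c0[OF that] by (intro iota0_eq_0[where k=0]) auto
    then show ?thesis by (subst exp_small_at_cong[OF U]) (auto intro: exp_small_at_zero[OF U x])
  qed
  define f where "f h x = iota0 v (\<alpha> h x) {}" for h x
  have fs: "smooth U f" unfolding f_def[abs_def] by (intro smooth_iota0[OF U] sm)
  have fE: "decay U w s f"
  proof (rule decay_local[OF U _ w])
    fix x \<beta> assume x: "x \<in> U"
    show "\<exists>V. open V \<and> x \<in> V \<and> derivs_bounded V (decay_weight w s \<beta>) f"
    proof (cases "x \<in> P")
      case True
      from bspec[OF est True] obtain V where V: "open V" "x \<in> V" "V \<subseteq> U"
        and e: "slice_bound V l p0 s (\<lambda>h x. iota0 v (\<alpha> h x) {})"
        by (elim exE conjE) (rule that; assumption)
      from asupp1_derivs_bounded_near[OF U fs lv V w_eq abs_ge_zero e[folded f_def[abs_def]]]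
      obtain V' where V': "open V'" "x \<in> V'" "\<forall>\<beta>. derivs_bounded V' (decay_weight w s \<beta>) f"
        by (elim exE conjE) (rule that; assumption)
      show ?thesis by (intro exI[of _ V'] conjI V' spec[OF V'(3)])
    next
      case False
      have "exp_small_at U f x" unfolding f_def[abs_def] by (intro exp_small_at_iota0[OF U] sm off x False)
      from exp_small_at_derivs_bounded[OF U this wc w, of s]
      obtain V' where V': "open V'" "x \<in> V'" "\<forall>\<beta>. derivs_bounded V' (decay_weight w s \<beta>) f"
        by (elim exE conjE) (rule that; assumption)
      show ?thesis by (intro exI[of _ V'] conjI V' spec[OF V'(3)])
    qed
  qed
  have Est: "decay U w s (\<lambda>h x. \<alpha> h x I)" for I
  proof (cases "card I = 1")
    case True
    then obtain i where I: "I = {i}" by (metis card_1_singletonE)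
    have lk: "l \<bullet> (axis i 1 - (l $ i) *\<^sub>R v) = 0" by (simp add: inner_diff_right lv inner_axis)
    have "decay U w s (\<lambda>h x. complex_of_real (l $ i) * f h x + iota0 (axis i 1 - (l $ i) *\<^sub>R v) (\<alpha> h x) {})"
      by (intro decay_add[OF U] smooth_cmult[OF U] decay_cmult[OF U] fs fE w smooth_iota0[OF U] sm decay_exp_small_at[OF U] tang lk wc)
    then show ?thesis unfolding I f_def by (simp add: covector_split[of _ i l v, symmetric])
  next
    case False
    then show ?thesis
      by (subst decay_cong[OF U c0]) (auto intro!: decay_exp_small_at[OF U] exp_small_at_zero[OF U] wc w)
  qed
  have "l \<bullet> u = 0" if "l' \<bullet> u = 0" for u using hyp(1)[of u] c that by simp
  then have "\<forall>u\<in>{v. l' \<bullet> v = 0}. \<forall>J. \<forall>x\<in>U. exp_small_at U (\<lambda>h x. iota0 u (\<alpha> h x) J) x" using tang by simp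
  moreover have "\<forall>x\<in>U - P'. \<forall>I. exp_small_at U (\<lambda>h x. \<alpha> h x I) x"
    using off PU by (intro ballI allI) (meson DiffD1 DiffD2 subsetD)
  ultimately show ?thesis
    unfolding asym_form_def w_def[symmetric] using fk Est by (intro conjI allI)
qed

subsection \<open>Solving the fixed point equations order by order\<close>

text \<open>\<open>Phi_of\<close> and \<open>Psi_of\<close> are definite descriptions, so unique
  existence is needed before their equations can be used. If \<open>T X j\<close> sees only entries
  below j, the finite stages stabilise and their diagonal is the solution.\<close>

lemma ex1_recursive:
  fixes T :: "(nat \<Rightarrow> 'a) \<Rightarrow> nat \<Rightarrow> 'a"
  assumes causal: "\<And>X Y j. X 0 = z \<Longrightarrow> Y 0 = z \<Longrightarrow> (\<And>i. i < j \<Longrightarrow> X i = Y i) \<Longrightarrow> T X j = T Y j"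
    and T0: "\<And>X. X 0 = z \<Longrightarrow> T X 0 = z"
  shows "\<exists>!X. X 0 = z \<and> (\<forall>j. X j = T X j)"
proof -
  \<comment> \<open>Stage \<open>Z n\<close> is correct up to index n; later stages alter only later
    entries.\<close>
  define Z where "Z = rec_nat (\<lambda>_. z) (\<lambda>n Zn. Zn(Suc n := T Zn (Suc n)))"
  have Z: "Z 0 = (\<lambda>_. z)" "Z (Suc n) = (Z n)(Suc n := T (Z n) (Suc n))" for n
    by (simp_all add: Z_def)
  have stable: "Z (n + k) i = Z n i" if "i \<le> n" for n k i
    using that by (induction k) (auto simp: Z)
  define X where "X j = Z j j" for j
  have XZ: "X i = Z n i" if "i \<le> n" for i n
    using stable[of i i "n - i"] that by (simp add: X_def)
  have X0: "X 0 = z" by (simp add: X_def Z)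
  have "X j = T X j" for j
  proof (cases j)
    case 0
    then show ?thesis using X0 T0 by simp
  next
    case (Suc n)
    have "X (Suc n) = T (Z n) (Suc n)" by (simp add: X_def Z)
    also have "\<dots> = T X (Suc n)"
      by (rule causal) (auto simp: XZ[of _ n] X0 XZ[of 0 n, symmetric])
    finally show ?thesis using Suc by simp
  qed
  then have ex: "X 0 = z \<and> (\<forall>j. X j = T X j)" using X0 by simp
  moreover have "Y = X" if Y: "Y 0 = z \<and> (\<forall>j. Y j = T Y j)" for Y
  proof
    fix j show "Y j = X j"
    proof (induction j rule: less_induct)
      case (less j)
      have "T Y j = T X j" by (rule causal) (use Y X0 less in auto)
      then show ?case using Y ex by metis
    qed
  qed
  ultimately show ?thesis by blast
qed

section \<open>Products of series and the two fixed points\<close>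

abbreviation zero_vform :: "'n::{finite,linorder} vform" where "zero_vform \<equiv> \<lambda>l h x K. 0"

lemma wedge_zero: "wedge (\<lambda>h x K. 0) B = (\<lambda>h x K. 0)" "wedge A (\<lambda>h x K. 0) = (\<lambda>h x K. 0)"
  by (simp_all add: wedge_def wedge0_def fun_eq_iff)

lemma twedge_zero: "twedge (\<lambda>h x K. 0) B = (\<lambda>h x K. 0)" "twedge A (\<lambda>h x K. 0) = (\<lambda>h x K. 0)"
  by (simp_all add: twedge_def fun_eq_iff)

lemma nabla_zero: "nabla w (\<lambda>h x K. 0) = (\<lambda>h x K. 0)"
  by (simp add: nabla_def fun_eq_iff pd_const)

lemma brk_zero: "brk g m m' zero_vform B = zero_vform" "brk g m m' A zero_vform = zero_vform"
  by (simp_all add: brk_def tbr_def wedge_zero twedge_zero nabla_zero)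

lemma nbr_zero: "nbr m m' zero_vform B = zero_vform" "nbr m m' A zero_vform = zero_vform"
  by (simp_all add: nbr_def wedge_zero)

lemma Hv_zero: "Hv G x0 m zero_vform = zero_vform"
proof -
  have "iota0 v (\<lambda>K. 0) J = 0" for v and J :: "'a set" by (simp add: iota0_def)
  then show ?thesis
    by (simp add: Hv_def Hm_def pull0_def oint_def fun_eq_iff)
qed

text \<open>The full bracket and the leading bracket differ only in the operation \<open>b\<close>
  on coefficients; keeping it as a parameter lets one argument handle both equations.\<close>

definition sprod :: "((int,'n::{finite,linorder}) vec \<Rightarrow> (int,'n) vec \<Rightarrow> 'n vform \<Rightarrow> 'n vform \<Rightarrow> 'n vform) \<Rightarrow> 'n series \<Rightarrow> 'n series \<Rightarrow> 'n series" where
  "sprod b \<Phi> \<Psi> j m = (\<lambda>l h x K. \<Sum>j1\<in>{..j}. \<Sum>m1\<in>ssupp \<Phi> j1.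
       b m1 (m - m1) (\<Phi> j1 m1) (\<Psi> (j - j1) (m - m1)) l h x K)"

lemma sbr_sprod: "sbr g = sprod (brk g)"
  by (simp add: fun_eq_iff sbr_def sprod_def)

lemma snat_sprod: "snat = sprod nbr"
  by (simp add: fun_eq_iff snat_def sprod_def)

text \<open>The orders 0 and j drop out because the coefficient of order 0 vanishes. Enlarging the
  index set from the support to a finite M allows two series to be subtracted term by term;
  finiteness matters, as a sum over an infinite set is 0 by convention.\<close>

lemma sprod_restrict:
  assumes b: "\<And>m m' B. b m m' zero_vform B = zero_vform" "\<And>m m' A. b m m' A zero_vform = zero_vform"
    and X0: "\<And>m. X 0 m = zero_vform"
    and M: "\<And>i. 0 < i \<Longrightarrow> i < j \<Longrightarrow> finite (M i) \<and> ssupp X i \<subseteq> M i"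
  shows "sprod b X X j m = (\<lambda>l h x K. \<Sum>j1\<in>{0<..<j}. \<Sum>m1\<in>M j1.
       b m1 (m - m1) (X j1 m1) (X (j - j1) (m - m1)) l h x K)"
proof (intro ext)
  fix l h x K
  have "(\<Sum>j1\<in>{..j}. \<Sum>m1\<in>ssupp X j1. b m1 (m - m1) (X j1 m1) (X (j - j1) (m - m1)) l h x K)
    = (\<Sum>j1\<in>{0<..<j}. \<Sum>m1\<in>ssupp X j1. b m1 (m - m1) (X j1 m1) (X (j - j1) (m - m1)) l h x K)"
  proof (rule sum.mono_neutral_right)
    show "\<forall>i\<in>{..j} - {0<..<j}. (\<Sum>m1\<in>ssupp X i. b m1 (m - m1) (X i m1) (X (j - i) (m - m1)) l h x K) = 0"
    proof
      fix i assume "i \<in> {..j} - {0<..<j}"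
      then have "i = 0 \<or> i = j" by auto
      then show "(\<Sum>m1\<in>ssupp X i. b m1 (m - m1) (X i m1) (X (j - i) (m - m1)) l h x K) = 0"
        by (auto simp: X0 b ssupp_def)
    qed
  qed auto
  also have "\<dots> = (\<Sum>j1\<in>{0<..<j}. \<Sum>m1\<in>M j1. b m1 (m - m1) (X j1 m1) (X (j - j1) (m - m1)) l h x K)"
  proof (rule sum.cong[OF refl])
    fix i assume "i \<in> {0<..<j}"
    then have Mi: "finite (M i)" "ssupp X i \<subseteq> M i" using M[of i] by auto
    show "(\<Sum>m1\<in>ssupp X i. b m1 (m - m1) (X i m1) (X (j - i) (m - m1)) l h x K)
       = (\<Sum>m1\<in>M i. b m1 (m - m1) (X i m1) (X (j - i) (m - m1)) l h x K)"
    proof (rule sum.mono_neutral_left[OF Mi])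
      show "\<forall>m1\<in>M i - ssupp X i. b m1 (m - m1) (X i m1) (X (j - i) (m - m1)) l h x K = 0"
      proof
        fix m1 assume "m1 \<in> M i - ssupp X i"
        then have "X i m1 = zero_vform" by (simp add: ssupp_def)
        then show "b m1 (m - m1) (X i m1) (X (j - i) (m - m1)) l h x K = 0" by (simp add: b)
      qed
    qed
  qed
  finally show "sprod b X X j m l h x K = (\<Sum>j1\<in>{0<..<j}. \<Sum>m1\<in>M j1. b m1 (m - m1) (X j1 m1) (X (j - j1) (m - m1)) l h x K)"
    by (simp add: sprod_def)
qed

text \<open>Order j of the product pairs the orders i and j - i, and a pair containing j itself
  meets the vanishing order 0. So \<open>X j\<close> occurs in the sum without influencing
  it.\<close>

lemma sprod_causal:
  assumes b: "\<And>m m' B. b m m' zero_vform B = zero_vform" "\<And>m m' A. b m m' A zero_vform = zero_vform"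
    and X0: "\<And>m. X 0 m = zero_vform" and Y0: "\<And>m. Y 0 m = zero_vform" and eq: "\<And>i. i < j \<Longrightarrow> X i = Y i"
  shows "sprod b X X j m = sprod b Y Y j m"
proof (intro ext)
  fix l h x K
  show "sprod b X X j m l h x K = sprod b Y Y j m l h x K"
    unfolding sprod_def
  proof (rule sum.cong[OF refl])
    fix i assume i: "i \<in> {..j}"
    consider "i = 0" | "i = j" | "0 < i" "i < j" using i by fastforce
    then show "(\<Sum>m1\<in>ssupp X i. b m1 (m - m1) (X i m1) (X (j - i) (m - m1)) l h x K)
        = (\<Sum>m1\<in>ssupp Y i. b m1 (m - m1) (Y i m1) (Y (j - i) (m - m1)) l h x K)"
    proof cases
      case 3
      then show ?thesis using eq[of i] eq[of "j - i"] by (simp add: ssupp_def)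
    qed (simp_all add: ssupp_def X0 Y0 b)
  qed
qed

lemma series_ex1:
  assumes b: "\<And>m m' B. b m m' zero_vform B = zero_vform" "\<And>m m' A. b m m' A zero_vform = zero_vform" and P0: "\<And>m. Pm 0 m = zero_vform"
  shows "\<exists>!X. (\<forall>m. X 0 m = zero_vform) \<and> (\<forall>j m. X j m = (\<lambda>l h x K. Pm j m l h x K - 1/2 * Hv G x0 m (sprod b X X j m) l h x K))"
proof -
  define T where "T X j = (\<lambda>m l h x K. Pm j m l h x K - 1/2 * Hv G x0 m (sprod b X X j m) l h x K)" for X j
  have "\<exists>!X. X 0 = (\<lambda>m. zero_vform) \<and> (\<forall>j. X j = T X j)"
  proof (rule ex1_recursive)
    show "T X j = T Y j" if "X 0 = (\<lambda>m. zero_vform)" "Y 0 = (\<lambda>m. zero_vform)" "\<And>i. i < j \<Longrightarrow> X i = Y i" for X Y j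
    proof -
      have "sprod b X X j m = sprod b Y Y j m" for m
        by (rule sprod_causal[where b=b, OF b]) (use that in auto)
      then show ?thesis by (simp add: T_def)
    qed
    show "T X 0 = (\<lambda>m. zero_vform)" if "X 0 = (\<lambda>m. zero_vform)" for X
    proof -
      have "sprod b X X 0 m = zero_vform" for m by (simp add: sprod_def ssupp_def that)
      then show ?thesis by (simp add: T_def P0 Hv_zero)
    qed
  qed
  then show ?thesis by (simp add: T_def fun_eq_iff)
qed

section \<open>The bracket in the basis \<open>ev\<close>\<close>

lemma pairing_ev: "pairing m (ev i) = m $ i"
  by (simp add: pairing_def ev_def axis_def if_distrib[of "\<lambda>y. _ * y"] cong: if_cong)

lemma ev_nth: "ev i $ l = (if l = i then 1 else 0)"
  by (simp add: ev_def axis_def)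

text \<open>The bracket is stored componentwise in the basis \<open>ev\<close>; bilinearity in the
  directions returns the formula for arbitrary covectors n and n'.\<close>

lemma nbr_line:
  fixes n n' :: "(int,'n::{finite,linorder}) vec"
  assumes "\<And>i K. A i h x K = of_int (n $ i) * f h x K" "\<And>i K. B i h x K = of_int (n' $ i) * f' h x K"
  shows "nbr m m' A B l h x K = of_int (pairing m' n * n' $ l - pairing m n' * n $ l) * wedge f f' h x K"
proof -
  have w: "wedge (A i) (B j) h x K = of_int (n $ i * n' $ j) * wedge f f' h x K" for i j
    by (simp add: wedge_def wedge0_def assms sum_distrib_left algebra_simps)
  have "nbr m m' A B l h x K = (\<Sum>i\<in>UNIV. \<Sum>j\<in>UNIV. of_int ((m' $ i * (if l = j then 1 else 0) - m $ j * (if l = i then 1 else 0)) * (n $ i * n' $ j))) * wedge f f' h x K"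
    unfolding nbr_def w pairing_ev ev_nth sum_distrib_right by (simp add: mult.assoc)
  also have "(\<Sum>i\<in>UNIV. \<Sum>j\<in>UNIV. of_int ((m' $ i * (if l = j then 1 else 0) - m $ j * (if l = i then 1 else 0)) * (n $ i * n' $ j)))
     = (of_int (\<Sum>i\<in>UNIV. \<Sum>j\<in>UNIV. (m' $ i * (if l = j then 1 else 0) - m $ j * (if l = i then 1 else 0)) * (n $ i * n' $ j)) :: complex)"
    by simp
  also have "(\<Sum>i\<in>UNIV. \<Sum>j\<in>UNIV. (m' $ i * (if l = j then 1 else 0) - m $ j * (if l = i then 1 else 0)) * (n $ i * n' $ j))
     = pairing m' n * n' $ l - pairing m n' * n $ l"
  proof -
    have "(\<Sum>i\<in>UNIV. \<Sum>j\<in>UNIV. (m' $ i * (if l = j then 1 else 0) - m $ j * (if l = i then 1 else 0)) * (n $ i * n' $ j))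
      = (\<Sum>i\<in>UNIV. \<Sum>j\<in>UNIV. (if l = j then m' $ i * n $ i * n' $ j else 0)) - (\<Sum>i\<in>UNIV. \<Sum>j\<in>UNIV. (if l = i then m $ j * n $ i * n' $ j else 0))"
      unfolding sum_subtractf[symmetric] by (intro sum.cong refl) (auto simp: algebra_simps)
    also have "(\<Sum>i\<in>UNIV. \<Sum>j\<in>UNIV. (if l = j then m' $ i * n $ i * n' $ j else 0)) = pairing m' n * n' $ l"
      by (simp add: pairing_def sum_distrib_right)
    also have "(\<Sum>i\<in>UNIV. \<Sum>j\<in>UNIV. (if l = i then m $ j * n $ i * n' $ j else 0)) = pairing m n' * n $ l"
      by (subst sum.swap) (simp add: pairing_def sum_distrib_left sum_distrib_right mult_ac)
    finally show ?thesis .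
  qed
  finally show ?thesis .
qed

text \<open>The derivative terms of the bracket of 1-forms. The second summand has a plus sign
  because the graded sign in \<open>twedge\<close> reverses the minus in \<open>tbr\<close>.\<close>

definition nabla_bracket :: "('n::{finite,linorder} rn \<Rightarrow> ((real,'n) vec,'n) vec) \<Rightarrow> 'n vform \<Rightarrow> 'n vform \<Rightarrow> 'n vform" where
  "nabla_bracket g A B = (\<lambda>l h x K. \<Sum>i\<in>UNIV. \<Sum>j\<in>UNIV.
       of_int (ev j $ l) * wedge (A i) (nabla (dvec g (ev i)) (B j)) h x K
     + of_int (ev i $ l) * wedge (B j) (nabla (dvec g (ev j)) (A i)) h x K)"

lemma brk_split:
  assumes "\<And>i I. card I \<noteq> 1 \<Longrightarrow> B i h x I = 0" "\<And>i j I. card I \<noteq> 1 \<Longrightarrow> nabla (dvec g (ev j)) (A i) h x I = 0"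
  shows "brk g m m' A B l h x K = nbr m m' A B l h x K + nabla_bracket g A B l h x K"
proof -
  have t: "twedge (B j) (nabla (dvec g (ev j)) (A i)) h x K = - wedge (B j) (nabla (dvec g (ev j)) (A i)) h x K" for i j
    by (rule twedge_eq) (use assms in auto)
  show ?thesis
    by (simp add: brk_def tbr_def nbr_def nabla_bracket_def t sum.distrib[symmetric] add.assoc)
qed

text \<open>Telescoping A B - A' B' = F B + A' F', so that each term contains exactly one error
  factor.\<close>

lemma nbr_diff:
  assumes "\<And>i K. A i h x K = A' i h x K + F i h x K" "\<And>i K. B i h x K = B' i h x K + F' i h x K"
  shows "nbr m m' A B l h x K - nbr m m' A' B' l h x K = nbr m m' F B l h x K + nbr m m' A' F' l h x K"
proof -
  have "wedge (A i) (B j) h x K = wedge (A' i) (B' j) h x K + wedge (F i) (B j) h x K + wedge (A' i) (F' j) h x K" for i j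
    unfolding wedge_def wedge0_def sum.distrib[symmetric]
    by (intro sum.cong refl) (simp add: assms algebra_simps)
  then show ?thesis
    unfolding nbr_def by (simp add: sum_subtractf[symmetric] sum.distrib[symmetric] algebra_simps)
qed

section \<open>Induction on the power of t\<close>

context two_walls
begin

lemmas A_zero = asym_form_zero[OF open_U continuous_w(1) w_nonneg(1)]
lemmas BQ_zero = asym_form_zero[OF open_U continuous_w(2) w_nonneg(2)]
lemmas A_cmult = asym_form_cmult[OF open_U _ w_nonneg(1)]
lemmas BQ_cmult = asym_form_cmult[OF open_U _ w_nonneg(2)]
lemmas A_add = asym_form_add[OF open_U]
lemmas BQ_sum = asym_form_sum[OF open_U _ continuous_w(2) w_nonneg(2)]
lemmas A_mono = asym_form_mono[OF open_U _ _ w_nonneg(1)]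

lemma BQ_nbr:
  assumes "\<And>i. A s p q (X i)" "\<And>i. A r p' q' (Y i)" "(p, q) \<noteq> (0, 0)" "(p', q') \<noteq> (0, 0)"
  shows "BQ (s + r) (nbr m m' X Y l)"
  unfolding nbr_def by (intro BQ_sum BQ_cmult A_wedge[where p=p and q=q and p'=p' and q'=q'] assms)

text \<open>The derivative comes with a factor h, so one factor drops to order 1 - 1 = 0 and the
  product has order 1 instead of 2.\<close>

lemma BQ_nabla_bracket:
  assumes g: "hessian_metric g"
    and X: "\<And>i. A 1 p q (X i)" and Y: "\<And>i. A 1 p' q' (Y i)" and nz: "(p, q) \<noteq> (0, 0)" "(p', q') \<noteq> (0, 0)"
  shows "BQ 1 (nabla_bracket g X Y l)"
proof -
  have 1: "BQ (1 + (1 - 1)) (wedge (X i) (nabla (dvec g (ev i)) (Y j)))" for i j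
    by (rule A_wedge[OF X asym_form_nabla[OF open_U g Y w_nonneg(1)] nz])
  have 2: "BQ (1 + (1 - 1)) (wedge (Y j) (nabla (dvec g (ev j)) (X i)))" for i j
    by (rule A_wedge[OF Y asym_form_nabla[OF open_U g X w_nonneg(1)] nz(2,1)])
  show ?thesis
    unfolding nabla_bracket_def using 1 2
    by (intro BQ_sum asym_form_add[OF open_U] BQ_cmult) simp_all
qed

text \<open>\<open>[X, Y] - \<natural>(X', Y')\<close>: at leading order only \<open>\<natural>\<close> contributes.\<close>

lemma BQ_brk_diff:
  assumes g: "hessian_metric g"
    and X: "\<And>i. A 1 p q (X' i)" "\<And>i. A 0 p q (\<lambda>h x K. X i h x K - X' i h x K)"
    and Y: "\<And>i. A 1 p' q' (Y' i)" "\<And>i. A 0 p' q' (\<lambda>h x K. Y i h x K - Y' i h x K)"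
    and nz: "(p, q) \<noteq> (0, 0)" "(p', q') \<noteq> (0, 0)"
  shows "BQ 1 (\<lambda>h x K. brk g m m' X Y l h x K - nbr m m' X' Y' l h x K)"
proof -
  have X1: "A 1 p q (X i)" for i
    using A_add[OF X(1)[of i] A_mono[OF X(2)[of i], of 1]] by simp
  have Y1: "A 1 p' q' (Y i)" for i
    using A_add[OF Y(1)[of i] A_mono[OF Y(2)[of i], of 1]] by simp
  let ?F = "\<lambda>i h x K. X i h x K - X' i h x K" and ?F' = "\<lambda>i h x K. Y i h x K - Y' i h x K"
  have "BQ (0 + 1) (nbr m m' ?F Y l)" "BQ (1 + 0) (nbr m m' X' ?F' l)"
    by (intro BQ_nbr[where p=p and q=q and p'=p' and q'=q'] X Y Y1 nz)+
  then have "BQ 1 (\<lambda>h x K. (nbr m m' ?F Y l h x K + nbr m m' X' ?F' l h x K) + nabla_bracket g X Y l h x K)"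
    by (intro asym_form_add[OF open_U] BQ_nabla_bracket[OF g X1 Y1 nz]) simp_all
  then show ?thesis
  proof (subst asym_form_cong[OF open_U])
    fix h x K assume hx: "(h::real) > 0" "x \<in> U"
    have "brk g m m' X Y l h x K = nbr m m' X Y l h x K + nabla_bracket g X Y l h x K"
      by (rule brk_split) (use asym_form_card[OF Y1 hx] asym_form_card[OF asym_form_nabla[OF open_U g X1 w_nonneg(1)] hx] in auto)
    moreover have "nbr m m' X Y l h x K - nbr m m' X' Y' l h x K = nbr m m' ?F Y l h x K + nbr m m' X' ?F' l h x K"
      by (rule nbr_diff) auto
    ultimately show "brk g m m' X Y l h x K - nbr m m' X' Y' l h x K =
      (nbr m m' ?F Y l h x K + nbr m m' X' ?F' l h x K) + nabla_bracket g X Y l h x K" by simp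
  qed
qed

definition modes :: "(int,'n) vec set" where "modes = {mode p q |p q. (p, q) \<noteq> (0, 0)}"

lemma modes_add: "m \<in> modes \<Longrightarrow> m' \<in> modes \<Longrightarrow> m + m' \<in> modes"
  unfolding modes_def by (force simp: mode_add)

text \<open>The direction and order statements for one coefficient \<open>X = \<Phi>\<^sub>j\<^sup>m\<close>, \<open>Y = \<Psi>\<^sub>j\<^sup>m\<close>.\<close>

definition good :: "nat \<Rightarrow> nat \<Rightarrow> 'n vform \<Rightarrow> 'n vform \<Rightarrow> bool" where
  "good p q X Y \<longleftrightarrow> (\<exists>f. A 1 p q f \<and> (\<forall>h>0. \<forall>x\<in>U. \<forall>l K. Y l h x K = of_int (N p q $ l) * f h x K)) \<and>
     (\<forall>l. A 0 p q (\<lambda>h x K. X l h x K - Y l h x K))"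

lemma good_zero: "good p q zero_vform zero_vform"
  unfolding good_def by (auto intro!: exI[of _ "\<lambda>h x K. 0"] A_zero)

lemma good_A:
  assumes "good p q X Y" shows "A 1 p q (Y i)" "A 0 p q (\<lambda>h x K. X i h x K - Y i h x K)"
proof -
  obtain f where f: "A 1 p q f" "\<forall>h>0. \<forall>x\<in>U. \<forall>l K. Y l h x K = of_int (N p q $ l) * f h x K"
    using assms by (auto simp: good_def)
  have "A 1 p q (\<lambda>h x K. of_int (N p q $ i) * f h x K)" by (rule A_cmult[OF f(1)])
  then show "A 1 p q (Y i)" using f(2) by (subst asym_form_cong[OF open_U, where \<beta>="\<lambda>h x K. of_int (N p q $ i) * f h x K"]) auto
  show "A 0 p q (\<lambda>h x K. X i h x K - Y i h x K)" using assms by (auto simp: good_def)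
qed

lemma good_brk:
  assumes "hessian_metric g" "good p q X X'" "good p' q' Y Y'" "(p, q) \<noteq> (0, 0)" "(p', q') \<noteq> (0, 0)"
  shows "BQ 1 (\<lambda>h x K. brk g m m' X Y l h x K - nbr m m' X' Y' l h x K)"
  using assms by (intro BQ_brk_diff[where p=p and q=q and p'=p' and q'=q'] good_A)

text \<open>Both inputs point along their covectors N. By \<open>pairing_mode_N\<close> the two
  terms of the bracket have the same coefficient, and by \<open>N_add\<close> their sum points along
  the covector of the total mode. Its order 2 becomes 1 under the homotopy operator.\<close>

lemma good_nbr:
  assumes "good p q X X'" "good p' q' Y Y'" "(p, q) \<noteq> (0, 0)" "(p', q') \<noteq> (0, 0)"
  shows "\<exists>\<gamma>. BQ 2 \<gamma> \<and> (\<forall>h>0. \<forall>x\<in>U. \<forall>l K. nbr (mode p q) (mode p' q') X' Y' l h x K = of_int (N (p + p') (q + q') $ l) * \<gamma> h x K)"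
proof -
  obtain f where f: "A 1 p q f" "\<forall>h>0. \<forall>x\<in>U. \<forall>l K. X' l h x K = of_int (N p q $ l) * f h x K"
    using assms(1) by (auto simp: good_def)
  obtain f' where f': "A 1 p' q' f'" "\<forall>h>0. \<forall>x\<in>U. \<forall>l K. Y' l h x K = of_int (N p' q' $ l) * f' h x K"
    using assms(2) by (auto simp: good_def)
  define c where "c = d1 * d2 * (int p * int q' - int q * int p')"
  have "BQ (1 + 1) (wedge f f')" by (rule A_wedge[OF f(1) f'(1) assms(3,4)])
  then have "BQ 2 (\<lambda>h x K. of_int c * wedge f f' h x K)" by (intro BQ_cmult) simp
  moreover have "nbr (mode p q) (mode p' q') X' Y' l h x K = of_int (N (p + p') (q + q') $ l) * (of_int c * wedge f f' h x K)"
    if "h > 0" "x \<in> U" for h x l K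
  proof -
    have "nbr (mode p q) (mode p' q') X' Y' l h x K =
      of_int (pairing (mode p' q') (N p q) * N p' q' $ l - pairing (mode p q) (N p' q') * N p q $ l) * wedge f f' h x K"
      by (rule nbr_line) (use f f' that in auto)
    also have "pairing (mode p' q') (N p q) * N p' q' $ l - pairing (mode p q) (N p' q') * N p q $ l = c * N (p + p') (q + q') $ l"
      unfolding pairing_mode_N N_add[symmetric] c_def by (simp add: algebra_simps)
    finally show ?thesis by simp
  qed
  ultimately show ?thesis by blast
qed

text \<open>Linearity of the homotopy operator is available for smooth 2-forms on U. Hence
  \<open>S\<close> is written as \<open>S'\<close> plus an error of order 1: the first contributes
  the directed part of order 1, the second an error of order 0.\<close>

lemma good_H:
  assumes nz: "(p, q) \<noteq> (0, 0)" and P: "good p q P P'"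
    and \<Gamma>: "BQ 2 \<Gamma>" "\<And>h x l K. h > 0 \<Longrightarrow> x \<in> U \<Longrightarrow> S' l h x K = of_int (N p q $ l) * \<Gamma> h x K"
    and S: "\<And>l. BQ 1 (\<lambda>h x K. S l h x K - S' l h x K)"
  shows "good p q (\<lambda>l h x K. P l h x K - 1/2 * Hv G x0 (mode p q) S l h x K) (\<lambda>l h x K. P' l h x K - 1/2 * Hv G x0 (mode p q) S' l h x K)"
proof -
  note H = nz refl
  obtain f where f: "A 1 p q f" "\<forall>h>0. \<forall>x\<in>U. \<forall>l K. P' l h x K = of_int (N p q $ l) * f h x K"
    using P by (auto simp: good_def)
  have fk: "formk U 2 \<Gamma>" using \<Gamma>(1) by (simp add: asym_form_def)
  have fkN: "formk U 2 (\<lambda>h x K. of_int (N p q $ l) * \<Gamma> h x K)" for l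
    using BQ_cmult[OF \<Gamma>(1)] by (simp add: asym_form_def)
  have fkS': "formk U 2 (S' l)" for l
    by (subst formk_cong[OF open_U \<Gamma>(2) ]) (auto intro: fkN)
  have HS': "Hm G x0 (mode p q) (S' l) h x K = of_int (N p q $ l) * Hm G x0 (mode p q) \<Gamma> h x K" if "h > 0" "x \<in> U" for l h x K
    using Hm_cong[OF H fkS' fkN \<Gamma>(2)[OF that(1)] that] Hm_cmult[OF H fk that] by simp
  have HS: "Hm G x0 (mode p q) (S l) h x K = Hm G x0 (mode p q) (S' l) h x K + Hm G x0 (mode p q) (\<lambda>h x K. S l h x K - S' l h x K) h x K"
    if "h > 0" "x \<in> U" for l h x K
  proof -
    have "formk U 2 (\<lambda>h x K. S l h x K - S' l h x K)" using S[of l] by (simp add: asym_form_def)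
    from Hm_add[OF H fkS'[of l] this that, of K]
    show ?thesis by simp
  qed
  have A1: "A 1 p q (Hm G x0 (mode p q) \<Gamma>)" using A_H[OF H \<Gamma>(1)] by simp
  have A0: "A 0 p q (Hm G x0 (mode p q) (\<lambda>h x K. S l h x K - S' l h x K))" for l using A_H[OF H S[of l]] by simp
  show ?thesis
    unfolding good_def
  proof (intro conjI allI)
    have "A 1 p q (\<lambda>h x K. f h x K + (- 1/2) * Hm G x0 (mode p q) \<Gamma> h x K)"
      by (intro A_add f A_cmult A1)
    moreover have "P' l h x K - 1/2 * Hv G x0 (mode p q) S' l h x K = of_int (N p q $ l) * (f h x K + (- 1/2) * Hm G x0 (mode p q) \<Gamma> h x K)"
      if "h > 0" "x \<in> U" for h x l K
      using f(2) that by (simp add: Hv_def HS' algebra_simps)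
    ultimately show "\<exists>f. A 1 p q f \<and> (\<forall>h>0. \<forall>x\<in>U. \<forall>l K. P' l h x K - 1/2 * Hv G x0 (mode p q) S' l h x K = of_int (N p q $ l) * f h x K)"
      by blast
    fix l
    have "A 0 p q (\<lambda>h x K. (P l h x K - P' l h x K) + (- 1/2) * Hm G x0 (mode p q) (\<lambda>h x K. S l h x K - S' l h x K) h x K)"
      by (intro A_add A_cmult A0 good_A[OF P])
    then show "A 0 p q (\<lambda>h x K. (P l h x K - 1/2 * Hv G x0 (mode p q) S l h x K) - (P' l h x K - 1/2 * Hv G x0 (mode p q) S' l h x K))"
      by (subst asym_form_cong[OF open_U]) (auto simp: Hv_def HS algebra_simps)
  qed
qed

text \<open>Finiteness of the supports belongs to the induction, because the sums over m1 carry
  information only for finite supports. Sums of modes are again nonzero modes in the cone of m1 and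
  m2, so \<open>A_H\<close> applies at every step.\<close>

lemma series_good:
  assumes g: "hessian_metric g"
    and P: "\<And>j. finite (ssupp P j)" "\<And>j. ssupp P j \<subseteq> modes" "\<And>j. finite (ssupp P' j)" "\<And>j. ssupp P' j \<subseteq> modes"
    and PP: "\<And>j p q. (p, q) \<noteq> (0, 0) \<Longrightarrow> good p q (P j (mode p q)) (P' j (mode p q))"
    and X0: "\<And>m. X 0 m = zero_vform" and X: "\<And>j m. X j m = (\<lambda>l h x K. P j m l h x K - 1/2 * Hv G x0 m (sprod (brk g) X X j m) l h x K)"
    and Y0: "\<And>m. Y 0 m = zero_vform" and Y: "\<And>j m. Y j m = (\<lambda>l h x K. P' j m l h x K - 1/2 * Hv G x0 m (sprod nbr Y Y j m) l h x K)"
  shows "finite (ssupp X j) \<and> finite (ssupp Y j) \<and> ssupp X j \<subseteq> modes \<and> ssupp Y j \<subseteq> modes \<and>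
     (\<forall>p q. (p, q) \<noteq> (0, 0) \<longrightarrow> good p q (X j (mode p q)) (Y j (mode p q)))"
proof (induction j rule: less_induct)
  case (less j)
  define M where "M i = ssupp X i \<union> ssupp Y i" for i
  have M: "finite (M i)" "M i \<subseteq> modes" if "i < j" for i using less[OF that] by (auto simp: M_def)
  have supp: "finite (ssupp Z j) \<and> ssupp Z j \<subseteq> modes"
    if b: "\<And>m m' B. b m m' zero_vform B = zero_vform" "\<And>m m' A. b m m' A zero_vform = zero_vform"
      and Z0: "\<And>m. Z 0 m = zero_vform" and Z: "\<And>m. Z j m = (\<lambda>l h x K. R j m l h x K - 1/2 * Hv G x0 m (sprod b Z Z j m) l h x K)"
      and R: "finite (ssupp R j)" "ssupp R j \<subseteq> modes" and F: "\<And>i. i < j \<Longrightarrow> finite (ssupp Z i) \<and> ssupp Z i \<subseteq> modes"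
    for b and Z R :: "'n series"
  proof -
    \<comment> \<open>The modes that products of lower-order coefficients can reach.\<close>
    define E where "E = (\<Union>i\<in>{0<..<j}. (\<lambda>(a, c). a + c) ` (ssupp Z i \<times> ssupp Z (j - i)))"
    have "finite E" unfolding E_def using F by auto
    moreover have "E \<subseteq> modes"
    proof
      fix m assume "m \<in> E"
      then obtain i a c where i: "i \<in> {0<..<j}" "a \<in> ssupp Z i" "c \<in> ssupp Z (j - i)" "m = a + c"
        unfolding E_def by auto
      then show "m \<in> modes" using F[of i] F[of "j - i"] by (auto intro: modes_add)
    qed
    moreover have "ssupp Z j \<subseteq> ssupp R j \<union> E"
    proof
      fix m assume m: "m \<in> ssupp Z j"
      show "m \<in> ssupp R j \<union> E"
      proof (rule ccontr)
        assume nE: "m \<notin> ssupp R j \<union> E"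
        have "b m1 (m - m1) (Z i m1) (Z (j - i) (m - m1)) = zero_vform" if i: "i \<in> {0<..<j}" for i m1
        proof (rule ccontr)
          assume ne: "b m1 (m - m1) (Z i m1) (Z (j - i) (m - m1)) \<noteq> zero_vform"
          then have "m1 \<in> ssupp Z i" "m - m1 \<in> ssupp Z (j - i)" using b by (auto simp: ssupp_def)
          then have "m1 + (m - m1) \<in> E" unfolding E_def using i by (intro UN_I[OF i] image_eqI[of _ _ "(m1, m - m1)"]) auto
          then show False using nE by simp
        qed
        moreover have "sprod b Z Z j m = (\<lambda>l h x K. \<Sum>j1\<in>{0<..<j}. \<Sum>m1\<in>ssupp Z j1.
           b m1 (m - m1) (Z j1 m1) (Z (j - j1) (m - m1)) l h x K)"
          by (rule sprod_restrict[where b=b and X=Z, OF b Z0]) (use F in auto)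
        ultimately have "sprod b Z Z j m = zero_vform" by simp
        moreover have "R j m = zero_vform" using nE by (simp add: ssupp_def)
        ultimately have "Z j m = zero_vform" unfolding Z by (simp add: Hv_zero)
        then show False using m by (simp add: ssupp_def)
      qed
    qed
    ultimately show ?thesis using R finite_subset by (meson finite_UnI le_sup_iff order_trans)
  qed
  have sX: "finite (ssupp X j) \<and> ssupp X j \<subseteq> modes"
    by (rule supp[where b="brk g" and Z=X and R=P, OF brk_zero X0 X]) (use P less in auto)
  have sY: "finite (ssupp Y j) \<and> ssupp Y j \<subseteq> modes"
    by (rule supp[where b=nbr and Z=Y and R=P', OF nbr_zero Y0 Y]) (use P less in auto)
  have eX: "sprod (brk g) X X j m = (\<lambda>l h x K. \<Sum>j1\<in>{0<..<j}. \<Sum>m1\<in>M j1.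
       brk g m1 (m - m1) (X j1 m1) (X (j - j1) (m - m1)) l h x K)" for m
    by (rule sprod_restrict[where b="brk g" and X=X, OF brk_zero X0]) (use M in \<open>auto simp: M_def\<close>)
  have eY: "sprod nbr Y Y j m = (\<lambda>l h x K. \<Sum>j1\<in>{0<..<j}. \<Sum>m1\<in>M j1.
       nbr m1 (m - m1) (Y j1 m1) (Y (j - j1) (m - m1)) l h x K)" for m
    by (rule sprod_restrict[where b=nbr and X=Y, OF nbr_zero Y0]) (use M in \<open>auto simp: M_def\<close>)
  have "good p q (X j (mode p q)) (Y j (mode p q))" if nz: "(p, q) \<noteq> (0, 0)" for p q
  proof -
    let ?m = "mode p q"
    have trm: "(\<forall>l. BQ 1 (\<lambda>h x K. brk g m1 (?m - m1) (X i m1) (X (j - i) (?m - m1)) l h x K - nbr m1 (?m - m1) (Y i m1) (Y (j - i) (?m - m1)) l h x K)) \<and>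
       (\<exists>\<gamma>. BQ 2 \<gamma> \<and> (\<forall>h>0. \<forall>x\<in>U. \<forall>l K. nbr m1 (?m - m1) (Y i m1) (Y (j - i) (?m - m1)) l h x K = of_int (N p q $ l) * \<gamma> h x K))"
      if i: "i \<in> {0<..<j}" and m1: "m1 \<in> M i" for i m1
    \<comment> \<open>Not every m1 in \<open>M i\<close> leaves a mode \<open>?m - m1\<close>; if it
      does not, the second coefficient is zero in both series.\<close>
    proof (cases "?m - m1 \<in> modes")
      case True
      obtain p1 q1 where 1: "m1 = mode p1 q1" "(p1, q1) \<noteq> (0, 0)" using m1 M(2)[of i] i by (auto simp: modes_def)
      obtain p2 q2 where 2: "?m - m1 = mode p2 q2" "(p2, q2) \<noteq> (0, 0)" using True by (auto simp: modes_def)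
      have "mode p q = mode p1 q1 + mode p2 q2" unfolding 1(1)[symmetric] 2(1)[symmetric] by simp
      then have pq: "p = p1 + p2" "q = q1 + q2" by (simp_all add: mode_add mode_eq_iff)
      have g1: "good p1 q1 (X i m1) (Y i m1)" using less[of i] i 1 by auto
      have g2: "good p2 q2 (X (j - i) (?m - m1)) (Y (j - i) (?m - m1))" unfolding 2(1) using less[of "j - i"] i 2(2) by auto
      show ?thesis
        using good_brk[OF g g1 g2 1(2) 2(2)] good_nbr[OF g1 g2 1(2) 2(2)]
        unfolding 1(1)[symmetric] 2(1)[symmetric] pq[symmetric] by blast
    next
      case False
      then have "X (j - i) (?m - m1) = zero_vform" "Y (j - i) (?m - m1) = zero_vform"
        using less[of "j - i"] i by (auto simp: ssupp_def)
      then show ?thesis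
        by (auto simp: brk_zero nbr_zero intro!: BQ_zero exI[of _ "\<lambda>h x K. 0"])
    qed
    \<comment> \<open>The forms exist separately for each pair (i, m1) and have to be chosen before
      they can be summed.\<close>
    have "\<forall>i m1. \<exists>\<gamma>. i \<in> {0<..<j} \<longrightarrow> m1 \<in> M i \<longrightarrow> BQ 2 \<gamma> \<and> (\<forall>h>0. \<forall>x\<in>U. \<forall>l K. nbr m1 (?m - m1) (Y i m1) (Y (j - i) (?m - m1)) l h x K = of_int (N p q $ l) * \<gamma> h x K)"
      using trm by blast
    then obtain \<gamma> where \<gamma>: "\<And>i m1. i \<in> {0<..<j} \<Longrightarrow> m1 \<in> M i \<Longrightarrow> BQ 2 (\<gamma> i m1) \<and> (\<forall>h>0. \<forall>x\<in>U. \<forall>l K. nbr m1 (?m - m1) (Y i m1) (Y (j - i) (?m - m1)) l h x K = of_int (N p q $ l) * \<gamma> i m1 h x K)"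
      by metis
    show ?thesis
      unfolding X[of j ?m] Y[of j ?m]
    proof (rule good_H[OF nz PP[OF nz]])
      show "BQ 2 (\<lambda>h x K. \<Sum>i\<in>{0<..<j}. \<Sum>m1\<in>M i. \<gamma> i m1 h x K)"
        using \<gamma> by (intro BQ_sum) blast
      show "sprod nbr Y Y j ?m l h x K = of_int (N p q $ l) * (\<Sum>i\<in>{0<..<j}. \<Sum>m1\<in>M i. \<gamma> i m1 h x K)"
        if "h > 0" "x \<in> U" for h x l K
        unfolding eY sum_distrib_left using \<gamma> that by (intro sum.cong refl) blast
      show "BQ 1 (\<lambda>h x K. sprod (brk g) X X j ?m l h x K - sprod nbr Y Y j ?m l h x K)" for l
        unfolding eX eY sum_subtractf[symmetric] using trm by (intro BQ_sum) blast
    qed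
  qed
  then show ?case using sX sY by blast
qed

end

subsection \<open>The input walls\<close>

lemma smult_inject:
  fixes m :: "(int,'n::{finite,linorder}) vec"
  assumes "m \<noteq> 0" shows "int k *s m = int k' *s m \<longleftrightarrow> k = k'"
  using assms by (auto simp: vec_eq_iff)

lemma wall_series_mult:
  assumes "m \<noteq> 0" "1 \<le> j" "1 \<le> k"
  shows "wall_series c \<delta> \<epsilon> m n j (int k *s m) = (\<lambda>l h x K. - of_int (n $ l) * c j k * (\<delta> j k h x K + \<epsilon> j k h x K))"
proof -
  have "(THE k'. 1 \<le> k' \<and> int k *s m = int k' *s m) = k"
    using assms by (intro the_equality) (auto simp: smult_inject)
  then show ?thesis using assms unfolding wall_series_def by (auto simp: Let_def)
qed

lemma wall_series_zero:
  "j = 0 \<or> (\<forall>k\<ge>1. m' \<noteq> int k *s m) \<Longrightarrow> wall_series c \<delta> \<epsilon> m n j m' = zero_vform"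
  unfolding wall_series_def by auto

lemma ssupp_wall_series:
  assumes "m \<noteq> 0"
  shows "ssupp (wall_series c \<delta> \<epsilon> m n) j \<subseteq> (\<lambda>k. int k *s m) ` {k. 1 \<le> k \<and> c j k \<noteq> 0}"
proof
  fix m' assume "m' \<in> ssupp (wall_series c \<delta> \<epsilon> m n) j"
  then have nz: "wall_series c \<delta> \<epsilon> m n j m' \<noteq> zero_vform" by (simp add: ssupp_def)
  then obtain k where k: "1 \<le> j" "1 \<le> k" "m' = int k *s m"
    using wall_series_zero[of j m' m c \<delta> \<epsilon> n] by (metis less_one not_less)
  moreover have "c j k \<noteq> 0"
    using nz unfolding k(3) wall_series_mult[OF assms k(1,2)] by auto
  ultimately show "m' \<in> (\<lambda>k. int k *s m) ` {k. 1 \<le> k \<and> c j k \<noteq> 0}" by auto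
qed

lemma ssupp_add: "ssupp (\<lambda>j m l h x K. X j m l h x K + Y j m l h x K) j \<subseteq> ssupp X j \<union> ssupp Y j"
  unfolding ssupp_def by auto

context two_walls
begin

lemma small_multiple: "\<exists>e0>0. \<forall>e. \<bar>e\<bar> < e0 \<longrightarrow> q0 + e *\<^sub>R z \<in> U"
proof -
  obtain r where r: "r > 0" "ball q0 r \<subseteq> U" using open_U q0U open_contains_ball by blast
  show ?thesis
  proof (intro exI[of _ "r / (norm z + 1)"] conjI allI impI)
    have n: "norm z + 1 > 0" by (simp add: add_nonneg_pos)
    then show "r / (norm z + 1) > 0" using r by simp
    fix e assume "\<bar>e\<bar> < r / (norm z + 1)"
    then have "\<bar>e\<bar> * (norm z + 1) < r" using n by (simp add: pos_less_divide_eq)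
    moreover have "\<bar>e\<bar> * norm z \<le> \<bar>e\<bar> * (norm z + 1)" by (intro mult_left_mono) auto
    ultimately have "q0 + e *\<^sub>R z \<in> ball q0 r" by (simp add: dist_norm)
    then show "q0 + e *\<^sub>R z \<in> U" using r by blast
  qed
qed

text \<open>S need only contain the part of the hyperplane behind Q. A point x in front of Q is
  reflected and shrunk: q0 + e (x - q0) with e \<tau> \<le> 0 and small |e| > 0 lies in S, and x is
  an affine combination of this point and q0.\<close>

lemma hull_eq:
  assumes nz: "(p, q) \<noteq> (0, 0)" and sub: "S \<subseteq> {x. rvec (N p q) \<bullet> (x - q0) = 0}"
    and half: "\<And>l \<tau>. l \<in> L \<Longrightarrow> \<tau> \<le> 0 \<Longrightarrow> q0 + l \<in> U \<Longrightarrow> q0 + l + \<tau> *\<^sub>R rvec (mode p q) \<in> U \<Longrightarrow> q0 + l + \<tau> *\<^sub>R rvec (mode p q) \<in> S"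
  shows "affine hull S = {x. rvec (N p q) \<bullet> (x - q0) = 0}"
proof
  have "{x. rvec (N p q) \<bullet> (x - q0) = 0} = {x. rvec (N p q) \<bullet> x = rvec (N p q) \<bullet> q0}"
    by (simp add: inner_diff_right)
  then show "affine hull S \<subseteq> {x. rvec (N p q) \<bullet> (x - q0) = 0}"
    using sub by (intro hull_minimal) (auto simp: affine_hyperplane)
  show "{x. rvec (N p q) \<bullet> (x - q0) = 0} \<subseteq> affine hull S"
  proof
    fix x assume "x \<in> {x. rvec (N p q) \<bullet> (x - q0) = 0}"
    then have "x - q0 \<in> W1 p q" by (simp add: W1_def)
    from W1_decomp[OF nz this] obtain \<tau> where l: "(x - q0) - \<tau> *\<^sub>R rvec (mode p q) \<in> L" ..
    define l where "l = (x - q0) - \<tau> *\<^sub>R rvec (mode p q)"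
    have lL: "l \<in> L" using l by (simp add: l_def)
    obtain e1 where e1: "e1 > 0" "\<And>e. \<bar>e\<bar> < e1 \<Longrightarrow> q0 + e *\<^sub>R l \<in> U" using small_multiple by blast
    obtain e2 where e2: "e2 > 0" "\<And>e. \<bar>e\<bar> < e2 \<Longrightarrow> q0 + e *\<^sub>R (x - q0) \<in> U" using small_multiple by blast
    define e where "e = (if \<tau> \<le> 0 then min e1 e2 / 2 else - (min e1 e2 / 2))"
    have e: "e \<noteq> 0" "\<bar>e\<bar> < e1" "\<bar>e\<bar> < e2" "e * \<tau> \<le> 0"
      using e1(1) e2(1) by (auto simp: e_def mult_nonneg_nonpos mult_nonpos_nonneg)
    have eq: "q0 + e *\<^sub>R (x - q0) = q0 + e *\<^sub>R l + (e * \<tau>) *\<^sub>R rvec (mode p q)"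
      by (simp add: l_def algebra_simps)
    have "q0 + e *\<^sub>R (x - q0) \<in> S"
      unfolding eq
      by (rule half) (use lL e1(2)[OF e(2)] e2(2)[OF e(3)] e(4) eq L(1) in \<open>auto simp: subspace_scale\<close>)
    moreover have "q0 \<in> S" using half[of 0 0] q0U subspace_0[OF L(1)] by simp
    ultimately have "(1 - 1 / e) *\<^sub>R q0 + (1 / e) *\<^sub>R (q0 + e *\<^sub>R (x - q0)) \<in> affine hull S"
      by (intro mem_affine[OF affine_affine_hull] hull_inc) auto
    moreover have "(1 - 1 / e) *\<^sub>R q0 + (1 / e) *\<^sub>R (q0 + e *\<^sub>R (x - q0)) = x"
      using e(1) by (simp add: algebra_simps)
    ultimately show "x \<in> affine hull S" by simp
  qed
qed

lemma t_line: "l \<in> L \<Longrightarrow> t1 (l + \<tau> *\<^sub>R rvec (mode p q)) = \<tau> * p" "l \<in> L \<Longrightarrow> t2 (l + \<tau> *\<^sub>R rvec (mode p q)) = \<tau> * q"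
  by (simp_all add: linear_add[OF linear_t(1)] linear_add[OF linear_t(2)]
       linear_scale[OF linear_t(1)] linear_scale[OF linear_t(2)] t_mode t_L)

lemma hull_P1:
  assumes "(p, q) \<noteq> (0, 0)"
  shows "affine hull P1 p q = {x. rvec (N p q) \<bullet> (x - q0) = 0}"
proof (rule hull_eq[OF assms])
  fix l \<tau> assume l: "l \<in> L" and "\<tau> \<le> 0" and U: "q0 + l + \<tau> *\<^sub>R rvec (mode p q) \<in> U"
  have e: "q0 + l + \<tau> *\<^sub>R rvec (mode p q) - q0 = l + \<tau> *\<^sub>R rvec (mode p q)" by simp
  show "q0 + l + \<tau> *\<^sub>R rvec (mode p q) \<in> P1 p q"
    unfolding P1_def mem_Collect_eq e N_inner t_line[OF l]
    using U \<open>\<tau> \<le> 0\<close> by (auto simp: mult_nonpos_nonneg)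
qed (auto simp: P1_def)

lemma A_imp_asupp1:
  assumes "(p, q) \<noteq> (0, 0)" "A s p q \<alpha>" shows "asupp1 U (P1 p q) s \<alpha>"
proof (rule asupp1I[OF open_U])
  show "asym_form U 1 {v. rvec (N p q) \<bullet> v = 0} (\<lambda>x. \<bar>rvec (N p q) \<bullet> (x - q0)\<bar>) (P1 p q) s \<alpha>"
    using assms(2) unfolding W1_def w1_def[abs_def] .
qed (use N_neq_0[OF assms(1)] hull_P1[OF assms(1)] in \<open>auto simp: rvec_eq_0_iff P1_def\<close>)

text \<open>The projection to \<open>Q\<close> of a point of \<open>U\<close> lying behind \<open>Q\<close> is again in the ball \<open>U\<close>.\<close>

lemma P1_eq:
  assumes pq: "0 < p" "0 < q" and UV: "U \<subseteq> V"
  shows "{y - t *\<^sub>R rvec (mode p q) |y t. y \<in> {q0 + l |l. l \<in> L} \<inter> V \<and> t \<ge> 0} \<inter> U = P1 p q"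
proof (intro equalityI subsetI)
  fix x assume "x \<in> {y - t *\<^sub>R rvec (mode p q) |y t. y \<in> {q0 + l |l. l \<in> L} \<inter> V \<and> t \<ge> 0} \<inter> U"
  then obtain l t where x: "x = q0 + l - t *\<^sub>R rvec (mode p q)" "l \<in> L" "t \<ge> 0" "x \<in> U" by auto
  have e: "x - q0 = l + (- t) *\<^sub>R rvec (mode p q)" by (simp add: x(1))
  show "x \<in> P1 p q"
    unfolding P1_def mem_Collect_eq e N_inner t_line[OF x(2)] using x by simp
next
  fix x assume x: "x \<in> P1 p q"
  then have xU: "x \<in> U" and "x - q0 \<in> W1 p q" and t1: "t1 (x - q0) \<le> 0" using pq by (auto simp: P1_def W1_def)
  then obtain \<tau> where l: "(x - q0) - \<tau> *\<^sub>R rvec (mode p q) \<in> L"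
    using W1_decomp[of p q "x - q0"] pq by auto
  define l where "l = (x - q0) - \<tau> *\<^sub>R rvec (mode p q)"
  have lL: "l \<in> L" using l by (simp add: l_def)
  have xe: "x = q0 + l + \<tau> *\<^sub>R rvec (mode p q)" by (simp add: l_def)
  have "t1 (x - q0) = \<tau> * p" unfolding xe using t_line(1)[OF lL, of \<tau> p q] by (simp add: add.assoc)
  then have \<tau>: "\<tau> \<le> 0" using t1 pq by (simp add: mult_le_0_iff)
  obtain s1 s2 where s: "s1 > 0" "s2 > 0" "x0 = q0 + s1 *\<^sub>R rvec m1 + s2 *\<^sub>R rvec m2" using x0 by auto
  have gexp: "gV G (l - a *\<^sub>R rvec m1 - b *\<^sub>R rvec m2) (l - a *\<^sub>R rvec m1 - b *\<^sub>R rvec m2)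
     = gV G l l + a\<^sup>2 * gV G (rvec m1) (rvec m1) + b\<^sup>2 * gV G (rvec m2) (rvec m2)" for a b
    using G(3,4) lL gV_sym[OF G(1), of "rvec m1" l] gV_sym[OF G(1), of "rvec m2" l] gV_sym[OF G(1), of "rvec m2" "rvec m1"]
    by (simp add: gV_bilinear power2_eq_square)
  have "gV G (q0 + l - x0) (q0 + l - x0) = gV G (l - s1 *\<^sub>R rvec m1 - s2 *\<^sub>R rvec m2) (l - s1 *\<^sub>R rvec m1 - s2 *\<^sub>R rvec m2)"
    by (simp add: s(3) algebra_simps)
  also have "\<dots> \<le> gV G l l + (s1 - \<tau> * p)\<^sup>2 * gV G (rvec m1) (rvec m1) + (s2 - \<tau> * q)\<^sup>2 * gV G (rvec m2) (rvec m2)"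
  proof -
    \<comment> \<open>Going from x along m to Q decreases both coordinate distances to x0, since
      \<tau> \<le> 0 and s1, s2 > 0.\<close>
    have "s1 \<le> s1 - \<tau> * p" "s2 \<le> s2 - \<tau> * q" using \<tau> by (simp_all add: mult_nonpos_nonneg)
    then show ?thesis
      unfolding gexp using s by (intro add_mono mult_right_mono power_mono gV_nonneg) auto
  qed
  also have "\<dots> = gV G (x - x0) (x - x0)"
  proof -
    have "x - x0 = l - (s1 - \<tau> * p) *\<^sub>R rvec m1 - (s2 - \<tau> * q) *\<^sub>R rvec m2"
      by (simp add: xe s(3) rvec_mode algebra_simps)
    then show ?thesis by (simp add: gexp)
  qed
  also have "\<dots> < R\<^sup>2" using xU by (simp add: U_eq)
  finally have "q0 + l \<in> U" by (simp add: U_eq)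
  then have "q0 + l \<in> {q0 + l |l. l \<in> L} \<inter> V" using lL UV by auto
  moreover have "x = (q0 + l) - (- \<tau>) *\<^sub>R rvec (mode p q)" by (simp add: xe)
  ultimately show "x \<in> {y - t *\<^sub>R rvec (mode p q) |y t. y \<in> {q0 + l |l. l \<in> L} \<inter> V \<and> t \<ge> 0} \<inter> U"
    using xU \<tau> by (intro IntI CollectI exI[of _ "q0 + l"] exI[of _ "- \<tau>"]) auto
qed

lemma P1_scale: "0 < k \<Longrightarrow> 0 < p \<Longrightarrow> 0 < q \<Longrightarrow> P1 (k * p) (k * q) = P1 p q"
proof -
  assume k: "0 < k" "0 < p" "0 < q"
  have "rvec (N (k * p) (k * q)) \<bullet> z = k * (rvec (N p q) \<bullet> z)" for z
    by (simp add: N_inner algebra_simps)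
  then show ?thesis using k by (simp add: P1_def)
qed

text \<open>A wall is two-sided, and for p = 0 or q = 0 the half-space condition in
  \<open>P1\<close> is void, so the wall is contained in \<open>P1 p q\<close>. The factor c allows
  for multiples of the direction of the wall.\<close>

lemma asupp1_imp_A:
  assumes nz: "(p, q) \<noteq> (0, 0)" "p = 0 \<or> q = 0" and UV: "U \<subseteq> V"
    and S: "S = {y + t *\<^sub>R m |y t. y \<in> {q0 + l |l. l \<in> L} \<inter> V} \<inter> V \<inter> U"
    and m: "rvec (mode p q) = c *\<^sub>R m" "c \<noteq> 0"
    and \<alpha>: "asupp1 U S s \<alpha>"
  shows "A s p q \<alpha>"
proof -
  have SH: "S \<subseteq> {x. rvec (N p q) \<bullet> (x - q0) = 0}"
  proof
    fix x assume "x \<in> S"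
    then obtain l t where l: "l \<in> L" "x = q0 + l + t *\<^sub>R m" unfolding S by auto
    then have "x - q0 = l + (t / c) *\<^sub>R rvec (mode p q)" using m by simp
    then show "x \<in> {x. rvec (N p q) \<bullet> (x - q0) = 0}"
      using t_line[OF l(1), of "t / c" p q] by (simp add: N_inner)
  qed
  have hull: "affine hull S = {x. rvec (N p q) \<bullet> (x - q0) = 0}"
  proof (rule hull_eq[OF nz(1) SH])
    fix l \<tau> assume "l \<in> L" "q0 + l \<in> U" "q0 + l + \<tau> *\<^sub>R rvec (mode p q) \<in> U"
    then show "q0 + l + \<tau> *\<^sub>R rvec (mode p q) \<in> S"
      unfolding S m using UV by (intro IntI CollectI exI[of _ "q0 + l"] exI[of _ "\<tau> * c"]) auto
  qed
  have "S \<subseteq> U" unfolding S by auto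
  then have "S \<subseteq> P1 p q" using SH nz(2) by (auto simp: P1_def)
  from asupp1D[OF open_U \<alpha> hull _ this]
  show ?thesis
    using N_neq_0[OF nz(1)] unfolding W1_def w1_def[abs_def] by (simp add: rvec_eq_0_iff)
qed

text \<open>On a wall, \<open>N p q\<close> is a nonzero multiple \<kappa> of the primitive
  covector; dividing the form by \<kappa> puts the input into the shape required by
  \<open>good\<close>. The term \<epsilon> enters only the difference, with order 0.\<close>

lemma good_wall:
  assumes "A 1 p q \<delta>" "A 0 p q \<epsilon>" "N p q = \<kappa> *s n" "\<kappa> \<noteq> 0"
  shows "good p q (\<lambda>l h x K. - of_int (n $ l) * c * (\<delta> h x K + \<epsilon> h x K)) (\<lambda>l h x K. - of_int (n $ l) * c * (\<delta> h x K + 0))"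
  unfolding good_def
proof (intro conjI allI)
  have "A 1 p q (\<lambda>h x K. (- c / of_int \<kappa>) * \<delta> h x K)" by (rule A_cmult[OF assms(1)])
  then show "\<exists>f. A 1 p q f \<and> (\<forall>h>0. \<forall>x\<in>U. \<forall>l K. - of_int (n $ l) * c * (\<delta> h x K + 0) = of_int (N p q $ l) * f h x K)"
    using assms(3,4) by (intro exI[of _ "\<lambda>h x K. (- c / of_int \<kappa>) * \<delta> h x K"]) simp
  fix l
  have "A 0 p q (\<lambda>h x K. (- of_int (n $ l) * c) * \<epsilon> h x K)" by (rule A_cmult[OF assms(2)])
  then show "A 0 p q (\<lambda>h x K. - of_int (n $ l) * c * (\<delta> h x K + \<epsilon> h x K) - - of_int (n $ l) * c * (\<delta> h x K + 0))"
    by (simp add: algebra_simps)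
qed

text \<open>L and the mode span a hyperplane, so the covectors annihilating both form a line and u
  is determined by its value on m2.\<close>

lemma covector_eq:
  assumes "0 < p" "0 < q" and na: "\<forall>l\<in>L. l \<bullet> u = 0" "rvec (mode p q) \<bullet> u = 0"
  shows "\<exists>c. u = c *\<^sub>R rvec (N p q)"
proof -
  \<comment> \<open>The value of \<open>N p q\<close> on m2 is d1 * d2 * p, so normalising by p
    yields the factor \<tau> / (d1 * d2) below.\<close>
  define \<tau> where "\<tau> = (rvec m2 \<bullet> u) / p"
  have m2: "rvec m2 \<bullet> u = \<tau> * p" using assms by (simp add: \<tau>_def)
  have "p * (rvec m1 \<bullet> u) + q * (\<tau> * p) = 0"
    using na(2) by (simp add: rvec_mode inner_add_left m2)
  then have "p * (rvec m1 \<bullet> u + q * \<tau>) = 0" by (simp add: algebra_simps)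
  then have m1: "rvec m1 \<bullet> u = - q * \<tau>" using assms by simp
  have "u \<bullet> z = (\<tau> / (d1 * d2)) *\<^sub>R rvec (N p q) \<bullet> z" for z
  proof -
    have "(z - t1 z *\<^sub>R rvec m1 - t2 z *\<^sub>R rvec m2) \<bullet> u = 0" using decomp na(1) by blast
    then have "z \<bullet> u = t1 z * (rvec m1 \<bullet> u) + t2 z * (rvec m2 \<bullet> u)" by (simp add: inner_diff_left)
    also have "\<dots> = \<tau> * (p * t2 z - q * t1 z)" by (simp add: m1 m2 algebra_simps)
    finally show ?thesis
      unfolding inner_scaleR_left N_inner inner_commute[of u z] using d_pos by simp
  qed
  then have "u = (\<tau> / (d1 * d2)) *\<^sub>R rvec (N p q)" by (metis vector_eq_rdot inner_commute)
  then show ?thesis ..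
qed

end

section \<open>Reading off the theorem from the invariant\<close>

theorem theorem5p25:
  fixes g :: "real^('n::{finite,linorder}) \<Rightarrow> real^('n::{finite,linorder})^('n::{finite,linorder})"
    and V L :: "(real^('n::{finite,linorder})) set" and q0 x0 :: "real^('n::{finite,linorder})"
    and m1 m2 n1 n2 :: "int^('n::{finite,linorder})" and G :: "real^('n::{finite,linorder})^('n::{finite,linorder})" and R :: real
    and c1 c2 :: "nat \<Rightarrow> nat \<Rightarrow> complex"
    and \<delta>1 \<delta>2 \<epsilon>1 \<epsilon>2 :: "nat \<Rightarrow> nat \<Rightarrow> 'n form"
    and a1 a2 :: int and \<nu>a :: "real^('n::{finite,linorder})" and na :: "int^('n::{finite,linorder})"
  defines "Q \<equiv> {q0 + l |l. l \<in> L} \<inter> V"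
  defines "P1 \<equiv> {q + t *\<^sub>R rvec m1 |q t. q \<in> Q} \<inter> V"
  defines "P2 \<equiv> {q + t *\<^sub>R rvec m2 |q t. q \<in> Q} \<inter> V"
  defines "U \<equiv> {y. gV G (y - x0) (y - x0) < R\<^sup>2}"
  defines "PiS \<equiv> (\<lambda>j m l h x K. wall_series c1 \<delta>1 \<epsilon>1 m1 n1 j m l h x K
                             + wall_series c2 \<delta>2 \<epsilon>2 m2 n2 j m l h x K)"
  defines "PiB \<equiv> (\<lambda>j m l h x K. wall_series c1 \<delta>1 (\<lambda>_ _ _ _ _. 0) m1 n1 j m l h x K
                             + wall_series c2 \<delta>2 (\<lambda>_ _ _ _ _. 0) m2 n2 j m l h x K)"
  defines "\<Phi> \<equiv> Phi_of g G x0 PiS"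
  defines "\<Psi> \<equiv> Psi_of G x0 PiB"
  defines "ma \<equiv> a1 *s m1 + a2 *s m2"
  defines "Pa \<equiv> {q - t *\<^sub>R rvec ma |q t. q \<in> Q \<and> t \<ge> 0} \<inter> U"
  assumes hess: "hessian_metric g"
    and V: "open V" "convex V"
    and L: "subspace L" "dim L + 2 = CARD('n)" "\<exists>S. S \<subseteq> range rvec \<and> L = span S"
    and q0: "q0 \<in> V"
    and m12: "\<forall>\<alpha> \<beta>. \<alpha> *\<^sub>R rvec m1 + \<beta> *\<^sub>R rvec m2 \<in> L \<longrightarrow> \<alpha> = 0 \<and> \<beta> = 0"
    and n1: "primitive n1" "\<forall>l\<in>L. l \<bullet> rvec n1 = 0" "pairing m1 n1 = 0" "pairing (- m2) n1 < 0"
    and n2: "primitive n2" "\<forall>l\<in>L. l \<bullet> rvec n2 = 0" "pairing m2 n2 = 0" "pairing m1 n2 < 0"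
    and G: "\<forall>i j. G $ i $ j = G $ j $ i" "\<forall>v. v \<noteq> 0 \<longrightarrow> gV G v v > 0"
           "gV G (rvec m1) (rvec m2) = 0"
           "\<forall>l\<in>L. gV G l (rvec m1) = 0 \<and> gV G l (rvec m2) = 0"
    and x0: "x0 \<in> V" "\<exists>s1 s2. s1 > 0 \<and> s2 > 0 \<and> x0 = q0 + s1 *\<^sub>R rvec m1 + s2 *\<^sub>R rvec m2"
    and U: "U \<subseteq> V" "q0 \<in> U"
    and c1: "\<forall>j. finite {k. c1 j k \<noteq> 0}" and c2: "\<forall>j. finite {k. c2 j k \<noteq> 0}"
    and wall1: "\<forall>j k. 1 \<le> j \<longrightarrow> 1 \<le> k \<longrightarrow>
                  asupp1 U (P1 \<inter> U) 1 (\<delta>1 j k) \<and> asupp1 U (P1 \<inter> U) 0 (\<epsilon>1 j k) \<and>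
                  gaussian_near U (P1 \<inter> U) (- rvec m2) (\<delta>1 j k)"
    and wall2: "\<forall>j k. 1 \<le> j \<longrightarrow> 1 \<le> k \<longrightarrow>
                  asupp1 U (P2 \<inter> U) 1 (\<delta>2 j k) \<and> asupp1 U (P2 \<inter> U) 0 (\<epsilon>2 j k) \<and>
                  gaussian_near U (P2 \<inter> U) (rvec m1) (\<delta>2 j k)"
    and mc1: "mc_mod g U (wall_series c1 \<delta>1 \<epsilon>1 m1 n1)"
    and mc2: "mc_mod g U (wall_series c2 \<delta>2 \<epsilon>2 m2 n2)"
    and a: "0 < a1" "0 < a2" "coprime a1 a2"
    and \<nu>a: "\<exists>\<alpha> \<beta> l. l \<in> L \<and> \<nu>a = \<alpha> *\<^sub>R rvec m1 + \<beta> *\<^sub>R rvec m2 + l \<and>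
               real_of_int a2 * \<alpha> - real_of_int a1 * \<beta> > 0"
    and na: "primitive na" "\<forall>l\<in>L. l \<bullet> rvec na = 0" "pairing ma na = 0" "\<nu>a \<bullet> rvec na < 0"
  shows "(\<forall>j. finite {k::nat. 1 \<le> k \<and>
             \<not> (\<forall>h>0. \<forall>x\<in>U. \<forall>l K. \<Psi> j (int k *s ma) l h x K = 0)}) \<and>
         (\<forall>j k::nat. 1 \<le> k \<longrightarrow> (\<exists>f. asupp1 U Pa 1 f \<and>
             (\<forall>h>0. \<forall>x\<in>U. \<forall>l K. \<Psi> j (int k *s ma) l h x K = of_int (na $ l) * f h x K))) \<and>
         (\<forall>j. finite {k::nat. 1 \<le> k \<and>
             \<not> (\<forall>h>0. \<forall>x\<in>U. \<forall>l K. \<Phi> j (int k *s ma) l h x K - \<Psi> j (int k *s ma) l h x K = 0)}) \<and>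
         (\<forall>j k::nat. 1 \<le> k \<longrightarrow> (\<exists>S f. finite S \<and> (\<forall>n\<in>S. asupp1 U Pa 0 (f n)) \<and>
             (\<forall>h>0. \<forall>x\<in>U. \<forall>l K. \<Phi> j (int k *s ma) l h x K - \<Psi> j (int k *s ma) l h x K
                                  = (\<Sum>n\<in>S. of_int (n $ l) * f n h x K))))"
proof -
  interpret tw: two_walls G x0 q0 L U m1 m2 n1 n2 R
    by (unfold_locales) (use L m12 n1 n2 G x0 U in \<open>auto simp: U_def\<close>)
  \<comment> \<open>With natural numbers p and q the k-th multiple of \<open>ma\<close> is
    \<open>mode (k * p) (k * q)\<close>, to which the invariant refers.\<close>
  define p q where "p = nat a1" and "q = nat a2"
  have pq: "0 < p" "0 < q" using a by (auto simp: p_def q_def)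
  have ma: "ma = tw.mode p q" using a by (simp add: ma_def tw.mode_def p_def q_def)
  have kma: "int k *s ma = tw.mode (k * p) (k * q)" for k
    by (simp add: ma tw.mode_def vec_eq_iff algebra_simps)
  have k1: "int k *s m1 = tw.mode k 0" and k2: "int k *s m2 = tw.mode 0 k" for k
    by (simp_all add: tw.mode_def vec_eq_iff)
  have m0: "m1 \<noteq> 0" "m2 \<noteq> 0"
    using k1[of 1] k2[of 1] tw.mode_eq_0_iff[of 1 0] tw.mode_eq_0_iff[of 0 1] by auto
  have Pa: "Pa = tw.P1 (k * p) (k * q)" if "1 \<le> k" for k
    unfolding Pa_def Q_def ma using tw.P1_eq[OF pq U(1)] tw.P1_scale[of k p q] pq that by simp
  have A1: "tw.A s k 0 \<alpha>" if "asupp1 U (P1 \<inter> U) s \<alpha>" "1 \<le> k" for s k \<alpha>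
    by (rule tw.asupp1_imp_A[OF _ _ U(1) _ _ _ that(1), of k 0 "rvec m1" "real k"])
      (use that(2) in \<open>auto simp: P1_def Q_def tw.rvec_mode\<close>)
  have A2: "tw.A s 0 k \<alpha>" if "asupp1 U (P2 \<inter> U) s \<alpha>" "1 \<le> k" for s k \<alpha>
    by (rule tw.asupp1_imp_A[OF _ _ U(1) _ _ _ that(1), of 0 k "rvec m2" "real k"])
      (use that(2) in \<open>auto simp: P2_def Q_def tw.rvec_mode\<close>)
  \<comment> \<open>No positive multiple of one wall's direction is a multiple of the other's, so at
    each mode at most one wall contributes, and interior modes receive nothing from the
    input.\<close>
  have off1: "wall_series c2 \<delta> \<epsilon> m2 n2 j (tw.mode k' l') = zero_vform" if "1 \<le> k'" for \<delta> \<epsilon> j k' l'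
    by (rule wall_series_zero) (use that in \<open>auto simp: k2 tw.mode_eq_iff\<close>)
  have off2: "wall_series c1 \<delta> \<epsilon> m1 n1 j (tw.mode k' l') = zero_vform" if "1 \<le> l'" for \<delta> \<epsilon> j k' l'
    by (rule wall_series_zero) (use that in \<open>auto simp: k1 tw.mode_eq_iff\<close>)
  have supp: "finite (ssupp (\<lambda>j m l h x K. wall_series c1 \<delta>1 e1 m1 n1 j m l h x K + wall_series c2 \<delta>2 e2 m2 n2 j m l h x K) j) \<and>
     ssupp (\<lambda>j m l h x K. wall_series c1 \<delta>1 e1 m1 n1 j m l h x K + wall_series c2 \<delta>2 e2 m2 n2 j m l h x K) j \<subseteq> tw.modes"
    for e1 e2 j
  proof -
    define T where "T = (\<lambda>k. int k *s m1) ` {k. 1 \<le> k \<and> c1 j k \<noteq> 0} \<union> (\<lambda>k. int k *s m2) ` {k. 1 \<le> k \<and> c2 j k \<noteq> 0}"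
    have "finite T" unfolding T_def using c1 c2 by simp
    moreover have "T \<subseteq> tw.modes" unfolding T_def k1 k2 tw.modes_def by fastforce
    moreover have "ssupp (\<lambda>j m l h x K. wall_series c1 \<delta>1 e1 m1 n1 j m l h x K + wall_series c2 \<delta>2 e2 m2 n2 j m l h x K) j \<subseteq> T"
      unfolding T_def by (rule order_trans[OF ssupp_add Un_mono[OF ssupp_wall_series[OF m0(1)] ssupp_wall_series[OF m0(2)]]])
    ultimately show ?thesis by (meson finite_subset order_trans)
  qed
  have base: "tw.good p' q' (PiS j (tw.mode p' q')) (PiB j (tw.mode p' q'))" if nz: "(p', q') \<noteq> (0, 0)" for j p' q'
  proof (cases "j = 0")
    case True
    then show ?thesis unfolding PiS_def PiB_def by (simp add: wall_series_zero tw.good_zero)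
  next
    case False
    then have j: "1 \<le> j" by simp
    consider "1 \<le> p'" "q' = 0" | "p' = 0" "1 \<le> q'" | "1 \<le> p'" "1 \<le> q'" using nz by (auto simp: Suc_le_eq)
    then show ?thesis
    proof cases
      case 1
      have w: "asupp1 U (P1 \<inter> U) 1 (\<delta>1 j p')" "asupp1 U (P1 \<inter> U) 0 (\<epsilon>1 j p')"
        using wall1[rule_format, OF j 1(1)] by blast+
      have "tw.good p' 0 (\<lambda>l h x K. - of_int (n1 $ l) * c1 j p' * (\<delta>1 j p' h x K + \<epsilon>1 j p' h x K)) (\<lambda>l h x K. - of_int (n1 $ l) * c1 j p' * (\<delta>1 j p' h x K + 0))"
        by (rule tw.good_wall[OF A1[OF w(1) 1(1)] A1[OF w(2) 1(1)], where \<kappa>="int p' * tw.d2"])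
          (use 1 tw.d_pos in \<open>auto simp: tw.N_def vec_eq_iff\<close>)
      then show ?thesis
        unfolding PiS_def PiB_def 1(2) off1[OF 1(1)] unfolding k1[symmetric] wall_series_mult[OF m0(1) j 1(1)] by simp
    next
      case 2
      have w: "asupp1 U (P2 \<inter> U) 1 (\<delta>2 j q')" "asupp1 U (P2 \<inter> U) 0 (\<epsilon>2 j q')"
        using wall2[rule_format, OF j 2(2)] by blast+
      have "tw.good 0 q' (\<lambda>l h x K. - of_int (n2 $ l) * c2 j q' * (\<delta>2 j q' h x K + \<epsilon>2 j q' h x K)) (\<lambda>l h x K. - of_int (n2 $ l) * c2 j q' * (\<delta>2 j q' h x K + 0))"
        by (rule tw.good_wall[OF A2[OF w(1) 2(2)] A2[OF w(2) 2(2)], where \<kappa>="int q' * tw.d1"])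
          (use 2 tw.d_pos in \<open>auto simp: tw.N_def vec_eq_iff\<close>)
      then show ?thesis
        unfolding PiS_def PiB_def 2(1) off2[OF 2(2)] unfolding k2[symmetric] wall_series_mult[OF m0(2) j 2(2)] by simp
    next
      case 3
      then show ?thesis unfolding PiS_def PiB_def by (simp add: off1 off2 tw.good_zero)
    qed
  qed
  have \<Phi>: "(\<forall>m. \<Phi> 0 m = zero_vform) \<and> (\<forall>j m. \<Phi> j m = (\<lambda>l h x K. PiS j m l h x K - 1/2 * Hv G x0 m (sprod (brk g) \<Phi> \<Phi> j m) l h x K))"
    unfolding \<Phi>_def Phi_of_def sbr_sprod
    by (rule theI'[OF series_ex1[where b="brk g", OF brk_zero]]) (simp add: PiS_def wall_series_zero)
  have \<Psi>: "(\<forall>m. \<Psi> 0 m = zero_vform) \<and> (\<forall>j m. \<Psi> j m = (\<lambda>l h x K. PiB j m l h x K - 1/2 * Hv G x0 m (sprod nbr \<Psi> \<Psi> j m) l h x K))"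
    unfolding \<Psi>_def Psi_of_def snat_sprod
    by (rule theI'[OF series_ex1[where b=nbr, OF nbr_zero]]) (simp add: PiB_def wall_series_zero)
  have all: "finite (ssupp \<Phi> j) \<and> finite (ssupp \<Psi> j) \<and> ssupp \<Phi> j \<subseteq> tw.modes \<and> ssupp \<Psi> j \<subseteq> tw.modes \<and>
     (\<forall>p q. (p, q) \<noteq> (0, 0) \<longrightarrow> tw.good p q (\<Phi> j (tw.mode p q)) (\<Psi> j (tw.mode p q)))" for j
  proof (rule tw.series_good[OF hess _ _ _ _ base])
    show "finite (ssupp PiS j)" "ssupp PiS j \<subseteq> tw.modes" "finite (ssupp PiB j)" "ssupp PiB j \<subseteq> tw.modes" for j
      unfolding PiS_def PiB_def using supp by blast+
  qed (use \<Phi> \<Psi> in blast)+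
  have fin: "finite {k::nat. 1 \<le> k \<and> int k *s ma \<in> ssupp X j}" if "finite (ssupp X j)" for X :: "'n series" and j
  proof -
    have "inj (\<lambda>k. int k *s ma)" unfolding kma using pq by (auto simp: inj_on_def tw.mode_eq_iff)
    from finite_vimageI[OF that this] show ?thesis by (rule finite_subset[rotated]) auto
  qed
  have na0: "rvec na \<noteq> 0" using na(1) by (auto simp: primitive_def rvec_eq_0_iff)
  show ?thesis
  proof (intro conjI allI impI)
    fix j
    show "finite {k::nat. 1 \<le> k \<and> \<not> (\<forall>h>0. \<forall>x\<in>U. \<forall>l K. \<Psi> j (int k *s ma) l h x K = 0)}"
      by (rule finite_subset[OF _ fin[of \<Psi> j]]) (use all[of j] in \<open>auto simp: ssupp_def\<close>)
    show "finite {k::nat. 1 \<le> k \<and> \<not> (\<forall>h>0. \<forall>x\<in>U. \<forall>l K. \<Phi> j (int k *s ma) l h x K - \<Psi> j (int k *s ma) l h x K = 0)}"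
      by (rule finite_subset[OF _ finite_UnI[OF fin[of \<Phi> j] fin[of \<Psi> j]]]) (use all[of j] in \<open>auto simp: ssupp_def\<close>)
  next
    fix j k :: nat assume k: "1 \<le> k"
    have nz: "(k * p, k * q) \<noteq> (0, 0)" and kpq: "0 < k * p" "0 < k * q" using k pq by auto
    have good: "tw.good (k * p) (k * q) (\<Phi> j (int k *s ma)) (\<Psi> j (int k *s ma))"
      unfolding kma using all[of j] nz by blast
    have "rvec (int k *s ma) \<bullet> rvec na = 0"
      using na(3) pairing_inner[of ma na] by (simp add: rvec_smult)
    \<comment> \<open>\<open>na\<close> annihilates L and the mode, hence is a real multiple of the
      covector \<open>N\<close>; the factor c is nonzero because \<open>na\<close> is, and it is
      absorbed into the form as 1 / c.\<close>
    then obtain c where c: "rvec na = c *\<^sub>R rvec (tw.N (k * p) (k * q))"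
      using tw.covector_eq[OF kpq na(2)] unfolding kma by blast
    have c0: "c \<noteq> 0" using na0 c by auto
    have cl: "complex_of_int (na $ l) = complex_of_real c * of_int (tw.N (k * p) (k * q) $ l)" for l
    proof -
      have "rvec na $ l = c * rvec (tw.N (k * p) (k * q)) $ l" unfolding c by simp
      then have "real_of_int (na $ l) = c * real_of_int (tw.N (k * p) (k * q) $ l)" by (simp add: rvec_def)
      then show ?thesis by (metis of_real_mult of_real_of_int_eq)
    qed
    obtain f where f: "tw.A 1 (k * p) (k * q) f"
      "\<forall>h>0. \<forall>x\<in>U. \<forall>l K. \<Psi> j (int k *s ma) l h x K = of_int (tw.N (k * p) (k * q) $ l) * f h x K"
      using good unfolding tw.good_def by blast
    show "\<exists>f. asupp1 U Pa 1 f \<and> (\<forall>h>0. \<forall>x\<in>U. \<forall>l K. \<Psi> j (int k *s ma) l h x K = of_int (na $ l) * f h x K)"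
    proof (intro exI conjI)
      show "asupp1 U Pa 1 (\<lambda>h x K. (1 / complex_of_real c) * f h x K)"
        unfolding Pa[OF k] by (rule tw.A_imp_asupp1[OF nz tw.A_cmult[OF f(1)]])
      show "\<forall>h>0. \<forall>x\<in>U. \<forall>l K. \<Psi> j (int k *s ma) l h x K = of_int (na $ l) * ((1 / complex_of_real c) * f h x K)"
        using f(2) c0 by (simp add: cl)
    qed
    \<comment> \<open>For the difference the basis vectors \<open>ev i\<close> serve as directions.
      \<open>inv ev\<close> turns such a vector back into its index, so that \<open>F (ev i)\<close>
      is the i-th component.\<close>
    define F where "F n = (\<lambda>h x K. \<Phi> j (int k *s ma) (inv ev n) h x K - \<Psi> j (int k *s ma) (inv ev n) h x K)" for n
    have inj: "inj (ev :: 'n \<Rightarrow> int^('n::{finite,linorder}))" by (auto simp: inj_on_def ev_def axis_eq_axis)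
    show "\<exists>S f. finite S \<and> (\<forall>n\<in>S. asupp1 U Pa 0 (f n)) \<and>
        (\<forall>h>0. \<forall>x\<in>U. \<forall>l K. \<Phi> j (int k *s ma) l h x K - \<Psi> j (int k *s ma) l h x K = (\<Sum>n\<in>S. of_int (n $ l) * f n h x K))"
    proof (intro exI[of _ "range ev"] exI[of _ F] conjI ballI allI impI)
      show "asupp1 U Pa 0 (F n)" if "n \<in> range ev" for n
        unfolding Pa[OF k] F_def by (rule tw.A_imp_asupp1[OF nz tw.good_A(2)[OF good]])
      show "\<Phi> j (int k *s ma) l h x K - \<Psi> j (int k *s ma) l h x K = (\<Sum>n\<in>range ev. of_int (n $ l) * F n h x K)" for h x l K
      proof -
        have "of_int (ev i $ l) * z = (if l = i then z else 0)" for i and z :: complex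
          by (simp add: ev_nth)
        then show ?thesis by (subst sum.reindex[OF inj]) (simp add: F_def inj)
      qed
    qed simp
  qed
qed

end
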